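(* Let $G=(V,E)$ be a connected, locally finite, quasi-transitive graph, let $v$ be a vertex of $G$ and let $p_c < p \leq 1$. Then $$\lim_{r\to\infty} \frac{1}{r} \log |\partial B_{\mathrm{int}}(v,r)| = \lim_{r\to\infty} \frac{1}{r} \log | B_{\mathrm{int}}(v,r)| = \gamma_{\mathrm{int}}(p)$$ $\mathbf{P}_p$-almost surely on the event that $K_v$ is infinite. Moreover, we also have that $$\liminf_{r\to\infty} e^{-\gamma_{\mathrm{int}}(p)r}|\partial B_{\mathrm{int}}(v,r)|>0$$ $\mathbf{P}_p$-almost surely on the event that $K_v$ is infinite.
   Context: A graph $G=(V,E)$ is quasi-transitive if the action of its automorphism group on $V$ has finitely many orbits. $\mathbf{P}_p$ and $\mathbf{E}_p$ denote probability and expectation for Bernoulli-$p$ bond percolation on $G$. Clusters are the connected components of the open subgraph, and $K_v$ is the cluster of $v$. $p_c$ is the supremum of those $p\in[0,1]$ for which there are no infinite clusters almost surely. The intrinsic distance is the graph distance within the open subgraph; $B_{\mathrm{int}}(v,r)$ is the set of vertices at intrinsic distance at most $r$ from $v$, $\partial B_{\mathrm{int}}(v,r)$ is the set of vertices at intrinsic distance exactly $r$ from $v$, and $|\cdot|$ denotes number of vertices. Define $\mathrm{Gr}_p(r)=\sup_{v\in V}\mathbf{E}_p|B_{\mathrm{int}}(v,r)|$; the limit $\gamma_{\mathrm{int}}(p)=\lim_{r\to\infty}\frac1r\log \mathrm{Gr}_p(r)=\inf_{r\ge1}\frac1r\log\mathrm{Gr}_p(r)$ exists in $[0,\infty)$.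 *)

theory Defs
  imports "HOL-Probability.Probability"
begin

text \<open>A graph is a vertex set \<open>V\<close> together with a set \<open>E\<close> of two-element subsets of \<open>V\<close>.\<close>

definition simple_graph :: "'a set \<Rightarrow> 'a set set \<Rightarrow> bool" where
  "simple_graph V E \<longleftrightarrow> (\<forall>e\<in>E. \<exists>x\<in>V. \<exists>y\<in>V. x \<noteq> y \<and> e = {x, y})"

definition adjacent :: "'a set set \<Rightarrow> 'a \<Rightarrow> 'a \<Rightarrow> bool" where
  "adjacent E x y \<longleftrightarrow> {x, y} \<in> E"

definition connected_graph :: "'a set \<Rightarrow> 'a set set \<Rightarrow> bool" where
  "connected_graph V E \<longleftrightarrow> (\<forall>x\<in>V. \<forall>y\<in>V. (adjacent E)\<^sup>*\<^sup>* x y)"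

definition locally_finite :: "'a set \<Rightarrow> 'a set set \<Rightarrow> bool" where
  "locally_finite V E \<longleftrightarrow> (\<forall>x\<in>V. finite {y. adjacent E x y})"

text \<open>Only the restriction of an automorphism to \<open>V\<close> is constrained; its values outside \<open>V\<close>
  are irrelevant for the orbits below.\<close>

definition automorphisms :: "'a set \<Rightarrow> 'a set set \<Rightarrow> ('a \<Rightarrow> 'a) set" where
  "automorphisms V E =
     {f. bij_betw f V V \<and> (\<forall>x\<in>V. \<forall>y\<in>V. adjacent E (f x) (f y) \<longleftrightarrow> adjacent E x y)}"

definition vertex_orbit :: "'a set \<Rightarrow> 'a set set \<Rightarrow> 'a \<Rightarrow> 'a set" where
  "vertex_orbit V E x = (\<lambda>f. f x) ` automorphisms V E"

definition quasi_transitive :: "'a set \<Rightarrow> 'a set set \<Rightarrow> bool" where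
  "quasi_transitive V E \<longleftrightarrow> finite (vertex_orbit V E ` V)"

text \<open>\<open>(adjacent E ^^ n) x y\<close> says that there is a walk of length \<open>n\<close> from \<open>x\<close> to \<open>y\<close>; the
  distance between vertices in different components is \<open>\<infinity>\<close>, the infimum of the empty set.\<close>

definition graph_dist :: "'a set set \<Rightarrow> 'a \<Rightarrow> 'a \<Rightarrow> enat" where
  "graph_dist E x y = (INF n\<in>{n. (adjacent E ^^ n) x y}. enat n)"

text \<open>A percolation configuration is a function \<open>\<omega>\<close> on the edges, with \<open>\<omega> e\<close> meaning that \<open>e\<close>
  is open. Under \<open>percolation E p\<close> the states of the edges are independent and each edge is open
  with probability \<open>p\<close>.\<close>

definition percolation :: "'a set set \<Rightarrow> real \<Rightarrow> ('a set \<Rightarrow> bool) measure" where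
  "percolation E p = PiM E (\<lambda>_. measure_pmf (bernoulli_pmf p))"

definition open_edges :: "'a set set \<Rightarrow> ('a set \<Rightarrow> bool) \<Rightarrow> 'a set set" where
  "open_edges E \<omega> = {e\<in>E. \<omega> e}"

definition open_cluster :: "'a set set \<Rightarrow> ('a set \<Rightarrow> bool) \<Rightarrow> 'a \<Rightarrow> 'a set" where
  "open_cluster E \<omega> v = {w. (adjacent (open_edges E \<omega>))\<^sup>*\<^sup>* v w}"

definition int_ball :: "'a set set \<Rightarrow> ('a set \<Rightarrow> bool) \<Rightarrow> 'a \<Rightarrow> nat \<Rightarrow> 'a set" where
  "int_ball E \<omega> v r = {w. graph_dist (open_edges E \<omega>) v w \<le> enat r}"

definition int_sphere :: "'a set set \<Rightarrow> ('a set \<Rightarrow> bool) \<Rightarrow> 'a \<Rightarrow> nat \<Rightarrow> 'a set" where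
  "int_sphere E \<omega> v r = {w. graph_dist (open_edges E \<omega>) v w = enat r}"

definition critical_prob :: "'a set \<Rightarrow> 'a set set \<Rightarrow> real" where
  "critical_prob V E =
     Sup {p\<in>{0..1}. AE \<omega> in percolation E p. \<not> (\<exists>v\<in>V. infinite (open_cluster E \<omega> v))}"

text \<open>In a locally finite, quasi-transitive graph the degrees are bounded, so the integrands below
  are bounded by a constant depending only on \<open>r\<close>; in particular the supremum is that of a
  bounded set of reals.\<close>

definition Gr :: "'a set \<Rightarrow> 'a set set \<Rightarrow> real \<Rightarrow> nat \<Rightarrow> real" where
  "Gr V E p r = (SUP v\<in>V. (\<integral>\<omega>. real (card (int_ball E \<omega> v r)) \<partial>percolation E p))"

definition gamma_int :: "'a set \<Rightarrow> 'a set set \<Rightarrow> real \<Rightarrow> real" where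
  "gamma_int V E p = lim (\<lambda>r. ln (Gr V E p r) / real r)"

end

theory Submission
  imports Defs "HOL-Real_Asymp.Real_Asymp"
begin

text \<open>Fix a percolation parameter above the critical one and write \<open>S(r)\<close> and \<open>B(r)\<close> for the
  intrinsic sphere and ball of radius \<open>r\<close> around \<open>v\<close>, \<open>Gr\<close> for the supremum
  of the expected ball sizes, and \<open>\<gamma>\<close> for the exponential rate of \<open>Gr\<close>.

  The upper bound is soft. After an exploration of the ball of radius \<open>r\<close>, whatever grows out of its
  sphere uses only unexplored edges (\<open>exploration_bound\<close>). Hence \<open>Gr\<close> is
  submultiplicative, Fekete's lemma gives the limit \<open>\<gamma>\<close> together with
  \<open>exp (\<gamma> r) \<le> Gr r\<close>, and Markov's inequality with Borel--Cantelli gives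
  \<open>card (B r) \<le> (r + 1)\<^sup>2 Gr r\<close> for all large \<open>r\<close>. Since \<open>S(r)\<close> is
  contained in \<open>B(r)\<close>, all assertions follow once
  \<open>card (S r) \<ge> \<epsilon> exp (\<gamma> r)\<close> holds for all \<open>r\<close> with a random
  \<open>\<epsilon> > 0\<close>, almost surely when the cluster of \<open>v\<close> is infinite
  (\<open>sphere_growth\<close>). For \<open>\<gamma> = 0\<close> this only says that the spheres of an infinite
  cluster are nonempty; let \<open>\<gamma> > 0\<close>.

  A record time is a \<open>t\<close> with \<open>Gr (t - r) \<le> C exp (- \<gamma> r) Gr t\<close> for all
  \<open>r \<le> t\<close>; for a suitable \<open>C\<close> there are infinitely many. A decomposition along
  geodesics together with Harris' inequality bounds the second moment of \<open>card (B t)\<close> by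
  \<open>Gr t * (\<Sum>k\<le>t. Gr (t - k))\<close> (\<open>second_moment\<close>), so at records the variables
  \<open>Z t = card (B t) / Gr t\<close> are bounded in \<open>L\<^sup>2\<close>. This has two consequences. First,
  some weighted averages \<open>W n\<close> of the \<open>Z t\<close> over records \<open>t \<ge> n\<close> converge
  almost surely at \<open>v\<close> (\<open>convex_combinations_converge\<close>). Secondly, since there are only
  finitely many orbits, the weights can be chosen such that the same averages, taken at some vertex
  \<open>y\<close>, have expectation at least \<open>1/2\<close>; by Paley--Zygmund, \<open>W n\<close> does not
  tend to zero at \<open>y\<close> with positive probability. Say that a vertex grows if its \<open>W n\<close> does
  not tend to zero.

  If \<open>v\<close> grows then its spheres are not thin: by convergence \<open>W n\<close> stays above some
  \<open>\<delta>\<close>, whereas conditionally on the first radius \<open>r\<close> with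
  \<open>card (S r) < \<epsilon> exp (\<gamma> r)\<close> the expectation of \<open>Z t\<close> is at most about
  \<open>exp (\<gamma> r) \<epsilon> Gr (t - r) / Gr t \<le> \<epsilon> C\<close>. So a thin sphere has probability
  at most \<open>\<epsilon> C / \<delta>\<close> on this event (\<open>thin_while_average_large\<close>), and
  \<open>\<epsilon>\<close> is arbitrary.

  What is left is that every infinite cluster grows, given that some vertex grows with positive probability. Growth
  is a property of the cluster, is increasing, and survives the removal of a finite set in the sense that one of the
  vertices next to the removed set still grows (\<open>grows_leave\<close>). By quasi-transitivity a large finite
  set contains a growing vertex with probability close to one. Exploring a large ball of an infinite cluster
  therefore shows that the cluster contains or is adjacent to growing vertices; closing finitely many edges improves
  this to: it contains a growing vertex, or infinitely many growing vertices are adjacent to it. Both the infinite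
  cluster and the growing vertices may belong to different levels of a monotone coupling of two percolations
  (\<open>meets_or_touches_infinitely_often\<close>). Let \<open>a\<close> be a parameter strictly between the
  critical one and the given one. Each edge gets one bit for the \<open>a\<close>-percolation and a second bit that
  opens further edges. If a cluster and the growing vertices are connected by infinitely many potential edges whose
  second bits have not been looked at, then some of these are open (\<open>self_blind_not_all_closed\<close>). Used
  twice, this shows that an infinite cluster contains an infinite \<open>a\<close>-cluster, and that an infinite
  \<open>a\<close>-cluster lies in a growing cluster. Being infinite is itself an instance of growing, for other
  weights, so that one argument covers both uses.\<close>

section \<open>Independent bits\<close>

definition bits :: "'j set \<Rightarrow> ('j \<Rightarrow> real) \<Rightarrow> ('j \<Rightarrow> bool) measure" where
  "bits J q = PiM J (\<lambda>j. measure_pmf (bernoulli_pmf (q j)))"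

text \<open>Events are predicates on arbitrary functions, not only on points of the product space, so that bits can be
  overwritten and configurations compared without regard to values outside the index set.\<close>
definition depends :: "(('j \<Rightarrow> bool) \<Rightarrow> 'b) \<Rightarrow> 'j set \<Rightarrow> bool" where
  "depends P X \<longleftrightarrow> (\<forall>\<omega> \<omega>'. (\<forall>j\<in>X. \<omega> j = \<omega>' j) \<longrightarrow> P \<omega> = P \<omega>')"

definition overwrite :: "'j set \<Rightarrow> bool \<Rightarrow> ('j \<Rightarrow> bool) \<Rightarrow> 'j \<Rightarrow> bool" where
  "overwrite F c \<omega> = (\<lambda>j. if j \<in> F then c else \<omega> j)"

lemma dependsI: "(\<And>\<omega> \<omega>'. (\<And>j. j \<in> X \<Longrightarrow> \<omega> j = \<omega>' j) \<Longrightarrow> P \<omega> = P \<omega>') \<Longrightarrow> depends P X"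
  unfolding depends_def by blast

lemma dependsD: "depends P X \<Longrightarrow> (\<And>j. j \<in> X \<Longrightarrow> \<omega> j = \<omega>' j) \<Longrightarrow> P \<omega> = P \<omega>'"
  unfolding depends_def by blast

lemma depends_mono: "depends P X \<Longrightarrow> X \<subseteq> Y \<Longrightarrow> depends P Y"
  unfolding depends_def by blast

lemma prob_space_bits [simp, intro]: "prob_space (bits J q)"
  unfolding bits_def by (intro prob_space_PiM prob_space_measure_pmf)

lemma space_bits: "space (bits J q) = (\<Pi>\<^sub>E j\<in>J. UNIV)"
  by (simp add: bits_def space_PiM)

lemma sets_bits: "sets (bits J q) = sets (PiM J (\<lambda>_. count_space UNIV))"
  unfolding bits_def by (intro sets_PiM_cong) auto

lemma bits_cong_measurable: "measurable (bits J q) N = measurable (PiM J (\<lambda>_. count_space UNIV)) N"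
  by (intro measurable_cong_sets sets_bits refl)

lemma pred_bits_coord [measurable]: "j \<in> J \<Longrightarrow> Measurable.pred (bits J q) (\<lambda>\<omega>. \<omega> j)"
  unfolding bits_cong_measurable by (rule measurable_component_singleton)

lemma measurable_bits_into:
  assumes "\<And>j. j \<in> J \<Longrightarrow> Measurable.pred M (\<lambda>x. f x j)"
  shows "(\<lambda>x. restrict (f x) J) \<in> measurable M (bits J q)"
proof -
  have "(\<lambda>x. restrict (f x) J) \<in> measurable M (PiM J (\<lambda>_. count_space UNIV))"
    using assms by (intro measurable_restrict) auto
  moreover have "measurable M (bits J q) = measurable M (PiM J (\<lambda>_. count_space UNIV))"
    by (intro measurable_cong_sets sets_bits refl)
  ultimately show ?thesis by simp
qed

lemma depends_restrict:
  assumes "depends P X" "\<omega> \<in> space (bits J q)"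
  shows "P \<omega> = P (restrict \<omega> (J \<inter> X))"
proof (rule dependsD[OF assms(1)])
  fix j assume "j \<in> X"
  then show "\<omega> j = restrict \<omega> (J \<inter> X) j"
    using assms(2) by (cases "j \<in> J") (auto simp: space_bits PiE_def extensional_def)
qed

lemma indep_vars_bits_coord:
  assumes "J \<noteq> {}"
  shows "prob_space.indep_vars (bits J q) (\<lambda>j. measure_pmf (bernoulli_pmf (q j))) (\<lambda>j \<omega>. \<omega> j) J"
proof -
  let ?M = "\<lambda>j. measure_pmf (bernoulli_pmf (q j))"
  interpret prob_space "bits J q" by simp
  have "distr (PiM J ?M) (PiM J ?M) (\<lambda>x. restrict x J) = distr (PiM J ?M) (PiM J ?M) (\<lambda>x. x)"
    by (intro distr_cong) (auto simp: space_PiM PiE_restrict)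
  also have "\<dots> = PiM J ?M" by simp
  also have "\<dots> = PiM J (\<lambda>i. distr (PiM J ?M) (?M i) (\<lambda>\<omega>. \<omega> i))"
    by (intro PiM_cong refl) (auto intro!: distr_PiM_component[symmetric] prob_space_measure_pmf)
  finally have *: "distr (bits J q) (PiM J ?M) (\<lambda>x. \<lambda>i\<in>J. x i)
      = PiM J (\<lambda>i. distr (bits J q) (?M i) (\<lambda>\<omega>. \<omega> i))"
    unfolding bits_def .
  show ?thesis
    using * by (subst indep_vars_iff_distr_eq_PiM'[OF assms])
      (auto simp: bits_def intro!: measurable_component_singleton simp del: measurable_pmf_measure2)
qed

text \<open>The coordinates are independent, hence so are their restrictions to two disjoint sets of indices; both predicates
  factor through such restrictions. Indices outside \<open>J\<close> carry no randomness, which is why only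
  \<open>J \<inter> X \<inter> Y\<close> has to be empty.\<close>
lemma bits_indep:
  assumes P: "Measurable.pred (bits J q) P" and R: "Measurable.pred (bits J q) R"
    and dP: "depends P X" and dR: "depends R Y" and XY: "J \<inter> X \<inter> Y = {}"
  shows "\<P>(\<omega> in bits J q. P \<omega> \<and> R \<omega>) = \<P>(\<omega> in bits J q. P \<omega>) * \<P>(\<omega> in bits J q. R \<omega>)"
proof -
  interpret prob_space "bits J q" by simp
  let ?M = "\<lambda>j. measure_pmf (bernoulli_pmf (q j))"
  define K0 where "K0 = J \<inter> X"
  define K1 where "K1 = J \<inter> Y"
  have K: "K0 \<subseteq> J" "K1 \<subseteq> J" "K0 \<inter> K1 = {}" using XY by (auto simp: K0_def K1_def)
  show ?thesis
  proof (cases "J = {}")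
    case True
    then have "space (bits J q) = {\<lambda>_. undefined}" by (simp add: space_bits)
    then have "{\<omega> \<in> space (bits J q). S \<omega>} = (if S (\<lambda>_. undefined) then space (bits J q) else {})" for S
      by auto
    then have "\<P>(\<omega> in bits J q. S \<omega>) = (if S (\<lambda>_. undefined) then 1 else 0)" for S
      by (simp add: prob_space)
    then show ?thesis by simp
  next
    case False
    have ind: "indep_vars ?M (\<lambda>j \<omega>. \<omega> j) J" by (rule indep_vars_bits_coord[OF False])
    have iv: "indep_var (PiM K0 ?M) (\<lambda>\<omega>. restrict (\<lambda>i. \<omega> i) K0) (PiM K1 ?M) (\<lambda>\<omega>. restrict (\<lambda>i. \<omega> i) K1)"
      by (rule indep_var_restrict[OF ind K(3,1,2)])
    have ext: "Measurable.pred (PiM K ?M) (\<lambda>\<xi>. Q (restrict \<xi> K))"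
      if "Measurable.pred (bits J q) Q" "K \<subseteq> J" for Q K
    proof -
      have "(\<lambda>\<xi>. restrict (\<lambda>j. if j \<in> K then \<xi> j else undefined) J) \<in> measurable (PiM K ?M) (bits J q)"
      proof (rule measurable_bits_into)
        fix j assume "j \<in> J"
        have "Measurable.pred (bits K q) (\<lambda>\<xi>. if j \<in> K then \<xi> j else undefined)"
          using pred_bits_coord[of j K q] by (cases "j \<in> K") (simp_all del: measurable_pmf_measure2)
        then show "Measurable.pred (PiM K ?M) (\<lambda>\<xi>. if j \<in> K then \<xi> j else undefined)"
          unfolding bits_def .
      qed
      from measurable_compose[OF this that(1)]
      have "Measurable.pred (PiM K ?M) (\<lambda>\<xi>. Q (restrict (\<lambda>j. if j \<in> K then \<xi> j else undefined) J))" .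
      moreover have "(\<lambda>\<xi>. Q (restrict (\<lambda>j. if j \<in> K then \<xi> j else undefined) J)) = (\<lambda>\<xi>. Q (restrict \<xi> K))"
        using that(2) by (intro ext arg_cong[where f=Q]) (auto simp: fun_eq_iff restrict_def)
      ultimately show ?thesis by (simp only:)
    qed
    note eP = depends_restrict[OF dP, of _ J q, folded K0_def]
    note eR = depends_restrict[OF dR, of _ J q, folded K1_def]
    have m0: "{\<xi>\<in>space (PiM K0 ?M). P (restrict \<xi> K0)} \<in> sets (PiM K0 ?M)"
      using ext[OF P K(1)] by (rule predE)
    have m1: "{\<xi>\<in>space (PiM K1 ?M). R (restrict \<xi> K1)} \<in> sets (PiM K1 ?M)"
      using ext[OF R K(2)] by (rule predE)
    have sp: "restrict \<omega> K0 \<in> space (PiM K0 ?M)" "restrict \<omega> K1 \<in> space (PiM K1 ?M)" for \<omega>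
      by (auto simp: space_PiM)
    have sp': "(\<omega> \<in> (\<Pi>\<^sub>E j\<in>K. UNIV)) = (\<omega> \<in> extensional K)" for \<omega> :: "'a \<Rightarrow> bool" and K by (auto simp: PiE_def)
    have "\<P>(\<omega> in bits J q. P \<omega> \<and> R \<omega>) = prob ((\<lambda>x. (restrict x K0, restrict x K1)) -`
        ({\<xi>\<in>space (PiM K0 ?M). P (restrict \<xi> K0)} \<times> {\<xi>\<in>space (PiM K1 ?M). R (restrict \<xi> K1)}) \<inter> space (bits J q))"
      using eP eR by (intro arg_cong[where f=prob]) (auto simp: sp space_PiM)
    also have "\<dots> = prob ((\<lambda>x. restrict x K0) -` {\<xi>\<in>space (PiM K0 ?M). P (restrict \<xi> K0)} \<inter> space (bits J q))
       * prob ((\<lambda>x. restrict x K1) -` {\<xi>\<in>space (PiM K1 ?M). R (restrict \<xi> K1)} \<inter> space (bits J q))"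
      using indep_varD[OF iv m0 m1] by simp
    also have "(\<lambda>x. restrict x K0) -` {\<xi>\<in>space (PiM K0 ?M). P (restrict \<xi> K0)} \<inter> space (bits J q)
       = {\<omega>\<in>space (bits J q). P \<omega>}"
      using eP by (auto simp: sp space_PiM)
    also have "(\<lambda>x. restrict x K1) -` {\<xi>\<in>space (PiM K1 ?M). R (restrict \<xi> K1)} \<inter> space (bits J q)
       = {\<omega>\<in>space (bits J q). R \<omega>}"
      using eR by (auto simp: sp space_PiM)
    finally show ?thesis .
  qed
qed

lemma prob_bit:
  assumes "j \<in> J" "0 \<le> q j" "q j \<le> 1"
  shows "\<P>(\<omega> in bits J q. \<omega> j = c) = (if c then q j else 1 - q j)"
proof -
  let ?M = "\<lambda>j. measure_pmf (bernoulli_pmf (q j))"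
  have m: "(\<lambda>\<omega>. \<omega> j) \<in> measurable (bits J q) (?M j)"
    unfolding bits_def by (rule measurable_component_singleton[OF assms(1)])
  have "distr (bits J q) (?M j) (\<lambda>\<omega>. \<omega> j) = ?M j"
    unfolding bits_def by (rule distr_PiM_component[OF _ assms(1)]) (rule prob_space_measure_pmf)
  then have "measure (?M j) {c} = measure (distr (bits J q) (?M j) (\<lambda>\<omega>. \<omega> j)) {c}" by (simp only:)
  also have "\<dots> = measure (bits J q) ((\<lambda>\<omega>. \<omega> j) -` {c} \<inter> space (bits J q))"
    by (rule measure_distr[OF m]) (simp only: sets_measure_pmf UNIV_I)
  also have "(\<lambda>\<omega>. \<omega> j) -` {c} \<inter> space (bits J q) = {\<omega>\<in>space (bits J q). \<omega> j = c}" by blast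
  finally have "\<P>(\<omega> in bits J q. \<omega> j = c) = pmf (bernoulli_pmf (q j)) c" by (simp only: measure_pmf_single)
  then show ?thesis using assms(2,3) by (cases c) simp_all
qed

lemma pred_overwrite:
  assumes "Measurable.pred (bits J q) P"
  shows "Measurable.pred (bits J q) (\<lambda>\<omega>. P (restrict (overwrite F c \<omega>) J))"
proof (rule measurable_compose[OF measurable_bits_into assms])
  fix j assume "j \<in> J"
  then show "Measurable.pred (bits J q) (\<lambda>\<omega>. overwrite F c \<omega> j)"
    by (cases "j \<in> F") (auto simp: overwrite_def)
qed

lemma pred_ball_coord:
  assumes "finite F" "F \<subseteq> J"
  shows "Measurable.pred (bits J q) (\<lambda>\<omega>. \<forall>j\<in>F. \<omega> j = c)"
proof -
  have "Measurable.pred (bits J q) (\<lambda>\<omega>. \<omega> j = c)" if "j \<in> F" for j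
    by (rule measurable_compose[OF pred_bits_coord]) (use that assms in auto)
  then show ?thesis using assms(1) by (intro pred_intros_finite)
qed

lemma pred_bex_countable:
  assumes "countable S" "\<And>i. i \<in> S \<Longrightarrow> Measurable.pred M (P i)"
  shows "Measurable.pred M (\<lambda>x. \<exists>i\<in>S. P i x)"
proof (cases "S = {}")
  case False
  have "(\<lambda>x. \<exists>i\<in>S. P i x) = (\<lambda>x. \<exists>n::nat. P (from_nat_into S n) x)"
    using False assms(1) by (metis from_nat_into from_nat_into_surj)
  moreover have "Measurable.pred M (\<lambda>x. \<exists>n::nat. P (from_nat_into S n) x)"
    by (intro pred_intros_countable assms(2) from_nat_into False)
  ultimately show ?thesis by (simp only:)
qed simp

lemma pred_ball_countable:
  assumes "countable S" "\<And>i. i \<in> S \<Longrightarrow> Measurable.pred M (P i)"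
  shows "Measurable.pred M (\<lambda>x. \<forall>i\<in>S. P i x)"
proof -
  have "Measurable.pred M (\<lambda>x. \<not> (\<exists>i\<in>S. \<not> P i x))"
    by (intro pred_intros_logic(2) pred_bex_countable assms)
  moreover have "(\<lambda>x. \<not> (\<exists>i\<in>S. \<not> P i x)) = (\<lambda>x. \<forall>i\<in>S. P i x)" by (rule ext) blast
  ultimately show ?thesis by (rule subst[rotated])
qed

lemma prob_all_eq:
  assumes "finite F" "F \<subseteq> J"
  shows "\<P>(\<omega> in bits J q. \<forall>j\<in>F. \<omega> j = c) = (\<Prod>j\<in>F. \<P>(\<omega> in bits J q. \<omega> j = c))"
  using assms
proof (induction F)
  case empty
  interpret prob_space "bits J q" by simp
  show ?case using prob_space by simp
next
  case (insert i F)
  have iF: "i \<in> J" "F \<subseteq> J" "finite F" "i \<notin> F" using insert.prems(1) insert.hyps by blast+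
  have "\<P>(\<omega> in bits J q. \<omega> i = c \<and> (\<forall>j\<in>F. \<omega> j = c)) =
      \<P>(\<omega> in bits J q. \<omega> i = c) * \<P>(\<omega> in bits J q. \<forall>j\<in>F. \<omega> j = c)"
  proof (rule bits_indep[where X="{i}" and Y=F])
    show "Measurable.pred (bits J q) (\<lambda>\<omega>. \<omega> i = c)"
      by (rule measurable_compose[OF pred_bits_coord[OF iF(1)]]) simp
    show "Measurable.pred (bits J q) (\<lambda>\<omega>. \<forall>j\<in>F. \<omega> j = c)"
      by (rule pred_ball_coord[OF iF(3,2)])
    show "J \<inter> {i} \<inter> F = {}" using iF by blast
  qed (auto simp: depends_def)
  moreover have "{\<omega> \<in> space (bits J q). \<omega> i = c \<and> (\<forall>j\<in>F. \<omega> j = c)} = {\<omega> \<in> space (bits J q). \<forall>j\<in>insert i F. \<omega> j = c}"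
    by blast
  ultimately show ?case unfolding prod.insert[OF iF(3,4)] insert.IH[OF iF(2), symmetric] by (simp only:)
qed

lemma prob_all_eq_pos:
  assumes "finite F" "F \<subseteq> J" "\<And>j. j \<in> F \<Longrightarrow> 0 < \<P>(\<omega> in bits J q. \<omega> j = c)"
  shows "0 < \<P>(\<omega> in bits J q. \<forall>j\<in>F. \<omega> j = c)"
  unfolding prob_all_eq[OF assms(1,2)] by (rule prod_pos) (rule assms(3))

text \<open>The modified configuration is independent of the bits in \<open>F\<close>, and with positive probability these bits
  already have the prescribed values, in which case nothing is modified.\<close>
lemma finite_modification_null:
  assumes P: "Measurable.pred (bits J q) P"
    and F: "finite F" "F \<subseteq> J" "\<And>j. j \<in> F \<Longrightarrow> 0 < \<P>(\<omega> in bits J q. \<omega> j = c)"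
    and null: "AE \<omega> in bits J q. \<not> P \<omega>"
  shows "AE \<omega> in bits J q. \<not> P (restrict (overwrite F c \<omega>) J)"
proof -
  interpret prob_space "bits J q" by simp
  let ?P = "\<lambda>\<omega>. P (restrict (overwrite F c \<omega>) J)"
  have mP: "Measurable.pred (bits J q) ?P" by (rule pred_overwrite[OF P])
  have mF: "Measurable.pred (bits J q) (\<lambda>\<omega>. \<forall>j\<in>F. \<omega> j = c)"
    by (rule pred_ball_coord[OF F(1,2)])
  have "\<P>(\<omega> in bits J q. (\<forall>j\<in>F. \<omega> j = c) \<and> ?P \<omega>) =
      \<P>(\<omega> in bits J q. \<forall>j\<in>F. \<omega> j = c) * \<P>(\<omega> in bits J q. ?P \<omega>)"
  proof (rule bits_indep[OF mF mP, where X=F and Y="-F"])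
    show "depends ?P (- F)"
      by (rule dependsI) (auto intro!: arg_cong[where f=P] simp: overwrite_def fun_eq_iff restrict_def)
  qed (auto simp: depends_def)
  moreover have "\<P>(\<omega> in bits J q. (\<forall>j\<in>F. \<omega> j = c) \<and> ?P \<omega>) = 0"
  proof -
    have "\<P>(\<omega> in bits J q. (\<forall>j\<in>F. \<omega> j = c) \<and> ?P \<omega>) \<le> \<P>(\<omega> in bits J q. P \<omega>)"
    proof (rule finite_measure_mono)
      show "{\<omega>\<in>space (bits J q). P \<omega>} \<in> events" using P by (rule predE)
      have eq: "restrict (overwrite F c \<omega>) J = \<omega>" if "\<omega> \<in> space (bits J q)" "\<forall>j\<in>F. \<omega> j = c" for \<omega>
        using that by (auto simp: space_bits fun_eq_iff overwrite_def restrict_def PiE_def extensional_def)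
      show "{\<omega> \<in> space (bits J q). (\<forall>j\<in>F. \<omega> j = c) \<and> ?P \<omega>} \<subseteq> {\<omega> \<in> space (bits J q). P \<omega>}"
      proof (intro subsetI CollectI conjI; elim CollectE conjE)
        fix \<omega> assume "\<omega> \<in> space (bits J q)" "\<forall>j\<in>F. \<omega> j = c" "?P \<omega>"
        then show "P \<omega>" by (simp only: eq)
      qed
    qed
    also have "\<dots> = 0" using null by (simp add: prob_eq_0[OF predE[OF P]])
    finally show ?thesis by (simp add: measure_le_0_iff)
  qed
  moreover have "0 < \<P>(\<omega> in bits J q. \<forall>j\<in>F. \<omega> j = c)" by (rule prob_all_eq_pos[OF F])
  ultimately have "\<P>(\<omega> in bits J q. ?P \<omega>) = 0" by auto
  then show ?thesis by (simp add: prob_eq_0[OF predE[OF mP]])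
qed

lemma pred_finite_depends:
  assumes "finite F" "F \<subseteq> J" "depends P F"
  shows "Measurable.pred (bits J q) P"
proof -
  have e: "P \<omega> \<longleftrightarrow> (\<exists>S\<in>Pow F. P (\<lambda>j. j \<in> S) \<and> (\<forall>j\<in>F. \<omega> j = (j \<in> S)))" (is "_ \<longleftrightarrow> ?R \<omega>") for \<omega>
  proof
    assume "P \<omega>"
    moreover have "P \<omega> = P (\<lambda>j. j \<in> {j\<in>F. \<omega> j})" by (rule dependsD[OF assms(3)]) auto
    ultimately show "\<exists>S\<in>Pow F. P (\<lambda>j. j \<in> S) \<and> (\<forall>j\<in>F. \<omega> j = (j \<in> S))"
      by (intro bexI[of _ "{j\<in>F. \<omega> j}"]) auto
  next
    assume "\<exists>S\<in>Pow F. P (\<lambda>j. j \<in> S) \<and> (\<forall>j\<in>F. \<omega> j = (j \<in> S))"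
    then obtain S where S: "P (\<lambda>j. j \<in> S)" "\<And>j. j \<in> F \<Longrightarrow> \<omega> j = (j \<in> S)" by blast
    have "P \<omega> = P (\<lambda>j. j \<in> S)" by (rule dependsD[OF assms(3)]) (rule S(2))
    then show "P \<omega>" using S(1) by simp
  qed
  have "Measurable.pred (bits J q) (\<lambda>\<omega>. \<exists>S\<in>Pow F. P (\<lambda>j. j \<in> S) \<and> (\<forall>j\<in>F. \<omega> j = (j \<in> S)))"
  proof -
    have 1: "Measurable.pred (bits J q) (\<lambda>\<omega>. \<omega> j = (j \<in> S))" if "j \<in> F" for j S
      using assms(2) that by (intro measurable_compose[OF pred_bits_coord]) auto
    have 2: "Measurable.pred (bits J q) (\<lambda>\<omega>. \<forall>j\<in>F. \<omega> j = (j \<in> S))" for S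
      by (intro pred_intros_finite 1 assms(1))
    have 3: "Measurable.pred (bits J q) (\<lambda>\<omega>. P (\<lambda>j. j \<in> S) \<and> (\<forall>j\<in>F. \<omega> j = (j \<in> S)))" for S
    proof (cases "P (\<lambda>j. j \<in> S)")
      case True
      then show ?thesis using 2[of S] by (simp only: simp_thms)
    qed simp
    show ?thesis by (intro pred_intros_finite 3) (use assms(1) in simp)
  qed
  note m = this
  have "P = ?R" by (rule ext) (rule e)
  show ?thesis by (subst \<open>P = ?R\<close>) (rule m)
qed

lemma prob_split_bit:
  assumes i: "i \<in> J" "0 \<le> q i" "q i \<le> 1" and P: "finite F" "F \<subseteq> J" "i \<notin> F" "depends P (insert i F)"
  shows "\<P>(\<omega> in bits J q. P \<omega>) = q i * \<P>(\<omega> in bits J q. P (fun_upd \<omega> i True))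
     + (1 - q i) * \<P>(\<omega> in bits J q. P (fun_upd \<omega> i False))"
proof -
  interpret prob_space "bits J q" by simp
  have m: "Measurable.pred (bits J q) (\<lambda>\<omega>. \<omega> i = c)" for c
    by (rule measurable_compose[OF pred_bits_coord[OF i(1)]]) simp
  have d: "depends (\<lambda>\<omega>. P (fun_upd \<omega> i c)) F" for c
    by (rule dependsI, rule dependsD[OF P(4)]) auto
  have mP: "Measurable.pred (bits J q) (\<lambda>\<omega>. P (fun_upd \<omega> i c))" for c
    by (rule pred_finite_depends[OF P(1,2) d])
  have e: "\<P>(\<omega> in bits J q. \<omega> i = c \<and> P (fun_upd \<omega> i c))
      = \<P>(\<omega> in bits J q. \<omega> i = c) * \<P>(\<omega> in bits J q. P (fun_upd \<omega> i c))" for c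
    by (rule bits_indep[OF m mP, where X="{i}" and Y=F]) (use d P in \<open>auto simp: depends_def\<close>)
  have up: "fun_upd \<omega> i (\<omega> i) = \<omega>" for \<omega> :: "'a \<Rightarrow> bool" by simp
  have "{\<omega>\<in>space (bits J q). P \<omega>} = {\<omega>\<in>space (bits J q). \<omega> i = True \<and> P (fun_upd \<omega> i True)}
     \<union> {\<omega>\<in>space (bits J q). \<omega> i = False \<and> P (fun_upd \<omega> i False)}"
  proof -
    have "P \<omega> \<longleftrightarrow> (\<omega> i = True \<and> P (fun_upd \<omega> i True)) \<or> (\<omega> i = False \<and> P (fun_upd \<omega> i False))" for \<omega>
      using up[of \<omega>] by (cases "\<omega> i") simp_all
    then show ?thesis by blast
  qed
  moreover have "{\<omega>\<in>space (bits J q). \<omega> i = c \<and> P (fun_upd \<omega> i c)} \<in> events" for c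
    by (rule predE) (intro pred_intros_logic m mP)
  ultimately have "\<P>(\<omega> in bits J q. P \<omega>) = \<P>(\<omega> in bits J q. \<omega> i = True \<and> P (fun_upd \<omega> i True))
     + \<P>(\<omega> in bits J q. \<omega> i = False \<and> P (fun_upd \<omega> i False))"
    by (simp only:) (rule finite_measure_Union; blast)
  then show ?thesis unfolding e prob_bit[of i J q, OF i] by simp
qed

text \<open>Harris' inequality for an increasing and a decreasing event, by induction on the number of bits: after conditioning
  on one bit it reduces to Chebyshev's sum inequality for two numbers, which are ordered oppositely for the two
  events.\<close>
lemma harris:
  assumes "finite F" "F \<subseteq> J" "\<And>j. j \<in> F \<Longrightarrow> 0 \<le> q j \<and> q j \<le> 1"
    and "depends A F" "depends B F"
    and "\<And>\<omega> \<omega>'. (\<And>j. \<omega> j \<Longrightarrow> \<omega>' j) \<Longrightarrow> A \<omega> \<Longrightarrow> A \<omega>'"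
    and "\<And>\<omega> \<omega>'. (\<And>j. \<omega> j \<Longrightarrow> \<omega>' j) \<Longrightarrow> B \<omega>' \<Longrightarrow> B \<omega>"
  shows "\<P>(\<omega> in bits J q. A \<omega> \<and> B \<omega>) \<le> \<P>(\<omega> in bits J q. A \<omega>) * \<P>(\<omega> in bits J q. B \<omega>)"
  using assms
proof (induction F arbitrary: A B)
  case empty
  interpret prob_space "bits J q" by simp
  have "A \<omega> = A (\<lambda>_. False)" "B \<omega> = B (\<lambda>_. False)" for \<omega>
    by (rule dependsD[OF empty(3)], simp) (rule dependsD[OF empty(4)], simp)
  then have A: "A = (\<lambda>_. A (\<lambda>_. False))" and B: "B = (\<lambda>_. B (\<lambda>_. False))" by blast+
  obtain a b where "A = (\<lambda>_. a)" "B = (\<lambda>_. b)" using A B by metis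
  then show ?case using prob_space by (cases a; cases b) simp_all
next
  case (insert i F)
  interpret prob_space "bits J q" by simp
  have i: "i \<in> J" "0 \<le> q i" "q i \<le> 1" and F: "finite F" "F \<subseteq> J" "i \<notin> F"
    using insert.prems(1,2) insert.hyps by blast+
  note sp = prob_split_bit[where q=q, OF i F]
  have dA: "depends (\<lambda>\<omega>. A (fun_upd \<omega> i c)) F" for c
    by (rule dependsI, rule dependsD[OF insert.prems(3)]) auto
  have dB: "depends (\<lambda>\<omega>. B (fun_upd \<omega> i c)) F" for c
    by (rule dependsI, rule dependsD[OF insert.prems(4)]) auto
  have dAB: "depends (\<lambda>\<omega>. A \<omega> \<and> B \<omega>) (insert i F)"
    using insert.prems(3,4) unfolding depends_def by blast
  have IH: "\<P>(\<omega> in bits J q. A (fun_upd \<omega> i c) \<and> B (fun_upd \<omega> i c))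
      \<le> \<P>(\<omega> in bits J q. A (fun_upd \<omega> i c)) * \<P>(\<omega> in bits J q. B (fun_upd \<omega> i c))" for c
  proof (rule insert.IH[OF F(2) _ dA dB])
    show "0 \<le> q j \<and> q j \<le> 1" if "j \<in> F" for j using insert.prems(2) that by blast
    fix \<omega> \<omega>' :: "'a \<Rightarrow> bool" assume le: "\<And>j. \<omega> j \<Longrightarrow> \<omega>' j"
    show "A (fun_upd \<omega>' i c)" if "A (fun_upd \<omega> i c)"
      by (rule insert.prems(5)[OF _ that]) (use le in \<open>auto split: if_splits\<close>)
    show "B (fun_upd \<omega> i c)" if "B (fun_upd \<omega>' i c)"
      by (rule insert.prems(6)[OF _ that]) (use le in \<open>auto split: if_splits\<close>)
  qed
  define a b where "a c = \<P>(\<omega> in bits J q. A (fun_upd \<omega> i c))" and "b c = \<P>(\<omega> in bits J q. B (fun_upd \<omega> i c))" for c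
  have "a False \<le> a True" unfolding a_def
  proof (rule finite_measure_mono)
    show "{\<omega> \<in> space (bits J q). A (fun_upd \<omega> i True)} \<in> events"
      by (rule predE[OF pred_finite_depends[OF F(1,2) dA]])
    have "A (fun_upd \<omega> i True)" if "A (fun_upd \<omega> i False)" for \<omega>
      by (rule insert.prems(5)[OF _ that]) (auto split: if_splits)
    then show "{\<omega> \<in> space (bits J q). A (fun_upd \<omega> i False)} \<subseteq> {\<omega> \<in> space (bits J q). A (fun_upd \<omega> i True)}" by blast
  qed
  moreover have "b True \<le> b False" unfolding b_def
  proof (rule finite_measure_mono)
    show "{\<omega> \<in> space (bits J q). B (fun_upd \<omega> i False)} \<in> events"
      by (rule predE[OF pred_finite_depends[OF F(1,2) dB]])
    have "B (fun_upd \<omega> i False)" if "B (fun_upd \<omega> i True)" for \<omega>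
      by (rule insert.prems(6)[OF _ that]) (auto split: if_splits)
    then show "{\<omega> \<in> space (bits J q). B (fun_upd \<omega> i True)} \<subseteq> {\<omega> \<in> space (bits J q). B (fun_upd \<omega> i False)}" by blast
  qed
  ultimately have *: "0 \<le> q i * (1 - q i) * ((a True - a False) * (b False - b True))"
    using i by simp
  have "\<P>(\<omega> in bits J q. A \<omega> \<and> B \<omega>) \<le> q i * (a True * b True) + (1 - q i) * (a False * b False)"
    unfolding sp[OF dAB] a_def b_def using i by (intro add_mono mult_left_mono IH) auto
  also have "\<dots> \<le> (q i * a True + (1 - q i) * a False) * (q i * b True + (1 - q i) * b False)"
    using * by (simp add: algebra_simps)
  also have "\<dots> = \<P>(\<omega> in bits J q. A \<omega>) * \<P>(\<omega> in bits J q. B \<omega>)"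
    unfolding sp[OF insert.prems(3)] sp[OF insert.prems(4)] a_def b_def by simp
  finally show ?case .
qed

section \<open>Events of infinitely many bits\<close>

text \<open>The events that can be approximated form a \<open>\<sigma>\<close>-algebra: a countable union is close to a finite
  partial union, whose members can be approximated one by one.\<close>
lemma finite_approximation:
  assumes P: "Measurable.pred (bits J q) P" and \<delta>: "0 < (\<delta>::real)"
  shows "\<exists>F L. finite F \<and> F \<subseteq> J \<and> depends L F \<and> \<P>(\<omega> in bits J q. P \<omega> \<noteq> L \<omega>) \<le> \<delta>"
proof -
  interpret prob_space "bits J q" by simp
  let ?G = "{{f \<in> \<Pi>\<^sub>E i\<in>J. UNIV. f i \<in> A} | i A. i \<in> J \<and> A \<in> sets (count_space (UNIV::bool set))}"
  define ap where "ap S \<longleftrightarrow> (\<forall>\<delta>>0. \<exists>F L. finite F \<and> F \<subseteq> J \<and> depends L F \<and>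
     \<P>(\<omega> in bits J q. (\<omega> \<in> S) \<noteq> L \<omega>) \<le> \<delta>)" for S
  have sets: "sets (bits J q) = sigma_sets (\<Pi>\<^sub>E i\<in>J. UNIV) ?G"
    unfolding sets_bits by (subst sets_PiM_single) simp
  have "S \<in> sigma_sets (\<Pi>\<^sub>E i\<in>J. UNIV) ?G \<Longrightarrow> ap S" for S
  proof (induction rule: sigma_sets.induct)
    case (Basic a)
    then obtain i A where a: "a = {f \<in> \<Pi>\<^sub>E i\<in>J. UNIV. f i \<in> A}" "i \<in> J" by blast
    have "{\<omega>\<in>space (bits J q). (\<omega> \<in> a) \<noteq> (\<omega> i \<in> A)} = {}"
      unfolding a space_bits by blast
    moreover have "depends (\<lambda>\<omega>. \<omega> i \<in> A) {i}" by (simp add: depends_def)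
    ultimately show ?case unfolding ap_def using a(2)
      by (intro allI impI exI[of _ "{i}"] exI[of _ "\<lambda>\<omega>. \<omega> i \<in> A"]) (simp del: Collect_empty_eq)
  next
    case Empty
    show ?case unfolding ap_def
      by (intro allI impI exI[of _ "{}"] exI[of _ "\<lambda>\<omega>. False"]) (simp add: depends_def)
  next
    case (Compl a)
    show ?case unfolding ap_def
    proof (intro allI impI)
      fix \<delta> :: real assume "0 < \<delta>"
      with Compl.IH obtain F L where FL: "finite F" "F \<subseteq> J" "depends L F" "\<P>(\<omega> in bits J q. (\<omega> \<in> a) \<noteq> L \<omega>) \<le> \<delta>"
        unfolding ap_def by blast
      have "{\<omega>\<in>space (bits J q). (\<omega> \<in> (\<Pi>\<^sub>E i\<in>J. UNIV) - a) \<noteq> (\<not> L \<omega>)} = {\<omega>\<in>space (bits J q). (\<omega> \<in> a) \<noteq> L \<omega>}"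
        unfolding space_bits by blast
      then have "\<P>(\<omega> in bits J q. (\<omega> \<in> (\<Pi>\<^sub>E i\<in>J. UNIV) - a) \<noteq> (\<not> L \<omega>)) \<le> \<delta>" using FL(4) by (simp only:)
      moreover have "depends (\<lambda>\<omega>. \<not> L \<omega>) F" using FL(3) unfolding depends_def by blast
      ultimately show "\<exists>F L. finite F \<and> F \<subseteq> J \<and> depends L F \<and>
          \<P>(\<omega> in bits J q. (\<omega> \<in> (\<Pi>\<^sub>E i\<in>J. UNIV) - a) \<noteq> L \<omega>) \<le> \<delta>"
        using FL(1,2) by blast
    qed
  next
    case (Union A)
    show ?case unfolding ap_def
    proof (intro allI impI)
      fix \<delta> :: real assume \<delta>: "0 < \<delta>"
      have A: "A i \<in> events" for i unfolding sets using Union.hyps .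
      let ?B = "\<lambda>n. \<Union>i<n. A i"
      have "(\<lambda>n. prob (?B n)) \<longlonglongrightarrow> prob (\<Union>n. ?B n)"
        by (rule finite_Lim_measure_incseq) (use A in \<open>auto intro!: incseq_SucI simp: lessThan_Suc\<close>)
      moreover have "(\<Union>n. ?B n) = (\<Union>i. A i)" by blast
      ultimately have "(\<lambda>n. prob (?B n)) \<longlonglongrightarrow> prob (\<Union>i. A i)" by simp
      then have "eventually (\<lambda>n. prob (\<Union>i. A i) - \<delta>/2 < prob (?B n)) sequentially"
        by (rule order_tendstoD) (use \<delta> in simp)
      then obtain n where n: "prob (\<Union>i. A i) - \<delta>/2 < prob (?B n)" by (auto simp: eventually_sequentially)
      have n': "prob ((\<Union>i. A i) - ?B n) \<le> \<delta>/2"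
        using n A by (subst finite_measure_Diff) auto
      define \<eta> where "\<eta> = \<delta> / (2 * (real n + 1))"
      have "0 < \<eta>" using \<delta> by (simp add: \<eta>_def)
      define gd where "gd i F L \<longleftrightarrow> finite F \<and> F \<subseteq> J \<and> depends L F \<and> \<P>(\<omega> in bits J q. (\<omega> \<in> A i) \<noteq> L \<omega>) \<le> \<eta>"
        for i :: nat and F L
      have "\<exists>F L. gd i F L" for i
        using Union.IH[of i] \<open>0 < \<eta>\<close> unfolding ap_def gd_def by blast
      then obtain F L where "\<And>i. gd i (F i) (L i)" by metis
      then have FL: "\<And>i::nat. finite (F i)" "\<And>i. F i \<subseteq> J" "\<And>i. depends (L i) (F i)"
          "\<And>i. \<P>(\<omega> in bits J q. (\<omega> \<in> A i) \<noteq> L i \<omega>) \<le> \<eta>" unfolding gd_def by blast+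
      let ?F = "\<Union>i<n. F i" let ?L = "\<lambda>\<omega>. \<exists>i<n. L i \<omega>"
      let ?D = "\<lambda>i. {\<omega>\<in>space (bits J q). (\<omega> \<in> A i) \<noteq> L i \<omega>}"
      have mL: "Measurable.pred (bits J q) (L i)" for i by (rule pred_finite_depends[OF FL(1,2,3)])
      have mD: "?D i \<in> events" for i
      proof -
        have "?D i = (A i - {\<omega>\<in>space (bits J q). L i \<omega>}) \<union> ({\<omega>\<in>space (bits J q). L i \<omega>} - A i)"
          using sets.sets_into_space[OF A[of i]] by blast
        then show ?thesis by (simp only:) (intro sets.Un sets.Diff A predE mL)
      qed
      have "\<P>(\<omega> in bits J q. (\<omega> \<in> (\<Union>i. A i)) \<noteq> ?L \<omega>) \<le> prob (((\<Union>i. A i) - ?B n) \<union> (\<Union>i<n. ?D i))"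
      proof (rule finite_measure_mono)
        show "((\<Union>i. A i) - ?B n) \<union> (\<Union>i<n. ?D i) \<in> events"
          by (intro sets.Un sets.Diff sets.countable_UN sets.finite_UN image_subsetI A mD) auto
        show "{\<omega>\<in>space (bits J q). (\<omega> \<in> (\<Union>i. A i)) \<noteq> ?L \<omega>} \<subseteq> ((\<Union>i. A i) - ?B n) \<union> (\<Union>i<n. ?D i)"
          by blast
      qed
      also have "\<dots> \<le> prob ((\<Union>i. A i) - ?B n) + prob (\<Union>i<n. ?D i)"
        by (rule measure_Un_le) (intro sets.Un sets.Diff sets.countable_UN sets.finite_UN image_subsetI A mD; simp)+
      also have "prob (\<Union>i<n. ?D i) \<le> (\<Sum>i<n. prob (?D i))"
        by (rule finite_measure_subadditive_finite) (simp, intro image_subsetI mD)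
      also have "\<dots> \<le> (\<Sum>i<n. \<eta>)" by (rule sum_mono) (rule FL(4))
      also have "\<dots> \<le> \<delta> / 2" using \<delta> by (simp add: \<eta>_def field_simps)
      also note n'
      finally have "\<P>(\<omega> in bits J q. (\<omega> \<in> (\<Union>i. A i)) \<noteq> ?L \<omega>) \<le> \<delta>" by simp
      moreover have "depends ?L ?F"
        using FL(3) unfolding depends_def by (metis UN_I lessThan_iff)
      moreover have "finite ?F" "?F \<subseteq> J" using FL by auto
      ultimately show "\<exists>F L. finite F \<and> F \<subseteq> J \<and> depends L F \<and>
          \<P>(\<omega> in bits J q. (\<omega> \<in> (\<Union>i. A i)) \<noteq> L \<omega>) \<le> \<delta>" by blast
    qed
  qed
  moreover have "{\<omega>\<in>space (bits J q). P \<omega>} \<in> sigma_sets (\<Pi>\<^sub>E i\<in>J. UNIV) ?G"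
    unfolding sets[symmetric] by (rule predE[OF P])
  ultimately have "ap {\<omega>\<in>space (bits J q). P \<omega>}" by blast
  then obtain F L where FL: "finite F" "F \<subseteq> J" "depends L F"
      "\<P>(\<omega> in bits J q. (\<omega> \<in> {\<omega>\<in>space (bits J q). P \<omega>}) \<noteq> L \<omega>) \<le> \<delta>"
    using \<delta> unfolding ap_def by blast
  have "{\<omega>\<in>space (bits J q). (\<omega> \<in> {\<omega>\<in>space (bits J q). P \<omega>}) \<noteq> L \<omega>} = {\<omega>\<in>space (bits J q). P \<omega> \<noteq> L \<omega>}" by blast
  then show ?thesis using FL by (intro exI[of _ F] exI[of _ L]) (simp only:)
qed

text \<open>Revealing the bits of the random set \<open>X\<close> last: the assumption \<open>blind\<close> says that
  \<open>X\<close> is found without looking at the bits of its own elements. Hence, given \<open>X\<close>, these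
  bits are still fresh, and the probability that at least \<open>k\<close> of them are all false is at most
  \<open>(1 - s) ^ k\<close>. The formal argument applies independence to the trace of \<open>X\<close> on a finite
  set \<open>Jn n\<close> of bits.\<close>
lemma self_blind_not_all_closed:
  assumes J: "countable J"
    and q: "\<And>j. j \<in> J \<Longrightarrow> q j \<le> 1" "\<And>\<omega> j. j \<in> X \<omega> \<Longrightarrow> s \<le> q j" and s: "0 < s" "s \<le> 1"
    and XJ: "\<And>\<omega>. X \<omega> \<subseteq> J"
    and mX: "\<And>j. j \<in> J \<Longrightarrow> Measurable.pred (bits J q) (\<lambda>\<omega>. j \<in> X \<omega>)"
    and blind: "\<And>\<omega> \<omega>' F. finite F \<Longrightarrow> F \<subseteq> X \<omega> \<Longrightarrow> (\<And>j. j \<notin> F \<Longrightarrow> \<omega> j = \<omega>' j) \<Longrightarrow> X \<omega>' = X \<omega>"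
  shows "AE \<omega> in bits J q. \<not> (infinite (X \<omega>) \<and> (\<forall>j\<in>X \<omega>. \<not> \<omega> j))"
proof -
  interpret prob_space "bits J q" by simp
  let ?M = "bits J q"
  define Jn where "Jn n = {j\<in>J. to_nat_on J j < n}" for n
  have finJ: "finite (Jn n)" for n
  proof -
    have "inj_on (to_nat_on J) (Jn n)" using J by (auto simp: Jn_def intro: inj_on_subset[OF inj_on_to_nat_on])
    moreover have "to_nat_on J ` Jn n \<subseteq> {..<n}" by (auto simp: Jn_def)
    ultimately show ?thesis by (metis finite_lessThan finite_imageD finite_subset)
  qed
  have JnJ: "Jn n \<subseteq> J" for n by (auto simp: Jn_def)
  have Jn_mono: "Jn n \<subseteq> Jn m" if "n \<le> m" for n m using that by (auto simp: Jn_def)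
  have JnU: "(\<Union>n. Jn n) = J" by (auto simp: Jn_def)
  have m1: "Measurable.pred ?M (\<lambda>\<omega>. X \<omega> \<inter> Jn n = F)" for n F
  proof -
    have "Measurable.pred ?M (\<lambda>\<omega>. F \<subseteq> Jn n \<and> (\<forall>j\<in>Jn n. (j \<in> X \<omega>) = (j \<in> F)))"
      using finJ JnJ mX by (intro pred_intros_logic pred_intros_finite) auto
    moreover have "(\<lambda>\<omega>. F \<subseteq> Jn n \<and> (\<forall>j\<in>Jn n. (j \<in> X \<omega>) = (j \<in> F))) = (\<lambda>\<omega>. X \<omega> \<inter> Jn n = F)" by (rule ext) blast
    ultimately show ?thesis by (simp only:)
  qed
  have mc: "Measurable.pred ?M (\<lambda>\<omega>. k \<le> card (X \<omega> \<inter> Jn n))" for k n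
  proof -
    have "Measurable.pred ?M (\<lambda>\<omega>. \<exists>F\<in>{F\<in>Pow (Jn n). k \<le> card F}. X \<omega> \<inter> Jn n = F)"
      by (intro pred_intros_finite m1) (use finJ in auto)
    moreover have "(\<lambda>\<omega>. \<exists>F\<in>{F\<in>Pow (Jn n). k \<le> card F}. X \<omega> \<inter> Jn n = F) = (\<lambda>\<omega>. k \<le> card (X \<omega> \<inter> Jn n))"
      by (rule ext) blast
    ultimately show ?thesis by (simp only:)
  qed
  have mall: "Measurable.pred ?M (\<lambda>\<omega>. \<forall>j\<in>J. j \<in> X \<omega> \<longrightarrow> \<not> \<omega> j)"
    by (intro pred_ball_countable J pred_intros_logic mX pred_bits_coord)
  \<comment> \<open>Split according to the value \<open>F\<close> of \<open>X \<inter> Jn n\<close>: by blindness this is an event of the bits outside \<open>F\<close>.\<close>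
  have bound: "\<P>(\<omega> in ?M. k \<le> card (X \<omega> \<inter> Jn n) \<and> (\<forall>j\<in>J. j \<in> X \<omega> \<longrightarrow> \<not> \<omega> j)) \<le> (1 - s) ^ k" for k n
  proof -
    let ?FF = "{F\<in>Pow (Jn n). k \<le> card F}"
    have "\<P>(\<omega> in ?M. k \<le> card (X \<omega> \<inter> Jn n) \<and> (\<forall>j\<in>J. j \<in> X \<omega> \<longrightarrow> \<not> \<omega> j))
       \<le> prob (\<Union>F\<in>?FF. {\<omega>\<in>space ?M. X \<omega> \<inter> Jn n = F \<and> (\<forall>j\<in>F. \<omega> j = False)})"
    proof (rule finite_measure_mono)
      show "(\<Union>F\<in>?FF. {\<omega>\<in>space ?M. X \<omega> \<inter> Jn n = F \<and> (\<forall>j\<in>F. \<omega> j = False)}) \<in> events"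
      proof (intro sets.finite_UN predE pred_intros_logic m1 pred_ball_coord)
        show "finite F" "F \<subseteq> J" if "F \<in> ?FF" for F using that finJ[of n] JnJ[of n] finite_subset by auto
      qed (use finJ in auto)
      show "{\<omega> \<in> space ?M. k \<le> card (X \<omega> \<inter> Jn n) \<and> (\<forall>j\<in>J. j \<in> X \<omega> \<longrightarrow> \<not> \<omega> j)}
        \<subseteq> (\<Union>F\<in>?FF. {\<omega>\<in>space ?M. X \<omega> \<inter> Jn n = F \<and> (\<forall>j\<in>F. \<omega> j = False)})"
        using JnJ[of n] by blast
    qed
    also have "\<dots> \<le> (\<Sum>F\<in>?FF. \<P>(\<omega> in ?M. X \<omega> \<inter> Jn n = F \<and> (\<forall>j\<in>F. \<omega> j = False)))"
    proof (rule finite_measure_subadditive_finite)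
      show "(\<lambda>F. {\<omega>\<in>space ?M. X \<omega> \<inter> Jn n = F \<and> (\<forall>j\<in>F. \<omega> j = False)}) ` ?FF \<subseteq> events"
      proof (intro image_subsetI predE pred_intros_logic m1 pred_ball_coord)
        show "finite F" "F \<subseteq> J" if "F \<in> ?FF" for F using that finJ[of n] JnJ[of n] finite_subset by auto
      qed
    qed (use finJ in auto)
    also have "\<dots> \<le> (\<Sum>F\<in>?FF. \<P>(\<omega> in ?M. X \<omega> \<inter> Jn n = F) * (1 - s) ^ k)"
    proof (rule sum_mono)
      fix F assume F: "F \<in> ?FF"
      then have F': "finite F" "F \<subseteq> J" "k \<le> card F" using finJ[of n] JnJ[of n] finite_subset by auto
      have "\<P>(\<omega> in ?M. X \<omega> \<inter> Jn n = F \<and> (\<forall>j\<in>F. \<omega> j = False))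
        = \<P>(\<omega> in ?M. X \<omega> \<inter> Jn n = F) * \<P>(\<omega> in ?M. \<forall>j\<in>F. \<omega> j = False)"
      proof (rule bits_indep[OF m1 pred_ball_coord[OF F'(1,2)], where X="-F" and Y=F])
        have half: "X \<omega>' \<inter> Jn n = F" if "\<And>j. j \<in> -F \<Longrightarrow> \<omega> j = \<omega>' j" "X \<omega> \<inter> Jn n = F" for \<omega> \<omega>'
        proof -
          have "X \<omega>' = X \<omega>" by (rule blind[of F]) (use that F' in auto)
          then show ?thesis using that by simp
        qed
        show "depends (\<lambda>\<omega>. X \<omega> \<inter> Jn n = F) (- F)"
        proof (rule dependsI)
          fix \<omega> \<omega>' :: "'a \<Rightarrow> bool" assume e: "\<And>j. j \<in> -F \<Longrightarrow> \<omega> j = \<omega>' j"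
          show "(X \<omega> \<inter> Jn n = F) = (X \<omega>' \<inter> Jn n = F)"
            using half[of \<omega> \<omega>'] half[of \<omega>' \<omega>] e by metis
        qed
      qed (auto simp: depends_def)
      also have "\<dots> \<le> \<P>(\<omega> in ?M. X \<omega> \<inter> Jn n = F) * (1 - s) ^ k"
      proof (cases "\<P>(\<omega> in ?M. X \<omega> \<inter> Jn n = F) = 0")
        case False
        have "\<exists>\<omega>. X \<omega> \<inter> Jn n = F"
        proof (rule ccontr)
          assume "\<nexists>\<omega>. X \<omega> \<inter> Jn n = F"
          then have "{\<omega>\<in>space ?M. X \<omega> \<inter> Jn n = F} = {}" by blast
          with False show False by (simp only: measure_empty)
        qed
        then obtain \<omega>0 where \<omega>0: "F \<subseteq> X \<omega>0" by blast
        have qF: "s \<le> q j" "q j \<le> 1" if "j \<in> F" for j using that \<omega>0 q(2)[of j \<omega>0] q(1)[of j] F'(2) by blast+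
        have "\<P>(\<omega> in ?M. \<forall>j\<in>F. \<omega> j = False) = (\<Prod>j\<in>F. 1 - q j)"
          unfolding prob_all_eq[OF F'(1,2)]
        proof (rule prod.cong[OF refl])
          fix j assume j: "j \<in> F"
          have "j \<in> J" "0 \<le> q j" "q j \<le> 1" using j F'(2) qF[OF j] s by auto
          from prob_bit[of j J q False, OF this] show "\<P>(\<omega> in ?M. \<omega> j = False) = 1 - q j"
            by (simp only: if_False)
        qed
        also have "\<dots> \<le> (\<Prod>j\<in>F. 1 - s)" using qF by (intro prod_mono) auto
        also have "\<dots> \<le> (1 - s) ^ k" using s F'(3) by (simp add: power_decreasing)
        finally show ?thesis by (intro mult_left_mono) auto
      qed (simp only: mult_zero_left order_refl)
      finally show "\<P>(\<omega> in ?M. X \<omega> \<inter> Jn n = F \<and> (\<forall>j\<in>F. \<omega> j = False))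
         \<le> \<P>(\<omega> in ?M. X \<omega> \<inter> Jn n = F) * (1 - s) ^ k" .
    qed
    also have "\<dots> = (\<Sum>F\<in>?FF. \<P>(\<omega> in ?M. X \<omega> \<inter> Jn n = F)) * (1 - s) ^ k"
      by (rule sum_distrib_right[symmetric])
    also have "\<dots> \<le> 1 * (1 - s) ^ k"
    proof (rule mult_right_mono)
      have "(\<Sum>F\<in>?FF. \<P>(\<omega> in ?M. X \<omega> \<inter> Jn n = F)) = prob (\<Union>F\<in>?FF. {\<omega>\<in>space ?M. X \<omega> \<inter> Jn n = F})"
      proof (rule finite_measure_finite_Union[symmetric])
        show "disjoint_family_on (\<lambda>F. {\<omega>\<in>space ?M. X \<omega> \<inter> Jn n = F}) ?FF" unfolding disjoint_family_on_def by blast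
        show "(\<lambda>F. {\<omega>\<in>space ?M. X \<omega> \<inter> Jn n = F}) ` ?FF \<subseteq> events" by (intro image_subsetI predE m1)
      qed (use finJ in auto)
      then show "(\<Sum>F\<in>?FF. \<P>(\<omega> in ?M. X \<omega> \<inter> Jn n = F)) \<le> 1" by (simp only: prob_le_1)
    qed (use s(2) in auto)
    finally show ?thesis by simp
  qed
  let ?C = "\<lambda>k n. {\<omega>\<in>space ?M. k \<le> card (X \<omega> \<inter> Jn n) \<and> (\<forall>j\<in>J. j \<in> X \<omega> \<longrightarrow> \<not> \<omega> j)}"
  let ?A = "{\<omega>\<in>space ?M. infinite (X \<omega>) \<and> (\<forall>j\<in>J. j \<in> X \<omega> \<longrightarrow> \<not> \<omega> j)}"
  have inf_iff: "infinite (X \<omega>) \<longleftrightarrow> (\<forall>k. \<exists>n. k \<le> card (X \<omega> \<inter> Jn n))" for \<omega>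
  proof
    assume inf: "infinite (X \<omega>)"
    show "\<forall>k. \<exists>n. k \<le> card (X \<omega> \<inter> Jn n)"
    proof
      fix k
      obtain F where F: "F \<subseteq> X \<omega>" "finite F" "card F = k" using infinite_arbitrarily_large[OF inf] by blast
      define n where "n = Suc (Max (insert 0 (to_nat_on J ` F)))"
      have "F \<subseteq> X \<omega> \<inter> Jn n"
      proof
        fix j assume j: "j \<in> F"
        have "to_nat_on J j \<le> Max (insert 0 (to_nat_on J ` F))" using F j by (intro Max_ge) auto
        then have "to_nat_on J j < n" unfolding n_def by (rule le_imp_less_Suc)
        then show "j \<in> X \<omega> \<inter> Jn n" using j F XJ[of \<omega>] by (auto simp: Jn_def)
      qed
      then have "k \<le> card (X \<omega> \<inter> Jn n)" unfolding F(3)[symmetric] using finJ[of n] by (intro card_mono) auto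
      then show "\<exists>n. k \<le> card (X \<omega> \<inter> Jn n)" by blast
    qed
  next
    assume *: "\<forall>k. \<exists>n. k \<le> card (X \<omega> \<inter> Jn n)"
    show "infinite (X \<omega>)"
    proof
      assume f: "finite (X \<omega>)"
      obtain n where "Suc (card (X \<omega>)) \<le> card (X \<omega> \<inter> Jn n)" using * by blast
      moreover have "card (X \<omega> \<inter> Jn n) \<le> card (X \<omega>)" using f by (intro card_mono) auto
      ultimately show False by simp
    qed
  qed
  have minf: "Measurable.pred ?M (\<lambda>\<omega>. infinite (X \<omega>) \<and> (\<forall>j\<in>J. j \<in> X \<omega> \<longrightarrow> \<not> \<omega> j))"
    unfolding inf_iff by (intro pred_intros_logic pred_intros_countable mc mall)
  have le: "prob ?A \<le> (1 - s) ^ k" for k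
  proof -
    have C: "?C k n \<in> events" for n by (intro predE pred_intros_logic mc mall)
    have inc: "incseq (?C k)"
    proof (rule incseq_SucI)
      fix n
      have "card (X \<omega> \<inter> Jn n) \<le> card (X \<omega> \<inter> Jn (Suc n))" for \<omega>
        using finJ[of "Suc n"] Jn_mono[of n "Suc n"] by (intro card_mono) auto
      then have "k \<le> card (X \<omega> \<inter> Jn (Suc n))" if "k \<le> card (X \<omega> \<inter> Jn n)" for \<omega>
        using that order_trans by blast
      then show "?C k n \<subseteq> ?C k (Suc n)" by blast
    qed
    have "(\<lambda>n. prob (?C k n)) \<longlonglongrightarrow> prob (\<Union>n. ?C k n)"
      by (rule finite_Lim_measure_incseq[OF _ inc]) (intro image_subsetI C)
    then have "prob (\<Union>n. ?C k n) \<le> (1 - s) ^ k"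
      by (rule LIMSEQ_le_const2) (intro exI allI impI bound)
    moreover have "prob ?A \<le> prob (\<Union>n. ?C k n)"
    proof (rule finite_measure_mono)
      show "(\<Union>n. ?C k n) \<in> events" by (intro sets.countable_UN image_subsetI C)
      show "?A \<subseteq> (\<Union>n. ?C k n)" unfolding inf_iff by blast
    qed
    ultimately show ?thesis by simp
  qed
  have "prob ?A \<le> 0"
  proof -
    have "(\<lambda>k. (1 - s) ^ k) \<longlonglongrightarrow> 0" using s by (intro LIMSEQ_power_zero) auto
    then show ?thesis by (rule LIMSEQ_le_const) (intro exI allI impI le)
  qed
  then have "prob ?A = 0" using measure_nonneg by (rule order_antisym)
  then have "AE \<omega> in ?M. \<omega> \<notin> ?A" by (simp only: prob_eq_0[OF predE[OF minf]])
  then show ?thesis using AE_space by eventually_elim (use XJ in blast)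
qed

text \<open>Finite-dimensional distributions factor by \<open>bits_indep\<close>. This serves for automorphisms, where a block
  is a single edge, and for couplings, where it consists of the two bits of an edge.\<close>
lemma distr_bits:
  fixes J :: "'j set" and E :: "'e set"
  assumes m: "\<And>e. e \<in> E \<Longrightarrow> Measurable.pred (bits J q) (\<lambda>\<omega>. g \<omega> e)"
    and d: "\<And>e. e \<in> E \<Longrightarrow> depends (\<lambda>\<omega>. g \<omega> e) (blk e)"
    and disj: "\<And>e e'. e \<in> E \<Longrightarrow> e' \<in> E \<Longrightarrow> e \<noteq> e' \<Longrightarrow> J \<inter> blk e \<inter> blk e' = {}"
    and p: "\<And>e. e \<in> E \<Longrightarrow> 0 \<le> p e \<and> p e \<le> 1 \<and> \<P>(\<omega> in bits J q. g \<omega> e) = p e"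
  shows "distr (bits J q) (bits E p) (\<lambda>\<omega>. restrict (g \<omega>) E) = bits E p"
proof -
  interpret prob_space "bits J q" by simp
  let ?N = "\<lambda>e. measure_pmf (bernoulli_pmf (p e))"
  let ?g = "\<lambda>\<omega>. restrict (g \<omega>) E"
  have mg: "?g \<in> measurable (bits J q) (bits E p)" by (rule measurable_bits_into[OF m])
  have mA: "Measurable.pred (bits J q) (\<lambda>\<omega>. g \<omega> e \<in> A)" if "e \<in> E" for e A
    by (rule measurable_compose[OF m[OF that]]) simp
  have pA: "\<P>(\<omega> in bits J q. g \<omega> e \<in> A) = measure (?N e) A" if e: "e \<in> E" for e A
  proof -
    have T: "\<P>(\<omega> in bits J q. g \<omega> e) = p e" and p01: "0 \<le> p e" "p e \<le> 1" using p[OF e] by auto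
    have F: "\<P>(\<omega> in bits J q. \<not> g \<omega> e) = 1 - p e"
      using prob_neg[OF predE[OF m[OF e]]] T by simp
    have "A = (if True \<in> A then {True} else {}) \<union> (if False \<in> A then {False} else {})"
    proof (rule set_eqI)
      show "b \<in> A \<longleftrightarrow> b \<in> (if True \<in> A then {True} else {}) \<union> (if False \<in> A then {False} else {})" for b
        by (cases b) simp_all
    qed
    then consider "A = {}" | "A = {True}" | "A = {False}" | "A = UNIV"
      unfolding UNIV_bool by (cases "True \<in> A"; cases "False \<in> A") auto
    then show ?thesis
    proof cases
      case 2 then show ?thesis using T p01 by (simp add: measure_pmf_single)
    next
      case 3 then show ?thesis using F p01 by (simp add: measure_pmf_single)
    qed (simp_all add: prob_space)
  qed
  have all: "\<P>(\<omega> in bits J q. \<forall>e\<in>K. g \<omega> e \<in> A e) = (\<Prod>e\<in>K. measure (?N e) (A e))"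
    if "finite K" "K \<subseteq> E" for K A
    using that
  proof (induction K)
    case empty
    show ?case using prob_space by simp
  next
    case (insert i K)
    have iF: "i \<in> E" "K \<subseteq> E" "finite K" "i \<notin> K" using insert.prems(1) insert.hyps by blast+
    have "\<P>(\<omega> in bits J q. g \<omega> i \<in> A i \<and> (\<forall>e\<in>K. g \<omega> e \<in> A e)) =
        \<P>(\<omega> in bits J q. g \<omega> i \<in> A i) * \<P>(\<omega> in bits J q. \<forall>e\<in>K. g \<omega> e \<in> A e)"
    proof (rule bits_indep[where X="blk i" and Y="\<Union>e\<in>K. blk e"])
      show "Measurable.pred (bits J q) (\<lambda>\<omega>. g \<omega> i \<in> A i)" by (rule mA[OF iF(1)])
      show "Measurable.pred (bits J q) (\<lambda>\<omega>. \<forall>e\<in>K. g \<omega> e \<in> A e)"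
        by (rule pred_intros_finite(3)) (use iF mA in auto)
      show "J \<inter> blk i \<inter> (\<Union>e\<in>K. blk e) = {}" using disj[OF iF(1)] iF by blast
      show "depends (\<lambda>\<omega>. g \<omega> i \<in> A i) (blk i)"
      proof (rule dependsI)
        fix \<omega> \<omega>' :: "'j \<Rightarrow> bool" assume "\<And>j. j \<in> blk i \<Longrightarrow> \<omega> j = \<omega>' j"
        then have "g \<omega> i = g \<omega>' i" by (rule dependsD[OF d[OF iF(1)]])
        then show "(g \<omega> i \<in> A i) = (g \<omega>' i \<in> A i)" by (simp only:)
      qed
      show "depends (\<lambda>\<omega>. \<forall>e\<in>K. g \<omega> e \<in> A e) (\<Union>e\<in>K. blk e)"
      proof (rule dependsI)
        fix \<omega> \<omega>' :: "'j \<Rightarrow> bool" assume eq: "\<And>j. j \<in> (\<Union>e\<in>K. blk e) \<Longrightarrow> \<omega> j = \<omega>' j"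
        have "g \<omega> e = g \<omega>' e" if "e \<in> K" for e
          by (rule dependsD[OF d[of e]]) (use that iF eq in auto)
        then show "(\<forall>e\<in>K. g \<omega> e \<in> A e) = (\<forall>e\<in>K. g \<omega>' e \<in> A e)" by auto
      qed
    qed
    moreover have "{\<omega> \<in> space (bits J q). g \<omega> i \<in> A i \<and> (\<forall>e\<in>K. g \<omega> e \<in> A e)}
        = {\<omega> \<in> space (bits J q). \<forall>e\<in>insert i K. g \<omega> e \<in> A e}" by blast
    ultimately show ?case
      unfolding prod.insert[OF iF(3,4)] insert.IH[OF iF(2), symmetric] pA[OF iF(1), symmetric] by (simp only:)
  qed
  show ?thesis unfolding bits_def[of E p]
  proof (rule measure_eqI_PiM_infinite)
    let ?D = "distr (bits J q) (Pi\<^sub>M E ?N) ?g"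
    show "sets ?D = sets (Pi\<^sub>M E ?N)" "sets (Pi\<^sub>M E ?N) = sets (Pi\<^sub>M E ?N)" by simp_all
    show "finite_measure ?D"
      by (rule prob_space.finite_measure, rule prob_space_distr) (use mg in \<open>simp add: bits_def\<close>)
    fix K A assume K: "finite K" "K \<subseteq> E" and A: "\<And>i. i \<in> K \<Longrightarrow> A i \<in> sets (?N i)"
    have "emeasure ?D (prod_emb E ?N K (Pi\<^sub>E K A)) = emeasure (bits J q) (?g -` prod_emb E ?N K (Pi\<^sub>E K A) \<inter> space (bits J q))"
      by (rule emeasure_distr) (use mg K A in \<open>auto simp: bits_def intro!: sets_PiM_I\<close>)
    also have "?g -` prod_emb E ?N K (Pi\<^sub>E K A) \<inter> space (bits J q) = {\<omega> \<in> space (bits J q). \<forall>e\<in>K. g \<omega> e \<in> A e}"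
      using K(2) by (auto simp: prod_emb_def PiE_iff restrict_def extensional_def subset_iff)
    also have "emeasure (bits J q) \<dots> = ennreal (\<Prod>e\<in>K. measure (?N e) (A e))"
      unfolding emeasure_eq_measure all[OF K] ..
    also have "\<dots> = (\<Prod>e\<in>K. emeasure (?N e) (A e))"
      by (subst prod_ennreal[symmetric]) (auto simp: measure_pmf.emeasure_eq_measure)
    also have "\<dots> = emeasure (Pi\<^sub>M E ?N) (prod_emb E ?N K (Pi\<^sub>E K A))"
      by (rule emeasure_PiM_emb[symmetric]) (use K A in \<open>auto intro: prob_space_measure_pmf\<close>)
    finally show "emeasure ?D (prod_emb E ?N K (Pi\<^sub>E K A)) = emeasure (Pi\<^sub>M E ?N) (prod_emb E ?N K (Pi\<^sub>E K A))" .
  qed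
qed

section \<open>Balls, spheres and clusters\<close>

text \<open>Balls in a set \<open>K\<close> of edges, defined by recursion on the radius rather than by the distance; they agree
  with the intrinsic balls by \<open>graph_dist_le_iff\<close> below.\<close>
fun bl :: "'a set set \<Rightarrow> 'a \<Rightarrow> nat \<Rightarrow> 'a set" where
  "bl K x 0 = {x}"
| "bl K x (Suc n) = bl K x n \<union> {w. \<exists>u\<in>bl K x n. {u, w} \<in> K}"

text \<open>The open ball, that is the ball of radius \<open>r - 1\<close>, which is empty for \<open>r = 0\<close>.\<close>
definition inn :: "'a set set \<Rightarrow> 'a \<Rightarrow> nat \<Rightarrow> 'a set" where
  "inn K x r = (\<Union>i<r. bl K x i)"

definition sph :: "'a set set \<Rightarrow> 'a \<Rightarrow> nat \<Rightarrow> 'a set" where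
  "sph K x r = bl K x r - inn K x r"

definition clu :: "'a set set \<Rightarrow> 'a \<Rightarrow> 'a set" where
  "clu K x = (\<Union>n. bl K x n)"

definition off :: "'a set \<Rightarrow> 'a set set \<Rightarrow> 'a set set" where
  "off A K = {e\<in>K. e \<inter> A = {}}"

lemma bl_refl [simp]: "x \<in> bl K x n"
  by (induction n) auto

lemma bl_mono_radius: "m \<le> n \<Longrightarrow> bl K x m \<subseteq> bl K x n"
  by (induction rule: dec_induct) auto

lemma bl_mono: "K \<subseteq> K' \<Longrightarrow> bl K x n \<subseteq> bl K' x n"
  by (induction n) auto

lemma bl_trans: "y \<in> bl K x m \<Longrightarrow> z \<in> bl K y n \<Longrightarrow> z \<in> bl K x (m + n)"
  by (induction n arbitrary: z) auto

lemma bl_sym: "y \<in> bl K x n \<Longrightarrow> x \<in> bl K y n"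
proof (induction n arbitrary: y)
  case (Suc n)
  from Suc.prems consider "y \<in> bl K x n" | u where "u \<in> bl K x n" "{u, y} \<in> K" by auto
  then show ?case
  proof cases
    case 1 then show ?thesis using Suc.IH by auto
  next
    case 2
    then have "u \<in> bl K y 1" by (auto simp: insert_commute)
    with Suc.IH[OF 2(1)] show ?thesis using bl_trans[of u K y 1 x n] by simp
  qed
qed simp

lemma bl_relpow: "w \<in> bl K x n \<longleftrightarrow> (\<exists>m\<le>n. (adjacent K ^^ m) x w)"
proof (induction n arbitrary: w)
  case (Suc n)
  show ?case
  proof
    assume "w \<in> bl K x (Suc n)"
    then consider "w \<in> bl K x n" | u where "u \<in> bl K x n" "{u, w} \<in> K" by auto
    then show "\<exists>m\<le>Suc n. (adjacent K ^^ m) x w"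
    proof cases
      case 1 then show ?thesis using Suc.IH[of w] by (meson le_SucI)
    next
      case 2
      then obtain m where "m \<le> n" "(adjacent K ^^ m) x u" using Suc.IH[of u] by blast
      moreover have "adjacent K u w" using 2 by (simp add: adjacent_def)
      ultimately show ?thesis by (intro exI[of _ "Suc m"]) auto
    qed
  next
    assume "\<exists>m\<le>Suc n. (adjacent K ^^ m) x w"
    then obtain m where m: "m \<le> Suc n" "(adjacent K ^^ m) x w" by blast
    show "w \<in> bl K x (Suc n)"
    proof (cases m)
      case 0
      then show ?thesis using m by simp
    next
      case (Suc k)
      then obtain u where "(adjacent K ^^ k) x u" "adjacent K u w" using m by auto
      moreover have "k \<le> n" using m Suc by simp
      ultimately have "u \<in> bl K x n" using Suc.IH[of u] by blast
      moreover have "{u, w} \<in> K" using \<open>adjacent K u w\<close> by (simp add: adjacent_def)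
      ultimately show ?thesis by auto
    qed
  qed
qed auto

lemma INF_enat_le_iff: "(INF n\<in>S. enat n) \<le> enat r \<longleftrightarrow> (\<exists>n\<in>S. n \<le> r)"
proof
  assume *: "(INF n\<in>S. enat n) \<le> enat r"
  show "\<exists>n\<in>S. n \<le> r"
  proof (rule ccontr)
    assume "\<not> (\<exists>n\<in>S. n \<le> r)"
    then have "enat (Suc r) \<le> (INF n\<in>S. enat n)" by (intro INF_greatest) auto
    with * have "enat (Suc r) \<le> enat r" by (rule order_trans[rotated])
    then show False by simp
  qed
qed (auto intro: INF_lower2)

lemma graph_dist_le_iff: "graph_dist K x w \<le> enat r \<longleftrightarrow> w \<in> bl K x r"
  unfolding graph_dist_def INF_enat_le_iff bl_relpow by auto

lemma int_ball_eq: "int_ball E \<omega> x r = bl (open_edges E \<omega>) x r"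
  unfolding int_ball_def graph_dist_le_iff by simp

lemma int_sphere_eq: "int_sphere E \<omega> x r = sph (open_edges E \<omega>) x r"
proof -
  have "d = enat r \<longleftrightarrow> d \<le> enat r \<and> \<not> (\<exists>i<r. d \<le> enat i)" for d
  proof (cases d)
    case (enat n)
    then show ?thesis by (auto simp: not_le) (metis nat_less_le not_le)
  qed simp
  then show ?thesis
    unfolding int_sphere_def sph_def inn_def by (auto simp: graph_dist_le_iff)
qed

lemma open_cluster_eq: "open_cluster E \<omega> x = clu (open_edges E \<omega>) x"
  unfolding open_cluster_def clu_def rtranclp_power bl_relpow UN_iff set_eq_iff mem_Collect_eq
  using order_refl by blast

lemma off_subset: "off A K \<subseteq> K" by (auto simp: off_def)

text \<open>After its last visit to the sphere of radius \<open>r\<close>, a shortest path avoids all edges that touch the open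
  ball.\<close>
lemma bl_through_sphere:
  "z \<in> bl K x (r + s) \<Longrightarrow> z \<notin> inn K x r \<Longrightarrow> \<exists>u\<in>sph K x r. z \<in> bl (off (inn K x r) K) u s"
proof (induction s arbitrary: z)
  case 0
  then show ?case by (intro bexI[of _ z]) (auto simp: sph_def)
next
  case (Suc s)
  show ?case
  proof (cases "z \<in> bl K x (r + s)")
    case True
    then show ?thesis using Suc by auto
  next
    case False
    then obtain u' where u': "u' \<in> bl K x (r + s)" "{u', z} \<in> K" using Suc.prems(1) by auto
    have "u' \<notin> inn K x r"
    proof
      assume "u' \<in> inn K x r"
      then obtain i where i: "i < r" "u' \<in> bl K x i" by (auto simp: inn_def)
      then have "z \<in> bl K x (Suc i)" using u'(2) by auto
      moreover have "bl K x (Suc i) \<subseteq> bl K x (r + s)" using i by (intro bl_mono_radius) simp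
      ultimately show False using False by blast
    qed
    then obtain u where u: "u \<in> sph K x r" "u' \<in> bl (off (inn K x r) K) u s" using Suc.IH u'(1) by blast
    have "{u', z} \<in> off (inn K x r) K" using u'(2) \<open>u' \<notin> inn K x r\<close> Suc.prems(2) by (auto simp: off_def)
    then show ?thesis using u by auto
  qed
qed

text \<open>Similarly, a path that ends outside \<open>A\<close> avoids \<open>A\<close> after its last exit.\<close>
lemma bl_leave_set:
  "x \<in> A \<Longrightarrow> z \<in> bl K x t \<Longrightarrow> z \<notin> A \<Longrightarrow>
     \<exists>u. u \<notin> A \<and> (\<exists>y\<in>A. {y, u} \<in> K) \<and> z \<in> bl (off A K) u t"
proof (induction t arbitrary: z)
  case (Suc t)
  show ?case
  proof (cases "z \<in> bl K x t")
    case True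
    then show ?thesis using Suc by fastforce
  next
    case False
    then obtain u' where u': "u' \<in> bl K x t" "{u', z} \<in> K" using Suc.prems by auto
    show ?thesis
    proof (cases "u' \<in> A")
      case True
      then show ?thesis using u' Suc.prems(3) by (intro exI[of _ z]) auto
    next
      case False
      then obtain u where u: "u \<notin> A" "\<exists>y\<in>A. {y, u} \<in> K" "u' \<in> bl (off A K) u t"
        using Suc.IH[OF Suc.prems(1) u'(1)] by blast
      have "{u', z} \<in> off A K" using u'(2) False Suc.prems(3) by (auto simp: off_def)
      then show ?thesis using u by (intro exI[of _ u]) auto
    qed
  qed
qed auto

text \<open>The sphere of radius \<open>r\<close> is found by looking only at edges that touch the open ball of radius
  \<open>r\<close>.\<close>
lemma bl_local:
  assumes "\<And>e. e \<inter> inn K x r \<noteq> {} \<Longrightarrow> e \<in> K \<longleftrightarrow> e \<in> K'" "i \<le> r"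
  shows "bl K x i = bl K' x i"
  using assms(2)
proof (induction i)
  case (Suc i)
  have "bl K x i \<subseteq> inn K x r" using Suc.prems by (auto simp: inn_def intro!: bexI[of _ i])
  then have "{u, w} \<in> K \<longleftrightarrow> {u, w} \<in> K'" if "u \<in> bl K x i" for u w
    using that by (intro assms(1)) auto
  moreover have "bl K x i = bl K' x i" using Suc by simp
  ultimately show ?case unfolding bl.simps by blast
qed simp

lemma inn_subset_bl: "inn K x r \<subseteq> bl K x r"
  unfolding inn_def by (intro UN_least bl_mono_radius) simp

lemma inn_Suc: "inn K x (Suc r) = bl K x r"
proof
  show "inn K x (Suc r) \<subseteq> bl K x r" unfolding inn_def by (intro UN_least bl_mono_radius) simp
qed (auto simp: inn_def)

lemma bl_local':
  assumes "\<And>e. e \<inter> bl K x r \<noteq> {} \<Longrightarrow> e \<in> K \<longleftrightarrow> e \<in> K'" "i \<le> r"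
  shows "bl K x i = bl K' x i"
proof (rule bl_local[of K x "Suc r"])
  fix e assume "e \<inter> inn K x (Suc r) \<noteq> {}"
  then show "e \<in> K \<longleftrightarrow> e \<in> K'" unfolding inn_Suc by (rule assms(1))
next
  show "i \<le> Suc r" using assms(2) by simp
qed

lemma clu_refl [simp]: "x \<in> clu K x"
  unfolding clu_def by (rule UN_I[of 0]) simp_all
lemma clu_mono: "K \<subseteq> K' \<Longrightarrow> clu K x \<subseteq> clu K' x"
  unfolding clu_def by (intro UN_mono bl_mono) auto
lemma clu_sym: "y \<in> clu K x \<Longrightarrow> x \<in> clu K y"
  unfolding clu_def UN_iff by (elim bexE, rule bexI, erule bl_sym, simp)
lemma clu_trans: "y \<in> clu K x \<Longrightarrow> z \<in> clu K y \<Longrightarrow> z \<in> clu K x"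
  unfolding clu_def UN_iff by (elim bexE, rule bexI, erule (1) bl_trans, simp)
lemma clu_edge: "y \<in> clu K x \<Longrightarrow> {y, z} \<in> K \<Longrightarrow> z \<in> clu K x"
  by (rule clu_trans[of y], assumption) (auto simp: clu_def intro!: exI[of _ 1])

lemma bl_cong_clu:
  assumes "\<And>e. e \<inter> clu K x \<noteq> {} \<Longrightarrow> e \<in> K \<longleftrightarrow> e \<in> K'"
  shows "bl K x i = bl K' x i"
proof (rule bl_local'[where r=i])
  fix e assume "e \<inter> bl K x i \<noteq> {}"
  then have "e \<inter> clu K x \<noteq> {}" by (auto simp: clu_def)
  then show "e \<in> K \<longleftrightarrow> e \<in> K'" by (rule assms)
qed simp

lemma sph_empty_imp_finite: "sph K x (Suc r) = {} \<Longrightarrow> clu K x = bl K x r"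
proof -
  assume "sph K x (Suc r) = {}"
  then have *: "bl K x (Suc r) = bl K x r" using bl_mono_radius[of r "Suc r" K x] by (auto simp: sph_def inn_Suc)
  have "bl K x (r + n) = bl K x r" for n
    by (induction n) (use * in auto)
  then have "bl K x n \<subseteq> bl K x r" for n
    using bl_mono_radius[of n "r + n" K x] by simp
  then show ?thesis unfolding clu_def by blast
qed

section \<open>Quasi-transitive graphs\<close>

locale qt_graph =
  fixes V :: "'a set" and E :: "'a set set"
  assumes simple: "simple_graph V E" and conn: "connected_graph V E"
    and locfin: "locally_finite V E" and qt: "quasi_transitive V E"
begin

lemma edge_in_V: "{x, y} \<in> E \<Longrightarrow> x \<in> V \<and> y \<in> V"
  using simple by (fastforce simp: simple_graph_def doubleton_eq_iff)

lemma edgeE: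
  assumes "e \<in> E" obtains x y where "e = {x, y}" "x \<in> V" "y \<in> V" "x \<noteq> y"
  using assms simple by (auto simp: simple_graph_def)

lemma bl_subset_V: "K \<subseteq> E \<Longrightarrow> x \<in> V \<Longrightarrow> bl K x n \<subseteq> V"
  by (induction n) (auto dest: edge_in_V)

lemma clu_subset_V: "K \<subseteq> E \<Longrightarrow> x \<in> V \<Longrightarrow> clu K x \<subseteq> V"
  unfolding clu_def by (intro UN_least bl_subset_V)

lemma finite_nbrs: "x \<in> V \<Longrightarrow> finite {y. {x, y} \<in> E}"
  using locfin by (auto simp: locally_finite_def adjacent_def)

lemma finite_bl: "K \<subseteq> E \<Longrightarrow> x \<in> V \<Longrightarrow> finite (bl K x n)"
proof (induction n)
  case (Suc n)
  have "{w. \<exists>u\<in>bl K x n. {u, w} \<in> K} \<subseteq> (\<Union>u\<in>bl K x n. {y. {u, y} \<in> E})" using Suc.prems by blast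
  moreover have "finite (\<Union>u\<in>bl K x n. {y. {u, y} \<in> E})"
    using Suc bl_subset_V[of K x n] by (intro finite_UN_I finite_nbrs) auto
  ultimately have "finite {w. \<exists>u\<in>bl K x n. {u, w} \<in> K}" by (rule finite_subset)
  then show ?case using Suc unfolding bl.simps by blast
qed simp

lemma V_eq_ball_union: "x \<in> V \<Longrightarrow> V = (\<Union>n. bl E x n)"
proof -
  assume x: "x \<in> V"
  have "w \<in> (\<Union>n. bl E x n)" if "w \<in> V" for w
  proof -
    have "(adjacent E)\<^sup>*\<^sup>* x w" using conn x that by (simp add: connected_graph_def)
    then obtain n where "(adjacent E ^^ n) x w" by (auto simp: rtranclp_power)
    then have "w \<in> bl E x n" by (auto simp: bl_relpow)
    then show ?thesis by blast
  qed
  then show ?thesis using bl_subset_V[OF order_refl x] by blast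
qed

lemma countable_V: "countable V"
proof (cases "V = {}")
  case False
  then obtain x where x: "x \<in> V" by blast
  have "countable (\<Union>n. bl E x n)"
    by (rule countable_UN) (simp_all add: countable_finite[OF finite_bl[OF order_refl x]])
  then show ?thesis using V_eq_ball_union[OF x] by simp
qed simp

lemma countable_E: "countable E"
proof -
  have "E \<subseteq> (\<lambda>(x, y). {x, y}) ` (V \<times> V)" by (auto elim!: edgeE)
  then show ?thesis using countable_V by (meson countable_SIGMA countable_image countable_subset)
qed

definition img :: "('a \<Rightarrow> 'a) \<Rightarrow> 'a set set \<Rightarrow> 'a set set" where
  "img f K = (\<lambda>e. f ` e) ` K"

lemma auto_bij: "f \<in> automorphisms V E \<Longrightarrow> bij_betw f V V"
  by (simp add: automorphisms_def)

lemma auto_in_V: "f \<in> automorphisms V E \<Longrightarrow> x \<in> V \<Longrightarrow> f x \<in> V"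
  using auto_bij bij_betwE by blast

lemma auto_inj: "f \<in> automorphisms V E \<Longrightarrow> inj_on f V"
  using auto_bij bij_betw_imp_inj_on by blast

lemma auto_edge: "f \<in> automorphisms V E \<Longrightarrow> x \<in> V \<Longrightarrow> y \<in> V \<Longrightarrow> {f x, f y} \<in> E \<longleftrightarrow> {x, y} \<in> E"
  by (auto simp: automorphisms_def adjacent_def)

lemma auto_inv:
  assumes f: "f \<in> automorphisms V E"
  shows "inv_into V f \<in> automorphisms V E"
proof -
  have b: "bij_betw (inv_into V f) V V" using auto_bij[OF f] by (rule bij_betw_inv_into)
  have "adjacent E (inv_into V f x) (inv_into V f y) \<longleftrightarrow> adjacent E x y" if "x \<in> V" "y \<in> V" for x y
  proof -
    have "inv_into V f x \<in> V" "inv_into V f y \<in> V" using b that bij_betwE by blast+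
    moreover have "f (inv_into V f x) = x" "f (inv_into V f y) = y"
      using that auto_bij[OF f] by (auto simp: bij_betw_inv_into_right)
    ultimately show ?thesis using auto_edge[OF f, of "inv_into V f x" "inv_into V f y"] by (simp add: adjacent_def)
  qed
  then show ?thesis using b by (simp add: automorphisms_def)
qed

lemma id_auto: "(\<lambda>x. x) \<in> automorphisms V E"
  by (auto simp: automorphisms_def bij_betw_def inj_on_def)

lemma representatives: "\<exists>R. finite R \<and> R \<subseteq> V \<and> (\<forall>x\<in>V. \<exists>y\<in>R. \<exists>f\<in>automorphisms V E. f y = x)"
proof -
  let ?c = "\<lambda>S. SOME y. y \<in> S"
  define R where "R = ?c ` (vertex_orbit V E ` V)"
  have c: "?c (vertex_orbit V E x) \<in> vertex_orbit V E x" if "x \<in> V" for x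
    by (rule someI[of _ x]) (auto simp: vertex_orbit_def intro!: image_eqI[of _ _ "\<lambda>x. x"] id_auto)
  have "finite R" using qt by (simp add: R_def quasi_transitive_def)
  moreover have "R \<subseteq> V" using c auto_in_V by (fastforce simp: R_def vertex_orbit_def)
  moreover have "\<exists>y\<in>R. \<exists>f\<in>automorphisms V E. f y = x" if x: "x \<in> V" for x
  proof -
    obtain f where f: "f \<in> automorphisms V E" "?c (vertex_orbit V E x) = f x"
      using c[OF x] by (auto simp: vertex_orbit_def)
    have "inv_into V f (f x) = x" using x auto_inj[OF f(1)] by simp
    then have "inv_into V f (?c (vertex_orbit V E x)) = x" using f(2) by simp
    moreover have "?c (vertex_orbit V E x) \<in> R" unfolding R_def using x by blast
    ultimately show ?thesis using auto_inv[OF f(1)] by blast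
  qed
  ultimately show ?thesis by blast
qed

text \<open>Automorphisms are constrained on \<open>V\<close> only, so an automorphism transports balls of sets of edges of the
  graph.\<close>
lemma bl_img:
  assumes f: "f \<in> automorphisms V E" and K: "K \<subseteq> E" and x: "x \<in> V"
  shows "bl (img f K) (f x) n = f ` bl K x n"
proof (induction n)
  case (Suc n)
  have e: "{f u, w'} \<in> img f K \<longleftrightarrow> (\<exists>w. w' = f w \<and> {u, w} \<in> K)" if u: "u \<in> bl K x n" for u w'
  proof
    assume "{f u, w'} \<in> img f K"
    then have "{f u, w'} \<in> (\<lambda>e. f ` e) ` K" unfolding img_def .
    then obtain e where e: "{f u, w'} = f ` e" "e \<in> K" by (rule imageE)
    obtain a b where ab: "e = {a, b}" "a \<in> V" "b \<in> V" using subsetD[OF K e(2)] by (rule edgeE)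
    have uV: "u \<in> V" using u bl_subset_V[OF K x] by blast
    have "{f u, w'} = {f a, f b}" using e(1) unfolding ab(1) by simp
    then consider "f a = f u" "f b = w'" | "f b = f u" "f a = w'" unfolding doubleton_eq_iff by metis
    then show "\<exists>w. w' = f w \<and> {u, w} \<in> K"
    proof cases
      case 1
      then have "a = u" using inj_onD[OF auto_inj[OF f] _ ab(2) uV] by blast
      then show ?thesis using 1 e(2) ab(1) by blast
    next
      case 2
      then have "b = u" using inj_onD[OF auto_inj[OF f] _ ab(3) uV] by blast
      then show ?thesis using 2 e(2) ab(1) by (intro exI[of _ a]) (simp add: insert_commute)
    qed
  next
    assume "\<exists>w. w' = f w \<and> {u, w} \<in> K"
    then obtain w where "w' = f w" "{u, w} \<in> K" by blast
    then show "{f u, w'} \<in> img f K" unfolding img_def by (intro image_eqI[of _ _ "{u, w}"]) simp_all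
  qed
  have "{w'. \<exists>u\<in>f ` bl K x n. {u, w'} \<in> img f K} = f ` {w. \<exists>u\<in>bl K x n. {u, w} \<in> K}"
    using e by blast
  then show ?case by (simp add: Suc.IH image_Un)
qed simp

lemma img_E: assumes f: "f \<in> automorphisms V E" shows "img f E = E"
proof
  show "img f E \<subseteq> E"
  proof
    fix e assume "e \<in> img f E"
    then obtain e' where e': "e = f ` e'" "e' \<in> E" unfolding img_def by (rule imageE)
    obtain x y where "e' = {x, y}" "x \<in> V" "y \<in> V" using e'(2) by (rule edgeE)
    then show "e \<in> E" using e' auto_edge[OF f, of x y] by simp
  qed
  show "E \<subseteq> img f E"
  proof
    fix e assume e: "e \<in> E"
    then obtain x y where xy: "e = {x, y}" "x \<in> V" "y \<in> V" by (rule edgeE)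
    obtain x' y' where "x' \<in> V" "y' \<in> V" "f x' = x" "f y' = y"
      using auto_bij[OF f] xy(2,3) by (metis bij_betw_iff_bijections)
    then have "{x', y'} \<in> E" "e = f ` {x', y'}" using e xy auto_edge[OF f, of x' y'] by simp_all
    then show "e \<in> img f E" unfolding img_def by blast
  qed
qed

lemma card_bl_img:
  assumes "f \<in> automorphisms V E" "K \<subseteq> E" "x \<in> V"
  shows "card (bl (img f K) (f x) n) = card (bl K x n)"
  unfolding bl_img[OF assms]
  by (rule card_image) (rule inj_on_subset[OF auto_inj[OF assms(1)] bl_subset_V[OF assms(2,3)]])

text \<open>Degrees are constant along the finitely many orbits.\<close>
lemma degree_bound: "\<exists>D\<ge>1. \<forall>x\<in>V. card (bl E x 1) \<le> D"
proof -
  obtain R where R: "finite R" "R \<subseteq> V" "\<forall>x\<in>V. \<exists>y\<in>R. \<exists>f\<in>automorphisms V E. f y = x"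
    using representatives by (elim exE conjE)
  let ?D = "Max (insert 1 ((\<lambda>y. card (bl E y 1)) ` R))"
  have "card (bl E x 1) \<le> ?D" if xV: "x \<in> V" for x
  proof -
    obtain y f where yf: "y \<in> R" "f \<in> automorphisms V E" "f y = x"
      using bspec[OF R(3) xV] by (elim bexE)
    have "y \<in> V" using yf(1) R(2) by blast
    from card_bl_img[OF yf(2) order_refl this, of 1] have "card (bl E x 1) = card (bl E y 1)"
      unfolding img_E[OF yf(2)] yf(3) .
    also have "\<dots> \<le> ?D" using R(1) yf(1) by (intro Max_ge) auto
    finally show ?thesis .
  qed
  moreover have "1 \<le> ?D" using R(1) by (intro Max_ge) auto
  ultimately show ?thesis by blast
qed

definition D :: nat where "D = (SOME D. D \<ge> 1 \<and> (\<forall>x\<in>V. card (bl E x 1) \<le> D))"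

lemma D: "1 \<le> D" "x \<in> V \<Longrightarrow> card (bl E x 1) \<le> D"
  using someI_ex[OF degree_bound, folded D_def] by auto

lemma card_bl_Suc:
  assumes K: "K \<subseteq> E" and x: "x \<in> V"
  shows "card (bl K x (n + d)) \<le> D ^ d * card (bl K x n)"
proof (induction d)
  case (Suc d)
  have "bl K x (Suc (n + d)) \<subseteq> (\<Union>u\<in>bl K x (n + d). bl E u 1)" using K by auto
  then have "card (bl K x (Suc (n + d))) \<le> card (\<Union>u\<in>bl K x (n + d). bl E u 1)"
  proof (intro card_mono finite_UN_I)
    show "finite (bl K x (n + d))" by (rule finite_bl[OF K x])
    show "finite (bl E u 1)" if "u \<in> bl K x (n + d)" for u
      using that bl_subset_V[OF K x] by (intro finite_bl) blast+
  qed
  also have "\<dots> \<le> (\<Sum>u\<in>bl K x (n + d). card (bl E u 1))"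
    by (rule card_UN_le) (rule finite_bl[OF K x])
  also have "\<dots> \<le> (\<Sum>u\<in>bl K x (n + d). D)"
    using bl_subset_V[OF K x] by (intro sum_mono D) auto
  also have "\<dots> = D * card (bl K x (n + d))" by simp
  also have "\<dots> \<le> D * (D ^ d * card (bl K x n))" using Suc.IH by (rule mult_le_mono2)
  finally show ?case by (simp add: mult.assoc)
qed simp

lemma card_bl_le: "K \<subseteq> E \<Longrightarrow> x \<in> V \<Longrightarrow> card (bl K x n) \<le> D ^ n"
  using card_bl_Suc[of K x 0 n] by simp

lemma card_bl_move:
  assumes K: "K \<subseteq> E" and x: "x \<in> V" and y: "y \<in> bl K x d"
  shows "card (bl K x t) \<le> D ^ d * card (bl K y t)"
proof -
  have yV: "y \<in> V" using y bl_subset_V[OF K x] by blast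
  have "bl K x t \<subseteq> bl K y (t + d)"
    using bl_trans[OF bl_sym[OF y]] by (subst add.commute) blast
  then have "card (bl K x t) \<le> card (bl K y (t + d))" by (intro card_mono finite_bl[OF K yV])
  also have "\<dots> \<le> D ^ d * card (bl K y t)" by (rule card_bl_Suc[OF K yV])
  finally show ?thesis .
qed

lemma card_bl_pos: "K \<subseteq> E \<Longrightarrow> x \<in> V \<Longrightarrow> 1 \<le> card (bl K x n)"
  using finite_bl[of K x n] bl_refl[of x K n] by (metis One_nat_def Suc_leI card_gt_0_iff empty_iff)

lemma infinite_clu_sph:
  assumes "K \<subseteq> E" "x \<in> V" "infinite (clu K x)"
  shows "sph K x r \<noteq> {}"
proof (cases r)
  case 0 then show ?thesis by (simp add: sph_def inn_def)
next
  case (Suc k)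
  then show ?thesis using sph_empty_imp_finite[of K x k] finite_bl[OF assms(1,2), of k] assms(3) by auto
qed

lemma infinite_clu_card:
  assumes "K \<subseteq> E" "x \<in> V" "infinite (clu K x)"
  shows "n + 1 \<le> card (bl K x n)"
proof (induction n)
  case (Suc n)
  have "bl K x n \<subset> bl K x (Suc n)"
    using infinite_clu_sph[OF assms, of "Suc n"] bl_mono_radius[of n "Suc n" K x] by (auto simp: sph_def inn_Suc)
  then have "card (bl K x n) < card (bl K x (Suc n))" by (intro psubset_card_mono finite_bl[OF assms(1,2)])
  then show ?case using Suc by simp
qed simp

lemma infinite_clu_iff:
  assumes "K \<subseteq> E" "x \<in> V"
  shows "infinite (clu K x) \<longleftrightarrow> (\<forall>n. sph K x n \<noteq> {})"
proof
  assume *: "\<forall>n. sph K x n \<noteq> {}"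
  show "infinite (clu K x)"
  proof
    assume f: "finite (clu K x)"
    have "Suc n \<le> card (bl K x n)" for n
    proof (induction n)
      case (Suc n)
      have "bl K x n \<subset> bl K x (Suc n)"
        using spec[OF *, of "Suc n"] bl_mono_radius[of n "Suc n" K x] by (auto simp: sph_def inn_Suc)
      then have "card (bl K x n) < card (bl K x (Suc n))" by (intro psubset_card_mono finite_bl[OF assms])
      then show ?case using Suc by simp
    qed simp
    from this[of "card (clu K x)"] have "Suc (card (clu K x)) \<le> card (bl K x (card (clu K x)))" .
    moreover have "card (bl K x (card (clu K x))) \<le> card (clu K x)"
      using f by (intro card_mono) (auto simp: clu_def)
    ultimately show False by simp
  qed
qed (use infinite_clu_sph[OF assms] in blast)

text \<open>A random set of edges; this covers the open edges of a configuration and everything obtained from them by removing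
  edges.\<close>
definition random_edges :: "'w measure \<Rightarrow> ('w \<Rightarrow> 'a set set) \<Rightarrow> bool" where
  "random_edges M K \<longleftrightarrow> (\<forall>\<omega>. K \<omega> \<subseteq> E) \<and> (\<forall>e\<in>E. Measurable.pred M (\<lambda>\<omega>. e \<in> K \<omega>))"

lemma random_edges_off: "random_edges M K \<Longrightarrow> random_edges M (\<lambda>\<omega>. off A (K \<omega>))"
  unfolding random_edges_def off_def by (auto intro!: pred_intros_logic)

lemma pred_bl:
  assumes K: "random_edges M K"
  shows "Measurable.pred M (\<lambda>\<omega>. w \<in> bl (K \<omega>) x n)"
proof (cases "x \<in> V")
  case True
  show ?thesis
  proof (induction n arbitrary: w)
    case (Suc n)
    have eq: "(\<lambda>\<omega>. w \<in> bl (K \<omega>) x (Suc n)) = (\<lambda>\<omega>. w \<in> bl (K \<omega>) x n \<or> (\<exists>u\<in>V. u \<in> bl (K \<omega>) x n \<and> {u, w} \<in> K \<omega>))"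
    proof (rule ext)
      fix \<omega>
      have "K \<omega> \<subseteq> E" using K by (simp add: random_edges_def)
      then have "bl (K \<omega>) x n \<subseteq> V" using bl_subset_V True by blast
      then show "(w \<in> bl (K \<omega>) x (Suc n)) = (w \<in> bl (K \<omega>) x n \<or> (\<exists>u\<in>V. u \<in> bl (K \<omega>) x n \<and> {u, w} \<in> K \<omega>))"
        unfolding bl.simps by blast
    qed
    have "Measurable.pred M (\<lambda>\<omega>. {u, w} \<in> K \<omega>)" for u
    proof (cases "{u, w} \<in> E")
      case False
      then have "(\<lambda>\<omega>. {u, w} \<in> K \<omega>) = (\<lambda>_. False)" using K by (auto simp: random_edges_def)
      then show ?thesis by simp
    qed (use K in \<open>simp add: random_edges_def\<close>)
    then show ?case unfolding eq
      by (intro pred_intros_logic pred_bex_countable countable_V Suc.IH)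
  qed simp
next
  case False
  have "bl (K \<omega>) x n = {x}" for \<omega>
  proof (induction n)
    case (Suc n)
    have "{x, w} \<notin> K \<omega>" for w using False K edge_in_V[of x w] by (auto simp: random_edges_def)
    then show ?case using Suc by simp
  qed simp
  then show ?thesis by simp
qed

lemma pred_clu:
  assumes "random_edges M K" shows "Measurable.pred M (\<lambda>\<omega>. w \<in> clu (K \<omega>) x)"
proof -
  have "(\<lambda>\<omega>. w \<in> clu (K \<omega>) x) = (\<lambda>\<omega>. \<exists>n. w \<in> bl (K \<omega>) x n)" by (auto simp: clu_def)
  then show ?thesis using pred_bl[OF assms] by (simp only:) (intro pred_intros_countable)
qed

lemma pred_inn:
  assumes "random_edges M K" shows "Measurable.pred M (\<lambda>\<omega>. w \<in> inn (K \<omega>) x r)"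
proof -
  have "(\<lambda>\<omega>. w \<in> inn (K \<omega>) x r) = (\<lambda>\<omega>. \<exists>i\<in>{..<r}. w \<in> bl (K \<omega>) x i)" by (auto simp: inn_def)
  then show ?thesis using pred_bl[OF assms] by (simp only:) (intro pred_intros_finite finite_lessThan)
qed

lemma pred_sph:
  assumes "random_edges M K" shows "Measurable.pred M (\<lambda>\<omega>. w \<in> sph (K \<omega>) x r)"
  unfolding sph_def Diff_iff by (intro pred_intros_logic pred_bl pred_inn assms)

lemma pred_set_eq:
  assumes "finite B" "\<And>\<omega>. S \<omega> \<subseteq> B" "\<And>w. Measurable.pred M (\<lambda>\<omega>. w \<in> S \<omega>)"
  shows "Measurable.pred M (\<lambda>\<omega>. S \<omega> = A)"
proof -
  have "(\<lambda>\<omega>. S \<omega> = A) = (\<lambda>\<omega>. A \<subseteq> B \<and> (\<forall>w\<in>B. (w \<in> S \<omega>) = (w \<in> A)))"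
    using assms(2) by (intro ext) blast
  then show ?thesis
    by (simp only:) (intro pred_intros_logic pred_intros_finite assms; simp)
qed

lemma card_eq_sum_indicator:
  assumes "finite B" "S \<subseteq> B"
  shows "real (card S) = (\<Sum>w\<in>B. of_bool (w \<in> S))"
proof -
  have "(\<Sum>w\<in>B. of_bool (w \<in> S)) = (\<Sum>w\<in>B. if w \<in> S then 1 else (0::real))" by (intro sum.cong) auto
  also have "\<dots> = real (card (B \<inter> S))" using assms(1) by (simp add: sum.If_cases)
  also have "B \<inter> S = S" using assms(2) by blast
  finally show ?thesis by simp
qed

lemma measurable_card:
  assumes "finite B" "\<And>\<omega>. S \<omega> \<subseteq> B" "\<And>w. Measurable.pred M (\<lambda>\<omega>. w \<in> S \<omega>)"
  shows "(\<lambda>\<omega>. real (card (S \<omega>))) \<in> borel_measurable M"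
proof -
  have "(\<lambda>\<omega>. real (card (S \<omega>))) = (\<lambda>\<omega>. \<Sum>w\<in>B. of_bool (w \<in> S \<omega>))"
    by (rule ext) (rule card_eq_sum_indicator[OF assms(1,2)])
  moreover have "(\<lambda>\<omega>. \<Sum>w\<in>B. of_bool (w \<in> S \<omega>) :: real) \<in> borel_measurable M"
  proof (rule borel_measurable_sum)
    fix w
    show "(\<lambda>\<omega>. of_bool (w \<in> S \<omega>) :: real) \<in> borel_measurable M"
      by (rule measurable_compose[OF assms(3)]) simp
  qed
  ultimately show ?thesis by simp
qed

lemma measurable_card_bl:
  assumes "random_edges M K" "x \<in> V"
  shows "(\<lambda>\<omega>. real (card (bl (K \<omega>) x n))) \<in> borel_measurable M"
proof (rule measurable_card[of "bl E x n"])
  show "finite (bl E x n)" by (rule finite_bl[OF order_refl assms(2)])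
  show "bl (K \<omega>) x n \<subseteq> bl E x n" for \<omega>
    using assms(1) by (intro bl_mono) (simp add: random_edges_def)
  show "Measurable.pred M (\<lambda>\<omega>. w \<in> bl (K \<omega>) x n)" for w by (rule pred_bl[OF assms(1)])
qed

lemma pred_infinite_clu:
  assumes "random_edges M K" "x \<in> V"
  shows "Measurable.pred M (\<lambda>\<omega>. infinite (clu (K \<omega>) x))"
proof -
  have "(\<lambda>\<omega>. infinite (clu (K \<omega>) x)) = (\<lambda>\<omega>. \<forall>n. \<exists>w\<in>V. w \<in> sph (K \<omega>) x n)"
  proof (rule ext)
    fix \<omega>
    have K: "K \<omega> \<subseteq> E" using assms(1) by (simp add: random_edges_def)
    have "sph (K \<omega>) x n \<subseteq> V" for n using bl_subset_V[OF K assms(2)] by (auto simp: sph_def)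
    then show "infinite (clu (K \<omega>) x) = (\<forall>n. \<exists>w\<in>V. w \<in> sph (K \<omega>) x n)"
      unfolding infinite_clu_iff[OF K assms(2)] by blast
  qed
  then show ?thesis
    by (simp only:) (intro pred_intros_countable pred_bex_countable countable_V pred_sph assms)
qed

end

section \<open>Functions of finitely many bits\<close>

text \<open>A function of finitely many bits is a finite combination of indicators of patterns; this yields measurability,
  integrability and the product formula for expectations without further measure theory.\<close>
lemma finite_depends_eq:
  fixes f :: "('j \<Rightarrow> bool) \<Rightarrow> real"
  assumes "finite F" "depends f F"
  shows "f \<omega> = (\<Sum>S\<in>Pow F. f (\<lambda>j. j \<in> S) * of_bool (\<forall>j\<in>F. \<omega> j = (j \<in> S)))"
proof -
  let ?S = "{j\<in>F. \<omega> j}"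
  have "(\<Sum>S\<in>Pow F. f (\<lambda>j. j \<in> S) * of_bool (\<forall>j\<in>F. \<omega> j = (j \<in> S)))
      = (\<Sum>S\<in>Pow F. if S = ?S then f (\<lambda>j. j \<in> ?S) else 0)"
  proof (rule sum.cong[OF refl])
    fix S assume "S \<in> Pow F"
    then have "(\<forall>j\<in>F. \<omega> j = (j \<in> S)) \<longleftrightarrow> S = ?S" by blast
    then show "f (\<lambda>j. j \<in> S) * of_bool (\<forall>j\<in>F. \<omega> j = (j \<in> S)) = (if S = ?S then f (\<lambda>j. j \<in> ?S) else 0)"
      by simp
  qed
  also have "\<dots> = f (\<lambda>j. j \<in> ?S)"
  proof -
    have "finite (Pow F)" "?S \<in> Pow F" using assms(1) by auto
    then show ?thesis by (simp only: sum.delta' sum.delta if_True)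
  qed
  also have "\<dots> = f \<omega>" by (rule dependsD[OF assms(2)]) auto
  finally show ?thesis by simp
qed

lemma pred_pattern:
  assumes "finite F" "F \<subseteq> J"
  shows "Measurable.pred (bits J q) (\<lambda>\<omega>. \<forall>j\<in>F. \<omega> j = (j \<in> S))"
  by (rule pred_finite_depends[OF assms]) (auto simp: depends_def)

lemma measurable_finite_depends:
  fixes f :: "('j \<Rightarrow> bool) \<Rightarrow> real"
  assumes F: "finite F" "F \<subseteq> J" "depends f F"
  shows "f \<in> borel_measurable (bits J q)"
proof -
  have "(\<lambda>\<omega>. of_bool (\<forall>j\<in>F. \<omega> j = (j \<in> S)) :: real) \<in> borel_measurable (bits J q)" for S
    by (rule measurable_compose[OF pred_pattern[OF F(1,2)]]) simp
  then have "(\<lambda>\<omega>. \<Sum>S\<in>Pow F. f (\<lambda>j. j \<in> S) * of_bool (\<forall>j\<in>F. \<omega> j = (j \<in> S))) \<in> borel_measurable (bits J q)"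
    by (intro borel_measurable_sum borel_measurable_times borel_measurable_const)
  moreover have "(\<lambda>\<omega>. \<Sum>S\<in>Pow F. f (\<lambda>j. j \<in> S) * of_bool (\<forall>j\<in>F. \<omega> j = (j \<in> S))) = f"
    by (rule ext) (rule finite_depends_eq[OF F(1,3), symmetric])
  ultimately show ?thesis by simp
qed

lemma integrable_finite_depends:
  fixes f :: "('j \<Rightarrow> bool) \<Rightarrow> real"
  assumes F: "finite F" "F \<subseteq> J" "depends f F"
  shows "integrable (bits J q) f"
proof -
  interpret prob_space "bits J q" by simp
  have "\<bar>f \<omega>\<bar> \<le> (\<Sum>S\<in>Pow F. \<bar>f (\<lambda>j. j \<in> S)\<bar>)" for \<omega>
    by (subst finite_depends_eq[OF F(1,3)], rule order_trans[OF sum_abs], rule sum_mono) simp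
  then show ?thesis
    by (intro integrable_const_bound[of _ "\<Sum>S\<in>Pow F. \<bar>f (\<lambda>j. j \<in> S)\<bar>"] measurable_finite_depends[OF F]) auto
qed

lemma (in prob_space) integral_of_bool:
  assumes "Measurable.pred M P"
  shows "(\<integral>\<omega>. of_bool (P \<omega>) \<partial>M) = \<P>(\<omega> in M. P \<omega>)"
proof -
  have "(\<integral>\<omega>. of_bool (P \<omega>) \<partial>M) = (\<integral>\<omega>. indicator {\<omega>\<in>space M. P \<omega>} \<omega> \<partial>M)"
    by (rule Bochner_Integration.integral_cong[OF refl]) (auto simp: indicator_def)
  also have "\<dots> = measure M ({\<omega>\<in>space M. P \<omega>} \<inter> space M)"
    by (rule Bochner_Integration.integral_indicator)
  also have "{\<omega>\<in>space M. P \<omega>} \<inter> space M = {\<omega>\<in>space M. P \<omega>}" by blast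
  finally show ?thesis .
qed

lemma integral_finite_depends:
  fixes f :: "('j \<Rightarrow> bool) \<Rightarrow> real"
  assumes F: "finite F" "F \<subseteq> J" "depends f F"
  shows "(\<integral>\<omega>. f \<omega> \<partial>bits J q) = (\<Sum>S\<in>Pow F. f (\<lambda>j. j \<in> S) * \<P>(\<omega> in bits J q. \<forall>j\<in>F. \<omega> j = (j \<in> S)))"
proof -
  interpret prob_space "bits J q" by simp
  have i: "integrable (bits J q) (\<lambda>\<omega>. of_bool (\<forall>j\<in>F. \<omega> j = (j \<in> S)) :: real)" for S
    by (rule integrable_finite_depends[OF F(1,2)]) (auto simp: depends_def)
  have "(\<integral>\<omega>. f \<omega> \<partial>bits J q) = (\<integral>\<omega>. (\<Sum>S\<in>Pow F. f (\<lambda>j. j \<in> S) * of_bool (\<forall>j\<in>F. \<omega> j = (j \<in> S))) \<partial>bits J q)"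
    by (rule arg_cong[where f="lebesgue_integral (bits J q)"]) (rule ext, rule finite_depends_eq[OF F(1,3)])
  also have "\<dots> = (\<Sum>S\<in>Pow F. f (\<lambda>j. j \<in> S) * (\<integral>\<omega>. of_bool (\<forall>j\<in>F. \<omega> j = (j \<in> S)) \<partial>bits J q))"
    by (simp only: Bochner_Integration.integral_sum integrable_mult_right i integral_mult_right_zero)
  finally show ?thesis unfolding integral_of_bool[OF pred_pattern[OF F(1,2)]] .
qed

lemma bits_indep_expectation:
  fixes f g :: "('j \<Rightarrow> bool) \<Rightarrow> real"
  assumes F: "finite F" "F \<subseteq> J" "depends f F" and G: "finite G" "G \<subseteq> J" "depends g G" and FG: "F \<inter> G = {}"
  shows "(\<integral>\<omega>. f \<omega> * g \<omega> \<partial>bits J q) = (\<integral>\<omega>. f \<omega> \<partial>bits J q) * (\<integral>\<omega>. g \<omega> \<partial>bits J q)"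
proof -
  interpret prob_space "bits J q" by simp
  let ?M = "bits J q"
  let ?a = "\<lambda>F S \<omega>. \<forall>j\<in>F. \<omega> j = (j \<in> S)"
  have i: "integrable ?M (\<lambda>\<omega>. of_bool (?a F S \<omega> \<and> ?a G T \<omega>) :: real)" for S T
    by (rule integrable_finite_depends[of "F \<union> G"]) (use F G in \<open>auto simp: depends_def\<close>)
  have "f \<omega> * g \<omega> = (\<Sum>S\<in>Pow F. \<Sum>T\<in>Pow G. (f (\<lambda>j. j \<in> S) * g (\<lambda>j. j \<in> T)) * of_bool (?a F S \<omega> \<and> ?a G T \<omega>))" for \<omega>
    by (subst finite_depends_eq[OF F(1,3), of \<omega>], subst finite_depends_eq[OF G(1,3), of \<omega>])
       (simp only: sum_product of_bool_conj mult_ac)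
  then have "(\<integral>\<omega>. f \<omega> * g \<omega> \<partial>?M) = (\<integral>\<omega>. (\<Sum>S\<in>Pow F. \<Sum>T\<in>Pow G. (f (\<lambda>j. j \<in> S) * g (\<lambda>j. j \<in> T)) * of_bool (?a F S \<omega> \<and> ?a G T \<omega>)) \<partial>?M)"
    by (simp only:)
  also have "\<dots> = (\<Sum>S\<in>Pow F. \<Sum>T\<in>Pow G. (f (\<lambda>j. j \<in> S) * g (\<lambda>j. j \<in> T)) * (\<integral>\<omega>. of_bool (?a F S \<omega> \<and> ?a G T \<omega>) \<partial>?M))"
  proof -
    have i': "integrable ?M (\<lambda>\<omega>. c * of_bool (?a F S \<omega> \<and> ?a G T \<omega>) :: real)" for c S T
      by (rule integrable_mult_right) (rule i)
    show ?thesis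
      by (subst Bochner_Integration.integral_sum, intro Bochner_Integration.integrable_sum i', rule sum.cong[OF refl],
          subst Bochner_Integration.integral_sum, rule i', rule sum.cong[OF refl], rule integral_mult_right_zero)
  qed
  also have "\<dots> = (\<Sum>S\<in>Pow F. \<Sum>T\<in>Pow G. (f (\<lambda>j. j \<in> S) * \<P>(\<omega> in ?M. ?a F S \<omega>)) * (g (\<lambda>j. j \<in> T) * \<P>(\<omega> in ?M. ?a G T \<omega>)))"
  proof (intro sum.cong refl)
    fix S T
    have "(\<integral>\<omega>. of_bool (?a F S \<omega> \<and> ?a G T \<omega>) \<partial>?M) = \<P>(\<omega> in ?M. ?a F S \<omega> \<and> ?a G T \<omega>)"
      by (intro integral_of_bool pred_intros_logic pred_pattern F G)
    also have "\<dots> = \<P>(\<omega> in ?M. ?a F S \<omega>) * \<P>(\<omega> in ?M. ?a G T \<omega>)"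
      by (rule bits_indep[OF pred_pattern[OF F(1,2)] pred_pattern[OF G(1,2)], where X=F and Y=G])
         (use FG in \<open>auto simp: depends_def\<close>)
    finally show "(f (\<lambda>j. j \<in> S) * g (\<lambda>j. j \<in> T)) * (\<integral>\<omega>. of_bool (?a F S \<omega> \<and> ?a G T \<omega>) \<partial>?M)
      = (f (\<lambda>j. j \<in> S) * \<P>(\<omega> in ?M. ?a F S \<omega>)) * (g (\<lambda>j. j \<in> T) * \<P>(\<omega> in ?M. ?a G T \<omega>))"
      by (simp only: mult_ac)
  qed
  finally show ?thesis
    unfolding integral_finite_depends[OF F] integral_finite_depends[OF G] sum_product .
qed

section \<open>Subadditive sequences\<close>

lemma fekete:
  fixes a :: "nat \<Rightarrow> real"
  assumes sub: "\<And>m n. a (m + n) \<le> a m + a n" and nn: "\<And>n. 0 \<le> a n"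
  obtains L where "0 \<le> L" "(\<lambda>n. a n / real n) \<longlonglongrightarrow> L" "\<And>n. L * real n \<le> a n"
proof -
  define L where "L = Inf ((\<lambda>n. a n / real n) ` {1..})"
  have bdd: "bdd_below ((\<lambda>n. a n / real n) ` {1..})"
    by (rule bdd_belowI[of _ 0]) (auto simp: nn)
  have L_le: "L \<le> a n / real n" if "1 \<le> n" for n
    unfolding L_def using that by (intro cInf_lower[OF _ bdd]) auto
  have "0 \<le> L" unfolding L_def by (rule cInf_greatest) (auto simp: nn)
  have mult: "a (q * m + r) \<le> real q * a m + a r" for q m r
  proof (induction q)
    case (Suc q)
    have "a (Suc q * m + r) = a (m + (q * m + r))" by (simp add: add_ac)
    also have "\<dots> \<le> a m + a (q * m + r)" by (rule sub)
    also have "\<dots> \<le> a m + (real q * a m + a r)" using Suc by simp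
    finally show ?case by (simp add: algebra_simps)
  qed simp
  have "(\<lambda>n. a n / real n) \<longlonglongrightarrow> L"
  proof (rule order_tendstoI)
    fix y assume "y < L"
    then have "\<forall>n\<ge>1. y < a n / real n" using L_le by fastforce
    then show "\<forall>\<^sub>F n in sequentially. y < a n / real n" unfolding eventually_sequentially by blast
  next
    fix y assume "L < y"
    then obtain z where z: "L < z" "z < y" using dense by blast
    then obtain m where m: "1 \<le> m" "a m / real m < z"
      using cInf_lessD[of "(\<lambda>n. a n / real n) ` {1..}" z] unfolding L_def by auto
    define B where "B = Max (a ` {..<m})"
    have B: "a r \<le> B" if "r < m" for r unfolding B_def using that by (intro Max_ge) auto
    have am: "a m \<le> z * real m" using m by (simp add: field_simps)
    have "0 \<le> z" using \<open>0 \<le> L\<close> z by simp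
    have bound: "a n / real n \<le> z + B / real n" if n: "1 \<le> n" for n
    proof -
      have "a n = a (n div m * m + n mod m)" by simp
      also have "\<dots> \<le> real (n div m) * a m + a (n mod m)" by (rule mult)
      also have "\<dots> \<le> real (n div m) * (z * real m) + B"
        using B[of "n mod m"] m(1) am by (intro add_mono mult_left_mono) auto
      also have "real (n div m) * (z * real m) = z * real (n div m * m)" by simp
      also have "\<dots> \<le> z * real n" using \<open>0 \<le> z\<close> div_times_less_eq_dividend[of n m] by (intro mult_left_mono) (simp_all only: of_nat_le_iff)
      finally show ?thesis using n by (simp add: field_simps)
    qed
    have "(\<lambda>n. z + B / real n) \<longlonglongrightarrow> z + 0"
      by (intro tendsto_add tendsto_const lim_const_over_n)
    then have "\<forall>\<^sub>F n in sequentially. z + B / real n < y" by (rule order_tendstoD) (use z in simp)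
    with eventually_ge_at_top[of 1] show "\<forall>\<^sub>F n in sequentially. a n / real n < y"
      by eventually_elim (use bound in fastforce)
  qed
  moreover have "L * real n \<le> a n" for n
  proof (cases "n = 0")
    case False
    then show ?thesis using L_le[of n] by (simp add: field_simps)
  qed (use nn in simp)
  ultimately show ?thesis using that \<open>0 \<le> L\<close> by blast
qed

section \<open>Edges seen by an exploration\<close>

context qt_graph
begin

abbreviation opn :: "('a set \<Rightarrow> bool) \<Rightarrow> 'a set set" where "opn \<omega> \<equiv> open_edges E \<omega>"

lemma opn_subset: "opn \<omega> \<subseteq> E" by (auto simp: open_edges_def)

lemma random_edges_opn: "random_edges (bits E q) opn"
  unfolding random_edges_def
proof (intro conjI allI ballI opn_subset)
  fix e assume e: "e \<in> E"
  then have "(\<lambda>\<omega>. e \<in> opn \<omega>) = (\<lambda>\<omega>. \<omega> e)" by (auto simp: open_edges_def)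
  then show "Measurable.pred (bits E q) (\<lambda>\<omega>. e \<in> opn \<omega>)" using pred_bits_coord[OF e] by (simp only:)
qed

text \<open>The edges that an exploration of \<open>A\<close> looks at, open or not.\<close>
definition touching :: "'a set \<Rightarrow> 'a set set" where "touching A = {e\<in>E. e \<inter> A \<noteq> {}}"

lemma touching_subset: "touching A \<subseteq> E" by (auto simp: touching_def)

lemma finite_touching: assumes "finite A" "A \<subseteq> V" shows "finite (touching A)"
proof -
  have "touching A \<subseteq> (\<Union>x\<in>A. (\<lambda>y. {x, y}) ` {y. {x, y} \<in> E})"
  proof
    fix e assume "e \<in> touching A"
    then have e: "e \<in> E" "e \<inter> A \<noteq> {}" by (auto simp: touching_def)
    obtain x y where xy: "e = {x, y}" using e(1) by (rule edgeE)
    then consider "x \<in> A" | "y \<in> A" using e(2) by blast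
    then show "e \<in> (\<Union>x\<in>A. (\<lambda>y. {x, y}) ` {y. {x, y} \<in> E})"
    proof cases
      case 1 then show ?thesis using e xy by blast
    next
      case 2
      have "{y, x} = e" using xy by blast
      then show ?thesis using 2 e by blast
    qed
  qed
  moreover have "finite (\<Union>x\<in>A. (\<lambda>y. {x, y}) ` {y. {x, y} \<in> E})"
    using assms finite_nbrs by (intro finite_UN_I finite_imageI) auto
  ultimately show ?thesis by (rule finite_subset)
qed

definition near :: "'a \<Rightarrow> nat \<Rightarrow> 'a set set" where "near x n = touching (bl E x n)"

lemma near_subset: "near x n \<subseteq> E" by (simp add: near_def touching_subset)

lemma finite_near: "x \<in> V \<Longrightarrow> finite (near x n)"
  unfolding near_def by (intro finite_touching finite_bl bl_subset_V) auto

lemma near_mono: "m \<le> n \<Longrightarrow> near x m \<subseteq> near x n"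
  using bl_mono_radius[of m n E x] by (auto simp: near_def touching_def)

lemma bl_depends:
  assumes agree: "\<And>e. e \<in> near x n \<Longrightarrow> \<omega> e = \<omega>' e" and i: "i \<le> n"
  shows "bl (opn \<omega>) x i = bl (opn \<omega>') x i"
proof (rule bl_local'[where r=n, OF _ i])
  fix e assume e: "e \<inter> bl (opn \<omega>) x n \<noteq> {}"
  have "e \<inter> bl E x n \<noteq> {}" using e bl_mono[OF opn_subset[of \<omega>], of x n] by blast
  then show "e \<in> opn \<omega> \<longleftrightarrow> e \<in> opn \<omega>'"
    using agree[of e] by (auto simp: open_edges_def near_def touching_def)
qed

lemma bl_off_depends:
  assumes agree: "\<And>e. e \<in> near x n - touching A \<Longrightarrow> \<omega> e = \<omega>' e" and i: "i \<le> n"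
  shows "bl (off A (opn \<omega>)) x i = bl (off A (opn \<omega>')) x i"
proof (rule bl_local'[where r=n, OF _ i])
  fix e assume e: "e \<inter> bl (off A (opn \<omega>)) x n \<noteq> {}"
  have "off A (opn \<omega>) \<subseteq> E" using off_subset opn_subset by blast
  then have "e \<inter> bl E x n \<noteq> {}" using e bl_mono[of "off A (opn \<omega>)" E x n] by blast
  then show "e \<in> off A (opn \<omega>) \<longleftrightarrow> e \<in> off A (opn \<omega>')"
    using agree[of e] by (auto simp: open_edges_def near_def touching_def off_def)
qed

text \<open>All that an exploration up to radius \<open>r\<close> reveals: the ball of radius \<open>r\<close> and all smaller
  ones. Values beyond \<open>r\<close> are set to the empty set, so that equal histories are equal as functions.\<close>
definition hist :: "('a set \<Rightarrow> bool) \<Rightarrow> 'a \<Rightarrow> nat \<Rightarrow> nat \<Rightarrow> 'a set" where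
  "hist \<omega> x r = (\<lambda>i. if i \<le> r then bl (opn \<omega>) x i else {})"

lemma hist_inn: "inn (opn \<omega>) x r = (\<Union>i<r. hist \<omega> x r i)"
  by (auto simp: inn_def hist_def)

lemma hist_sph: "sph (opn \<omega>) x r = hist \<omega> x r r - (\<Union>i<r. hist \<omega> x r i)"
  by (auto simp: sph_def hist_def inn_def)

lemma hist_near: "(\<And>e. e \<in> near x r \<Longrightarrow> \<omega> e = \<omega>' e) \<Longrightarrow> hist \<omega> x r = hist \<omega>' x r"
  unfolding hist_def using bl_depends[of x r \<omega> \<omega>'] by (intro ext) simp

lemma hist_local:
  assumes "\<And>e. e \<in> touching (inn (opn \<omega>) x r) \<Longrightarrow> \<omega> e = \<omega>' e"
  shows "hist \<omega> x r = hist \<omega>' x r"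
proof -
  have "bl (opn \<omega>) x i = bl (opn \<omega>') x i" if "i \<le> r" for i
  proof (rule bl_local[OF _ that])
    fix e assume "e \<inter> inn (opn \<omega>) x r \<noteq> {}"
    then show "e \<in> opn \<omega> \<longleftrightarrow> e \<in> opn \<omega>'" using assms[of e] by (auto simp: open_edges_def touching_def)
  qed
  then show ?thesis by (intro ext) (simp add: hist_def)
qed

text \<open>If the open ball is \<open>A\<close> then only edges touching \<open>A\<close> have been examined. This is the
  spatial Markov property in the form in which it is combined with \<open>bits_indep\<close>.\<close>
lemma hist_event_depends:
  "depends (\<lambda>\<omega>. inn (opn \<omega>) x r = A \<and> H (hist \<omega> x r)) (touching A)"
proof (rule dependsI)
  have half: "inn (opn \<omega>') x r = A \<and> H (hist \<omega>' x r)"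
    if agree: "\<And>e. e \<in> touching A \<Longrightarrow> \<omega> e = \<omega>' e" and A: "inn (opn \<omega>) x r = A" "H (hist \<omega> x r)" for \<omega> \<omega>'
  proof -
    have "hist \<omega> x r = hist \<omega>' x r" by (rule hist_local) (rule agree, simp add: A)
    then show ?thesis using A by (simp add: hist_inn)
  qed
  fix \<omega> \<omega>' :: "'a set \<Rightarrow> bool" assume "\<And>e. e \<in> touching A \<Longrightarrow> \<omega> e = \<omega>' e"
  then show "(inn (opn \<omega>) x r = A \<and> H (hist \<omega> x r)) = (inn (opn \<omega>') x r = A \<and> H (hist \<omega>' x r))"
    using half[of \<omega> \<omega>'] half[of \<omega>' \<omega>] by metis
qed

end

section \<open>Expected ball sizes\<close>

locale perc = qt_graph +
  fixes p :: real
  assumes p: "0 \<le> p" "p \<le> 1" and V_ne: "V \<noteq> {}"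
begin

abbreviation M where "M \<equiv> bits E (\<lambda>_. p)"

sublocale prob_space M by (rule prob_space_bits)

lemma percolation_eq: "percolation E p = M"
  by (simp add: percolation_def bits_def)

abbreviation B where "B \<omega> x t \<equiv> bl (opn \<omega>) x t"

definition EB :: "'a \<Rightarrow> nat \<Rightarrow> real" where "EB x t = (\<integral>\<omega>. real (card (B \<omega> x t)) \<partial>M)"

lemma integrable_near:
  fixes f :: "('a set \<Rightarrow> bool) \<Rightarrow> real"
  assumes "x \<in> V" "\<And>\<omega> \<omega>'. (\<And>e. e \<in> near x t \<Longrightarrow> \<omega> e = \<omega>' e) \<Longrightarrow> f \<omega> = f \<omega>'"
  shows "integrable M f"
  by (rule integrable_finite_depends[OF finite_near[OF assms(1)] near_subset], rule dependsI, rule assms(2))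

lemma integrable_card_B: "x \<in> V \<Longrightarrow> integrable M (\<lambda>\<omega>. real (card (B \<omega> x t)))"
proof (rule integrable_near[of x t])
  fix \<omega> \<omega>' :: "'a set \<Rightarrow> bool" assume "\<And>e. e \<in> near x t \<Longrightarrow> \<omega> e = \<omega>' e"
  then have "B \<omega> x t = B \<omega>' x t" by (rule bl_depends[OF _ order_refl])
  then show "real (card (B \<omega> x t)) = real (card (B \<omega>' x t))" by (simp only:)
qed

lemma EB_le: "x \<in> V \<Longrightarrow> EB x t \<le> real (D ^ t)"
proof -
  assume x: "x \<in> V"
  have "EB x t \<le> (\<integral>\<omega>. real (D ^ t) \<partial>M)" unfolding EB_def
    by (rule integral_mono[OF integrable_card_B[OF x]])
       (simp_all only: integrable_const of_nat_le_iff card_bl_le[OF opn_subset x])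
  then show ?thesis by (simp add: prob_space)
qed

lemma Gr_eq: "Gr V E p t = (SUP x\<in>V. EB x t)"
  by (simp add: Gr_def EB_def percolation_eq int_ball_eq)

lemma EB_le_Gr: "x \<in> V \<Longrightarrow> EB x t \<le> Gr V E p t"
  unfolding Gr_eq by (rule cSUP_upper) (auto intro!: bdd_aboveI2[of _ _ "real (D ^ t)"] EB_le)

lemma EB_ge_1: "x \<in> V \<Longrightarrow> 1 \<le> EB x t"
proof -
  assume x: "x \<in> V"
  have "(\<integral>\<omega>. 1 \<partial>M) \<le> EB x t" unfolding EB_def
    by (rule integral_mono[OF _ integrable_card_B[OF x]]) (use card_bl_pos[OF opn_subset x] in auto)
  then show ?thesis by (simp add: prob_space)
qed

end

section \<open>Submultiplicativity and the upper bound\<close>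

lemma (in prob_space) markov:
  fixes f :: "'a \<Rightarrow> real"
  assumes f: "integrable M f" "\<And>\<omega>. 0 \<le> f \<omega>" and c: "0 \<le> c"
  shows "c * \<P>(\<omega> in M. c \<le> f \<omega>) \<le> (\<integral>\<omega>. f \<omega> \<partial>M)"
proof -
  have m: "Measurable.pred M (\<lambda>\<omega>. c \<le> f \<omega>)"
    using borel_measurable_integrable[OF f(1)] by measurable
  have "integrable M (\<lambda>\<omega>. of_bool (c \<le> f \<omega>) :: real)"
  proof (rule integrable_const_bound[of _ 1])
    show "(\<lambda>\<omega>. of_bool (c \<le> f \<omega>) :: real) \<in> borel_measurable M"
      by (rule measurable_compose[OF m]) simp
  qed simp
  then have i: "integrable M (\<lambda>\<omega>. c * of_bool (c \<le> f \<omega>))" by (intro integrable_mult_right)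
  have "c * \<P>(\<omega> in M. c \<le> f \<omega>) = (\<integral>\<omega>. c * of_bool (c \<le> f \<omega>) \<partial>M)"
    unfolding integral_of_bool[OF m, symmetric] by (rule integral_mult_right_zero[symmetric])
  also have "\<dots> \<le> (\<integral>\<omega>. f \<omega> \<partial>M)"
  proof (rule integral_mono[OF i f(1)])
    show "c * of_bool (c \<le> f \<omega>) \<le> f \<omega>" for \<omega> using f(2)[of \<omega>] by (cases "c \<le> f \<omega>") simp_all
  qed
  finally show ?thesis .
qed

context perc begin

text \<open>A vertex at distance at least \<open>r\<close> from \<open>x\<close> is reached from some \<open>u\<close> in the
  sphere of radius \<open>r\<close> by a path off the open ball \<open>A\<close>. Given \<open>A\<close> and the
  history, the edges off \<open>A\<close> are still independent, so each \<open>u\<close> contributes at most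
  \<open>Gr s\<close> on average. The history event \<open>H\<close> is kept because the first thin sphere is such
  an event.\<close>
lemma exploration_bound:
  assumes x: "x \<in> V"
  shows "(\<integral>\<omega>. of_bool (H (hist \<omega> x r)) * real (card (B \<omega> x (r + s))) \<partial>M)
    \<le> (\<integral>\<omega>. of_bool (H (hist \<omega> x r)) * real (card (inn (opn \<omega>) x r)) \<partial>M)
      + (\<integral>\<omega>. of_bool (H (hist \<omega> x r)) * real (card (sph (opn \<omega>) x r)) \<partial>M) * Gr V E p s"
proof -
  let ?PB = "Pow (bl E x r)"
  define st where "st A S \<omega> \<longleftrightarrow> inn (opn \<omega>) x r = A \<and> (sph (opn \<omega>) x r = S \<and> H (hist \<omega> x r))" for A S \<omega>
  define g where "g A u \<omega> = real (card (bl (off A (opn \<omega>)) u s))" for A u \<omega>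
  have fin: "finite (bl E x r)" by (rule finite_bl[OF order_refl x])
  have inB: "B \<omega> x r \<subseteq> bl E x r" for \<omega> by (rule bl_mono[OF opn_subset])
  have inV: "bl E x r \<subseteq> V" by (rule bl_subset_V[OF order_refl x])
  have A_sub: "inn (opn \<omega>) x r \<subseteq> bl E x r" "sph (opn \<omega>) x r \<subseteq> bl E x r" for \<omega>
    using inB[of \<omega>] inn_subset_bl[of "opn \<omega>" x r] by (auto simp: sph_def)
  have st_dep: "depends (st A S) (touching A)" for A S
  proof -
    have "st A S = (\<lambda>\<omega>. inn (opn \<omega>) x r = A \<and> (\<lambda>h. h r - (\<Union>i<r. h i) = S \<and> H h) (hist \<omega> x r))"
      unfolding st_def hist_sph by (rule ext) simp
    then show ?thesis using hist_event_depends[where H="\<lambda>h. h r - (\<Union>i<r. h i) = S \<and> H h"] by simp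
  qed
  have g_dep: "depends (g A u) (near u s - touching A)" for A u
  proof (rule dependsI)
    fix \<omega> \<omega>' :: "'a set \<Rightarrow> bool" assume "\<And>e. e \<in> near u s - touching A \<Longrightarrow> \<omega> e = \<omega>' e"
    then have "bl (off A (opn \<omega>)) u s = bl (off A (opn \<omega>')) u s" by (rule bl_off_depends[OF _ order_refl])
    then show "g A u \<omega> = g A u \<omega>'" unfolding g_def by (simp only:)
  qed
  have st_b: "depends (\<lambda>\<omega>. of_bool (st A S \<omega>) :: real) (touching A)" for A S
  proof (rule dependsI)
    fix \<omega> \<omega>' :: "'a set \<Rightarrow> bool" assume "\<And>e. e \<in> touching A \<Longrightarrow> \<omega> e = \<omega>' e"
    then have "st A S \<omega> = st A S \<omega>'" by (rule dependsD[OF st_dep])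
    then show "of_bool (st A S \<omega>) = (of_bool (st A S \<omega>') :: real)" by (simp only:)
  qed
  have fT: "finite (touching A)" if "A \<in> ?PB" for A
    using that fin inV by (intro finite_touching) (auto intro: finite_subset)
  have st_i: "integrable M (\<lambda>\<omega>. of_bool (st A S \<omega>) :: real)" if "A \<in> ?PB" for A S
    by (rule integrable_finite_depends[OF fT[OF that] touching_subset st_b])
  have g_i: "integrable M (g A u)" if "u \<in> V" for A u
    by (rule integrable_finite_depends[OF _ _ g_dep]) (use finite_near[OF that] near_subset in auto)
  have sg_i: "integrable M (\<lambda>\<omega>. of_bool (st A S \<omega>) * g A u \<omega>)" if "A \<in> ?PB" "u \<in> V" for A S u
  proof (rule integrable_finite_depends[of "touching A \<union> near u s"])
    show "depends (\<lambda>\<omega>. of_bool (st A S \<omega>) * g A u \<omega>) (touching A \<union> near u s)"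
    proof (rule dependsI)
      fix \<omega> \<omega>' :: "'a set \<Rightarrow> bool" assume a: "\<And>j. j \<in> touching A \<union> near u s \<Longrightarrow> \<omega> j = \<omega>' j"
      have "st A S \<omega> = st A S \<omega>'" by (rule dependsD[OF st_dep]) (use a in blast)
      moreover have "g A u \<omega> = g A u \<omega>'" by (rule dependsD[OF g_dep]) (use a in blast)
      ultimately show "of_bool (st A S \<omega>) * g A u \<omega> = of_bool (st A S \<omega>') * g A u \<omega>'" by simp
    qed
  qed (use fT[OF that(1)] finite_near[OF that(2)] touching_subset near_subset in auto)
  \<comment> \<open>The state \<open>st A S\<close> is read off edges touching \<open>A\<close>, the remaining growth \<open>g A u\<close> off the other edges.\<close>
  have gE: "(\<integral>\<omega>. of_bool (st A S \<omega>) * g A u \<omega> \<partial>M) \<le> (\<integral>\<omega>. of_bool (st A S \<omega>) \<partial>M) * Gr V E p s"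
    if A: "A \<in> ?PB" and u: "u \<in> V" for A S u
  proof -
    have "(\<integral>\<omega>. of_bool (st A S \<omega>) * g A u \<omega> \<partial>M) = (\<integral>\<omega>. of_bool (st A S \<omega>) \<partial>M) * (\<integral>\<omega>. g A u \<omega> \<partial>M)"
      by (rule bits_indep_expectation[OF fT[OF A] touching_subset st_b _ _ g_dep])
         (use finite_near[OF u] near_subset in auto)
    also have "(\<integral>\<omega>. g A u \<omega> \<partial>M) \<le> EB u s" unfolding EB_def
    proof (rule integral_mono[OF g_i[OF u] integrable_card_B[OF u]])
      show "g A u \<omega> \<le> real (card (B \<omega> u s))" for \<omega>
        unfolding g_def of_nat_le_iff by (intro card_mono finite_bl opn_subset u bl_mono off_subset)
    qed
    also have "\<dots> \<le> Gr V E p s" by (rule EB_le_Gr[OF u])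
    finally show ?thesis by (simp add: mult_left_mono integral_nonneg_AE)
  qed
  have pw: "of_bool (H (hist \<omega> x r)) * real (card (B \<omega> x (r + s)))
     \<le> of_bool (H (hist \<omega> x r)) * real (card (inn (opn \<omega>) x r))
       + (\<Sum>A\<in>?PB. \<Sum>S\<in>?PB. \<Sum>u\<in>S. of_bool (st A S \<omega>) * g A u \<omega>)" for \<omega>
  proof (cases "H (hist \<omega> x r)")
    case True
    let ?A = "inn (opn \<omega>) x r" and ?S = "sph (opn \<omega>) x r"
    have sub: "B \<omega> x (r + s) \<subseteq> ?A \<union> (\<Union>u\<in>?S. bl (off ?A (opn \<omega>)) u s)"
      using bl_through_sphere[of _ "opn \<omega>" x r s] by blast
    have finA: "finite ?A" "finite ?S" by (rule finite_subset[OF A_sub(1) fin], rule finite_subset[OF A_sub(2) fin])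
    have SV: "?S \<subseteq> V" using A_sub(2) inV by blast
    have "off ?A (opn \<omega>) \<subseteq> E" using off_subset opn_subset by blast
    then have f2: "finite (\<Union>u\<in>?S. bl (off ?A (opn \<omega>)) u s)"
      by (intro finite_UN_I finA finite_bl) (use SV in blast)+
    have "card (B \<omega> x (r + s)) \<le> card (?A \<union> (\<Union>u\<in>?S. bl (off ?A (opn \<omega>)) u s))"
      by (rule card_mono[OF finite_UnI[OF finA(1) f2] sub])
    also have "\<dots> \<le> card ?A + card (\<Union>u\<in>?S. bl (off ?A (opn \<omega>)) u s)" by (rule card_Un_le)
    also have "card (\<Union>u\<in>?S. bl (off ?A (opn \<omega>)) u s) \<le> (\<Sum>u\<in>?S. card (bl (off ?A (opn \<omega>)) u s))"
      by (rule card_UN_le[OF finA(2)])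
    finally have "real (card (B \<omega> x (r + s))) \<le> real (card ?A) + (\<Sum>u\<in>?S. g ?A u \<omega>)"
      unfolding g_def by (simp only: of_nat_add[symmetric] of_nat_sum[symmetric] of_nat_le_iff)
    also have "(\<Sum>u\<in>?S. g ?A u \<omega>) = (\<Sum>A\<in>?PB. \<Sum>S\<in>?PB. \<Sum>u\<in>S. of_bool (st A S \<omega>) * g A u \<omega>)"
    proof -
      have "(\<Sum>A\<in>?PB. \<Sum>S\<in>?PB. \<Sum>u\<in>S. of_bool (st A S \<omega>) * g A u \<omega>)
        = (\<Sum>A\<in>?PB. \<Sum>S\<in>?PB. if S = ?S then (if A = ?A then \<Sum>u\<in>?S. g ?A u \<omega> else 0) else 0)"
        by (intro sum.cong refl) (auto simp: st_def True)
      also have "\<dots> = (\<Sum>A\<in>?PB. if A = ?A then \<Sum>u\<in>?S. g ?A u \<omega> else 0)"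
        using fin A_sub(2)[of \<omega>] by (simp add: sum.delta')
      also have "\<dots> = (\<Sum>u\<in>?S. g ?A u \<omega>)"
        using fin A_sub(1)[of \<omega>] by (simp add: sum.delta')
      finally show ?thesis by simp
    qed
    finally show ?thesis using True by simp
  next
    case False
    then show ?thesis by (simp add: st_def)
  qed
  have iH: "integrable M (\<lambda>\<omega>. of_bool (H (hist \<omega> x r)) * real (card (F (hist \<omega> x r))))" for F :: "(nat \<Rightarrow> 'a set) \<Rightarrow> 'a set"
  proof (rule integrable_near[OF x, of r])
    fix \<omega> \<omega>' :: "'a set \<Rightarrow> bool" assume "\<And>e. e \<in> near x r \<Longrightarrow> \<omega> e = \<omega>' e"
    then have "hist \<omega> x r = hist \<omega>' x r" by (rule hist_near)
    then show "of_bool (H (hist \<omega> x r)) * real (card (F (hist \<omega> x r))) = of_bool (H (hist \<omega>' x r)) * real (card (F (hist \<omega>' x r)))"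
      by (simp only:)
  qed
  have iB: "integrable M (\<lambda>\<omega>. of_bool (H (hist \<omega> x r)) * real (card (B \<omega> x (r + s))))"
  proof (rule integrable_near[OF x, of "r + s"])
    fix \<omega> \<omega>' :: "'a set \<Rightarrow> bool" assume a: "\<And>e. e \<in> near x (r + s) \<Longrightarrow> \<omega> e = \<omega>' e"
    have "B \<omega> x (r + s) = B \<omega>' x (r + s)" by (rule bl_depends[OF a order_refl])
    moreover have "hist \<omega> x r = hist \<omega>' x r" by (rule hist_near, rule a) (use near_mono[of r "r + s" x] in auto)
    ultimately show "of_bool (H (hist \<omega> x r)) * real (card (B \<omega> x (r + s))) = of_bool (H (hist \<omega>' x r)) * real (card (B \<omega>' x (r + s)))"
      by simp
  qed
  have i1: "integrable M (\<lambda>\<omega>. of_bool (H (hist \<omega> x r)) * real (card (inn (opn \<omega>) x r)))"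
    unfolding hist_inn by (rule iH)
  have i2: "integrable M (\<lambda>\<omega>. \<Sum>A\<in>?PB. \<Sum>S\<in>?PB. \<Sum>u\<in>S. of_bool (st A S \<omega>) * g A u \<omega>)"
    using inV by (intro Bochner_Integration.integrable_sum sg_i) auto
  have "(\<integral>\<omega>. of_bool (H (hist \<omega> x r)) * real (card (B \<omega> x (r + s))) \<partial>M)
    \<le> (\<integral>\<omega>. of_bool (H (hist \<omega> x r)) * real (card (inn (opn \<omega>) x r))
       + (\<Sum>A\<in>?PB. \<Sum>S\<in>?PB. \<Sum>u\<in>S. of_bool (st A S \<omega>) * g A u \<omega>) \<partial>M)"
    by (rule integral_mono[OF iB Bochner_Integration.integrable_add[OF i1 i2] pw])
  also have "\<dots> = (\<integral>\<omega>. of_bool (H (hist \<omega> x r)) * real (card (inn (opn \<omega>) x r)) \<partial>M)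
     + (\<integral>\<omega>. (\<Sum>A\<in>?PB. \<Sum>S\<in>?PB. \<Sum>u\<in>S. of_bool (st A S \<omega>) * g A u \<omega>) \<partial>M)"
    by (rule Bochner_Integration.integral_add[OF i1 i2])
  also have "(\<integral>\<omega>. (\<Sum>A\<in>?PB. \<Sum>S\<in>?PB. \<Sum>u\<in>S. of_bool (st A S \<omega>) * g A u \<omega>) \<partial>M)
     = (\<Sum>A\<in>?PB. \<Sum>S\<in>?PB. \<Sum>u\<in>S. (\<integral>\<omega>. of_bool (st A S \<omega>) * g A u \<omega> \<partial>M))"
  proof -
    have 1: "integrable M (\<lambda>\<omega>. of_bool (st A S \<omega>) * g A u \<omega>)" if "A \<in> ?PB" "S \<in> ?PB" "u \<in> S" for A S u
      using that inV by (intro sg_i) auto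
    have "(\<integral>\<omega>. (\<Sum>A\<in>?PB. \<Sum>S\<in>?PB. \<Sum>u\<in>S. of_bool (st A S \<omega>) * g A u \<omega>) \<partial>M)
     = (\<Sum>A\<in>?PB. (\<integral>\<omega>. (\<Sum>S\<in>?PB. \<Sum>u\<in>S. of_bool (st A S \<omega>) * g A u \<omega>) \<partial>M))"
      by (rule Bochner_Integration.integral_sum) (intro Bochner_Integration.integrable_sum 1)
    also have "\<dots> = (\<Sum>A\<in>?PB. \<Sum>S\<in>?PB. (\<integral>\<omega>. (\<Sum>u\<in>S. of_bool (st A S \<omega>) * g A u \<omega>) \<partial>M))"
      by (rule sum.cong[OF refl], rule Bochner_Integration.integral_sum) (intro Bochner_Integration.integrable_sum 1)
    also have "\<dots> = (\<Sum>A\<in>?PB. \<Sum>S\<in>?PB. \<Sum>u\<in>S. (\<integral>\<omega>. of_bool (st A S \<omega>) * g A u \<omega> \<partial>M))"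
      by (rule sum.cong[OF refl], rule sum.cong[OF refl], rule Bochner_Integration.integral_sum) (intro 1)
    finally show ?thesis .
  qed
  also have "\<dots> \<le> (\<Sum>A\<in>?PB. \<Sum>S\<in>?PB. \<Sum>u\<in>S. (\<integral>\<omega>. of_bool (st A S \<omega>) \<partial>M) * Gr V E p s)"
    using inV by (intro sum_mono gE) auto
  also have "\<dots> = (\<Sum>A\<in>?PB. \<Sum>S\<in>?PB. (\<integral>\<omega>. of_bool (st A S \<omega>) * real (card S) \<partial>M)) * Gr V E p s"
    by (simp add: sum_distrib_right sum_distrib_left mult_ac)
  also have "(\<Sum>A\<in>?PB. \<Sum>S\<in>?PB. (\<integral>\<omega>. of_bool (st A S \<omega>) * real (card S) \<partial>M))
     = (\<integral>\<omega>. (\<Sum>A\<in>?PB. \<Sum>S\<in>?PB. of_bool (st A S \<omega>) * real (card S)) \<partial>M)"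
  proof -
    have 1: "integrable M (\<lambda>\<omega>. of_bool (st A S \<omega>) * real (card S))" if "A \<in> ?PB" for A S
      using st_i[OF that] by (intro integrable_mult_left) auto
    have "(\<integral>\<omega>. (\<Sum>A\<in>?PB. \<Sum>S\<in>?PB. of_bool (st A S \<omega>) * real (card S)) \<partial>M)
      = (\<Sum>A\<in>?PB. (\<integral>\<omega>. (\<Sum>S\<in>?PB. of_bool (st A S \<omega>) * real (card S)) \<partial>M))"
      by (rule Bochner_Integration.integral_sum) (intro Bochner_Integration.integrable_sum 1)
    also have "\<dots> = (\<Sum>A\<in>?PB. \<Sum>S\<in>?PB. (\<integral>\<omega>. of_bool (st A S \<omega>) * real (card S) \<partial>M))"
      by (rule sum.cong[OF refl], rule Bochner_Integration.integral_sum) (intro 1)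
    finally show ?thesis by simp
  qed
  also have "(\<lambda>\<omega>. (\<Sum>A\<in>?PB. \<Sum>S\<in>?PB. of_bool (st A S \<omega>) * real (card S)))
     = (\<lambda>\<omega>. of_bool (H (hist \<omega> x r)) * real (card (sph (opn \<omega>) x r)))"
  proof (rule ext)
    fix \<omega>
    let ?A = "inn (opn \<omega>) x r" and ?S = "sph (opn \<omega>) x r" and ?h = "of_bool (H (hist \<omega> x r)) :: real"
    have "(\<Sum>A\<in>?PB. \<Sum>S\<in>?PB. of_bool (st A S \<omega>) * real (card S))
      = (\<Sum>A\<in>?PB. \<Sum>S\<in>?PB. if S = ?S then (if A = ?A then ?h * real (card ?S) else 0) else 0)"
      by (intro sum.cong refl) (auto simp: st_def)
    also have "\<dots> = (\<Sum>A\<in>?PB. if A = ?A then ?h * real (card ?S) else 0)"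
      using fin A_sub(2)[of \<omega>] by (simp add: sum.delta')
    also have "\<dots> = ?h * real (card ?S)"
      using fin A_sub(1)[of \<omega>] by (simp add: sum.delta')
    finally show "(\<Sum>A\<in>?PB. \<Sum>S\<in>?PB. of_bool (st A S \<omega>) * real (card S)) = ?h * real (card ?S)" .
  qed
  finally show ?thesis by simp
qed

lemma integrable_card_inn: "x \<in> V \<Longrightarrow> integrable M (\<lambda>\<omega>. real (card (inn (opn \<omega>) x r)))"
  and integrable_card_sph: "x \<in> V \<Longrightarrow> integrable M (\<lambda>\<omega>. real (card (sph (opn \<omega>) x r)))"
proof -
  have i: "integrable M (\<lambda>\<omega>. real (card (F (hist \<omega> x r))))" if x: "x \<in> V" for F :: "(nat \<Rightarrow> 'a set) \<Rightarrow> 'a set"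
  proof (rule integrable_near[OF x, of r])
    fix \<omega> \<omega>' :: "'a set \<Rightarrow> bool" assume "\<And>e. e \<in> near x r \<Longrightarrow> \<omega> e = \<omega>' e"
    then have "hist \<omega> x r = hist \<omega>' x r" by (rule hist_near)
    then show "real (card (F (hist \<omega> x r))) = real (card (F (hist \<omega>' x r)))" by (simp only:)
  qed
  show "x \<in> V \<Longrightarrow> integrable M (\<lambda>\<omega>. real (card (inn (opn \<omega>) x r)))" unfolding hist_inn by (rule i)
  show "x \<in> V \<Longrightarrow> integrable M (\<lambda>\<omega>. real (card (sph (opn \<omega>) x r)))" unfolding hist_sph by (rule i)
qed

lemma card_B_split:
  assumes "x \<in> V"
  shows "real (card (B \<omega> x r)) = real (card (inn (opn \<omega>) x r)) + real (card (sph (opn \<omega>) x r))"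
proof -
  have f: "finite (B \<omega> x r)" by (rule finite_bl[OF opn_subset assms])
  have "B \<omega> x r = inn (opn \<omega>) x r \<union> sph (opn \<omega>) x r" "inn (opn \<omega>) x r \<inter> sph (opn \<omega>) x r = {}"
    using inn_subset_bl[of "opn \<omega>" x r] by (auto simp: sph_def)
  moreover have "finite (inn (opn \<omega>) x r)" "finite (sph (opn \<omega>) x r)"
    using f inn_subset_bl[of "opn \<omega>" x r] by (auto simp: sph_def intro: finite_subset)
  ultimately have "card (B \<omega> x r) = card (inn (opn \<omega>) x r) + card (sph (opn \<omega>) x r)"
    by (metis card_Un_disjoint)
  then show ?thesis by simp
qed

lemma EB_split: "x \<in> V \<Longrightarrow> EB x r = (\<integral>\<omega>. real (card (inn (opn \<omega>) x r)) \<partial>M) + (\<integral>\<omega>. real (card (sph (opn \<omega>) x r)) \<partial>M)"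
  unfolding EB_def card_B_split
  by (rule Bochner_Integration.integral_add[OF integrable_card_inn integrable_card_sph])

lemma Gr_ge_1: "1 \<le> Gr V E p r"
proof -
  obtain x where x: "x \<in> V" using V_ne by blast
  show ?thesis using EB_ge_1[OF x, of r] EB_le_Gr[OF x, of r] by linarith
qed

lemma Gr_submult: "Gr V E p (r + s) \<le> Gr V E p r * Gr V E p s"
proof -
  have "EB x (r + s) \<le> Gr V E p r * Gr V E p s" if x: "x \<in> V" for x
  proof -
    let ?i = "\<integral>\<omega>. real (card (inn (opn \<omega>) x r)) \<partial>M" and ?s = "\<integral>\<omega>. real (card (sph (opn \<omega>) x r)) \<partial>M"
    have "EB x (r + s) \<le> ?i + ?s * Gr V E p s"
      using exploration_bound[OF x, of "\<lambda>_. True" r s] unfolding EB_def by (simp only: of_bool_eq mult_1)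
    also have "?i \<le> ?i * Gr V E p s"
      using mult_left_mono[OF Gr_ge_1[of s], of ?i] by (simp add: integral_nonneg_AE)
    also have "?i * Gr V E p s + ?s * Gr V E p s = EB x r * Gr V E p s"
      unfolding EB_split[OF x] by (rule distrib_right[symmetric])
    also have "\<dots> \<le> Gr V E p r * Gr V E p s"
      using EB_le_Gr[OF x, of r] Gr_ge_1[of s] by (intro mult_right_mono) auto
    finally show ?thesis by simp
  qed
  then show ?thesis unfolding Gr_eq[of "r + s"] by (intro cSUP_least V_ne)
qed

definition \<gamma> :: real where "\<gamma> = gamma_int V E p"

lemma gamma_facts: "0 \<le> \<gamma>" "(\<lambda>r. ln (Gr V E p r) / real r) \<longlonglongrightarrow> \<gamma>" "exp (\<gamma> * real r) \<le> Gr V E p r"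
proof -
  have sub: "ln (Gr V E p (m + n)) \<le> ln (Gr V E p m) + ln (Gr V E p n)" for m n
  proof -
    have pos: "0 < Gr V E p k" for k using Gr_ge_1[of k] by linarith
    have "ln (Gr V E p (m + n)) \<le> ln (Gr V E p m * Gr V E p n)"
      using Gr_submult[of m n] pos by (simp add: ln_mono)
    also have "\<dots> = ln (Gr V E p m) + ln (Gr V E p n)"
      using pos[of m] pos[of n] by (simp add: ln_mult)
    finally show ?thesis .
  qed
  have nn: "0 \<le> ln (Gr V E p n)" for n using Gr_ge_1[of n] by (rule ln_ge_zero)
  obtain L where L: "0 \<le> L" "(\<lambda>n. ln (Gr V E p n) / real n) \<longlonglongrightarrow> L" "\<And>n. L * real n \<le> ln (Gr V E p n)"
    using fekete[of "\<lambda>n. ln (Gr V E p n)", OF sub nn] by blast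
  have eq: "\<gamma> = L" unfolding \<gamma>_def gamma_int_def using L(2) by (rule limI)
  show "0 \<le> \<gamma>" "(\<lambda>r. ln (Gr V E p r) / real r) \<longlonglongrightarrow> \<gamma>" using L eq by simp_all
  have "exp (L * real r) \<le> exp (ln (Gr V E p r))" using L(3)[of r] by simp
  also have "\<dots> = Gr V E p r" using Gr_ge_1[of r] by simp
  finally show "exp (\<gamma> * real r) \<le> Gr V E p r" using eq by simp
qed

text \<open>Markov and Borel--Cantelli, as \<open>\<Sum>r. 1 / (r + 1)\<^sup>2\<close> is finite.\<close>
lemma ball_upper_bound:
  assumes x: "x \<in> V"
  shows "AE \<omega> in M. \<forall>\<^sub>F r in sequentially. real (card (B \<omega> x r)) \<le> (real r + 1)\<^sup>2 * Gr V E p r"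
proof -
  let ?c = "\<lambda>r. (real r + 1)\<^sup>2 * Gr V E p r"
  let ?A = "\<lambda>r. {\<omega>\<in>space M. ?c r \<le> real (card (B \<omega> x r))}"
  have m: "?A r \<in> events" for r
    using borel_measurable_integrable[OF integrable_card_B[OF x, of r]] by measurable
  have G: "0 < Gr V E p r" for r using Gr_ge_1[of r] by linarith
  have P: "prob (?A r) \<le> inverse (real (Suc r) ^ 2)" for r
  proof -
    have "?c r * prob (?A r) \<le> EB x r" unfolding EB_def
      by (rule markov[OF integrable_card_B[OF x]]) (use G[of r] in auto)
    also have "\<dots> \<le> Gr V E p r" by (rule EB_le_Gr[OF x])
    finally have "((real r + 1)\<^sup>2 * prob (?A r)) * Gr V E p r \<le> 1 * Gr V E p r" by (simp only: mult_ac mult_1)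
    then have "(real r + 1)\<^sup>2 * prob (?A r) \<le> 1" using G[of r] by (simp only: mult_le_cancel_right_pos)
    then have "prob (?A r) \<le> 1 / (real r + 1)\<^sup>2" by (simp only: pos_le_divide_eq zero_less_power of_nat_0_le_iff add_nonneg_pos zero_less_one mult.commute)
    then show ?thesis by (simp only: inverse_eq_divide of_nat_Suc add.commute)
  qed
  have "summable (\<lambda>r. inverse (real (Suc r) ^ 2))"
    using inverse_power_summable[of 2, where 'a=real] by (subst summable_Suc_iff) simp
  then have summ: "summable (\<lambda>r. prob (?A r))"
    by (rule summable_comparison_test'[of _ 0]) (use P in \<open>simp only: real_norm_def abs_of_nonneg measure_nonneg\<close>)
  have "AE \<omega> in M. \<forall>\<^sub>F r in sequentially. \<omega> \<in> space M - ?A r"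
    by (intro borel_cantelli_AE1[OF m _ summ]) (simp only: emeasure_eq_measure ennreal_less_top infinity_ennreal_def)
  then show ?thesis
  proof (rule AE_mp, intro AE_I2 impI)
    fix \<omega> assume "\<omega> \<in> space M" "\<forall>\<^sub>F r in sequentially. \<omega> \<in> space M - ?A r"
    then show "\<forall>\<^sub>F r in sequentially. real (card (B \<omega> x r)) \<le> ?c r"
      by (elim eventually_mono) (auto simp only: Diff_iff mem_Collect_eq not_le intro: less_imp_le)
  qed
qed

end

text \<open>A nonnegative sequence is either bounded, with \<open>b\<close> a bound, or exceeds all its earlier values
  infinitely often.\<close>
lemma records:
  fixes a :: "nat \<Rightarrow> real"
  assumes nn: "\<And>n. 0 \<le> a n"
  shows "\<exists>b\<ge>0. \<forall>N. \<exists>t\<ge>N. \<forall>s\<le>t. a s \<le> a t + b"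
proof (cases "\<exists>K. \<forall>n. a n \<le> K")
  case True
  then obtain K where K: "\<And>n. a n \<le> K" by blast
  have "a s \<le> a t + K" for s t using K[of s] nn[of t] by linarith
  moreover have "0 \<le> K" using K[of 0] nn[of 0] by linarith
  ultimately show ?thesis by blast
next
  case False
  have "\<exists>t\<ge>N. \<forall>s\<le>t. a s \<le> a t + 0" for N
  proof -
    define K where "K = Max (a ` {..N})"
    have K: "a n \<le> K" if "n \<le> N" for n unfolding K_def using that by (intro Max_ge) auto
    obtain n where n: "K < a n" using False by (auto simp: not_le)
    define t where "t = (LEAST n. K < a n)"
    have t: "K < a t" unfolding t_def using n by (rule LeastI)
    have l: "a s \<le> K" if "s < t" for s using not_less_Least[of s "\<lambda>n. K < a n"] that by (simp add: t_def not_less)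
    have "N \<le> t" using K[of t] t by (meson linorder_not_le nat_le_linear)
    moreover have "a s \<le> a t + 0" if "s \<le> t" for s using l[of s] t that by (cases "s = t") auto
    ultimately show ?thesis by blast
  qed
  then show ?thesis by (intro exI[of _ 0]) auto
qed

lemma growth_limits:
  fixes S T :: "nat \<Rightarrow> nat" and G :: "nat \<Rightarrow> real"
  assumes G: "\<And>r. 1 \<le> G r" "(\<lambda>r. ln (G r) / real r) \<longlonglongrightarrow> g"
    and ST: "\<And>r. S r \<le> T r"
    and up: "\<forall>\<^sub>F r in sequentially. real (T r) \<le> (real r + 1)\<^sup>2 * G r"
    and c: "0 < c" and low: "\<forall>\<^sub>F r in sequentially. c * exp (g * real r) \<le> real (S r)"
  shows "(\<lambda>r. ln (real (S r)) / real r) \<longlonglongrightarrow> g \<and> (\<lambda>r. ln (real (T r)) / real r) \<longlonglongrightarrow> g"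
proof -
  have l: "(\<lambda>r. ln c / real r + g) \<longlonglongrightarrow> 0 + g"
    by (intro tendsto_add tendsto_const lim_const_over_n)
  have u0: "(\<lambda>r. 2 * (ln (real r + 1) / real r)) \<longlonglongrightarrow> 2 * 0"
  proof (intro tendsto_mult tendsto_const)
    show "(\<lambda>r. ln (real r + 1) / real r) \<longlonglongrightarrow> 0" by real_asymp
  qed
  have u: "(\<lambda>r. 2 * (ln (real r + 1) / real r) + ln (G r) / real r) \<longlonglongrightarrow> 2 * 0 + g"
    by (intro tendsto_add u0 G(2))
  have L: "\<forall>\<^sub>F r in sequentially. ln c / real r + g \<le> ln (real (S r)) / real r"
    using low eventually_gt_at_top[of 0]
  proof eventually_elim
    case (elim r)
    have "ln c + g * real r = ln (c * exp (g * real r))" using c by (simp add: ln_mult)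
    also have "\<dots> \<le> ln (real (S r))" using elim(1) c by (intro ln_mono) (auto intro: mult_pos_pos less_le_trans)
    finally have "(ln c + g * real r) / real r \<le> ln (real (S r)) / real r" by (rule divide_right_mono) simp
    then show ?case using elim(2) by (simp add: add_divide_distrib)
  qed
  have pos: "\<forall>\<^sub>F r in sequentially. 0 < real (S r)"
    using low
  proof eventually_elim
    case (elim r)
    have "0 < c * exp (g * real r)" using c by simp
    then show ?case using elim by (rule less_le_trans)
  qed
  have LM: "\<forall>\<^sub>F r in sequentially. ln (real (S r)) / real r \<le> ln (real (T r)) / real r"
    using pos
  proof eventually_elim
    case (elim r)
    have "ln (real (S r)) \<le> ln (real (T r))" using elim ST[of r] by (intro ln_mono) auto
    then show ?case by (rule divide_right_mono) simp
  qed
  have U: "\<forall>\<^sub>F r in sequentially. ln (real (T r)) / real r \<le> 2 * (ln (real r + 1) / real r) + ln (G r) / real r"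
    using pos up
  proof eventually_elim
    case (elim r)
    have G0: "0 < G r" using G(1)[of r] by linarith
    have "ln (real (T r)) \<le> ln ((real r + 1)\<^sup>2 * G r)"
      using elim ST[of r] G0 by (intro ln_mono) auto
    also have "\<dots> = 2 * ln (real r + 1) + ln (G r)"
      using G0 by (simp add: ln_mult ln_realpow)
    finally have "ln (real (T r)) / real r \<le> (2 * ln (real r + 1) + ln (G r)) / real r"
      by (rule divide_right_mono) simp
    then show ?case by (simp add: add_divide_distrib)
  qed
  have "(\<lambda>r. ln (real (T r)) / real r) \<longlonglongrightarrow> g"
  proof (rule tendsto_sandwich[OF _ U])
    show "\<forall>\<^sub>F r in sequentially. ln c / real r + g \<le> ln (real (T r)) / real r"
      using L LM by eventually_elim linarith
  qed (use l u in simp_all)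
  moreover have "(\<lambda>r. ln (real (S r)) / real r) \<longlonglongrightarrow> g"
  proof (rule tendsto_sandwich[OF L])
    show "\<forall>\<^sub>F r in sequentially. ln (real (S r)) / real r \<le> 2 * (ln (real r + 1) / real r) + ln (G r) / real r"
      using LM U by eventually_elim linarith
  qed (use l u in simp_all)
  ultimately show ?thesis by blast
qed

section \<open>Geodesics and the second moment\<close>

definition path_edges :: "'a list \<Rightarrow> 'a set set" where
  "path_edges xs = {{xs ! i, xs ! Suc i} | i. Suc i < length xs}"

context qt_graph
begin

text \<open>An enumeration of the vertices that breaks ties between geodesics.\<close>
definition ord :: "'a \<Rightarrow> nat" where "ord = to_nat_on V"

lemma ord_inj: "u \<in> V \<Longrightarrow> w \<in> V \<Longrightarrow> ord u = ord w \<Longrightarrow> u = w"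
  using inj_on_to_nat_on[OF countable_V] by (auto simp: ord_def inj_on_def)

text \<open>The part of \<open>xs\<close> being the canonical geodesic that does not ask for its edges to be open: no vertex of
  \<open>xs\<close> can be reached faster, and each predecessor on \<open>xs\<close> is the least possible one. Both
  conditions only become harder when edges are added, as \<open>shortest_antimono\<close> records.\<close>
definition shortest :: "'a set set \<Rightarrow> 'a \<Rightarrow> 'a list \<Rightarrow> bool" where
  "shortest K x xs \<longleftrightarrow> (\<forall>i<length xs. \<forall>j<i. xs ! i \<notin> bl K x j) \<and>
     (\<forall>i. Suc i < length xs \<longrightarrow> (\<forall>u. u \<in> bl K x i \<longrightarrow> {u, xs ! Suc i} \<in> K \<longrightarrow> ord (xs ! i) \<le> ord u))"

definition geo :: "'a set set \<Rightarrow> 'a \<Rightarrow> 'a list \<Rightarrow> bool" where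
  "geo K x xs \<longleftrightarrow> path_edges xs \<subseteq> K \<and> shortest K x xs"

definition paths :: "'a \<Rightarrow> nat \<Rightarrow> 'a list set" where
  "paths x t = {xs. set xs \<subseteq> bl E x t \<and> length xs \<le> Suc t \<and> xs \<noteq> [] \<and> hd xs = x}"

lemma finite_paths: "x \<in> V \<Longrightarrow> finite (paths x t)"
  unfolding paths_def
  by (rule finite_subset[OF _ finite_lists_length_le[of "bl E x t" "Suc t"]]) (auto intro: finite_bl)

lemma shortest_antimono: "K \<subseteq> K' \<Longrightarrow> shortest K' x xs \<Longrightarrow> shortest K x xs"
  unfolding shortest_def using bl_mono[of K K' x] by blast

lemma path_in_bl:
  assumes "path_edges xs \<subseteq> K" "hd xs = x" "i < length xs"
  shows "xs ! i \<in> bl K x i"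
  using assms(3)
proof (induction i)
  case 0
  then show ?case using assms(2) by (cases xs) auto
next
  case (Suc i)
  have "{xs ! i, xs ! Suc i} \<in> path_edges xs" using Suc.prems by (auto simp: path_edges_def)
  then have "{xs ! i, xs ! Suc i} \<in> K" using assms(1) by blast
  then show ?case using Suc by auto
qed

lemma geo_exists:
  assumes K: "K \<subseteq> E" and x: "x \<in> V"
  shows "z \<in> sph K x j \<Longrightarrow> \<exists>xs. geo K x xs \<and> length xs = Suc j \<and> hd xs = x \<and> last xs = z \<and> set xs \<subseteq> bl K x j"
proof (induction j arbitrary: z)
  case 0
  then have "z = x" by (auto simp: sph_def)
  then show ?case by (intro exI[of _ "[x]"]) (auto simp: geo_def path_edges_def shortest_def)
next
  case (Suc j)
  have z: "z \<in> bl K x (Suc j)" "z \<notin> bl K x j" using Suc.prems by (auto simp: sph_def inn_Suc)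
  let ?U = "{u\<in>bl K x j. {u, z} \<in> K}"
  have "?U \<noteq> {}" using z by auto
  then obtain u where u: "u \<in> ?U" "\<And>w. w \<in> ?U \<Longrightarrow> ord u \<le> ord w"
    using ex_has_least_nat[of "\<lambda>u. u \<in> ?U" _ ord] by blast
  have "u \<notin> inn K x j"
  proof
    assume "u \<in> inn K x j"
    then obtain i where i: "i < j" "u \<in> bl K x i" by (auto simp: inn_def)
    then have "z \<in> bl K x (Suc i)" using u(1) by auto
    moreover have "bl K x (Suc i) \<subseteq> bl K x j" using i by (intro bl_mono_radius) simp
    ultimately show False using z by blast
  qed
  then have "u \<in> sph K x j" using u(1) by (auto simp: sph_def)
  from Suc.IH[OF this] obtain xs where xs: "geo K x xs" "length xs = Suc j" "hd xs = x" "last xs = u" "set xs \<subseteq> bl K x j"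
    by blast
  have ne: "xs \<noteq> []" using xs(2) by auto
  have lastu: "xs ! j = u" using xs(2,4) ne by (simp add: last_conv_nth)
  let ?ys = "xs @ [z]"
  have nth: "?ys ! i = xs ! i" if "i \<le> j" for i using that xs(2) by (simp add: nth_append)
  have nthz: "?ys ! Suc j = z" using xs(2) by (simp add: nth_append)
  have "path_edges ?ys \<subseteq> K"
  proof
    fix e assume "e \<in> path_edges ?ys"
    then obtain i where i: "e = {?ys ! i, ?ys ! Suc i}" "Suc i < length ?ys" unfolding path_edges_def by blast
    show "e \<in> K"
    proof (cases "i = j")
      case True
      then show ?thesis using i nth[of j] nthz lastu u(1) by simp
    next
      case False
      then have "i < j" using i xs(2) by simp
      then have "e \<in> path_edges xs" using i nth[of i] nth[of "Suc i"] xs(2) by (auto simp: path_edges_def)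
      then show ?thesis using xs(1) by (auto simp: geo_def)
    qed
  qed
  moreover have "shortest K x ?ys"
  proof -
    have sh: "shortest K x xs" using xs(1) by (simp add: geo_def)
    have "?ys ! i \<notin> bl K x k" if ik: "i < length ?ys" "k < i" for i k
    proof (cases "i = Suc j")
      case True
      have "bl K x k \<subseteq> bl K x j" using ik True by (intro bl_mono_radius) simp
      then show ?thesis using True nthz z(2) by auto
    next
      case False
      then show ?thesis using sh ik xs(2) nth[of i] by (auto simp: shortest_def)
    qed
    moreover have "ord (?ys ! i) \<le> ord w" if i: "Suc i < length ?ys" and w: "w \<in> bl K x i" "{w, ?ys ! Suc i} \<in> K" for i w
    proof (cases "i = j")
      case True
      then show ?thesis using u(2)[of w] w nth[of j] nthz lastu by simp
    next
      case False
      then have "i < j" using i xs(2) by simp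
      then show ?thesis using sh w nth[of i] nth[of "Suc i"] xs(2) by (auto simp: shortest_def)
    qed
    ultimately show ?thesis unfolding shortest_def by blast
  qed
  ultimately have "geo K x ?ys" by (simp add: geo_def)
  moreover have "set ?ys \<subseteq> bl K x (Suc j)" using xs(5) z(1) by auto
  ultimately show ?case using xs ne by (intro exI[of _ ?ys]) auto
qed

lemma geo_unique:
  assumes K: "K \<subseteq> E" and x: "x \<in> V"
    and xs: "geo K x xs" "hd xs = x" "xs \<noteq> []" and ys: "geo K x ys" "hd ys = x" "ys \<noteq> []"
    and l: "last xs = last ys"
  shows "xs = ys"
proof -
  have len: "length zs \<le> length ws" if "geo K x zs" "zs \<noteq> []" "geo K x ws" "hd ws = x" "ws \<noteq> []" "last zs = last ws" for zs ws
  proof (rule ccontr)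
    assume "\<not> length zs \<le> length ws"
    then have less: "length ws - 1 < length zs - 1" using that(5) by (cases ws) auto
    have "ws ! (length ws - 1) \<in> bl K x (length ws - 1)"
      using that by (intro path_in_bl) (auto simp: geo_def)
    then have "zs ! (length zs - 1) \<in> bl K x (length ws - 1)"
      using that by (simp add: last_conv_nth)
    moreover have "zs ! (length zs - 1) \<notin> bl K x (length ws - 1)"
      using that(1,2) less by (auto simp: geo_def shortest_def)
    ultimately show False by blast
  qed
  have lens: "length xs = length ys"
    using len[of xs ys] len[of ys xs] xs ys l by simp
  have inV: "zs ! i \<in> V" if "geo K x zs" "hd zs = x" "i < length zs" for zs i
    using path_in_bl[of zs K x i] that bl_subset_V[OF K x] by (auto simp: geo_def)
  have step: "ord (zs ! i) \<le> ord (ws ! i)"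
    if "geo K x zs" "geo K x ws" "hd ws = x" "Suc i < length zs" "length zs = length ws" "zs ! Suc i = ws ! Suc i" for zs ws i
  proof -
    have "ws ! i \<in> bl K x i" using that by (intro path_in_bl) (auto simp: geo_def)
    moreover have "{ws ! i, ws ! Suc i} \<in> path_edges ws" using that(4,5) by (auto simp: path_edges_def)
    then have "{ws ! i, zs ! Suc i} \<in> K" using that(2,6) by (auto simp: geo_def)
    ultimately show ?thesis using that(1,4) by (auto simp: geo_def shortest_def)
  qed
  have backward: "xs ! (length xs - 1 - k) = ys ! (length xs - 1 - k)" if "k < length xs" for k
    using that
  proof (induction k)
    case 0
    then show ?case using l xs ys lens by (simp add: last_conv_nth)
  next
    case (Suc k)
    let ?i = "length xs - 1 - Suc k"
    have i: "Suc ?i = length xs - 1 - k" "Suc ?i < length xs" using Suc.prems by auto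
    have eq: "xs ! Suc ?i = ys ! Suc ?i" using Suc i by simp
    have "ord (xs ! ?i) \<le> ord (ys ! ?i)" by (rule step[OF xs(1) ys(1,2) i(2) lens eq])
    moreover have "ord (ys ! ?i) \<le> ord (xs ! ?i)"
      by (rule step[OF ys(1) xs(1,2) _ lens[symmetric] eq[symmetric]]) (use i lens in simp)
    ultimately show ?case
      using inV[OF xs(1,2), of ?i] inV[OF ys(1,2), of ?i] i lens by (intro ord_inj) auto
  qed
  have "xs ! i = ys ! i" if "i < length xs" for i
    using that backward[of "length xs - 1 - i"] by simp
  then show ?thesis using lens by (intro nth_equalityI) auto
qed

text \<open>Canonical geodesics correspond to the vertices of the ball, by \<open>geo_exists\<close> and
  \<open>geo_unique\<close>.\<close>
lemma sum_geo:
  assumes K: "K \<subseteq> E" and x: "x \<in> V"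
  shows "(\<Sum>xs\<in>paths x t. of_bool (geo K x xs)) = real (card (bl K x t))"
proof -
  have bij: "bij_betw last {xs\<in>paths x t. geo K x xs} (bl K x t)"
    unfolding bij_betw_def
  proof
    show "inj_on last {xs\<in>paths x t. geo K x xs}"
      by (rule inj_onI) (rule geo_unique[OF K x]; simp add: paths_def)
    show "last ` {xs\<in>paths x t. geo K x xs} = bl K x t"
    proof (intro equalityI subsetI)
      fix z assume "z \<in> last ` {xs\<in>paths x t. geo K x xs}"
      then obtain xs where xs: "z = last xs" "xs \<in> paths x t" "geo K x xs" by blast
      have "xs ! (length xs - 1) \<in> bl K x (length xs - 1)"
        using xs by (intro path_in_bl) (auto simp: geo_def paths_def)
      moreover have "length xs - 1 \<le> t" "last xs = xs ! (length xs - 1)" using xs by (auto simp: paths_def last_conv_nth)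
      ultimately show "z \<in> bl K x t"
        using xs(1) bl_mono_radius[of "length xs - 1" t K x] by auto
    next
      fix z assume z: "z \<in> bl K x t"
      define j where "j = (LEAST j. z \<in> bl K x j)"
      have j: "z \<in> bl K x j" unfolding j_def using z by (rule LeastI)
      have jt: "j \<le> t" unfolding j_def using z by (rule Least_le)
      have "z \<notin> inn K x j" unfolding inn_def j_def using not_less_Least by auto
      then have "z \<in> sph K x j" using j by (simp add: sph_def)
      from geo_exists[OF K x this] obtain xs where xs: "geo K x xs" "length xs = Suc j" "hd xs = x" "last xs = z" "set xs \<subseteq> bl K x j"
        by blast
      have "bl K x j \<subseteq> bl E x t" using bl_mono[OF K, of x j] bl_mono_radius[OF jt, of E x] by blast
      then have "xs \<in> paths x t" using xs jt by (auto simp: paths_def)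
      then show "z \<in> last ` {xs\<in>paths x t. geo K x xs}" using xs by blast
    qed
  qed
  have "(\<Sum>xs\<in>paths x t. of_bool (geo K x xs)) = real (card {xs\<in>paths x t. geo K x xs})"
    using finite_paths[OF x] by (simp add: of_bool_def sum.If_cases Int_def)
  then show ?thesis using bij_betw_same_card[OF bij] by simp
qed

lemma path_vertex: "xs \<in> paths x t \<Longrightarrow> i < length xs \<Longrightarrow> xs ! i \<in> bl E x t"
  using nth_mem by (fastforce simp: paths_def)

lemma path_edges_near: "xs \<in> paths x t \<Longrightarrow> path_edges xs \<inter> E \<subseteq> near x t"
  using path_vertex by (fastforce simp: path_edges_def near_def touching_def)

lemma shortest_depends:
  assumes xs: "xs \<in> paths x t" and n: "\<And>e. e \<in> near x t \<Longrightarrow> \<omega> e = \<omega>' e"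
  shows "shortest (opn \<omega>) x xs = shortest (opn \<omega>') x xs"
proof -
  have b: "bl (opn \<omega>) x i = bl (opn \<omega>') x i" if "i \<le> t" for i by (rule bl_depends[OF n that])
  have e: "({v, xs ! i} \<in> opn \<omega>) = ({v, xs ! i} \<in> opn \<omega>')" if "i < length xs" for v i
  proof -
    have "{v, xs ! i} \<in> near x t" if "{v, xs ! i} \<in> E"
      using that path_vertex[OF xs \<open>i < length xs\<close>] by (auto simp: near_def touching_def)
    then show ?thesis using n[of "{v, xs ! i}"] by (auto simp: open_edges_def)
  qed
  have len: "length xs \<le> Suc t" using xs by (simp add: paths_def)
  have 1: "(\<forall>i<length xs. \<forall>j<i. xs ! i \<notin> bl (opn \<omega>) x j) = (\<forall>i<length xs. \<forall>j<i. xs ! i \<notin> bl (opn \<omega>') x j)"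
  proof -
    have "(xs ! i \<notin> bl (opn \<omega>) x j) = (xs ! i \<notin> bl (opn \<omega>') x j)" if "i < length xs" "j < i" for i j
    proof -
      have "j \<le> t" using that len by simp
      then show ?thesis by (simp only: b)
    qed
    then show ?thesis by blast
  qed
  have 2: "(\<forall>i. Suc i < length xs \<longrightarrow> (\<forall>u. u \<in> bl (opn \<omega>) x i \<longrightarrow> {u, xs ! Suc i} \<in> opn \<omega> \<longrightarrow> ord (xs ! i) \<le> ord u))
     = (\<forall>i. Suc i < length xs \<longrightarrow> (\<forall>u. u \<in> bl (opn \<omega>') x i \<longrightarrow> {u, xs ! Suc i} \<in> opn \<omega>' \<longrightarrow> ord (xs ! i) \<le> ord u))"
  proof -
    have "(v \<in> bl (opn \<omega>) x i) = (v \<in> bl (opn \<omega>') x i)" if "Suc i < length xs" for i v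
    proof -
      have "i \<le> t" using that len by simp
      then show ?thesis by (simp only: b)
    qed
    moreover have "({v, xs ! Suc i} \<in> opn \<omega>) = ({v, xs ! Suc i} \<in> opn \<omega>')" if "Suc i < length xs" for i v
      by (rule e[OF that])
    ultimately show ?thesis by blast
  qed
  show ?thesis unfolding shortest_def 1 2 ..
qed

lemma random_edges_minus: "random_edges M K \<Longrightarrow> random_edges M (\<lambda>\<omega>. K \<omega> - P)"
  unfolding random_edges_def by (auto intro!: pred_intros_logic)

text \<open>A shortest path to \<open>y\<close> leaves the geodesic \<open>xs\<close> for the last time at some
  \<open>xs ! k\<close>. As \<open>xs ! k\<close> is at distance \<open>k\<close> from \<open>x\<close>, at most
  \<open>n - k\<close> steps remain, none of which uses an edge of \<open>xs\<close>.\<close>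
lemma branch_from_geodesic:
  assumes g: "geo K x xs" "hd xs = x" "xs \<noteq> []"
  shows "y \<in> bl K x n \<Longrightarrow> \<exists>k<length xs. k \<le> n \<and> y \<in> bl (K - path_edges xs) (xs ! k) (n - k)"
proof (induction n arbitrary: y)
  case 0
  then have "y = xs ! 0" using g by (cases xs) auto
  then show ?case using g(3) by (intro exI[of _ 0]) auto
next
  case (Suc n)
  show ?case
  proof (cases "y \<in> bl K x n")
    case True
    then obtain k where "k < length xs" "k \<le> n" "y \<in> bl (K - path_edges xs) (xs ! k) (n - k)" using Suc.IH by blast
    moreover have "n - k \<le> Suc n - k" by simp
    ultimately show ?thesis using bl_mono_radius[of "n - k" "Suc n - k" "K - path_edges xs" "xs ! k"] by (intro exI[of _ k]) auto
  next
    case False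
    then obtain u where u: "u \<in> bl K x n" "{u, y} \<in> K" using Suc.prems by auto
    show ?thesis
    proof (cases "{u, y} \<in> path_edges xs")
      case True
      then obtain i where i: "i < length xs" "y = xs ! i" by (auto simp: path_edges_def doubleton_eq_iff dest: Suc_lessD)
      have "i \<le> Suc n"
      proof (rule ccontr)
        assume "\<not> i \<le> Suc n"
        then have "xs ! i \<notin> bl K x (Suc n)" using g(1) i(1) by (simp add: geo_def shortest_def del: bl.simps)
        then show False using Suc.prems i(2) by blast
      qed
      then show ?thesis using i by (intro exI[of _ i]) simp
    next
      case False
      obtain k where k: "k < length xs" "k \<le> n" "u \<in> bl (K - path_edges xs) (xs ! k) (n - k)" using Suc.IH[OF u(1)] by blast
      have "Suc n - k = Suc (n - k)" using k(2) by simp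
      then show ?thesis using k u(2) False by (intro exI[of _ k]) auto
    qed
  qed
qed

end

context perc
begin

text \<open>The event that \<open>xs\<close> is the canonical geodesic says that its edges are open and that a decreasing event
  of the other edges holds (the edges of \<open>xs\<close> may be declared open in it). Connections off
  \<open>xs\<close> are an increasing event of the other edges, so Harris' inequality gives negative correlation.\<close>
lemma geo_indep:
  assumes x: "x \<in> V" and xs: "xs \<in> paths x t" and u: "u \<in> V"
  shows "\<P>(\<omega> in M. geo (opn \<omega>) x xs \<and> w \<in> bl (opn \<omega> - path_edges xs) u s)
     \<le> \<P>(\<omega> in M. geo (opn \<omega>) x xs) * \<P>(\<omega> in M. w \<in> bl (opn \<omega>) u s)"
proof -
  define P where "P = path_edges xs"
  define Op where "Op \<omega> \<longleftrightarrow> P \<subseteq> opn \<omega>" for \<omega>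
  \<comment> \<open>Overwriting the path by open edges makes this event independent of the states of the path edges.\<close>
  define De where "De \<omega> \<longleftrightarrow> shortest (opn (overwrite P True \<omega>)) x xs" for \<omega>
  define Re where "Re \<omega> \<longleftrightarrow> w \<in> bl (opn \<omega> - P) u s" for \<omega>
  have geo_iff: "geo (opn \<omega>) x xs \<longleftrightarrow> Op \<omega> \<and> De \<omega>" for \<omega>
  proof (cases "Op \<omega>")
    case True
    then have "opn (overwrite P True \<omega>) = opn \<omega>" by (auto simp: Op_def open_edges_def overwrite_def)
    then show ?thesis using True by (simp add: geo_def Op_def De_def P_def)
  next
    case False
    then show ?thesis by (simp add: geo_def Op_def P_def)
  qed
  have PB: "P \<inter> E \<subseteq> near x t" unfolding P_def by (rule path_edges_near[OF xs])
  define F where "F = (near x t \<union> near u s) - P"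
  have finF: "finite F" "F \<subseteq> E" using finite_near[OF x, of t] finite_near[OF u, of s] near_subset[of x t] near_subset[of u s] by (auto simp: F_def)
  have finP: "finite (P \<inter> E)" using PB finite_near[OF x] by (rule finite_subset)
  have dOp: "depends Op (P \<inter> E)"
  proof (rule dependsI)
    fix \<omega> \<omega>' :: "'a set \<Rightarrow> bool" assume "\<And>j. j \<in> P \<inter> E \<Longrightarrow> \<omega> j = \<omega>' j"
    then show "Op \<omega> = Op \<omega>'" unfolding Op_def open_edges_def by blast
  qed
  have dDe: "depends De F"
  proof (rule dependsI)
    fix \<omega> \<omega>' :: "'a set \<Rightarrow> bool" assume a: "\<And>j. j \<in> F \<Longrightarrow> \<omega> j = \<omega>' j"
    show "De \<omega> = De \<omega>'" unfolding De_def
    proof (rule shortest_depends[OF xs])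
      show "overwrite P True \<omega> e = overwrite P True \<omega>' e" if "e \<in> near x t" for e
        using a[of e] that by (auto simp: overwrite_def F_def)
    qed
  qed
  have dRe: "depends Re F"
  proof (rule dependsI)
    fix \<omega> \<omega>' :: "'a set \<Rightarrow> bool" assume a: "\<And>j. j \<in> F \<Longrightarrow> \<omega> j = \<omega>' j"
    have "bl (opn \<omega> - P) u s = bl (opn \<omega>' - P) u s"
    proof (rule bl_local'[OF _ order_refl])
      fix e assume e: "e \<inter> bl (opn \<omega> - P) u s \<noteq> {}"
      have "opn \<omega> - P \<subseteq> E" using opn_subset by blast
      then have "e \<inter> bl E u s \<noteq> {}" using e bl_mono[of "opn \<omega> - P" E u s] by blast
      then show "e \<in> opn \<omega> - P \<longleftrightarrow> e \<in> opn \<omega>' - P"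
        using a[of e] by (auto simp: open_edges_def near_def touching_def F_def)
    qed
    then show "Re \<omega> = Re \<omega>'" unfolding Re_def by (simp only:)
  qed
  have mOp: "Measurable.pred M Op" by (rule pred_finite_depends[OF finP Int_lower2 dOp])
  have mDe: "Measurable.pred M De" by (rule pred_finite_depends[OF finF dDe])
  have mRe: "Measurable.pred M Re" by (rule pred_finite_depends[OF finF dRe])
  have dDR: "depends (\<lambda>\<omega>. De \<omega> \<and> Re \<omega>) F"
  proof (rule dependsI)
    fix \<omega> \<omega>' :: "'a set \<Rightarrow> bool" assume a: "\<And>j. j \<in> F \<Longrightarrow> \<omega> j = \<omega>' j"
    have "De \<omega> = De \<omega>'" "Re \<omega> = Re \<omega>'" by (rule dependsD[OF dDe a], assumption) (rule dependsD[OF dRe a], assumption)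
    then show "(De \<omega> \<and> Re \<omega>) = (De \<omega>' \<and> Re \<omega>')" by simp
  qed
  have disj: "E \<inter> (P \<inter> E) \<inter> F = {}" by (auto simp: F_def)
  have "\<P>(\<omega> in M. geo (opn \<omega>) x xs \<and> w \<in> bl (opn \<omega> - path_edges xs) u s) = \<P>(\<omega> in M. Op \<omega> \<and> (De \<omega> \<and> Re \<omega>))"
    unfolding geo_iff Re_def P_def by (simp only: conj_assoc)
  also have "\<dots> = \<P>(\<omega> in M. Op \<omega>) * \<P>(\<omega> in M. De \<omega> \<and> Re \<omega>)"
    by (rule bits_indep[OF mOp _ dOp dDR disj]) (intro pred_intros_logic mDe mRe)
  also have "\<P>(\<omega> in M. De \<omega> \<and> Re \<omega>) = \<P>(\<omega> in M. Re \<omega> \<and> De \<omega>)" by (simp only: conj_commute)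
  also have "\<dots> \<le> \<P>(\<omega> in M. Re \<omega>) * \<P>(\<omega> in M. De \<omega>)"
  proof (rule harris[OF finF _ dRe dDe])
    fix \<omega> \<omega>' :: "'a set \<Rightarrow> bool" assume le: "\<And>j. \<omega> j \<Longrightarrow> \<omega>' j"
    then have sub: "opn \<omega> \<subseteq> opn \<omega>'" by (auto simp: open_edges_def)
    show "Re \<omega>'" if "Re \<omega>"
      using that bl_mono[of "opn \<omega> - P" "opn \<omega>' - P" u s] sub unfolding Re_def by blast
    have "opn (overwrite P True \<omega>) \<subseteq> opn (overwrite P True \<omega>')"
      using le by (auto simp: open_edges_def overwrite_def)
    then show "De \<omega>" if "De \<omega>'" using that unfolding De_def by (rule shortest_antimono)
  qed (use p in auto)
  also have "\<P>(\<omega> in M. Op \<omega>) * (\<P>(\<omega> in M. Re \<omega>) * \<P>(\<omega> in M. De \<omega>))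
      = (\<P>(\<omega> in M. Op \<omega>) * \<P>(\<omega> in M. De \<omega>)) * \<P>(\<omega> in M. Re \<omega>)" by (simp only: mult_ac)
  also have "\<P>(\<omega> in M. Op \<omega>) * \<P>(\<omega> in M. De \<omega>) = \<P>(\<omega> in M. Op \<omega> \<and> De \<omega>)"
    by (rule bits_indep[OF mOp mDe dOp dDe disj, symmetric])
  also have "\<P>(\<omega> in M. Op \<omega> \<and> De \<omega>) = \<P>(\<omega> in M. geo (opn \<omega>) x xs)" unfolding geo_iff ..
  also have "\<P>(\<omega> in M. Re \<omega>) \<le> \<P>(\<omega> in M. w \<in> bl (opn \<omega>) u s)"
  proof (rule finite_measure_mono)
    show "{\<omega> \<in> space M. w \<in> bl (opn \<omega>) u s} \<in> events" by (rule predE[OF pred_bl[OF random_edges_opn]])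
    show "{\<omega> \<in> space M. Re \<omega>} \<subseteq> {\<omega> \<in> space M. w \<in> bl (opn \<omega>) u s}"
      unfolding Re_def using bl_mono[of "opn _ - P" "opn _" u s] by blast
  qed
  finally show ?thesis by (simp add: mult_left_mono)
qed

lemma geo_depends:
  assumes xs: "xs \<in> paths x t"
  shows "depends (\<lambda>\<omega>. geo (opn \<omega>) x xs) (near x t)"
proof (rule dependsI)
  fix \<omega> \<omega>' :: "'a set \<Rightarrow> bool" assume a: "\<And>j. j \<in> near x t \<Longrightarrow> \<omega> j = \<omega>' j"
  have "shortest (opn \<omega>) x xs = shortest (opn \<omega>') x xs" by (rule shortest_depends[OF xs a])
  moreover have "path_edges xs \<subseteq> opn \<omega> \<longleftrightarrow> path_edges xs \<subseteq> opn \<omega>'"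
    using path_edges_near[OF xs] a by (auto simp: open_edges_def subset_iff)
  ultimately show "geo (opn \<omega>) x xs = geo (opn \<omega>') x xs" by (simp only: geo_def)
qed

lemma integrable_of_bool:
  assumes "Measurable.pred M P"
  shows "integrable M (\<lambda>\<omega>. of_bool (P \<omega>) :: real)"
proof (rule integrable_const_bound[of _ 1])
  show "(\<lambda>\<omega>. of_bool (P \<omega>) :: real) \<in> borel_measurable M"
    by (rule measurable_compose[OF assms]) simp
qed simp

lemma sum_prob_le_EB:
  assumes u: "u \<in> V" and W: "finite W"
  shows "(\<Sum>w\<in>W. \<P>(\<omega> in M. w \<in> B \<omega> u s)) \<le> EB u s"
proof -
  have m: "Measurable.pred M (\<lambda>\<omega>. w \<in> B \<omega> u s)" for w by (rule pred_bl[OF random_edges_opn])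
  have "(\<Sum>w\<in>W. \<P>(\<omega> in M. w \<in> B \<omega> u s)) = (\<Sum>w\<in>W. (\<integral>\<omega>. of_bool (w \<in> B \<omega> u s) \<partial>M))"
    unfolding integral_of_bool[OF m] ..
  also have "\<dots> = (\<integral>\<omega>. (\<Sum>w\<in>W. of_bool (w \<in> B \<omega> u s)) \<partial>M)"
    by (rule Bochner_Integration.integral_sum[symmetric]) (rule integrable_of_bool[OF m])
  also have "\<dots> \<le> EB u s" unfolding EB_def
  proof (rule integral_mono[OF _ integrable_card_B[OF u]])
    show "integrable M (\<lambda>\<omega>. \<Sum>w\<in>W. of_bool (w \<in> B \<omega> u s) :: real)"
      by (rule Bochner_Integration.integrable_sum) (rule integrable_of_bool[OF m])
    fix \<omega>
    have f: "finite (B \<omega> u s)" by (rule finite_bl[OF opn_subset u])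
    have "(\<Sum>w\<in>W. of_bool (w \<in> B \<omega> u s)) = real (card (W \<inter> B \<omega> u s))"
      using W by (simp add: of_bool_def sum.If_cases)
    also have "\<dots> \<le> real (card (B \<omega> u s))" using f by (simp add: card_mono)
    finally show "(\<Sum>w\<in>W. of_bool (w \<in> B \<omega> u s)) \<le> real (card (B \<omega> u s))" .
  qed
  finally show ?thesis .
qed

text \<open>\<open>card (B t)\<^sup>2\<close> counts pairs of a canonical geodesic and a vertex, and the vertex is reached from
  the \<open>k\<close>-th point of the geodesic within \<open>t - k\<close> steps off the geodesic. By
  \<open>geo_indep\<close> the expected number of such vertices is at most \<open>Gr (t - k)\<close> for each
  geodesic and each \<open>k\<close>, and the expected number of geodesics is at most \<open>Gr t\<close>.\<close>
lemma second_moment: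
  assumes x: "x \<in> V"
  shows "(\<integral>\<omega>. (real (card (B \<omega> x t)))\<^sup>2 \<partial>M) \<le> Gr V E p t * (\<Sum>k\<le>t. Gr V E p (t - k))"
proof -
  let ?W = "bl E x t"
  let ?P = "paths x t"
  define Q where "Q xs k w \<omega> \<longleftrightarrow> geo (opn \<omega>) x xs \<and> w \<in> bl (opn \<omega> - path_edges xs) (xs ! k) (t - k)" for xs k w \<omega>
  have fin: "finite ?W" by (rule finite_bl[OF order_refl x])
  have WV: "?W \<subseteq> V" by (rule bl_subset_V[OF order_refl x])
  have mgeo: "Measurable.pred M (\<lambda>\<omega>. geo (opn \<omega>) x xs)" if xs: "xs \<in> ?P" for xs
    by (rule pred_finite_depends[OF finite_near[OF x] near_subset geo_depends[OF xs]])
  have mQ: "Measurable.pred M (Q xs k w)" if xs: "xs \<in> ?P" for xs k w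
    unfolding Q_def
    by (intro pred_intros_logic mgeo[OF xs] pred_bl[OF random_edges_minus[OF random_edges_opn]])
  have iQ: "integrable M (\<lambda>\<omega>. of_bool (Q xs k w \<omega>) :: real)" if xs: "xs \<in> ?P" for xs k w
    by (rule integrable_of_bool[OF mQ[OF xs]])
  have pw: "(real (card (B \<omega> x t)))\<^sup>2 \<le> (\<Sum>xs\<in>?P. \<Sum>k<length xs. \<Sum>w\<in>?W. of_bool (Q xs k w \<omega>))" for \<omega>
  proof -
    have "(real (card (B \<omega> x t)))\<^sup>2 = (\<Sum>xs\<in>?P. of_bool (geo (opn \<omega>) x xs) * real (card (B \<omega> x t)))"
      unfolding power2_eq_square sum_distrib_right[symmetric] sum_geo[OF opn_subset x] ..
    also have "\<dots> \<le> (\<Sum>xs\<in>?P. \<Sum>k<length xs. \<Sum>w\<in>?W. of_bool (Q xs k w \<omega>))"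
    proof (rule sum_mono)
      fix xs assume xs: "xs \<in> ?P"
      show "of_bool (geo (opn \<omega>) x xs) * real (card (B \<omega> x t)) \<le> (\<Sum>k<length xs. \<Sum>w\<in>?W. of_bool (Q xs k w \<omega>))"
      proof (cases "geo (opn \<omega>) x xs")
        case True
        have sub: "B \<omega> x t \<subseteq> ?W" by (rule bl_mono[OF opn_subset])
        have "real (card (B \<omega> x t)) = (\<Sum>w\<in>?W. of_bool (w \<in> B \<omega> x t))"
          by (rule card_eq_sum_indicator[OF fin sub])
        also have "\<dots> \<le> (\<Sum>w\<in>?W. \<Sum>k<length xs. of_bool (Q xs k w \<omega>))"
        proof (rule sum_mono)
          fix w
          show "of_bool (w \<in> B \<omega> x t) \<le> (\<Sum>k<length xs. of_bool (Q xs k w \<omega>) :: real)"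
          proof (cases "w \<in> B \<omega> x t")
            case w: True
            have "hd xs = x" "xs \<noteq> []" using xs by (auto simp: paths_def)
            from branch_from_geodesic[OF True this w]
            obtain k where k: "k < length xs" "w \<in> bl (opn \<omega> - path_edges xs) (xs ! k) (t - k)" by blast
            have "of_bool (Q xs k w \<omega>) \<le> (\<Sum>k<length xs. of_bool (Q xs k w \<omega>) :: real)"
              using k(1) by (intro member_le_sum) auto
            moreover have "Q xs k w \<omega>" using True k(2) by (simp add: Q_def)
            ultimately show ?thesis using w by simp
          qed (simp add: sum_nonneg)
        qed
        also have "\<dots> = (\<Sum>k<length xs. \<Sum>w\<in>?W. of_bool (Q xs k w \<omega>))" by (rule sum.swap)
        finally show ?thesis using True by simp
      next
        case False
        then show ?thesis by (simp add: sum_nonneg)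
      qed
    qed
    finally show ?thesis .
  qed
  have "(\<integral>\<omega>. (real (card (B \<omega> x t)))\<^sup>2 \<partial>M) \<le> (\<integral>\<omega>. (\<Sum>xs\<in>?P. \<Sum>k<length xs. \<Sum>w\<in>?W. of_bool (Q xs k w \<omega>)) \<partial>M)"
  proof (rule integral_mono[OF _ _ pw])
    show "integrable M (\<lambda>\<omega>. (real (card (B \<omega> x t)))\<^sup>2)"
    proof (rule integrable_near[OF x, of t])
      fix \<omega> \<omega>' :: "'a set \<Rightarrow> bool" assume "\<And>e. e \<in> near x t \<Longrightarrow> \<omega> e = \<omega>' e"
      then have "B \<omega> x t = B \<omega>' x t" by (rule bl_depends[OF _ order_refl])
      then show "(real (card (B \<omega> x t)))\<^sup>2 = (real (card (B \<omega>' x t)))\<^sup>2" by (simp only:)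
    qed
    show "integrable M (\<lambda>\<omega>. \<Sum>xs\<in>?P. \<Sum>k<length xs. \<Sum>w\<in>?W. of_bool (Q xs k w \<omega>) :: real)"
      by (intro Bochner_Integration.integrable_sum iQ)
  qed
  also have "\<dots> = (\<Sum>xs\<in>?P. \<Sum>k<length xs. \<Sum>w\<in>?W. (\<integral>\<omega>. of_bool (Q xs k w \<omega>) \<partial>M))"
  proof -
    have "(\<integral>\<omega>. (\<Sum>xs\<in>?P. \<Sum>k<length xs. \<Sum>w\<in>?W. of_bool (Q xs k w \<omega>) :: real) \<partial>M)
       = (\<Sum>xs\<in>?P. (\<integral>\<omega>. (\<Sum>k<length xs. \<Sum>w\<in>?W. of_bool (Q xs k w \<omega>)) \<partial>M))"
      by (rule Bochner_Integration.integral_sum) (intro Bochner_Integration.integrable_sum iQ)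
    also have "\<dots> = (\<Sum>xs\<in>?P. \<Sum>k<length xs. (\<integral>\<omega>. (\<Sum>w\<in>?W. of_bool (Q xs k w \<omega>)) \<partial>M))"
      by (rule sum.cong[OF refl], rule Bochner_Integration.integral_sum) (intro Bochner_Integration.integrable_sum iQ)
    also have "\<dots> = (\<Sum>xs\<in>?P. \<Sum>k<length xs. \<Sum>w\<in>?W. (\<integral>\<omega>. of_bool (Q xs k w \<omega>) \<partial>M))"
      by (rule sum.cong[OF refl], rule sum.cong[OF refl], rule Bochner_Integration.integral_sum) (intro iQ)
    finally show ?thesis .
  qed
  also have "\<dots> \<le> (\<Sum>xs\<in>?P. \<P>(\<omega> in M. geo (opn \<omega>) x xs) * (\<Sum>k\<le>t. Gr V E p (t - k)))"
  proof (rule sum_mono)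
    fix xs assume xs: "xs \<in> ?P"
    let ?g = "\<P>(\<omega> in M. geo (opn \<omega>) x xs)"
    have len: "length xs \<le> Suc t" using xs by (simp add: paths_def)
    have k: "(\<Sum>w\<in>?W. (\<integral>\<omega>. of_bool (Q xs k w \<omega>) \<partial>M)) \<le> ?g * Gr V E p (t - k)" if "k < length xs" for k
    proof -
      have u: "xs ! k \<in> V" using path_vertex[OF xs that] WV by blast
      have "(\<Sum>w\<in>?W. (\<integral>\<omega>. of_bool (Q xs k w \<omega>) \<partial>M)) = (\<Sum>w\<in>?W. \<P>(\<omega> in M. Q xs k w \<omega>))"
        unfolding integral_of_bool[OF mQ[OF xs]] ..
      also have "\<dots> \<le> (\<Sum>w\<in>?W. ?g * \<P>(\<omega> in M. w \<in> B \<omega> (xs ! k) (t - k)))"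
        unfolding Q_def by (intro sum_mono geo_indep[OF x xs u])
      also have "\<dots> = ?g * (\<Sum>w\<in>?W. \<P>(\<omega> in M. w \<in> B \<omega> (xs ! k) (t - k)))"
        by (rule sum_distrib_left[symmetric])
      also have "\<dots> \<le> ?g * Gr V E p (t - k)"
        using order_trans[OF sum_prob_le_EB[OF u fin] EB_le_Gr[OF u]] by (intro mult_left_mono measure_nonneg)
      finally show ?thesis .
    qed
    have "(\<Sum>k<length xs. \<Sum>w\<in>?W. (\<integral>\<omega>. of_bool (Q xs k w \<omega>) \<partial>M)) \<le> (\<Sum>k<length xs. ?g * Gr V E p (t - k))"
      by (rule sum_mono) (rule k, simp)
    also have "\<dots> = ?g * (\<Sum>k<length xs. Gr V E p (t - k))" by (rule sum_distrib_left[symmetric])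
    also have "\<dots> \<le> ?g * (\<Sum>k\<le>t. Gr V E p (t - k))"
    proof (intro mult_left_mono measure_nonneg sum_mono2)
      show "{..<length xs} \<subseteq> {..t}" using len by auto
      show "0 \<le> Gr V E p (t - b)" for b using Gr_ge_1[of "t - b"] by linarith
    qed simp
    finally show "(\<Sum>k<length xs. \<Sum>w\<in>?W. (\<integral>\<omega>. of_bool (Q xs k w \<omega>) \<partial>M)) \<le> ?g * (\<Sum>k\<le>t. Gr V E p (t - k))" .
  qed
  also have "\<dots> = (\<Sum>xs\<in>?P. \<P>(\<omega> in M. geo (opn \<omega>) x xs)) * (\<Sum>k\<le>t. Gr V E p (t - k))"
    by (rule sum_distrib_right[symmetric])
  also have "(\<Sum>xs\<in>?P. \<P>(\<omega> in M. geo (opn \<omega>) x xs)) = EB x t"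
  proof -
    have "(\<Sum>xs\<in>?P. \<P>(\<omega> in M. geo (opn \<omega>) x xs)) = (\<Sum>xs\<in>?P. (\<integral>\<omega>. of_bool (geo (opn \<omega>) x xs) \<partial>M))"
      by (rule sum.cong[OF refl]) (rule integral_of_bool[OF mgeo, symmetric])
    also have "\<dots> = (\<integral>\<omega>. (\<Sum>xs\<in>?P. of_bool (geo (opn \<omega>) x xs)) \<partial>M)"
      by (rule Bochner_Integration.integral_sum[symmetric]) (rule integrable_of_bool[OF mgeo])
    also have "\<dots> = EB x t" unfolding EB_def sum_geo[OF opn_subset x] ..
    finally show ?thesis .
  qed
  also have "EB x t * (\<Sum>k\<le>t. Gr V E p (t - k)) \<le> Gr V E p t * (\<Sum>k\<le>t. Gr V E p (t - k))"
  proof (rule mult_right_mono[OF EB_le_Gr[OF x]])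
    show "0 \<le> (\<Sum>k\<le>t. Gr V E p (t - k))"
      by (rule sum_nonneg) (use Gr_ge_1 in \<open>meson order_trans zero_le_one\<close>)
  qed
  finally show ?thesis .
qed

end

section \<open>Almost surely convergent averages\<close>

text \<open>Among the convex combinations of \<open>Z t\<close> with \<open>t \<ge> m\<close> consider the infimum
  \<open>d m\<close> of the squared norm. It increases to a finite limit \<open>dd\<close>. Near-minimizers for
  large \<open>m\<close> are close to each other by the parallelogram identity, because their midpoint is again a
  convex combination of late terms. With errors \<open>(1/4) ^ k\<close> consecutive near-minimizers differ by at
  most \<open>sqrt (1/2) ^ k\<close> for all large \<open>k\<close>, almost surely.\<close>
lemma (in prob_space) convex_combinations_converge:
  fixes Z :: "nat \<Rightarrow> 'a \<Rightarrow> real"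
  assumes int: "\<And>s t. integrable M (\<lambda>\<omega>. Z s \<omega> * Z t \<omega>)"
    and bd: "\<And>t. t \<in> T \<Longrightarrow> (\<integral>\<omega>. (Z t \<omega>)\<^sup>2 \<partial>M) \<le> C" and T: "infinite T"
  shows "\<exists>N l. (\<forall>n t. 0 \<le> l n t) \<and> (\<forall>n t. l n t \<noteq> 0 \<longrightarrow> t \<in> T \<and> n \<le> t \<and> t < N n) \<and> (\<forall>n. (\<Sum>t<N n. l n t) = (1::real))
     \<and> (AE \<omega> in M. convergent (\<lambda>n. \<Sum>t<N n. l n t * Z t \<omega>))"
proof -
  define cmb where "cmb n X \<longleftrightarrow> (\<forall>t. 0 \<le> snd X t) \<and> (\<forall>t. snd X t \<noteq> 0 \<longrightarrow> t \<in> T \<and> n \<le> t \<and> t < fst X) \<and> (\<Sum>t<fst X. snd X t) = (1::real)"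
    for n :: nat and X :: "nat \<times> (nat \<Rightarrow> real)"
  define W where "W X \<omega> = (\<Sum>t<fst X. snd X t * Z t \<omega>)" for X :: "nat \<times> (nat \<Rightarrow> real)" and \<omega>
  have Wi: "integrable M (\<lambda>\<omega>. W X \<omega> * W Y \<omega>)" for X Y
  proof -
    have "(\<lambda>\<omega>. W X \<omega> * W Y \<omega>) = (\<lambda>\<omega>. \<Sum>s<fst X. \<Sum>t<fst Y. (snd X s * snd Y t) * (Z s \<omega> * Z t \<omega>))"
      unfolding W_def sum_product by (rule ext) (simp only: mult_ac)
    then show ?thesis
      by (simp only:) (intro Bochner_Integration.integrable_sum integrable_mult_right int)
  qed
  define nrm where "nrm X = (\<integral>\<omega>. (W X \<omega>)\<^sup>2 \<partial>M)" for X
  have nrm0: "0 \<le> nrm X" for X unfolding nrm_def by (rule integral_nonneg_AE) simp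
  define d where "d n = Inf (nrm ` {X. cmb n X})" for n
  have bdd: "bdd_below (nrm ` {X. cmb n X})" for n by (rule bdd_belowI[of _ 0]) (auto simp: nrm0)
  have cmb_mono: "cmb m X" if "cmb n X" "m \<le> n" for m n X using that unfolding cmb_def by (meson order_trans)
  have single: "\<exists>X. cmb n X \<and> nrm X \<le> C" for n
  proof -
    obtain t where t: "t \<in> T" "n \<le> t" using T by (meson infinite_nat_iff_unbounded_le)
    let ?X = "(Suc t, \<lambda>s. if s = t then 1 else (0::real))"
    have "cmb n ?X" using t by (auto simp: cmb_def)
    moreover have "W ?X = Z t" unfolding W_def by (rule ext) (simp add: if_distrib[of "\<lambda>x. x * _"] cong: if_cong)
    ultimately show ?thesis using bd[OF t(1)] unfolding nrm_def by (intro exI[of _ ?X]) simp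
  qed
  have ne: "nrm ` {X. cmb n X} \<noteq> {}" for n using single[of n] by blast
  have d_le: "d n \<le> nrm X" if "cmb n X" for n X unfolding d_def using that by (intro cInf_lower[OF _ bdd]) auto
  have d_mono: "d m \<le> d n" if "m \<le> n" for m n
    unfolding d_def using cmb_mono[OF _ that] by (intro cInf_superset_mono[OF ne bdd]) auto
  have d_C: "d n \<le> C" for n using single[of n] d_le by (meson order_trans)
  define dd where "dd = (SUP n. d n)"
  have bd_above: "bdd_above (range d)" by (rule bdd_aboveI[of _ C]) (auto simp: d_C)
  have dd: "d n \<le> dd" for n unfolding dd_def by (rule cSUP_upper[OF _ bd_above]) simp
  have "\<exists>X. \<exists>m\<ge>k. cmb m X \<and> nrm X \<le> d m + (1/4)^k \<and> dd - (1/4)^k \<le> d m" for k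
  proof -
    have "dd - (1/4)^k < dd" by simp
    then obtain m where m: "dd - (1/4)^k < d m" unfolding dd_def using less_cSUP_iff[OF _ bd_above] by auto
    \<comment> \<open>The index must exceed both \<open>m\<close>, to be close to the limit, and \<open>k\<close>, to use only late terms.\<close>
    let ?m = "max m k"
    have "d ?m < d ?m + (1/4)^k" by simp
    then obtain y where "y \<in> nrm ` {X. cmb ?m X}" "y < d ?m + (1/4)^k"
      unfolding d_def[of ?m] using cInf_less_iff[OF ne bdd] by blast
    then obtain X where X: "cmb ?m X" "nrm X < d ?m + (1/4)^k" by blast
    have "dd - (1/4)^k \<le> d ?m" using m d_mono[of m ?m] by simp
    then show ?thesis using X by (intro exI[of _ X] exI[of _ ?m]) auto
  qed
  then obtain X m where X: "\<And>k. k \<le> m k" "\<And>k. cmb (m k) (X k)" "\<And>k. nrm (X k) \<le> d (m k) + (1/4)^k" "\<And>k. dd - (1/4)^k \<le> d (m k)"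
    by metis
  \<comment> \<open>Parallelogram identity; the midpoint \<open>?Y\<close> is a competitor for the infimum, which bounds its norm from below.\<close>
  have close: "(\<integral>\<omega>. (W (X (Suc k)) \<omega> - W (X k) \<omega>)\<^sup>2 \<partial>M) \<le> 8 * (1/4)^k" for k
  proof -
    let ?A = "X k" and ?B = "X (Suc k)"
    let ?n = "min (m k) (m (Suc k))"
    let ?Y = "(max (fst ?A) (fst ?B), \<lambda>t. (snd ?A t + snd ?B t) / 2)"
    have ext: "(\<Sum>t<max (fst ?A) (fst ?B). snd Q t * c t) = (\<Sum>t<fst Q. snd Q t * c t)" if "Q = ?A \<or> Q = ?B" for Q c
    proof (rule sum.mono_neutral_right)
      have "cmb (m k) ?A" "cmb (m (Suc k)) ?B" by (rule X(2))+
      then show "\<forall>i\<in>{..<max (fst ?A) (fst ?B)} - {..<fst Q}. snd Q i * c i = 0"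
        using that unfolding cmb_def by (metis DiffD2 lessThan_iff mult_zero_left)
    qed (use that in auto)
    have "cmb ?n ?Y"
    proof -
      have A: "cmb ?n ?A" "cmb ?n ?B" using cmb_mono[OF X(2)] by simp_all
      have "(\<Sum>t<max (fst ?A) (fst ?B). (snd ?A t + snd ?B t) / 2) = ((\<Sum>t<max (fst ?A) (fst ?B). snd ?A t * 1) + (\<Sum>t<max (fst ?A) (fst ?B). snd ?B t * 1)) / 2"
        by (simp add: sum.distrib sum_divide_distrib[symmetric])
      also have "\<dots> = 1" unfolding ext[of ?A, OF disjI1[OF refl]] ext[of ?B, OF disjI2[OF refl]] using A by (simp add: cmb_def)
      finally have "(\<Sum>t<max (fst ?A) (fst ?B). (snd ?A t + snd ?B t) / 2) = 1" .
      moreover have "0 \<le> (snd ?A t + snd ?B t) / 2" for t using A by (simp add: cmb_def)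
      moreover have "t \<in> T \<and> ?n \<le> t \<and> t < max (fst ?A) (fst ?B)" if "(snd ?A t + snd ?B t) / 2 \<noteq> 0" for t
      proof -
        have "snd ?A t \<noteq> 0 \<or> snd ?B t \<noteq> 0" using that by auto
        then show ?thesis using A unfolding cmb_def by (metis less_max_iff_disj)
      qed
      ultimately show ?thesis unfolding cmb_def fst_conv snd_conv by blast
    qed
    note cY = this
    have low: "dd - (1/4)^k \<le> nrm ?Y"
    proof -
      have "(1/4::real)^Suc k \<le> (1/4)^k" by simp
      moreover have "d ?n = d (m k) \<or> d ?n = d (m (Suc k))" by (simp add: min_def)
      ultimately show ?thesis
        using d_le[OF cY] X(4)[of k] X(4)[of "Suc k"] by linarith
    qed
    have WY: "W ?Y \<omega> = (W ?A \<omega> + W ?B \<omega>) / 2" for \<omega>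
    proof -
      have "W ?Y \<omega> = ((\<Sum>t<max (fst ?A) (fst ?B). snd ?A t * Z t \<omega>) + (\<Sum>t<max (fst ?A) (fst ?B). snd ?B t * Z t \<omega>)) / 2"
        unfolding W_def fst_conv snd_conv by (simp add: sum.distrib[symmetric] sum_divide_distrib algebra_simps add_divide_distrib)
      then show ?thesis unfolding ext[of ?A, OF disjI1[OF refl]] ext[of ?B, OF disjI2[OF refl]] W_def .
    qed
    have i2: "integrable M (\<lambda>\<omega>. (W Q \<omega>)\<^sup>2)" for Q using Wi[of Q Q] by (simp add: power2_eq_square)
    have par: "(W ?B \<omega> - W ?A \<omega>)\<^sup>2 = (2 * (W ?A \<omega>)\<^sup>2 + 2 * (W ?B \<omega>)\<^sup>2) - 4 * (W ?Y \<omega>)\<^sup>2" for \<omega>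
      unfolding WY by (simp add: power2_eq_square algebra_simps)
    have "(\<integral>\<omega>. (W ?B \<omega> - W ?A \<omega>)\<^sup>2 \<partial>M) = (\<integral>\<omega>. (2 * (W ?A \<omega>)\<^sup>2 + 2 * (W ?B \<omega>)\<^sup>2) - 4 * (W ?Y \<omega>)\<^sup>2 \<partial>M)"
      by (simp only: par)
    also have "\<dots> = (2 * nrm ?A + 2 * nrm ?B) - 4 * nrm ?Y"
      unfolding nrm_def by (simp only: Bochner_Integration.integral_diff Bochner_Integration.integral_add
          Bochner_Integration.integrable_add integrable_mult_right i2 integral_mult_right_zero)
    also have "\<dots> \<le> (2 * (dd + (1/4)^k) + 2 * (dd + (1/4)^Suc k)) - 4 * (dd - (1/4)^k)"
    proof -
      have h: "nrm (X j) \<le> dd + (1/4)^j" for j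
        by (rule order_trans[OF X(3) add_right_mono[OF dd]])
      show ?thesis
        by (intro diff_mono add_mono mult_left_mono low h) simp_all
    qed
    also have "\<dots> \<le> 8 * (1/4)^k" by simp
    finally show ?thesis .
  qed
  let ?\<Delta> = "\<lambda>k \<omega>. W (X (Suc k)) \<omega> - W (X k) \<omega>"
  \<comment> \<open>By Markov this has probability at most \<open>8 * (1/2) ^ k\<close>, which is summable.\<close>
  let ?E = "\<lambda>k. {\<omega>\<in>space M. (1/2)^k \<le> (?\<Delta> k \<omega>)\<^sup>2}"
  have i\<Delta>: "integrable M (\<lambda>\<omega>. (?\<Delta> k \<omega>)\<^sup>2)" for k
  proof -
    have "(\<lambda>\<omega>. (?\<Delta> k \<omega>)\<^sup>2) = (\<lambda>\<omega>. (W (X (Suc k)) \<omega> * W (X (Suc k)) \<omega> + W (X k) \<omega> * W (X k) \<omega>) - 2 * (W (X (Suc k)) \<omega> * W (X k) \<omega>))"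
      by (rule ext) (simp add: power2_eq_square algebra_simps)
    then show ?thesis by (simp only:) (intro Bochner_Integration.integrable_diff Bochner_Integration.integrable_add integrable_mult_right Wi)
  qed
  have mE: "?E k \<in> events" for k using borel_measurable_integrable[OF i\<Delta>[of k]] by measurable
  have PE: "prob (?E k) \<le> 8 * (1/2)^k" for k
  proof -
    have "(1/2)^k * prob (?E k) \<le> 8 * (1/4)^k"
      using markov[OF i\<Delta>[of k], of "(1/2)^k"] close[of k] by simp
    also have "\<dots> = (1/2)^k * (8 * (1/2)^k)" by (simp add: power_mult_distrib[symmetric])
    finally show ?thesis by simp
  qed
  have summ: "summable (\<lambda>k. prob (?E k))"
  proof (rule summable_comparison_test'[of "\<lambda>k. 8 * (1/2)^k" 0])
    show "summable (\<lambda>k. 8 * (1/2::real)^k)" by (intro summable_mult summable_geometric) simp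
    show "norm (prob (?E k)) \<le> 8 * (1/2)^k" for k using PE[of k] by (simp only: real_norm_def abs_of_nonneg measure_nonneg)
  qed
  have "AE \<omega> in M. \<forall>\<^sub>F k in sequentially. \<omega> \<in> space M - ?E k"
    by (intro borel_cantelli_AE1[OF mE _ summ]) (simp only: emeasure_eq_measure ennreal_less_top infinity_ennreal_def)
  then have conv: "AE \<omega> in M. convergent (\<lambda>k. W (X k) \<omega>)"
  proof (rule AE_mp, intro AE_I2 impI)
    fix \<omega> assume \<omega>: "\<omega> \<in> space M" and ev: "\<forall>\<^sub>F k in sequentially. \<omega> \<in> space M - ?E k"
    have "\<forall>\<^sub>F k in sequentially. norm (?\<Delta> k \<omega>) \<le> (sqrt (1/2))^k"
      using ev
    proof (rule eventually_mono)
      fix k assume "\<omega> \<in> space M - ?E k"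
      then have "(?\<Delta> k \<omega>)\<^sup>2 \<le> (1/2)^k" using \<omega> by auto
      then have "sqrt ((?\<Delta> k \<omega>)\<^sup>2) \<le> sqrt ((1/2)^k)" by (rule real_sqrt_le_mono)
      then show "norm (?\<Delta> k \<omega>) \<le> (sqrt (1/2))^k" unfolding real_sqrt_abs real_norm_def by (simp only: real_sqrt_power)
    qed
    moreover have "summable (\<lambda>k. (sqrt (1/2))^k)" by (intro summable_geometric) (simp add: real_sqrt_divide)
    ultimately have "summable (\<lambda>k. ?\<Delta> k \<omega>)" by (rule summable_comparison_test_ev)
    then have "convergent (\<lambda>n. \<Sum>k<n. ?\<Delta> k \<omega>)" by (simp only: summable_iff_convergent)
    moreover have "(\<Sum>k<n. ?\<Delta> k \<omega>) = W (X n) \<omega> - W (X 0) \<omega>" for n by (rule sum_lessThan_telescope)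
    ultimately have "convergent (\<lambda>n. W (X n) \<omega> - W (X 0) \<omega>)" by simp
    then have "convergent (\<lambda>n. (W (X n) \<omega> - W (X 0) \<omega>) + W (X 0) \<omega>)" by (intro convergent_add convergent_const)
    then show "convergent (\<lambda>k. W (X k) \<omega>)" by simp
  qed
  have "\<forall>n t. snd (X n) t \<noteq> 0 \<longrightarrow> t \<in> T \<and> n \<le> t \<and> t < fst (X n)"
    using X(1,2) unfolding cmb_def by (meson order_trans)
  moreover have "\<forall>n t. 0 \<le> snd (X n) t" "\<forall>n. (\<Sum>t<fst (X n). snd (X n) t) = 1" using X(2) unfolding cmb_def by blast+
  ultimately show ?thesis
    using conv unfolding W_def by (intro exI[of _ "\<lambda>n. fst (X n)"] exI[of _ "\<lambda>n. snd (X n)"]) blast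
qed

section \<open>Automorphism invariance and record times\<close>

context perc
begin

definition shift :: "('a \<Rightarrow> 'a) \<Rightarrow> ('a set \<Rightarrow> bool) \<Rightarrow> 'a set \<Rightarrow> bool" where
  "shift f \<omega> = restrict (\<lambda>e. \<omega> (f ` e)) E"

lemma edge_subset_V: "e \<in> E \<Longrightarrow> e \<subseteq> V" by (auto elim: edgeE)

lemma auto_edge_inj:
  assumes f: "f \<in> automorphisms V E" and "e \<in> E" "e' \<in> E" "f ` e = f ` e'"
  shows "e = e'"
  using inj_on_image_eq_iff[OF auto_inj[OF f] edge_subset_V edge_subset_V] assms by blast

lemma auto_edge_image: "f \<in> automorphisms V E \<Longrightarrow> e \<in> E \<Longrightarrow> f ` e \<in> E"
  using img_E[of f] by (auto simp: img_def)

lemma img_shift: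
  assumes f: "f \<in> automorphisms V E"
  shows "img f (opn (shift f \<omega>)) = opn \<omega>"
proof (intro equalityI subsetI)
  fix e assume "e \<in> img f (opn (shift f \<omega>))"
  then obtain e' where "e = f ` e'" "e' \<in> E" "\<omega> (f ` e')" by (auto simp: img_def open_edges_def shift_def)
  then show "e \<in> opn \<omega>" using auto_edge_image[OF f] by (auto simp: open_edges_def)
next
  fix e assume e: "e \<in> opn \<omega>"
  then have "e \<in> img f E" unfolding img_E[OF f] by (simp add: open_edges_def)
  then obtain e' where "e = f ` e'" "e' \<in> E" unfolding img_def by (rule imageE)
  then have "e' \<in> opn (shift f \<omega>)" using e by (simp add: open_edges_def shift_def)
  then show "e \<in> img f (opn (shift f \<omega>))" using \<open>e = f ` e'\<close> unfolding img_def by blast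
qed

lemma card_bl_shift:
  assumes "f \<in> automorphisms V E" "x \<in> V"
  shows "card (B (shift f \<omega>) x t) = card (B \<omega> (f x) t)"
  using card_bl_img[OF assms(1) opn_subset assms(2), of "shift f \<omega>" t] unfolding img_shift[OF assms(1)] by simp

lemma distr_shift:
  assumes f: "f \<in> automorphisms V E"
  shows "distr M M (shift f) = M"
  unfolding shift_def
proof (rule distr_bits[where blk="\<lambda>e. {f ` e}"])
  fix e assume e: "e \<in> E"
  show "Measurable.pred M (\<lambda>\<omega>. \<omega> (f ` e))" by (rule pred_bits_coord[OF auto_edge_image[OF f e]])
  show "depends (\<lambda>\<omega>. \<omega> (f ` e)) {f ` e}" by (rule dependsI) simp
  show "0 \<le> p \<and> p \<le> 1 \<and> \<P>(\<omega> in M. \<omega> (f ` e)) = p"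
    using p prob_bit[of "f ` e" E "\<lambda>_. p" True, OF auto_edge_image[OF f e] p] by simp
  show "E \<inter> {f ` e} \<inter> {f ` e'} = {}" if "e' \<in> E" "e \<noteq> e'" for e'
    using auto_edge_inj[OF f e that(1)] that(2) by blast
qed

lemma measurable_shift: "f \<in> automorphisms V E \<Longrightarrow> shift f \<in> measurable M M"
  unfolding shift_def by (rule measurable_bits_into) (rule pred_bits_coord[OF auto_edge_image])

lemma prob_shift:
  assumes f: "f \<in> automorphisms V E" and P: "Measurable.pred M P"
  shows "\<P>(\<omega> in M. P (shift f \<omega>)) = \<P>(\<omega> in M. P \<omega>)"
proof -
  have "\<P>(\<omega> in M. P \<omega>) = measure (distr M M (shift f)) {\<omega>\<in>space M. P \<omega>}" by (simp only: distr_shift[OF f])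
  also have "\<dots> = measure M (shift f -` {\<omega>\<in>space M. P \<omega>} \<inter> space M)"
    by (rule measure_distr[OF measurable_shift[OF f] predE[OF P]])
  also have "shift f -` {\<omega>\<in>space M. P \<omega>} \<inter> space M = {\<omega>\<in>space M. P (shift f \<omega>)}"
    using measurable_space[OF measurable_shift[OF f]] by blast
  finally show ?thesis by simp
qed

lemma EB_auto:
  assumes f: "f \<in> automorphisms V E" and x: "x \<in> V"
  shows "EB (f x) t = EB x t"
proof -
  have "EB x t = (\<integral>\<omega>. real (card (B \<omega> x t)) \<partial>(distr M M (shift f)))" by (simp only: distr_shift[OF f] EB_def)
  also have "\<dots> = (\<integral>\<omega>. real (card (B (shift f \<omega>) x t)) \<partial>M)"
    by (rule integral_distr[OF measurable_shift[OF f] borel_measurable_integrable[OF integrable_card_B[OF x]]])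
  also have "\<dots> = EB (f x) t" unfolding card_bl_shift[OF f x] EB_def ..
  finally show ?thesis by simp
qed

text \<open>For \<open>a t = ln (Gr t) - \<gamma> t\<close>, which is nonnegative, this says that no earlier value of
  \<open>a\<close> exceeds \<open>a t\<close> by more than \<open>ln C\<close>.\<close>
definition is_record :: "real \<Rightarrow> nat \<Rightarrow> bool" where
  "is_record C t \<longleftrightarrow> (\<forall>s\<le>t. Gr V E p s \<le> C * exp (- \<gamma> * real (t - s)) * Gr V E p t)"

lemma infinitely_many_records: "\<exists>C\<ge>1. \<forall>N. \<exists>t\<ge>N. is_record C t"
proof -
  have pos: "0 < Gr V E p t" for t using Gr_ge_1[of t] by linarith
  define a where "a t = ln (Gr V E p t) - \<gamma> * real t" for t
  have "0 \<le> a t" for t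
  proof -
    have "ln (exp (\<gamma> * real t)) \<le> ln (Gr V E p t)" using gamma_facts(3)[of t] by (intro ln_mono) simp_all
    then show ?thesis by (simp add: a_def)
  qed
  then obtain b where b: "0 \<le> b" "\<forall>N. \<exists>t\<ge>N. \<forall>s\<le>t. a s \<le> a t + b" using records[of a] by blast
  have Ga: "Gr V E p t = exp (a t + \<gamma> * real t)" for t using pos[of t] by (simp add: a_def)
  have "is_record (exp b) t" if "\<forall>s\<le>t. a s \<le> a t + b" for t
    unfolding is_record_def
  proof (intro allI impI)
    fix s assume s: "s \<le> t"
    have "Gr V E p s \<le> exp ((a t + b) + \<gamma> * real s)" unfolding Ga[of s] using that s by simp
    also have "\<dots> = exp (b + (- \<gamma> * real (t - s)) + (a t + \<gamma> * real t))"
      using s by (simp add: of_nat_diff algebra_simps)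
    also have "\<dots> = exp b * exp (- \<gamma> * real (t - s)) * Gr V E p t" unfolding Ga[of t] exp_add ..
    finally show "Gr V E p s \<le> exp b * exp (- \<gamma> * real (t - s)) * Gr V E p t" .
  qed
  then show ?thesis using b by (intro exI[of _ "exp b"]) (auto, blast)
qed

definition Z :: "nat \<Rightarrow> 'a \<Rightarrow> ('a set \<Rightarrow> bool) \<Rightarrow> real" where
  "Z t x \<omega> = real (card (B \<omega> x t)) / Gr V E p t"

text \<open>At a record, the sum in \<open>second_moment\<close> is dominated by a geometric series.\<close>
lemma Z_second_moment:
  assumes \<gamma>: "0 < \<gamma>" and r: "is_record C t" and C: "0 \<le> C" and x: "x \<in> V"
  shows "(\<integral>\<omega>. (Z t x \<omega>)\<^sup>2 \<partial>M) \<le> C / (1 - exp (- \<gamma>))"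
proof -
  have G: "0 < Gr V E p t" using Gr_ge_1[of t] by linarith
  have e: "0 < exp (- \<gamma>)" "exp (- \<gamma>) < 1" using \<gamma> by simp_all
  have "(\<Sum>k\<le>t. Gr V E p (t - k)) \<le> (\<Sum>k\<le>t. C * Gr V E p t * exp (- \<gamma>) ^ k)"
  proof (rule sum_mono)
    fix k assume "k \<in> {..t}"
    have "Gr V E p (t - k) \<le> C * exp (- \<gamma> * real (t - (t - k))) * Gr V E p t"
      by (rule r[unfolded is_record_def, rule_format]) simp
    also have "exp (- \<gamma> * real (t - (t - k))) = exp (- \<gamma>) ^ k"
      using \<open>k \<in> {..t}\<close> by (simp add: exp_of_nat_mult[symmetric] mult.commute)
    finally show "Gr V E p (t - k) \<le> C * Gr V E p t * exp (- \<gamma>) ^ k" by (simp add: mult_ac)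
  qed
  also have "\<dots> = C * Gr V E p t * (\<Sum>k\<le>t. exp (- \<gamma>) ^ k)" by (rule sum_distrib_left[symmetric])
  also have "\<dots> \<le> C * Gr V E p t * (1 / (1 - exp (- \<gamma>)))"
  proof (rule mult_left_mono)
    have "(\<Sum>k\<le>t. exp (- \<gamma>) ^ k) \<le> (\<Sum>k. exp (- \<gamma>) ^ k)"
      using e by (intro sum_le_suminf summable_geometric) auto
    also have "\<dots> = 1 / (1 - exp (- \<gamma>))" using e by (intro suminf_geometric) auto
    finally show "(\<Sum>k\<le>t. exp (- \<gamma>) ^ k) \<le> 1 / (1 - exp (- \<gamma>))" .
  qed (use C G in simp)
  finally have S: "(\<Sum>k\<le>t. Gr V E p (t - k)) \<le> C * Gr V E p t * (1 / (1 - exp (- \<gamma>)))" .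
  have "(\<integral>\<omega>. (Z t x \<omega>)\<^sup>2 \<partial>M) = (\<integral>\<omega>. (real (card (B \<omega> x t)))\<^sup>2 / (Gr V E p t)\<^sup>2 \<partial>M)"
    unfolding Z_def power_divide ..
  also have "\<dots> = (\<integral>\<omega>. (real (card (B \<omega> x t)))\<^sup>2 \<partial>M) / (Gr V E p t)\<^sup>2" by (rule integral_divide_zero)
  also have "\<dots> \<le> (Gr V E p t * (C * Gr V E p t * (1 / (1 - exp (- \<gamma>))))) / (Gr V E p t)\<^sup>2"
    by (intro divide_right_mono order_trans[OF second_moment[OF x]] mult_left_mono S) (use G in auto)
  also have "\<dots> = C / (1 - exp (- \<gamma>))" using G by (simp add: power2_eq_square)
  finally show ?thesis .
qed

lemma Z_nonneg: "0 \<le> Z t x \<omega>"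
  unfolding Z_def using Gr_ge_1[of t] by simp

lemma integrable_Z_mult: "x \<in> V \<Longrightarrow> integrable M (\<lambda>\<omega>. Z s x \<omega> * Z t x \<omega>)"
proof (rule integrable_near[of x "max s t"])
  fix \<omega> \<omega>' :: "'a set \<Rightarrow> bool" assume a: "\<And>e. e \<in> near x (max s t) \<Longrightarrow> \<omega> e = \<omega>' e"
  have "B \<omega> x s = B \<omega>' x s" "B \<omega> x t = B \<omega>' x t" by (rule bl_depends[OF a], assumption, simp)+
  then show "Z s x \<omega> * Z t x \<omega> = Z s x \<omega>' * Z t x \<omega>'" by (simp only: Z_def)
qed

lemma integrable_Z: "x \<in> V \<Longrightarrow> integrable M (Z t x)"
  unfolding Z_def using integrable_card_B by (intro integrable_divide) auto

text \<open>At every time some vertex has expected ball size at least \<open>Gr t / 2\<close>, and by invariance it may be taken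
  from a finite set of orbit representatives; one representative serves infinitely many records.\<close>
lemma good_root:
  "\<exists>C\<ge>1. \<exists>y\<in>V. infinite {t. is_record C t \<and> 1/2 \<le> (\<integral>\<omega>. Z t y \<omega> \<partial>M)}"
proof -
  obtain C where C: "1 \<le> C" "\<forall>N. \<exists>t\<ge>N. is_record C t" using infinitely_many_records by blast
  obtain R where R: "finite R" "R \<subseteq> V" "\<forall>x\<in>V. \<exists>y\<in>R. \<exists>f\<in>automorphisms V E. f y = x"
    using representatives by (elim exE conjE)
  have Zint: "(\<integral>\<omega>. Z t y \<omega> \<partial>M) = EB y t / Gr V E p t" for t y unfolding Z_def EB_def by (rule integral_divide_zero)
  have ex: "\<exists>y\<in>R. 1/2 \<le> (\<integral>\<omega>. Z t y \<omega> \<partial>M)" for t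
  proof -
    have G: "0 < Gr V E p t" using Gr_ge_1[of t] by linarith
    then have "Gr V E p t / 2 < (SUP x\<in>V. EB x t)" unfolding Gr_eq[symmetric] by simp
    then obtain x where x: "x \<in> V" "Gr V E p t / 2 < EB x t"
      by (subst (asm) less_cSUP_iff) (auto simp: V_ne intro!: bdd_aboveI2[of _ _ "real (D ^ t)"] EB_le)
    obtain y f where yf: "y \<in> R" "f \<in> automorphisms V E" "f y = x" using bspec[OF R(3) x(1)] by (elim bexE)
    have "y \<in> V" using yf(1) R(2) by blast
    then have "EB x t = EB y t" using EB_auto[OF yf(2), of y t] yf(3) by simp
    then show ?thesis using x(2) G yf(1) unfolding Zint by (intro bexI[of _ y]) (simp_all add: field_simps)
  qed
  let ?T = "\<lambda>y. {t. is_record C t \<and> 1/2 \<le> (\<integral>\<omega>. Z t y \<omega> \<partial>M)}"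
  have "infinite {t. is_record C t}" unfolding infinite_nat_iff_unbounded_le using C(2) by blast
  moreover have "{t. is_record C t} \<subseteq> (\<Union>y\<in>R. ?T y)" using ex by blast
  ultimately have "infinite (\<Union>y\<in>R. ?T y)" using finite_subset by blast
  then obtain y where "y \<in> R" "infinite (?T y)" using R(1) by blast
  then show ?thesis using C(1) R(2) by (intro exI[of _ C]) auto
qed

end

section \<open>Weighted growth\<close>

text \<open>Weights for averages of ball sizes. The main instance weights the ball of radius \<open>t\<close> by a coefficient
  of a convex combination, divided by \<open>Gr t\<close>; its total weight tends to zero because
  \<open>Gr t\<close> tends to infinity when \<open>\<gamma> > 0\<close>. As a consequence, bounded contributions to
  ball sizes are invisible.\<close>
locale growth_weights =
  fixes N :: "nat \<Rightarrow> nat" and H :: "nat \<Rightarrow> nat \<Rightarrow> real"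
  assumes H_nonneg: "0 \<le> H n t" and H_sum: "(\<lambda>n. \<Sum>t<N n. H n t) \<longlonglongrightarrow> 0"

text \<open>The averages do not tend to zero. An upper limit is used because it is positive for a finite sum of nonnegative
  sequences only if it is positive for one of the summands.\<close>
definition grows :: "(nat \<Rightarrow> nat) \<Rightarrow> (nat \<Rightarrow> nat \<Rightarrow> real) \<Rightarrow> 'a set set \<Rightarrow> 'a \<Rightarrow> bool" where
  "grows N H K x \<longleftrightarrow> (\<exists>c>0. \<forall>m. \<exists>n\<ge>m. c \<le> (\<Sum>t<N n. H n t * real (card (bl K x t))))"

lemma square_of_average_le:
  fixes l a :: "nat \<Rightarrow> real"
  assumes "\<And>t. 0 \<le> l t" "(\<Sum>t<n. l t) = 1"
  shows "(\<Sum>t<n. l t * a t)\<^sup>2 \<le> (\<Sum>t<n. l t * (a t)\<^sup>2)"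
proof -
  define m where "m = (\<Sum>t<n. l t * a t)"
  have "0 \<le> (\<Sum>t<n. l t * (a t - m)\<^sup>2)" using assms(1) by (intro sum_nonneg) simp
  also have "\<dots> = (\<Sum>t<n. l t * (a t)\<^sup>2) - 2 * m * (\<Sum>t<n. l t * a t) + m\<^sup>2 * (\<Sum>t<n. l t)"
    by (simp add: power2_eq_square algebra_simps sum.distrib sum_subtractf sum_distrib_left)
  also have "\<dots> = (\<Sum>t<n. l t * (a t)\<^sup>2) - m\<^sup>2" unfolding assms(2) m_def[symmetric] by (simp add: power2_eq_square)
  finally show ?thesis by (simp add: m_def)
qed

text \<open>Paley--Zygmund, from the pointwise bound \<open>f \<le> 1/4 + f\<^sup>2 / (8 C) + 2 C\<close>, whose last term is
  needed only where \<open>f \<ge> 1/4\<close>.\<close>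
lemma (in prob_space) paley_zygmund:
  fixes f :: "'a \<Rightarrow> real"
  assumes i: "integrable M f" "integrable M (\<lambda>\<omega>. (f \<omega>)\<^sup>2)" and C: "0 < C"
    and m: "1/2 \<le> (\<integral>\<omega>. f \<omega> \<partial>M)" "(\<integral>\<omega>. (f \<omega>)\<^sup>2 \<partial>M) \<le> C"
  shows "1 / (16 * C) \<le> \<P>(\<omega> in M. 1/4 \<le> f \<omega>)"
proof -
  have mp: "Measurable.pred M (\<lambda>\<omega>. 1/4 \<le> f \<omega>)" using borel_measurable_integrable[OF i(1)] by measurable
  have ib: "integrable M (\<lambda>\<omega>. of_bool (1/4 \<le> f \<omega>) :: real)"
  proof (rule integrable_const_bound[of _ 1])
    show "(\<lambda>\<omega>. of_bool (1/4 \<le> f \<omega>) :: real) \<in> borel_measurable M" by (rule measurable_compose[OF mp]) simp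
  qed simp
  have pw: "f \<omega> \<le> (1/4 + (f \<omega>)\<^sup>2 / (8 * C)) + 2 * C * of_bool (1/4 \<le> f \<omega>)" for \<omega>
  proof (cases "1/4 \<le> f \<omega>")
    case True
    have "0 \<le> (f \<omega> - 4 * C)\<^sup>2 / (8 * C)" using C by simp
    also have "\<dots> = (f \<omega>)\<^sup>2 / (8 * C) - f \<omega> + 2 * C" using C by (simp add: power2_eq_square field_simps)
    finally show ?thesis using True by simp
  next
    case False
    have "0 \<le> (f \<omega>)\<^sup>2 / (8 * C)" using C by simp
    then show ?thesis using False by simp
  qed
  have i': "integrable M (\<lambda>\<omega>. 1/4 + (f \<omega>)\<^sup>2 / (8 * C))" using i(2) by simp
  have i'': "integrable M (\<lambda>\<omega>. 2 * C * of_bool (1/4 \<le> f \<omega>))" using ib by (intro integrable_mult_right)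
  have "1/2 \<le> (\<integral>\<omega>. (1/4 + (f \<omega>)\<^sup>2 / (8 * C)) + 2 * C * of_bool (1/4 \<le> f \<omega>) \<partial>M)"
    by (rule order_trans[OF m(1)], rule integral_mono[OF i(1) Bochner_Integration.integrable_add[OF i' i''] pw])
  also have "\<dots> = (\<integral>\<omega>. 1/4 + (f \<omega>)\<^sup>2 / (8 * C) \<partial>M) + (\<integral>\<omega>. 2 * C * of_bool (1/4 \<le> f \<omega>) \<partial>M)"
    by (rule Bochner_Integration.integral_add[OF i' i''])
  also have "(\<integral>\<omega>. 1/4 + (f \<omega>)\<^sup>2 / (8 * C) \<partial>M) = 1/4 + (\<integral>\<omega>. (f \<omega>)\<^sup>2 \<partial>M) / (8 * C)"
    using i(2) by (simp add: prob_space)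
  also have "(\<integral>\<omega>. 2 * C * of_bool (1/4 \<le> f \<omega>) \<partial>M) = 2 * C * \<P>(\<omega> in M. 1/4 \<le> f \<omega>)"
    unfolding integral_mult_right_zero integral_of_bool[OF mp] ..
  also have "(\<integral>\<omega>. (f \<omega>)\<^sup>2 \<partial>M) / (8 * C) \<le> 1/8" using m(2) C by (simp add: field_simps)
  finally have "1/8 \<le> 2 * C * \<P>(\<omega> in M. 1/4 \<le> f \<omega>)" by simp
  then show ?thesis using C by (simp add: field_simps)
qed

lemma (in prob_space) prob_infinitely_often_ge:
  fixes A :: "nat \<Rightarrow> 'a \<Rightarrow> bool"
  assumes m: "\<And>n. Measurable.pred M (A n)" and c: "\<And>n. c \<le> \<P>(\<omega> in M. A n \<omega>)"
  shows "c \<le> \<P>(\<omega> in M. \<forall>m. \<exists>n\<ge>m. A n \<omega>)"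
proof -
  let ?U = "\<lambda>m. {\<omega>\<in>space M. \<exists>n\<ge>m. A n \<omega>}"
  have mU: "?U m \<in> events" for m
    by (rule predE) (intro pred_intros_countable pred_intros_logic m measurable_const; simp)
  have "(\<lambda>m. prob (?U m)) \<longlonglongrightarrow> prob (\<Inter>m. ?U m)"
  proof (rule finite_Lim_measure_decseq)
    show "range ?U \<subseteq> events" by (intro image_subsetI mU)
    show "decseq ?U" unfolding decseq_def by (blast intro: order_trans)
  qed
  moreover have "c \<le> prob (?U m)" for m
    by (rule order_trans[OF c[of m]], rule finite_measure_mono[OF _ mU]) blast
  ultimately have "c \<le> prob (\<Inter>m. ?U m)" by (intro LIMSEQ_le_const) blast+
  also have "(\<Inter>m. ?U m) = {\<omega>\<in>space M. \<forall>m. \<exists>n\<ge>m. A n \<omega>}" by blast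
  finally show ?thesis .
qed

section \<open>Thin spheres\<close>

context perc
begin

text \<open>Sphere sizes as functions of the history.\<close>
definition sz :: "(nat \<Rightarrow> 'a set) \<Rightarrow> nat \<Rightarrow> nat" where "sz h i = card (h i - (\<Union>j<i. h j))"

lemma sz_hist: "i \<le> r \<Longrightarrow> sz (hist \<omega> x r) i = card (sph (opn \<omega>) x i)"
  unfolding sz_def hist_def sph_def inn_def by (intro arg_cong[where f=card]) auto

text \<open>The radius \<open>r\<close> is the first at which the sphere is thin, so that these events are disjoint for
  different \<open>r\<close>.\<close>
definition thin :: "real \<Rightarrow> nat \<Rightarrow> (nat \<Rightarrow> 'a set) \<Rightarrow> bool" where
  "thin \<epsilon> r h \<longleftrightarrow> real (sz h r) < \<epsilon> * exp (\<gamma> * real r) \<and> (\<forall>i<r. \<not> real (sz h i) < \<epsilon> * exp (\<gamma> * real i))"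

lemma thin_hist: "thin \<epsilon> r (hist \<omega> x r) \<longleftrightarrow> real (card (sph (opn \<omega>) x r)) < \<epsilon> * exp (\<gamma> * real r)
    \<and> (\<forall>i<r. \<not> real (card (sph (opn \<omega>) x i)) < \<epsilon> * exp (\<gamma> * real i))"
  by (simp add: thin_def sz_hist)

lemma pred_hist: "x \<in> V \<Longrightarrow> Measurable.pred M (\<lambda>\<omega>. Q (hist \<omega> x r))"
proof (rule pred_finite_depends[OF finite_near near_subset])
  show "depends (\<lambda>\<omega>. Q (hist \<omega> x r)) (near x r)"
  proof (rule dependsI)
    fix \<omega> \<omega>' :: "'a set \<Rightarrow> bool" assume "\<And>e. e \<in> near x r \<Longrightarrow> \<omega> e = \<omega>' e"
    then have "hist \<omega> x r = hist \<omega>' x r" by (rule hist_near)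
    then show "Q (hist \<omega> x r) = Q (hist \<omega>' x r)" by (simp only:)
  qed
qed

text \<open>Exploring up to the thin sphere and using the record property: the sphere has at most
  \<open>\<epsilon> exp (\<gamma> r)\<close> vertices, and each contributes at most
  \<open>Gr (t - r) / Gr t \<le> C exp (- \<gamma> r)\<close>. The inside of the ball contributes a term that
  vanishes as \<open>t\<close> grows.\<close>
lemma thin_expectation:
  assumes x: "x \<in> V" and rec: "is_record C t" and rt: "r \<le> t" and C: "0 \<le> C" and \<epsilon>: "0 \<le> \<epsilon>"
  shows "(\<integral>\<omega>. of_bool (thin \<epsilon> r (hist \<omega> x r)) * Z t x \<omega> \<partial>M)
    \<le> real (D ^ r) * exp (- \<gamma> * real t) + \<epsilon> * C * \<P>(\<omega> in M. thin \<epsilon> r (hist \<omega> x r))"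
proof -
  let ?h = "\<lambda>\<omega>. of_bool (thin \<epsilon> r (hist \<omega> x r)) :: real"
  let ?P = "\<P>(\<omega> in M. thin \<epsilon> r (hist \<omega> x r))"
  have G: "0 < Gr V E p t" using Gr_ge_1[of t] by linarith
  have mh: "Measurable.pred M (\<lambda>\<omega>. thin \<epsilon> r (hist \<omega> x r))" by (rule pred_hist[OF x])
  have ih: "integrable M ?h" by (rule integrable_of_bool[OF mh])
  have mult: "integrable M (\<lambda>\<omega>. ?h \<omega> * real (card (F (hist \<omega> x r))))" for F :: "(nat \<Rightarrow> 'a set) \<Rightarrow> 'a set"
  proof (rule integrable_near[OF x, of r])
    fix \<omega> \<omega>' :: "'a set \<Rightarrow> bool" assume "\<And>e. e \<in> near x r \<Longrightarrow> \<omega> e = \<omega>' e"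
    then have "hist \<omega> x r = hist \<omega>' x r" by (rule hist_near)
    then show "?h \<omega> * real (card (F (hist \<omega> x r))) = ?h \<omega>' * real (card (F (hist \<omega>' x r)))" by (simp only:)
  qed
  have 1: "(\<integral>\<omega>. ?h \<omega> * real (card (inn (opn \<omega>) x r)) \<partial>M) \<le> real (D ^ r)"
  proof -
    have i1: "integrable M (\<lambda>\<omega>. ?h \<omega> * real (card (inn (opn \<omega>) x r)))" unfolding hist_inn by (rule mult)
    have le: "?h \<omega> * real (card (inn (opn \<omega>) x r)) \<le> real (D ^ r)" for \<omega>
    proof -
      have "card (inn (opn \<omega>) x r) \<le> card (B \<omega> x r)"
        by (intro card_mono finite_bl[OF opn_subset x] inn_subset_bl)
      also have "\<dots> \<le> D ^ r" by (rule card_bl_le[OF opn_subset x])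
      finally have "real (card (inn (opn \<omega>) x r)) \<le> real (D ^ r)" by (simp only: of_nat_le_iff)
      then show ?thesis by (simp add: of_bool_def)
    qed
    have "(\<integral>\<omega>. ?h \<omega> * real (card (inn (opn \<omega>) x r)) \<partial>M) \<le> (\<integral>\<omega>. real (D ^ r) \<partial>M)"
      by (rule integral_mono[OF i1 integrable_const le])
    then show ?thesis by (simp add: prob_space)
  qed
  have 2: "(\<integral>\<omega>. ?h \<omega> * real (card (sph (opn \<omega>) x r)) \<partial>M) \<le> \<epsilon> * exp (\<gamma> * real r) * ?P"
  proof -
    have i2: "integrable M (\<lambda>\<omega>. ?h \<omega> * real (card (sph (opn \<omega>) x r)))" unfolding hist_sph by (rule mult)
    have le: "?h \<omega> * real (card (sph (opn \<omega>) x r)) \<le> \<epsilon> * exp (\<gamma> * real r) * ?h \<omega>" for \<omega>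
      by (auto simp: of_bool_def thin_hist)
    have "(\<integral>\<omega>. ?h \<omega> * real (card (sph (opn \<omega>) x r)) \<partial>M) \<le> (\<integral>\<omega>. \<epsilon> * exp (\<gamma> * real r) * ?h \<omega> \<partial>M)"
      by (rule integral_mono[OF i2 integrable_mult_right le]) (rule ih)
    also have "\<dots> = \<epsilon> * exp (\<gamma> * real r) * ?P" unfolding integral_mult_right_zero integral_of_bool[OF mh] ..
    finally show ?thesis .
  qed
  have "(\<integral>\<omega>. ?h \<omega> * real (card (B \<omega> x t)) \<partial>M)
     \<le> (\<integral>\<omega>. ?h \<omega> * real (card (inn (opn \<omega>) x r)) \<partial>M) + (\<integral>\<omega>. ?h \<omega> * real (card (sph (opn \<omega>) x r)) \<partial>M) * Gr V E p (t - r)"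
    using exploration_bound[OF x, of "thin \<epsilon> r" r "t - r"] rt by simp
  also have "\<dots> \<le> real (D ^ r) + (\<epsilon> * exp (\<gamma> * real r) * ?P) * (C * exp (- \<gamma> * real r) * Gr V E p t)"
  proof (rule add_mono[OF 1 mult_mono[OF 2]])
    have "Gr V E p (t - r) \<le> C * exp (- \<gamma> * real (t - (t - r))) * Gr V E p t"
      by (rule rec[unfolded is_record_def, rule_format]) simp
    then show "Gr V E p (t - r) \<le> C * exp (- \<gamma> * real r) * Gr V E p t" using rt by (simp only: diff_diff_cancel)
    show "0 \<le> Gr V E p (t - r)" using Gr_ge_1[of "t - r"] by linarith
  qed (use \<epsilon> in simp)
  also have "(\<epsilon> * exp (\<gamma> * real r) * ?P) * (C * exp (- \<gamma> * real r) * Gr V E p t)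
     = (\<epsilon> * C * ?P * Gr V E p t) * (exp (\<gamma> * real r) * exp (- \<gamma> * real r))" by (simp only: mult_ac)
  also have "exp (\<gamma> * real r) * exp (- \<gamma> * real r) = 1" by (simp add: exp_add[symmetric])
  finally have *: "(\<integral>\<omega>. ?h \<omega> * real (card (B \<omega> x t)) \<partial>M) \<le> real (D ^ r) + \<epsilon> * C * ?P * Gr V E p t" by simp
  have "(\<integral>\<omega>. ?h \<omega> * Z t x \<omega> \<partial>M) = (\<integral>\<omega>. ?h \<omega> * real (card (B \<omega> x t)) \<partial>M) / Gr V E p t"
    unfolding Z_def times_divide_eq_right by (rule integral_divide_zero)
  also have "\<dots> \<le> (real (D ^ r) + \<epsilon> * C * ?P * Gr V E p t) / Gr V E p t" by (rule divide_right_mono[OF *]) (use G in simp)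
  also have "\<dots> = real (D ^ r) * (1 / Gr V E p t) + \<epsilon> * C * ?P" using G by (simp add: field_simps)
  also have "\<dots> \<le> real (D ^ r) * exp (- \<gamma> * real t) + \<epsilon> * C * ?P"
  proof (intro add_right_mono mult_left_mono)
    have "1 / Gr V E p t \<le> 1 / exp (\<gamma> * real t)" using gamma_facts(3)[of t] G by (intro divide_left_mono) auto
    then show "1 / Gr V E p t \<le> exp (- \<gamma> * real t)" by (simp add: exp_minus field_simps)
  qed simp
  finally show ?thesis .
qed

end

context perc
begin

lemma exists_thin_iff:
  "(\<exists>r. thin \<epsilon> r (hist \<omega> x r)) \<longleftrightarrow> (\<exists>r. real (card (sph (opn \<omega>) x r)) < \<epsilon> * exp (\<gamma> * real r))"
proof
  let ?Q = "\<lambda>r. real (card (sph (opn \<omega>) x r)) < \<epsilon> * exp (\<gamma> * real r)"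
  assume "\<exists>r. ?Q r"
  then have "?Q (LEAST r. ?Q r)" by (rule LeastI_ex)
  moreover have "\<not> ?Q i" if "i < (LEAST r. ?Q r)" for i using not_less_Least[OF that] .
  ultimately show "\<exists>r. thin \<epsilon> r (hist \<omega> x r)" unfolding thin_hist by blast
qed (auto simp: thin_hist)

text \<open>Sum \<open>thin_expectation\<close> over the disjoint events that the first thin radius is \<open>r \<le> R\<close>
  and average over \<open>t\<close>. On the event in question \<open>W n\<close> is at least
  \<open>\<delta>\<close>, so letting first \<open>n\<close> and then \<open>R\<close> tend to infinity gives the
  bound.\<close>
lemma thin_while_average_large:
  fixes l :: "nat \<Rightarrow> nat \<Rightarrow> real" and N :: "nat \<Rightarrow> nat"
  assumes x: "x \<in> V" and \<gamma>: "0 < \<gamma>" and C: "0 \<le> C" and \<epsilon>: "0 \<le> \<epsilon>" and \<delta>: "0 < \<delta>"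
    and l: "\<And>n t. 0 \<le> l n t" "\<And>n t. l n t \<noteq> 0 \<Longrightarrow> is_record C t \<and> n \<le> t" "\<And>n. (\<Sum>t<N n. l n t) = 1"
  defines "W n \<omega> \<equiv> \<Sum>t<N n. l n t * Z t x \<omega>"
  shows "\<delta> * \<P>(\<omega> in M. (\<exists>n0. \<forall>n\<ge>n0. \<delta> \<le> W n \<omega>) \<and> (\<exists>r. thin \<epsilon> r (hist \<omega> x r))) \<le> \<epsilon> * C"
proof -
  let ?h = "\<lambda>r \<omega>. thin \<epsilon> r (hist \<omega> x r)"
  have mh: "Measurable.pred M (?h r)" for r by (rule pred_hist[OF x])
  have iZ: "integrable M (Z t x)" for t by (rule integrable_Z[OF x])
  have iW: "integrable M (W n)" for n unfolding W_def by (intro Bochner_Integration.integrable_sum integrable_mult_right iZ)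
  have W0: "0 \<le> W n \<omega>" for n \<omega> unfolding W_def by (intro sum_nonneg mult_nonneg_nonneg l(1) Z_nonneg)
  have mW: "Measurable.pred M (\<lambda>\<omega>. \<delta> \<le> W n \<omega>)" for n using borel_measurable_integrable[OF iW] by measurable
  have ihZ: "integrable M (\<lambda>\<omega>. of_bool (?h r \<omega>) * Z t x \<omega>)" for r t
  proof (rule integrable_near[OF x, of "max r t"])
    fix \<omega> \<omega>' :: "'a set \<Rightarrow> bool" assume a: "\<And>e. e \<in> near x (max r t) \<Longrightarrow> \<omega> e = \<omega>' e"
    have "B \<omega> x t = B \<omega>' x t" by (rule bl_depends[OF a max.cobounded2])
    moreover have "hist \<omega> x r = hist \<omega>' x r" by (rule hist_near, rule a) (use near_mono[of r "max r t" x] in auto)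
    ultimately show "of_bool (?h r \<omega>) * Z t x \<omega> = of_bool (?h r \<omega>') * Z t x \<omega>'" by (simp only: Z_def)
  qed
  let ?S = "\<lambda>R. {\<omega>\<in>space M. (\<forall>n\<ge>R. \<delta> \<le> W n \<omega>) \<and> (\<exists>r\<in>{..R}. ?h r \<omega>)}"
  have mS: "Measurable.pred M (\<lambda>\<omega>. (\<forall>n\<ge>R. \<delta> \<le> W n \<omega>) \<and> (\<exists>r\<in>{..R}. ?h r \<omega>))" for R
  proof (rule pred_intros_logic(3))
    have "Measurable.pred M (\<lambda>\<omega>. \<forall>n\<in>{R..}. \<delta> \<le> W n \<omega>)" by (rule pred_ball_countable) (simp_all add: mW)
    then show "Measurable.pred M (\<lambda>\<omega>. \<forall>n\<ge>R. \<delta> \<le> W n \<omega>)" by (simp only: Ball_def atLeast_iff)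
    show "Measurable.pred M (\<lambda>\<omega>. \<exists>r\<in>{..R}. ?h r \<omega>)" by (rule pred_intros_finite(4)) (simp_all only: finite_atMost mh)
  qed
  \<comment> \<open>Integrate \<open>\<delta> \<le> W n\<close> over the event; for \<open>n \<ge> R\<close> all times \<open>t\<close> in the average are at least the thin radius.\<close>
  have bound: "\<delta> * prob (?S R) \<le> (\<Sum>r\<le>R. real (D ^ r)) * exp (- \<gamma> * real n) + \<epsilon> * C" if n: "R \<le> n" for R n
  proof -
    have "\<delta> * prob (?S R) = (\<integral>\<omega>. \<delta> * of_bool ((\<forall>n\<ge>R. \<delta> \<le> W n \<omega>) \<and> (\<exists>r\<in>{..R}. ?h r \<omega>)) \<partial>M)"
      unfolding integral_mult_right_zero integral_of_bool[OF mS] ..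
    also have "\<dots> \<le> (\<integral>\<omega>. (\<Sum>r\<le>R. \<Sum>t<N n. l n t * (of_bool (?h r \<omega>) * Z t x \<omega>)) \<partial>M)"
    proof (rule integral_mono)
      show "integrable M (\<lambda>\<omega>. \<delta> * of_bool ((\<forall>n\<ge>R. \<delta> \<le> W n \<omega>) \<and> (\<exists>r\<in>{..R}. ?h r \<omega>)))"
        by (intro integrable_mult_right integrable_of_bool mS)
      show "integrable M (\<lambda>\<omega>. \<Sum>r\<le>R. \<Sum>t<N n. l n t * (of_bool (?h r \<omega>) * Z t x \<omega>))"
        by (intro Bochner_Integration.integrable_sum integrable_mult_right ihZ)
      fix \<omega>
      have eq: "(\<Sum>t<N n. l n t * (of_bool (?h r \<omega>) * Z t x \<omega>)) = of_bool (?h r \<omega>) * W n \<omega>" for r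
        unfolding W_def sum_distrib_left by (intro sum.cong refl) (simp only: mult_ac)
      show "\<delta> * of_bool ((\<forall>n\<ge>R. \<delta> \<le> W n \<omega>) \<and> (\<exists>r\<in>{..R}. ?h r \<omega>)) \<le> (\<Sum>r\<le>R. \<Sum>t<N n. l n t * (of_bool (?h r \<omega>) * Z t x \<omega>))"
      proof (cases "(\<forall>n\<ge>R. \<delta> \<le> W n \<omega>) \<and> (\<exists>r\<in>{..R}. ?h r \<omega>)")
        case True
        then obtain r where r: "r \<in> {..R}" "?h r \<omega>" and "\<delta> \<le> W n \<omega>" using n by blast
        then have "\<delta> \<le> of_bool (?h r \<omega>) * W n \<omega>" by simp
        also have "\<dots> \<le> (\<Sum>r\<le>R. of_bool (?h r \<omega>) * W n \<omega>)"
          by (rule member_le_sum[OF r(1)]) (simp_all add: W0)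
        finally show ?thesis unfolding eq using True by simp
      next
        case False
        then have "\<delta> * of_bool ((\<forall>n\<ge>R. \<delta> \<le> W n \<omega>) \<and> (\<exists>r\<in>{..R}. ?h r \<omega>)) = 0" by simp
        also have "0 \<le> (\<Sum>r\<le>R. of_bool (?h r \<omega>) * W n \<omega>)" by (intro sum_nonneg mult_nonneg_nonneg W0) simp
        finally show ?thesis unfolding eq .
      qed
    qed
    also have "\<dots> = (\<Sum>r\<le>R. \<Sum>t<N n. l n t * (\<integral>\<omega>. of_bool (?h r \<omega>) * Z t x \<omega> \<partial>M))"
    proof -
      have i: "integrable M (\<lambda>\<omega>. l n t * (of_bool (?h r \<omega>) * Z t x \<omega>))" for r t by (intro integrable_mult_right ihZ)
      have "(\<integral>\<omega>. (\<Sum>r\<le>R. \<Sum>t<N n. l n t * (of_bool (?h r \<omega>) * Z t x \<omega>)) \<partial>M)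
        = (\<Sum>r\<le>R. (\<integral>\<omega>. (\<Sum>t<N n. l n t * (of_bool (?h r \<omega>) * Z t x \<omega>)) \<partial>M))"
        by (rule Bochner_Integration.integral_sum) (intro Bochner_Integration.integrable_sum i)
      also have "\<dots> = (\<Sum>r\<le>R. \<Sum>t<N n. (\<integral>\<omega>. l n t * (of_bool (?h r \<omega>) * Z t x \<omega>) \<partial>M))"
        by (rule sum.cong[OF refl], rule Bochner_Integration.integral_sum) (rule i)
      finally show ?thesis unfolding integral_mult_right_zero .
    qed
    also have "\<dots> \<le> (\<Sum>r\<le>R. \<Sum>t<N n. l n t * (real (D ^ r) * exp (- \<gamma> * real n) + \<epsilon> * C * \<P>(\<omega> in M. ?h r \<omega>)))"
    proof (intro sum_mono)
      fix r t assume r: "r \<in> {..R}"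
      show "l n t * (\<integral>\<omega>. of_bool (?h r \<omega>) * Z t x \<omega> \<partial>M) \<le> l n t * (real (D ^ r) * exp (- \<gamma> * real n) + \<epsilon> * C * \<P>(\<omega> in M. ?h r \<omega>))"
      proof (cases "l n t = 0")
        case False
        then have t: "is_record C t" "n \<le> t" using l(2)[of n t] by blast+
        have "r \<le> t" using r n t(2) by simp
        have "(\<integral>\<omega>. of_bool (?h r \<omega>) * Z t x \<omega> \<partial>M) \<le> real (D ^ r) * exp (- \<gamma> * real t) + \<epsilon> * C * \<P>(\<omega> in M. ?h r \<omega>)"
          by (rule thin_expectation[OF x t(1) \<open>r \<le> t\<close> C \<epsilon>])
        also have "\<dots> \<le> real (D ^ r) * exp (- \<gamma> * real n) + \<epsilon> * C * \<P>(\<omega> in M. ?h r \<omega>)"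
          using t(2) \<gamma> by (intro add_right_mono mult_left_mono) auto
        finally show ?thesis by (intro mult_left_mono l(1))
      qed simp
    qed
    also have "\<dots> = (\<Sum>r\<le>R. (\<Sum>t<N n. l n t) * (real (D ^ r) * exp (- \<gamma> * real n) + \<epsilon> * C * \<P>(\<omega> in M. ?h r \<omega>)))"
      by (simp only: sum_distrib_right)
    also have "\<dots> = (\<Sum>r\<le>R. real (D ^ r)) * exp (- \<gamma> * real n) + \<epsilon> * C * (\<Sum>r\<le>R. \<P>(\<omega> in M. ?h r \<omega>))"
      unfolding l(3) mult_1 sum.distrib sum_distrib_right sum_distrib_left ..
    also have "\<epsilon> * C * (\<Sum>r\<le>R. \<P>(\<omega> in M. ?h r \<omega>)) \<le> \<epsilon> * C * 1"
    proof (rule mult_left_mono)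
      have disj: "\<not> (?h r \<omega> \<and> ?h r' \<omega>)" if "r < r'" for r r' \<omega> using that by (auto simp: thin_hist)
      have "(\<Sum>r\<le>R. \<P>(\<omega> in M. ?h r \<omega>)) = prob (\<Union>r\<in>{..R}. {\<omega>\<in>space M. ?h r \<omega>})"
      proof (rule finite_measure_finite_Union[symmetric])
        show "disjoint_family_on (\<lambda>r. {\<omega>\<in>space M. ?h r \<omega>}) {..R}"
          unfolding disjoint_family_on_def
        proof (intro ballI impI)
          fix r r' :: nat assume "r \<noteq> r'"
          then consider "r < r'" | "r' < r" by linarith
          then show "{\<omega>\<in>space M. ?h r \<omega>} \<inter> {\<omega>\<in>space M. ?h r' \<omega>} = {}" using disj by cases blast+
        qed
        show "(\<lambda>r. {\<omega>\<in>space M. ?h r \<omega>}) ` {..R} \<subseteq> events" by (intro image_subsetI predE mh)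
      qed simp
      then show "(\<Sum>r\<le>R. \<P>(\<omega> in M. ?h r \<omega>)) \<le> 1" by (simp only: prob_le_1)
    qed (use \<epsilon> C in simp)
    finally show ?thesis by simp
  qed
  have lim: "\<delta> * prob (?S R) \<le> \<epsilon> * C" for R
  proof -
    have "(\<lambda>n. exp (- \<gamma> * real n)) \<longlonglongrightarrow> 0" using \<gamma> by real_asymp
    then have "(\<lambda>n. (\<Sum>r\<le>R. real (D ^ r)) * exp (- \<gamma> * real n) + \<epsilon> * C) \<longlonglongrightarrow> (\<Sum>r\<le>R. real (D ^ r)) * 0 + \<epsilon> * C"
      by (intro tendsto_add tendsto_mult tendsto_const)
    then have "\<delta> * prob (?S R) \<le> (\<Sum>r\<le>R. real (D ^ r)) * 0 + \<epsilon> * C"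
      by (rule LIMSEQ_le_const) (use bound in blast)
    then show ?thesis by simp
  qed
  have "(\<lambda>R. prob (?S R)) \<longlonglongrightarrow> prob (\<Union>R. ?S R)"
  proof (rule finite_Lim_measure_incseq)
    show "range ?S \<subseteq> events" by (intro image_subsetI predE mS)
    show "incseq ?S"
    proof (rule incseq_SucI)
      show "?S R \<subseteq> ?S (Suc R)" for R by (auto simp: le_Suc_eq)
    qed
  qed
  then have "(\<lambda>R. \<delta> * prob (?S R)) \<longlonglongrightarrow> \<delta> * prob (\<Union>R. ?S R)" by (intro tendsto_mult tendsto_const)
  then have "\<delta> * prob (\<Union>R. ?S R) \<le> \<epsilon> * C" by (rule LIMSEQ_le_const2) (use lim in blast)
  also have "(\<Union>R. ?S R) = {\<omega>\<in>space M. (\<exists>n0. \<forall>n\<ge>n0. \<delta> \<le> W n \<omega>) \<and> (\<exists>r. ?h r \<omega>)}"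
  proof (intro equalityI subsetI)
    fix \<omega> assume "\<omega> \<in> {\<omega>\<in>space M. (\<exists>n0. \<forall>n\<ge>n0. \<delta> \<le> W n \<omega>) \<and> (\<exists>r. ?h r \<omega>)}"
    then obtain n0 r where "\<omega> \<in> space M" "\<forall>n\<ge>n0. \<delta> \<le> W n \<omega>" "?h r \<omega>" by blast
    then have "\<omega> \<in> ?S (max n0 r)" by auto
    then show "\<omega> \<in> (\<Union>R. ?S R)" by blast
  qed blast
  finally show ?thesis .
qed

text \<open>By the preceding bound, for fixed \<open>\<delta>\<close> the probability of having a thin sphere for every
  \<open>\<epsilon> > 0\<close> is zero.\<close>
lemma spheres_not_thin:
  fixes l :: "nat \<Rightarrow> nat \<Rightarrow> real" and N :: "nat \<Rightarrow> nat"
  assumes x: "x \<in> V" and \<gamma>: "0 < \<gamma>" and C: "0 \<le> C"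
    and l: "\<And>n t. 0 \<le> l n t" "\<And>n t. l n t \<noteq> 0 \<Longrightarrow> is_record C t \<and> n \<le> t" "\<And>n. (\<Sum>t<N n. l n t) = 1"
  defines "W n \<omega> \<equiv> \<Sum>t<N n. l n t * Z t x \<omega>"
  shows "AE \<omega> in M. (\<exists>\<delta>>0. \<exists>n0. \<forall>n\<ge>n0. \<delta> \<le> W n \<omega>) \<longrightarrow>
     (\<exists>\<epsilon>>0. \<forall>r. \<epsilon> * exp (\<gamma> * real r) \<le> real (card (sph (opn \<omega>) x r)))"
proof -
  have iW: "integrable M (W n)" for n unfolding W_def
    by (intro Bochner_Integration.integrable_sum integrable_mult_right integrable_Z x)
  have mW: "Measurable.pred M (\<lambda>\<omega>. \<delta> \<le> W n \<omega>)" for n \<delta> using borel_measurable_integrable[OF iW] by measurable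
  let ?A = "\<lambda>i \<omega>. \<exists>n0. \<forall>n\<ge>n0. inverse (real (Suc i)) \<le> W n \<omega>"
  let ?L = "\<lambda>j \<omega>. \<exists>r. thin (inverse (real (Suc j))) r (hist \<omega> x r)"
  have mA: "Measurable.pred M (?A i)" for i
  proof -
    have "Measurable.pred M (\<lambda>\<omega>. \<exists>n0. \<forall>n\<in>{n0..}. inverse (real (Suc i)) \<le> W n \<omega>)"
      by (intro pred_intros_countable pred_ball_countable mW) simp
    then show ?thesis by (simp only: Ball_def atLeast_iff)
  qed
  have mL: "Measurable.pred M (?L j)" for j by (intro pred_intros_countable pred_hist x)
  have null: "AE \<omega> in M. \<not> (?A i \<omega> \<and> (\<forall>j. ?L j \<omega>))" for i
  proof -
    have m: "Measurable.pred M (\<lambda>\<omega>. ?A i \<omega> \<and> (\<forall>j. ?L j \<omega>))" by (intro pred_intros_logic pred_intros_countable mA mL)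
    let ?p = "\<P>(\<omega> in M. ?A i \<omega> \<and> (\<forall>j. ?L j \<omega>))"
    let ?d = "inverse (real (Suc i))"
    have "?d * ?p \<le> inverse (real (Suc j)) * C" for j
    proof -
      have "?d * ?p \<le> ?d * \<P>(\<omega> in M. ?A i \<omega> \<and> ?L j \<omega>)"
      proof (intro mult_left_mono finite_measure_mono)
        show "{\<omega>\<in>space M. ?A i \<omega> \<and> ?L j \<omega>} \<in> events" by (intro predE pred_intros_logic mA mL)
      qed auto
      also have "\<dots> \<le> inverse (real (Suc j)) * C"
        unfolding W_def by (rule thin_while_average_large[OF x \<gamma> C _ _ l]) simp_all
      finally show ?thesis .
    qed
    moreover have "(\<lambda>j. inverse (real (Suc j)) * C) \<longlonglongrightarrow> 0 * C" by (intro tendsto_mult LIMSEQ_inverse_real_of_nat tendsto_const)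
    ultimately have "?d * ?p \<le> 0 * C" by (intro LIMSEQ_le_const) blast+
    then have "?p \<le> 0" by (simp add: mult_le_0_iff)
    then have "?p = 0" using measure_nonneg by (rule order_antisym)
    then have "AE \<omega> in M. \<omega> \<notin> {\<omega>\<in>space M. ?A i \<omega> \<and> (\<forall>j. ?L j \<omega>)}" by (simp only: prob_eq_0[OF predE[OF m]])
    then show ?thesis using AE_space by eventually_elim blast
  qed
  have "AE \<omega> in M. \<forall>i. \<not> (?A i \<omega> \<and> (\<forall>j. ?L j \<omega>))"
    unfolding AE_all_countable by (rule allI) (rule null)
  then show ?thesis
  proof eventually_elim
    case (elim \<omega>)
    show ?case
    proof
      assume "\<exists>\<delta>>0. \<exists>n0. \<forall>n\<ge>n0. \<delta> \<le> W n \<omega>"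
      then obtain \<delta> n0 where d: "0 < \<delta>" "\<forall>n\<ge>n0. \<delta> \<le> W n \<omega>" by blast
      obtain i where "inverse (real (Suc i)) < \<delta>" using reals_Archimedean[OF d(1)] by blast
      then have "?A i \<omega>" using d(2) by (meson less_imp_le order_trans)
      then obtain j where "\<not> ?L j \<omega>" using elim by blast
      then have "\<forall>r. inverse (real (Suc j)) * exp (\<gamma> * real r) \<le> real (card (sph (opn \<omega>) x r))"
        unfolding exists_thin_iff by (simp only: not_ex not_less) blast
      moreover have "0 < inverse (real (Suc j))" by simp
      ultimately show "\<exists>\<epsilon>>0. \<forall>r. \<epsilon> * exp (\<gamma> * real r) \<le> real (card (sph (opn \<omega>) x r))" by blast
    qed
  qed
qed

text \<open>The weights are those of almost surely convergent averages at \<open>v\<close>, divided by \<open>Gr t\<close>. They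
  are supported on records at which the vertex \<open>y\<close> of \<open>good_root\<close> has large expectation,
  so Paley--Zygmund applies at \<open>y\<close>. At \<open>v\<close>, convergence turns the upper limit in
  \<open>grows\<close> into a lower bound for all large \<open>n\<close>, as required by
  \<open>spheres_not_thin\<close>.\<close>
lemma growth_property:
  assumes \<gamma>: "0 < \<gamma>" and v: "v \<in> V"
  shows "\<exists>N H. growth_weights N H \<and> (\<exists>y\<in>V. 0 < \<P>(\<omega> in M. grows N H (opn \<omega>) y)) \<and>
    (AE \<omega> in M. grows N H (opn \<omega>) v \<longrightarrow> (\<exists>\<epsilon>>0. \<forall>r. \<epsilon> * exp (\<gamma> * real r) \<le> real (card (sph (opn \<omega>) v r))))"
proof -
  obtain C y where C: "1 \<le> C" and y: "y \<in> V" and inf: "infinite {t. is_record C t \<and> 1/2 \<le> (\<integral>\<omega>. Z t y \<omega> \<partial>M)}"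
    using good_root by blast
  let ?T = "{t. is_record C t \<and> 1/2 \<le> (\<integral>\<omega>. Z t y \<omega> \<partial>M)}"
  define C' where "C' = C / (1 - exp (- \<gamma>))"
  have C'0: "0 < C'" unfolding C'_def using C \<gamma> by simp
  have Z2: "(\<integral>\<omega>. (Z t x \<omega>)\<^sup>2 \<partial>M) \<le> C'" if "t \<in> ?T" "x \<in> V" for t x
    unfolding C'_def by (rule Z_second_moment[OF \<gamma>]) (use that C in auto)
  obtain N l where l: "\<And>n t. 0 \<le> l n t" "\<And>n t. l n t \<noteq> 0 \<Longrightarrow> t \<in> ?T \<and> n \<le> t \<and> t < N n"
      "\<And>n. (\<Sum>t<N n. l n t) = (1::real)" "AE \<omega> in M. convergent (\<lambda>n. \<Sum>t<N n. l n t * Z t v \<omega>)"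
    using convex_combinations_converge[of "\<lambda>t. Z t v" ?T C', OF integrable_Z_mult[OF v] Z2[OF _ v] inf] by blast
  define H where "H n t = l n t / Gr V E p t" for n t
  have G: "0 < Gr V E p t" for t using Gr_ge_1[of t] by linarith
  have HW: "(\<Sum>t<N n. H n t * real (card (B \<omega> x t))) = (\<Sum>t<N n. l n t * Z t x \<omega>)" for n x \<omega>
    unfolding H_def Z_def by (intro sum.cong refl) simp
  have gw: "growth_weights N H"
  proof
    show "0 \<le> H n t" for n t unfolding H_def using l(1)[of n t] G[of t] by simp
    show "(\<lambda>n. \<Sum>t<N n. H n t) \<longlonglongrightarrow> 0"
    proof (rule tendsto_sandwich[of "\<lambda>_. 0" _ _ "\<lambda>n. exp (- \<gamma> * real n)"])
      show "\<forall>\<^sub>F n in sequentially. 0 \<le> (\<Sum>t<N n. H n t)"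
        unfolding H_def by (intro always_eventually allI sum_nonneg divide_nonneg_pos l(1) G)
      have "(\<Sum>t<N n. H n t) \<le> exp (- \<gamma> * real n)" for n
      proof -
        have "(\<Sum>t<N n. H n t) \<le> (\<Sum>t<N n. l n t * exp (- \<gamma> * real n))"
        proof (rule sum_mono)
          fix t
          show "H n t \<le> l n t * exp (- \<gamma> * real n)"
          proof (cases "l n t = 0")
            case False
            then have "n \<le> t" using l(2) by blast
            then have "exp (\<gamma> * real n) \<le> exp (\<gamma> * real t)" using \<gamma> by simp
            also have "\<dots> \<le> Gr V E p t" by (rule gamma_facts(3))
            finally have "1 / Gr V E p t \<le> 1 / exp (\<gamma> * real n)" using G[of t] by (intro divide_left_mono) auto
            also have "\<dots> = exp (- \<gamma> * real n)" by (simp add: exp_minus field_simps)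
            finally have "l n t * (1 / Gr V E p t) \<le> l n t * exp (- \<gamma> * real n)" by (intro mult_left_mono l(1))
            then show ?thesis by (simp add: H_def)
          qed (simp add: H_def)
        qed
        also have "\<dots> = exp (- \<gamma> * real n)" unfolding sum_distrib_right[symmetric] l(3) by simp
        finally show ?thesis .
      qed
      then show "\<forall>\<^sub>F n in sequentially. (\<Sum>t<N n. H n t) \<le> exp (- \<gamma> * real n)" by (intro always_eventually allI)
      show "(\<lambda>n. exp (- \<gamma> * real n)) \<longlonglongrightarrow> 0" using \<gamma> by real_asymp
    qed simp
  qed
  have pos: "0 < \<P>(\<omega> in M. grows N H (opn \<omega>) y)"
  proof -
    let ?W = "\<lambda>n \<omega>. \<Sum>t<N n. l n t * Z t y \<omega>"
    have iZ: "integrable M (Z t y)" for t by (rule integrable_Z[OF y])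
    have iW: "integrable M (?W n)" for n by (intro Bochner_Integration.integrable_sum integrable_mult_right iZ)
    have iZ2: "integrable M (\<lambda>\<omega>. (Z t y \<omega>)\<^sup>2)" for t unfolding power2_eq_square by (rule integrable_Z_mult[OF y])
    have iW2: "integrable M (\<lambda>\<omega>. (?W n \<omega>)\<^sup>2)" for n
    proof -
      have "(\<lambda>\<omega>. (?W n \<omega>)\<^sup>2) = (\<lambda>\<omega>. \<Sum>s<N n. \<Sum>t<N n. (l n s * l n t) * (Z s y \<omega> * Z t y \<omega>))"
        unfolding power2_eq_square sum_product by (rule ext) (simp only: mult_ac)
      then show ?thesis
        by (simp only:) (intro Bochner_Integration.integrable_sum integrable_mult_right integrable_Z_mult y)
    qed
    have m1: "1/2 \<le> (\<integral>\<omega>. ?W n \<omega> \<partial>M)" for n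
    proof -
      have "1/2 = (\<Sum>t<N n. l n t * (1/2))" unfolding sum_distrib_right[symmetric] l(3) by simp
      also have "\<dots> \<le> (\<Sum>t<N n. l n t * (\<integral>\<omega>. Z t y \<omega> \<partial>M))"
      proof (rule sum_mono)
        fix t show "l n t * (1/2) \<le> l n t * (\<integral>\<omega>. Z t y \<omega> \<partial>M)"
          using l(1)[of n t] l(2)[of n t] by (cases "l n t = 0") (auto intro!: mult_left_mono)
      qed
      also have "\<dots> = (\<integral>\<omega>. ?W n \<omega> \<partial>M)"
        unfolding integral_mult_right_zero[symmetric]
        by (rule Bochner_Integration.integral_sum[symmetric]) (intro integrable_mult_right iZ)
      finally show ?thesis .
    qed
    have m2: "(\<integral>\<omega>. (?W n \<omega>)\<^sup>2 \<partial>M) \<le> C'" for n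
    proof -
      have "(\<integral>\<omega>. (?W n \<omega>)\<^sup>2 \<partial>M) \<le> (\<integral>\<omega>. (\<Sum>t<N n. l n t * (Z t y \<omega>)\<^sup>2) \<partial>M)"
        by (rule integral_mono[OF iW2 _ square_of_average_le[OF l(1,3)]])
           (intro Bochner_Integration.integrable_sum integrable_mult_right iZ2)
      also have "\<dots> = (\<Sum>t<N n. l n t * (\<integral>\<omega>. (Z t y \<omega>)\<^sup>2 \<partial>M))"
        unfolding integral_mult_right_zero[symmetric]
        by (rule Bochner_Integration.integral_sum) (intro integrable_mult_right iZ2)
      also have "\<dots> \<le> (\<Sum>t<N n. l n t * C')"
      proof (rule sum_mono)
        fix t show "l n t * (\<integral>\<omega>. (Z t y \<omega>)\<^sup>2 \<partial>M) \<le> l n t * C'"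
        proof (cases "l n t = 0")
          case False
          then have "t \<in> ?T" using l(2) by blast
          then show ?thesis by (intro mult_left_mono Z2 y l(1))
        qed simp
      qed
      also have "\<dots> = C'" unfolding sum_distrib_right[symmetric] l(3) by simp
      finally show ?thesis .
    qed
    have mp: "Measurable.pred M (\<lambda>\<omega>. 1/4 \<le> ?W n \<omega>)" for n using borel_measurable_integrable[OF iW] by measurable
    have "0 < 1 / (16 * C')" using C'0 by simp
    also have "1 / (16 * C') \<le> \<P>(\<omega> in M. \<forall>m. \<exists>n\<ge>m. 1/4 \<le> ?W n \<omega>)"
      by (rule prob_infinitely_often_ge[OF mp paley_zygmund[OF iW iW2 C'0 m1 m2]])
    also have "\<dots> \<le> \<P>(\<omega> in M. grows N H (opn \<omega>) y)"
    proof (rule finite_measure_mono)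
      show "{\<omega>\<in>space M. \<forall>m. \<exists>n\<ge>m. 1/4 \<le> ?W n \<omega>} \<subseteq> {\<omega>\<in>space M. grows N H (opn \<omega>) y}"
        unfolding grows_def HW by (auto intro!: exI[of _ "1/4"])
      show "{\<omega>\<in>space M. grows N H (opn \<omega>) y} \<in> events"
      proof (rule predE)
        have "(\<lambda>\<omega>. grows N H (opn \<omega>) y) = (\<lambda>\<omega>. \<exists>i. \<forall>m. \<exists>n. m \<le> n \<and> inverse (real (Suc i)) \<le> ?W n \<omega>)"
        proof (rule ext, rule iffI)
          fix \<omega> assume "grows N H (opn \<omega>) y"
          then obtain c where c: "0 < c" "\<forall>m. \<exists>n\<ge>m. c \<le> ?W n \<omega>" unfolding grows_def HW by blast
          obtain i where "inverse (real (Suc i)) < c" using reals_Archimedean[OF c(1)] by blast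
          then show "\<exists>i. \<forall>m. \<exists>n. m \<le> n \<and> inverse (real (Suc i)) \<le> ?W n \<omega>" using c(2) by (meson less_imp_le order_trans)
        next
          fix \<omega> assume "\<exists>i. \<forall>m. \<exists>n. m \<le> n \<and> inverse (real (Suc i)) \<le> ?W n \<omega>"
          then obtain i where i: "\<forall>m. \<exists>n. m \<le> n \<and> inverse (real (Suc i)) \<le> ?W n \<omega>" by blast
          then show "grows N H (opn \<omega>) y" unfolding grows_def HW by (intro exI[of _ "inverse (real (Suc i))"]) simp
        qed
        moreover have "Measurable.pred M (\<lambda>\<omega>. \<exists>i. \<forall>m. \<exists>n. m \<le> n \<and> inverse (real (Suc i)) \<le> ?W n \<omega>)"
        proof (intro pred_intros_countable pred_intros_logic)
          fix i n :: nat show "Measurable.pred M (\<lambda>\<omega>. inverse (real (Suc i)) \<le> ?W n \<omega>)"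
            using borel_measurable_integrable[OF iW] by measurable
        qed simp
        ultimately show "Measurable.pred M (\<lambda>\<omega>. grows N H (opn \<omega>) y)" by (simp only:)
      qed
    qed
    finally show ?thesis .
  qed
  have "AE \<omega> in M. grows N H (opn \<omega>) v \<longrightarrow> (\<exists>\<epsilon>>0. \<forall>r. \<epsilon> * exp (\<gamma> * real r) \<le> real (card (sph (opn \<omega>) v r)))"
  proof -
    have "AE \<omega> in M. (\<exists>\<delta>>0. \<exists>n0. \<forall>n\<ge>n0. \<delta> \<le> (\<Sum>t<N n. l n t * Z t v \<omega>)) \<longrightarrow>
       (\<exists>\<epsilon>>0. \<forall>r. \<epsilon> * exp (\<gamma> * real r) \<le> real (card (sph (opn \<omega>) v r)))"
      by (rule spheres_not_thin[OF v \<gamma> _ l(1) _ l(3), of C]) (use C l(2) in auto)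
    with l(4) show ?thesis
    proof eventually_elim
      case (elim \<omega>)
      show ?case
      proof
        assume "grows N H (opn \<omega>) v"
        then obtain c where c: "0 < c" "\<forall>m. \<exists>n\<ge>m. c \<le> (\<Sum>t<N n. l n t * Z t v \<omega>)" unfolding grows_def HW by blast
        obtain L where L: "(\<lambda>n. \<Sum>t<N n. l n t * Z t v \<omega>) \<longlonglongrightarrow> L" using elim(1) by (auto simp: convergent_def)
        have "c \<le> L"
        proof (rule ccontr)
          assume "\<not> c \<le> L"
          then have "\<forall>\<^sub>F n in sequentially. (\<Sum>t<N n. l n t * Z t v \<omega>) < c" using L by (intro order_tendstoD(2)) auto
          then show False using c(2) by (auto simp: eventually_sequentially not_le[symmetric])
        qed
        then have "c / 2 < L" using c(1) by simp
        then have "\<forall>\<^sub>F n in sequentially. c / 2 < (\<Sum>t<N n. l n t * Z t v \<omega>)" by (rule order_tendstoD(1)[OF L])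
        then have "\<exists>n0. \<forall>n\<ge>n0. c / 2 \<le> (\<Sum>t<N n. l n t * Z t v \<omega>)"
          unfolding eventually_sequentially by (meson less_imp_le)
        then have "\<exists>\<delta>>0. \<exists>n0. \<forall>n\<ge>n0. \<delta> \<le> (\<Sum>t<N n. l n t * Z t v \<omega>)" using c(1) by (intro exI[of _ "c / 2"]) simp
        then show "\<exists>\<epsilon>>0. \<forall>r. \<epsilon> * exp (\<gamma> * real r) \<le> real (card (sph (opn \<omega>) v r))" using elim(2) by blast
      qed
    qed
  qed
  then show ?thesis using gw pos y by blast
qed

end

section \<open>Growth as a property of clusters\<close>

locale growing = qt_graph V E + growth_weights N H
  for V :: "'a set" and E N H
begin

abbreviation G :: "'a set set \<Rightarrow> 'a \<Rightarrow> bool" where "G \<equiv> grows N H"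

abbreviation av :: "'a set set \<Rightarrow> 'a \<Rightarrow> nat \<Rightarrow> real" where
  "av K x n \<equiv> \<Sum>t<N n. H n t * real (card (bl K x t))"

lemma grows_cong: "(\<And>t. bl K x t = bl K' x t) \<Longrightarrow> G K x = G K' x"
  unfolding grows_def by simp

lemma grows_le:
  assumes "0 < a" "\<And>t. real (card (bl K x t)) \<le> a * real (card (bl K' y t))" "G K x"
  shows "G K' y"
proof -
  obtain c where c: "0 < c" "\<forall>m. \<exists>n\<ge>m. c \<le> av K x n" using assms(3) unfolding grows_def by blast
  have le: "av K x n \<le> a * av K' y n" for n
  proof -
    have "av K x n \<le> (\<Sum>t<N n. H n t * (a * real (card (bl K' y t))))"
      by (intro sum_mono mult_left_mono assms(2) H_nonneg)
    also have "\<dots> = a * av K' y n" unfolding sum_distrib_left by (intro sum.cong refl) (simp only: mult_ac)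
    finally show ?thesis .
  qed
  have "c / a \<le> av K' y n" if "c \<le> av K x n" for n
    using le[of n] that assms(1) by (simp add: field_simps)
  then have "\<forall>m. \<exists>n\<ge>m. c / a \<le> av K' y n" using c(2) by blast
  then show ?thesis unfolding grows_def using c(1) assms(1) by (intro exI[of _ "c / a"]) simp
qed

lemma grows_mono:
  assumes "K \<subseteq> K'" "K' \<subseteq> E" "x \<in> V" "G K x"
  shows "G K' x"
  by (rule grows_le[of 1 K x K' x, OF _ _ assms(4)])
     (use assms(1,2,3) in \<open>auto intro!: card_mono finite_bl dest: bl_mono\<close>)

text \<open>Moving the centre by a distance \<open>d\<close> changes ball sizes at most by the factor \<open>D ^ d\<close>.\<close>
lemma grows_clu:
  assumes K: "K \<subseteq> E" and x: "x \<in> V" and g: "G K x" and y: "y \<in> clu K x"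
  shows "G K y"
proof -
  obtain d where d: "y \<in> bl K x d" using y unfolding clu_def by blast
  have "real (card (bl K x t)) \<le> real (D ^ d) * real (card (bl K y t))" for t
    using card_bl_move[OF K x d, of t] by (simp only: of_nat_mult[symmetric] of_nat_le_iff)
  moreover have "0 < real (D ^ d)" using D(1) by simp
  ultimately show ?thesis using grows_le g by blast
qed

text \<open>Up to the vertices of \<open>A\<close>, the ball around \<open>x\<close> is covered by balls off \<open>A\<close>
  around the finitely many vertices \<open>u\<close> joined to \<open>A\<close>. The vertices of \<open>A\<close> do
  not matter in the limit, so one of the \<open>u\<close> grows.\<close>
lemma grows_leave:
  assumes A: "finite A" "A \<subseteq> V" and K: "K \<subseteq> E" and x: "x \<in> A" and g: "G K x"
  shows "\<exists>u. u \<notin> A \<and> (\<exists>y\<in>A. {y, u} \<in> K) \<and> G (off A K) u"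
proof (rule ccontr)
  define U where "U = {u. u \<notin> A \<and> (\<exists>y\<in>A. {y, u} \<in> K)}"
  assume "\<not> ?thesis"
  then have nG: "\<not> G (off A K) u" if "u \<in> U" for u using that unfolding U_def by blast
  have offE: "off A K \<subseteq> E" using off_subset K by blast
  have "U \<subseteq> (\<Union>y\<in>A. {u. {y, u} \<in> E})" unfolding U_def using K by blast
  moreover have "finite (\<Union>y\<in>A. {u. {y, u} \<in> E})" using A finite_nbrs by (intro finite_UN_I) auto
  ultimately have finU: "finite U" by (rule finite_subset)
  have UV: "U \<subseteq> V" unfolding U_def using K edge_in_V by blast
  have card_le: "real (card (bl K x t)) \<le> real (card A) + (\<Sum>u\<in>U. real (card (bl (off A K) u t)))" for t
  proof -
    have "bl K x t \<subseteq> A \<union> (\<Union>u\<in>U. bl (off A K) u t)"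
      using bl_leave_set[OF x, of _ K t] unfolding U_def by blast
    moreover have "finite (\<Union>u\<in>U. bl (off A K) u t)" using UV by (intro finite_UN_I finU finite_bl[OF offE]) auto
    ultimately have "card (bl K x t) \<le> card (A \<union> (\<Union>u\<in>U. bl (off A K) u t))" using A(1) by (intro card_mono) auto
    also have "\<dots> \<le> card A + card (\<Union>u\<in>U. bl (off A K) u t)" by (rule card_Un_le)
    also have "card (\<Union>u\<in>U. bl (off A K) u t) \<le> (\<Sum>u\<in>U. card (bl (off A K) u t))" by (rule card_UN_le[OF finU])
    finally have "card (bl K x t) \<le> card A + (\<Sum>u\<in>U. card (bl (off A K) u t))" by simp
    then have "real (card (bl K x t)) \<le> real (card A + (\<Sum>u\<in>U. card (bl (off A K) u t)))" by (simp only: of_nat_le_iff)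
    then show ?thesis by simp
  qed
  have av_le: "av K x n \<le> real (card A) * (\<Sum>t<N n. H n t) + (\<Sum>u\<in>U. av (off A K) u n)" for n
  proof -
    have "av K x n \<le> (\<Sum>t<N n. H n t * (real (card A) + (\<Sum>u\<in>U. real (card (bl (off A K) u t)))))"
      by (intro sum_mono mult_left_mono card_le H_nonneg)
    also have "\<dots> = real (card A) * (\<Sum>t<N n. H n t) + (\<Sum>t<N n. \<Sum>u\<in>U. H n t * real (card (bl (off A K) u t)))"
      by (simp only: distrib_left sum.distrib sum_distrib_left mult.commute)
    also have "(\<Sum>t<N n. \<Sum>u\<in>U. H n t * real (card (bl (off A K) u t))) = (\<Sum>u\<in>U. av (off A K) u n)" by (rule sum.swap)
    finally show ?thesis .
  qed
  obtain c where c: "0 < c" "\<forall>m. \<exists>n\<ge>m. c \<le> av K x n" using g unfolding grows_def by blast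
  define c' where "c' = c / (2 * (real (card U) + 1))"
  have c'0: "0 < c'" using c(1) by (simp add: c'_def)
  have ev1: "\<forall>\<^sub>F n in sequentially. \<forall>u\<in>U. av (off A K) u n < c'"
  proof (rule eventually_ball_finite[OF finU], rule ballI)
    fix u assume "u \<in> U"
    then have "\<not> (\<forall>m. \<exists>n\<ge>m. c' \<le> av (off A K) u n)" using nG c'0 unfolding grows_def by blast
    then obtain m where m: "\<And>n. m \<le> n \<Longrightarrow> \<not> c' \<le> av (off A K) u n" by blast
    show "\<forall>\<^sub>F n in sequentially. av (off A K) u n < c'"
      by (rule eventually_sequentiallyI[of m]) (rule linorder_not_le[THEN iffD1, OF m])
  qed
  have lim0: "(\<lambda>n. real (card A) * (\<Sum>t<N n. H n t)) \<longlonglongrightarrow> 0" by (rule tendsto_mult_right_zero[OF H_sum])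
  have half: "0 < c / 2" using c(1) by simp
  have ev2: "\<forall>\<^sub>F n in sequentially. real (card A) * (\<Sum>t<N n. H n t) < c / 2" by (rule order_tendstoD(2)[OF lim0 half])
  have "\<forall>\<^sub>F n in sequentially. av K x n < c"
    using ev1 ev2
  proof eventually_elim
    case (elim n)
    have "(\<Sum>u\<in>U. av (off A K) u n) \<le> (\<Sum>u\<in>U. c')" using elim(1) by (intro sum_mono less_imp_le) blast
    also have "\<dots> = real (card U) * c'" by simp
    also have "\<dots> \<le> c / 2" using c(1) unfolding c'_def by (simp add: field_simps)
    finally show ?case using av_le[of n] elim(2) by linarith
  qed
  then obtain m where "\<forall>n\<ge>m. av K x n < c" unfolding eventually_sequentially by blast
  then show False using c(2) by (meson not_le)
qed

lemma pred_grows: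
  assumes K: "random_edges M K" and x: "x \<in> V"
  shows "Measurable.pred M (\<lambda>\<omega>. G (K \<omega>) x)"
proof -
  have mav: "(\<lambda>\<omega>. av (K \<omega>) x n) \<in> borel_measurable M" for n
    by (intro borel_measurable_sum borel_measurable_times borel_measurable_const measurable_card_bl[OF K x])
  have "(\<lambda>\<omega>. G (K \<omega>) x) = (\<lambda>\<omega>. \<exists>i. \<forall>m. \<exists>n. m \<le> n \<and> inverse (real (Suc i)) \<le> av (K \<omega>) x n)"
  proof (rule ext, rule iffI)
    fix \<omega> assume "G (K \<omega>) x"
    then obtain c where c: "0 < c" "\<forall>m. \<exists>n\<ge>m. c \<le> av (K \<omega>) x n" unfolding grows_def by blast
    obtain i where "inverse (real (Suc i)) < c" using reals_Archimedean[OF c(1)] by blast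
    then show "\<exists>i. \<forall>m. \<exists>n. m \<le> n \<and> inverse (real (Suc i)) \<le> av (K \<omega>) x n" using c(2) by (meson less_imp_le order_trans)
  next
    fix \<omega> assume "\<exists>i. \<forall>m. \<exists>n. m \<le> n \<and> inverse (real (Suc i)) \<le> av (K \<omega>) x n"
    then obtain i where i: "\<forall>m. \<exists>n. m \<le> n \<and> inverse (real (Suc i)) \<le> av (K \<omega>) x n" by blast
    then show "G (K \<omega>) x" unfolding grows_def by (intro exI[of _ "inverse (real (Suc i))"]) simp
  qed
  moreover have "Measurable.pred M (\<lambda>\<omega>. \<exists>i. \<forall>m. \<exists>n. m \<le> n \<and> inverse (real (Suc i)) \<le> av (K \<omega>) x n)"
  proof (intro pred_intros_countable pred_intros_logic)
    fix i n :: nat show "Measurable.pred M (\<lambda>\<omega>. inverse (real (Suc i)) \<le> av (K \<omega>) x n)"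
      using mav[of n] by measurable
  qed simp
  ultimately show ?thesis by (simp only:)
qed

end

section \<open>Large sets of vertices meet a growing cluster\<close>

context qt_graph
begin

lemma near_disjoint:
  assumes "x' \<notin> bl E x (2 * m + 1)"
  shows "near x m \<inter> near x' m = {}"
proof (rule ccontr)
  assume "near x m \<inter> near x' m \<noteq> {}"
  then obtain e a b where e: "e \<in> E" "a \<in> e" "a \<in> bl E x m" "b \<in> e" "b \<in> bl E x' m"
    unfolding near_def touching_def by blast
  obtain s t where st: "e = {s, t}" using e(1) by (rule edgeE)
  have "b \<in> bl E a 1"
  proof (cases "a = b")
    case False
    then have "e = {a, b}" using st e by blast
    then show ?thesis using e(1) by auto
  qed simp
  from bl_trans[OF e(3) this] have "b \<in> bl E x (m + 1)" .
  from bl_trans[OF this bl_sym[OF e(5)]] have "x' \<in> bl E x (m + 1 + m)" .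
  moreover have "m + 1 + m = 2 * m + 1" by simp
  ultimately show False using assms by metis
qed

text \<open>Pick greedily, discarding a ball of at most \<open>D ^ (2 * m + 1)\<close> vertices each time.\<close>
lemma spread_subset:
  "finite A \<Longrightarrow> A \<subseteq> V \<Longrightarrow> k * D ^ (2 * m + 1) \<le> card A \<Longrightarrow>
   \<exists>S\<subseteq>A. card S = k \<and> (\<forall>x\<in>S. \<forall>y\<in>S. x \<noteq> y \<longrightarrow> near x m \<inter> near y m = {})"
proof (induction k arbitrary: A)
  case 0
  then show ?case by (intro exI[of _ "{}"]) simp
next
  case (Suc k)
  have "0 < D ^ (2 * m + 1)" using D(1) by simp
  then have "0 < Suc k * D ^ (2 * m + 1)" by (rule mult_pos_pos[rotated]) simp
  then have "0 < card A" using Suc.prems(3) by (rule less_le_trans)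
  then obtain x where x: "x \<in> A" by (metis card.empty equals0I less_irrefl)
  have xV: "x \<in> V" using x Suc.prems by blast
  let ?A = "A - bl E x (2 * m + 1)"
  have "card A - card (bl E x (2 * m + 1)) \<le> card ?A" by (rule diff_card_le_card_Diff[OF finite_bl[OF order_refl xV]])
  moreover have "card (bl E x (2 * m + 1)) \<le> D ^ (2 * m + 1)" by (rule card_bl_le[OF order_refl xV])
  moreover have "k * D ^ (2 * m + 1) + D ^ (2 * m + 1) \<le> card A" using Suc.prems(3) by (simp only: mult_Suc add.commute)
  ultimately have "k * D ^ (2 * m + 1) \<le> card ?A" by linarith
  from Suc.IH[OF _ _ this] Suc.prems obtain S where S: "S \<subseteq> ?A" "card S = k" "\<forall>x\<in>S. \<forall>y\<in>S. x \<noteq> y \<longrightarrow> near x m \<inter> near y m = {}"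
    by (meson Diff_subset finite_Diff order_trans)
  have xS: "x \<notin> S" using S(1) by auto
  have finS: "finite S" using S(1) Suc.prems(1) by (meson finite_Diff finite_subset)
  have "near x m \<inter> near y m = {}" if "y \<in> S" for y using S(1) that by (intro near_disjoint) blast
  then have "\<forall>a\<in>insert x S. \<forall>b\<in>insert x S. a \<noteq> b \<longrightarrow> near a m \<inter> near b m = {}" using S(3) by (auto simp: Int_commute)
  moreover have "insert x S \<subseteq> A" "card (insert x S) = Suc k" using x S xS finS by auto
  ultimately show ?case by blast
qed

lemma finite_path_edges_to:
  "x \<in> bl E y n \<Longrightarrow> \<exists>F. finite F \<and> F \<subseteq> E \<and> x \<in> bl F y n"
proof (induction n arbitrary: x)
  case 0
  then show ?case by (intro exI[of _ "{}"]) simp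
next
  case (Suc n)
  show ?case
  proof (cases "x \<in> bl E y n")
    case True
    then obtain F where "finite F" "F \<subseteq> E" "x \<in> bl F y n" using Suc.IH by blast
    then show ?thesis by (intro exI[of _ F]) simp
  next
    case False
    then obtain u where u: "u \<in> bl E y n" "{u, x} \<in> E" using Suc.prems by auto
    obtain F where F: "finite F" "F \<subseteq> E" "u \<in> bl F y n" using Suc.IH[OF u(1)] by blast
    have "u \<in> bl (insert {u, x} F) y n" using bl_mono[of F "insert {u, x} F" y n] F(3) by blast
    then show ?thesis using F u(2) by (intro exI[of _ "insert {u, x} F"]) auto
  qed
qed

lemma finite_subset_near:
  assumes "finite F" "F \<subseteq> E" "y \<in> V"
  shows "\<exists>m. F \<subseteq> near y m"
  using assms
proof (induction F)
  case (insert e F)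
  then obtain m where m: "F \<subseteq> near y m" by blast
  have "e \<in> E" using insert.prems by blast
  then obtain s t where st: "e = {s, t}" "s \<in> V" by (rule edgeE)
  obtain k where "s \<in> bl E y k" using st(2) V_eq_ball_union[OF assms(3)] by blast
  then have "e \<in> near y k" using st \<open>e \<in> E\<close> by (auto simp: near_def touching_def)
  then have "insert e F \<subseteq> near y (max m k)"
    using m near_mono[of m "max m k" y] near_mono[of k "max m k" y] by auto
  then show ?case by blast
qed simp

end

locale growing_perc = perc V E p + growing V E N H
  for V :: "'a set" and E p N H +
  assumes p_pos: "0 < p" and some_grows: "\<exists>y\<in>V. 0 < \<P>(\<omega> in bits E (\<lambda>_. p). grows N H (open_edges E \<omega>) y)"
begin

lemma pred_G: "x \<in> V \<Longrightarrow> Measurable.pred M (\<lambda>\<omega>. G (opn \<omega>) x)"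
  by (rule pred_grows[OF random_edges_opn])

lemma G_shift:
  assumes "f \<in> automorphisms V E" "x \<in> V"
  shows "G (opn (shift f \<omega>)) x = G (opn \<omega>) (f x)"
  unfolding grows_def card_bl_shift[OF assms] ..

lemma opn_overwrite: "F \<subseteq> E \<Longrightarrow> opn (restrict (overwrite F True \<omega>) E) = opn \<omega> \<union> F"
  by (auto simp: open_edges_def overwrite_def)

text \<open>Some vertex \<open>y\<close> grows with positive probability; opening the edges of a path from \<open>x\<close> to
  \<open>y\<close> then makes \<open>x\<close> grow as well.\<close>
lemma G_pos: assumes x: "x \<in> V" shows "0 < \<P>(\<omega> in M. G (opn \<omega>) x)"
proof (rule ccontr)
  assume "\<not> ?thesis"
  then have "\<P>(\<omega> in M. G (opn \<omega>) x) = 0" using measure_nonneg[of M "{\<omega>\<in>space M. G (opn \<omega>) x}"] by linarith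
  then have "AE \<omega> in M. \<omega> \<notin> {\<omega>\<in>space M. G (opn \<omega>) x}" by (simp only: prob_eq_0[OF predE[OF pred_G[OF x]]])
  then have nx: "AE \<omega> in M. \<not> G (opn \<omega>) x" using AE_space by eventually_elim blast
  obtain y where y: "y \<in> V" "0 < \<P>(\<omega> in M. G (opn \<omega>) y)" using some_grows by blast
  obtain n where n: "x \<in> bl E y n" using x V_eq_ball_union[OF y(1)] by blast
  obtain F where F: "finite F" "F \<subseteq> E" "x \<in> bl F y n" using finite_path_edges_to[OF n] by blast
  have pF: "0 < \<P>(\<omega> in M. \<omega> j = True)" if "j \<in> F" for j
  proof -
    have "j \<in> E" using that F(2) by blast
    from prob_bit[of j E "\<lambda>_. p" True, OF this p] show ?thesis using p_pos by (simp only: if_True)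
  qed
  have "AE \<omega> in M. \<not> G (opn (restrict (overwrite F True \<omega>) E)) x"
    by (rule finite_modification_null[OF pred_G[OF x] F(1,2) pF nx])
  then have "AE \<omega> in M. \<omega> \<notin> {\<omega>\<in>space M. G (opn \<omega>) y}"
  proof eventually_elim
    case (elim \<omega>)
    have sub: "opn \<omega> \<union> F \<subseteq> E" using opn_subset F(2) by blast
    have "x \<in> clu (opn \<omega> \<union> F) y" using F(3) bl_mono[of F "opn \<omega> \<union> F" y n] unfolding clu_def by blast
    then have "G (opn \<omega> \<union> F) x" if "G (opn \<omega>) y"
      using grows_clu[OF sub y(1) grows_mono[OF Un_upper1 sub y(1) that]] by blast
    then show ?case using elim unfolding opn_overwrite[OF F(2)] by blast
  qed
  then have "\<P>(\<omega> in M. G (opn \<omega>) y) = 0" by (simp only: prob_eq_0[OF predE[OF pred_G[OF y(1)]]])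
  then show False using y(2) by simp
qed

text \<open>By automorphism invariance finitely many vertices represent all cases, so positivity and locality hold uniformly.\<close>
lemma uniform_data:
  "\<exists>\<theta>>0. (\<forall>x\<in>V. \<theta> \<le> \<P>(\<omega> in M. G (opn \<omega>) x)) \<and>
    (\<forall>\<delta>>0. \<exists>m. \<forall>x\<in>V. \<exists>L. depends L (near x m) \<and> \<P>(\<omega> in M. G (opn \<omega>) x \<noteq> L \<omega>) \<le> \<delta>)"
proof -
  obtain R where R: "finite R" "R \<subseteq> V" "\<forall>x\<in>V. \<exists>y\<in>R. \<exists>f\<in>automorphisms V E. f y = x"
    using representatives by (elim exE conjE)
  have "R \<noteq> {}" using R(3) V_ne by blast
  define \<theta> where "\<theta> = Min ((\<lambda>y. \<P>(\<omega> in M. G (opn \<omega>) y)) ` R)"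
  have "0 < \<theta>" unfolding \<theta>_def using R \<open>R \<noteq> {}\<close> by (subst Min_gr_iff) (auto intro!: G_pos)
  moreover have "\<theta> \<le> \<P>(\<omega> in M. G (opn \<omega>) x)" if x: "x \<in> V" for x
  proof -
    obtain y f where yf: "y \<in> R" "f \<in> automorphisms V E" "f y = x" using bspec[OF R(3) x] by (elim bexE)
    have yV: "y \<in> V" using yf(1) R(2) by blast
    have "\<theta> \<le> \<P>(\<omega> in M. G (opn \<omega>) y)" unfolding \<theta>_def using R(1) yf(1) by (intro Min_le) auto
    also have "\<dots> = \<P>(\<omega> in M. G (opn (shift f \<omega>)) y)" by (rule prob_shift[OF yf(2) pred_G[OF yV], symmetric])
    finally show ?thesis unfolding G_shift[OF yf(2) yV] yf(3) .
  qed
  moreover have "\<exists>m. \<forall>x\<in>V. \<exists>L. depends L (near x m) \<and> \<P>(\<omega> in M. G (opn \<omega>) x \<noteq> L \<omega>) \<le> \<delta>" if \<delta>: "0 < \<delta>" for \<delta>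
  proof -
    have "\<exists>m L. depends L (near y m) \<and> \<P>(\<omega> in M. G (opn \<omega>) y \<noteq> L \<omega>) \<le> \<delta>" if y: "y \<in> V" for y
    proof -
      obtain F L where FL: "finite F" "F \<subseteq> E" "depends L F" "\<P>(\<omega> in M. G (opn \<omega>) y \<noteq> L \<omega>) \<le> \<delta>"
        using finite_approximation[OF pred_G[OF y] \<delta>] by blast
      obtain m where "F \<subseteq> near y m" using finite_subset_near[OF FL(1,2) y] by blast
      then show ?thesis using depends_mono[OF FL(3)] FL(4) by blast
    qed
    note ex = this
    define gd where "gd y m L \<longleftrightarrow> depends L (near y m) \<and> \<P>(\<omega> in M. G (opn \<omega>) y \<noteq> L \<omega>) \<le> \<delta>" for y m L
    have "\<forall>y\<in>V. \<exists>m L. gd y m L" unfolding gd_def using ex by blast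
    then obtain m L where "\<And>y. y \<in> V \<Longrightarrow> gd y (m y) (L y)" by metis
    then have mL: "\<And>y. y \<in> V \<Longrightarrow> depends (L y) (near y (m y)) \<and> \<P>(\<omega> in M. G (opn \<omega>) y \<noteq> L y \<omega>) \<le> \<delta>"
      unfolding gd_def .
    define k where "k = Max (m ` R)"
    have "\<exists>L. depends L (near x k) \<and> \<P>(\<omega> in M. G (opn \<omega>) x \<noteq> L \<omega>) \<le> \<delta>" if x: "x \<in> V" for x
    proof -
      obtain y f where yf: "y \<in> R" "f \<in> automorphisms V E" "f y = x" using bspec[OF R(3) x] by (elim bexE)
      have yV: "y \<in> V" using yf(1) R(2) by blast
      have "m y \<le> k" unfolding k_def using R(1) yf(1) by (intro Max_ge) auto
      then have dL: "depends (L y) (near y k)" using mL[OF yV] depends_mono near_mono by blast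
      have mLy: "Measurable.pred M (L y)" by (rule pred_finite_depends[OF finite_near[OF yV] near_subset dL])
      have img: "f ` e \<in> near x k" if "e \<in> near y k" for e
      proof -
        have e: "e \<in> E" "e \<inter> bl E y k \<noteq> {}" using that by (auto simp: near_def touching_def)
        have "bl E x k = f ` bl E y k" using bl_img[OF yf(2) order_refl yV, of k] unfolding img_E[OF yf(2)] yf(3) .
        then have "f ` e \<inter> bl E x k \<noteq> {}" using e(2) by blast
        then show ?thesis using auto_edge_image[OF yf(2) e(1)] by (simp add: near_def touching_def)
      qed
      have "depends (\<lambda>\<omega>. L y (shift f \<omega>)) (near x k)"
      proof (rule dependsI)
        fix \<omega> \<omega>' :: "'a set \<Rightarrow> bool" assume a: "\<And>j. j \<in> near x k \<Longrightarrow> \<omega> j = \<omega>' j"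
        show "L y (shift f \<omega>) = L y (shift f \<omega>')"
        proof (rule dependsD[OF dL])
          fix j assume "j \<in> near y k"
          then show "shift f \<omega> j = shift f \<omega>' j" using a[OF img] by (simp add: shift_def)
        qed
      qed
      moreover have "\<P>(\<omega> in M. G (opn \<omega>) x \<noteq> L y (shift f \<omega>)) = \<P>(\<omega> in M. G (opn \<omega>) y \<noteq> L y \<omega>)"
      proof -
        have m: "Measurable.pred M (\<lambda>\<omega>. G (opn \<omega>) y \<noteq> L y \<omega>)" by (intro pred_intros_logic pred_G yV mLy)
        show ?thesis using prob_shift[OF yf(2) m] unfolding G_shift[OF yf(2) yV] yf(3) .
      qed
      ultimately show ?thesis using mL[OF yV] by (intro exI[of _ "\<lambda>\<omega>. L y (shift f \<omega>)"]) simp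
    qed
    then show ?thesis by blast
  qed
  ultimately show ?thesis by blast
qed

text \<open>A large set contains \<open>k\<close> vertices that are far apart. Up to an error \<open>\<delta>\<close> for each,
  the events that they grow are determined by disjoint neighbourhoods, hence are independent with probabilities
  bounded below.\<close>
lemma large_sets_meet_G:
  assumes \<epsilon>: "0 < \<epsilon>"
  shows "\<exists>m. \<forall>A. finite A \<longrightarrow> A \<subseteq> V \<longrightarrow> m \<le> card A \<longrightarrow> \<P>(\<omega> in M. \<forall>x\<in>A. \<not> G (opn \<omega>) x) \<le> \<epsilon>"
proof -
  obtain \<theta> where \<theta>: "0 < \<theta>" "\<And>x. x \<in> V \<Longrightarrow> \<theta> \<le> \<P>(\<omega> in M. G (opn \<omega>) x)"
    and appr: "\<forall>\<delta>>0. \<exists>m. \<forall>x\<in>V. \<exists>L. depends L (near x m) \<and> \<P>(\<omega> in M. G (opn \<omega>) x \<noteq> L \<omega>) \<le> \<delta>"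
    using uniform_data by blast
  obtain x0 where x0: "x0 \<in> V" using V_ne by blast
  have \<theta>1: "\<theta> \<le> 1" by (rule order_trans[OF \<theta>(2)[OF x0] prob_le_1])
  have "(\<lambda>k. (1 - \<theta>/2) ^ k) \<longlonglongrightarrow> 0" using \<theta>(1) \<theta>1 by (intro LIMSEQ_power_zero) auto
  then have "\<forall>\<^sub>F k in sequentially. (1 - \<theta>/2) ^ k < \<epsilon>/2" by (rule order_tendstoD(2)) (use \<epsilon> in simp)
  then obtain k where k: "(1 - \<theta>/2) ^ k < \<epsilon>/2" by (auto simp: eventually_sequentially)
  \<comment> \<open>The first bound keeps the approximating events at probability at least \<open>\<theta>/2\<close>, the second makes the sum of \<open>k\<close> errors at most \<open>\<epsilon>/2\<close>.\<close>
  define \<delta> where "\<delta> = min (\<theta>/2) (\<epsilon> / (2 * (real k + 1)))"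
  have \<delta>: "0 < \<delta>" "\<delta> \<le> \<theta>/2" unfolding \<delta>_def using \<theta>(1) \<epsilon> by (simp, intro min.cobounded1)
  have "real k * \<delta> \<le> real k * (\<epsilon> / (2 * (real k + 1)))" unfolding \<delta>_def by (intro mult_left_mono min.cobounded2) simp
  also have "\<dots> \<le> \<epsilon>/2" using \<epsilon> by (simp add: field_simps)
  finally have k\<delta>: "real k * \<delta> \<le> \<epsilon>/2" .
  obtain m where m: "\<forall>x\<in>V. \<exists>L. depends L (near x m) \<and> \<P>(\<omega> in M. G (opn \<omega>) x \<noteq> L \<omega>) \<le> \<delta>"
    using appr \<delta>(1) by blast
  define gd where "gd x L \<longleftrightarrow> depends L (near x m) \<and> \<P>(\<omega> in M. G (opn \<omega>) x \<noteq> L \<omega>) \<le> \<delta>" for x L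
  have "\<forall>x\<in>V. \<exists>L. gd x L" unfolding gd_def by (rule m)
  then obtain L where gdL: "\<And>x. x \<in> V \<Longrightarrow> gd x (L x)" by metis
  have L: "\<And>x. x \<in> V \<Longrightarrow> depends (L x) (near x m)" "\<And>x. x \<in> V \<Longrightarrow> \<P>(\<omega> in M. G (opn \<omega>) x \<noteq> L x \<omega>) \<le> \<delta>"
    using gdL unfolding gd_def by blast+
  have mL: "Measurable.pred M (L x)" if "x \<in> V" for x
    by (rule pred_finite_depends[OF finite_near[OF that] near_subset L(1)[OF that]])
  have PL: "\<P>(\<omega> in M. \<not> L x \<omega>) \<le> 1 - \<theta>/2" if x: "x \<in> V" for x
  proof -
    have mG: "Measurable.pred M (\<lambda>\<omega>. \<not> G (opn \<omega>) x)" by (intro pred_intros_logic pred_G x)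
    have mD: "Measurable.pred M (\<lambda>\<omega>. G (opn \<omega>) x \<noteq> L x \<omega>)" by (intro pred_intros_logic pred_G x mL)
    have "\<P>(\<omega> in M. \<not> L x \<omega>) \<le> prob ({\<omega>\<in>space M. \<not> G (opn \<omega>) x} \<union> {\<omega>\<in>space M. G (opn \<omega>) x \<noteq> L x \<omega>})"
      by (rule finite_measure_mono[OF _ sets.Un[OF predE[OF mG] predE[OF mD]]]) blast
    also have "\<dots> \<le> \<P>(\<omega> in M. \<not> G (opn \<omega>) x) + \<P>(\<omega> in M. G (opn \<omega>) x \<noteq> L x \<omega>)"
      by (rule measure_Un_le[OF predE[OF mG] predE[OF mD]])
    also have "\<P>(\<omega> in M. \<not> G (opn \<omega>) x) = 1 - \<P>(\<omega> in M. G (opn \<omega>) x)" by (rule prob_neg[OF predE[OF pred_G[OF x]]])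
    finally show ?thesis using \<theta>(2)[OF x] L(2)[OF x] \<delta>(2) by linarith
  qed
  have prodL: "\<P>(\<omega> in M. \<forall>x\<in>S. \<not> L x \<omega>) \<le> (1 - \<theta>/2) ^ card S"
    if "finite S" "S \<subseteq> V" "\<forall>x\<in>S. \<forall>y\<in>S. x \<noteq> y \<longrightarrow> near x m \<inter> near y m = {}" for S
    using that
  proof (induction S)
    case empty
    then show ?case using prob_space by simp
  next
    case (insert x S)
    have xV: "x \<in> V" "S \<subseteq> V" using insert.prems by auto
    have "\<P>(\<omega> in M. \<not> L x \<omega> \<and> (\<forall>y\<in>S. \<not> L y \<omega>)) = \<P>(\<omega> in M. \<not> L x \<omega>) * \<P>(\<omega> in M. \<forall>y\<in>S. \<not> L y \<omega>)"
    proof (rule bits_indep)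
      show "Measurable.pred M (\<lambda>\<omega>. \<not> L x \<omega>)" by (intro pred_intros_logic mL xV)
      show "Measurable.pred M (\<lambda>\<omega>. \<forall>y\<in>S. \<not> L y \<omega>)"
        by (rule pred_intros_finite(3)[OF insert.hyps(1)], rule pred_intros_logic, rule mL) (use xV in blast)
      show "depends (\<lambda>\<omega>. \<not> L x \<omega>) (near x m)"
      proof (rule dependsI)
        fix \<omega> \<omega>' :: "'a set \<Rightarrow> bool" assume "\<And>j. j \<in> near x m \<Longrightarrow> \<omega> j = \<omega>' j"
        then have "L x \<omega> = L x \<omega>'" by (rule dependsD[OF L(1)[OF xV(1)]])
        then show "(\<not> L x \<omega>) = (\<not> L x \<omega>')" by simp
      qed
      show "depends (\<lambda>\<omega>. \<forall>y\<in>S. \<not> L y \<omega>) (\<Union>y\<in>S. near y m)"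
      proof (rule dependsI)
        fix \<omega> \<omega>' :: "'a set \<Rightarrow> bool" assume a: "\<And>j. j \<in> (\<Union>y\<in>S. near y m) \<Longrightarrow> \<omega> j = \<omega>' j"
        have "L y \<omega> = L y \<omega>'" if "y \<in> S" for y
          by (rule dependsD[OF L(1)]) (use that xV a in blast)+
        then show "(\<forall>y\<in>S. \<not> L y \<omega>) = (\<forall>y\<in>S. \<not> L y \<omega>')" by blast
      qed
      have d: "near x m \<inter> near y m = {}" if y: "y \<in> S" for y
      proof -
        have "x \<noteq> y" using y insert.hyps(2) by blast
        then show ?thesis using bspec[OF bspec[OF insert.prems(2) insertI1] insertI2[OF y]] by (rule mp[rotated])
      qed
      have "near x m \<inter> (\<Union>y\<in>S. near y m) = (\<Union>y\<in>S. near x m \<inter> near y m)" by blast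
      also have "\<dots> = {}" using d by simp
      finally show "E \<inter> near x m \<inter> (\<Union>y\<in>S. near y m) = {}" by (simp only: Int_assoc Int_empty_right)
    qed
    also have "\<dots> \<le> (1 - \<theta>/2) * (1 - \<theta>/2) ^ card S"
    proof (rule mult_mono[OF PL[OF xV(1)]])
      show "\<P>(\<omega> in M. \<forall>y\<in>S. \<not> L y \<omega>) \<le> (1 - \<theta>/2) ^ card S"
        by (rule insert.IH[OF xV(2)]) (rule ballI, rule ballI, rule bspec[OF bspec[OF insert.prems(2) insertI2] insertI2])
      show "0 \<le> 1 - \<theta>/2" using \<theta>1 by simp
    qed (rule measure_nonneg)
    also have "\<dots> = (1 - \<theta>/2) ^ card (insert x S)" unfolding card_insert_disjoint[OF insert.hyps] by (rule power_Suc[symmetric])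
    finally have "\<P>(\<omega> in M. \<not> L x \<omega> \<and> (\<forall>y\<in>S. \<not> L y \<omega>)) \<le> (1 - \<theta>/2) ^ card (insert x S)" .
    moreover have "{\<omega>\<in>space M. \<not> L x \<omega> \<and> (\<forall>y\<in>S. \<not> L y \<omega>)} = {\<omega>\<in>space M. \<forall>x\<in>insert x S. \<not> L x \<omega>}" by blast
    ultimately show ?case by (simp only:)
  qed
  have "\<P>(\<omega> in M. \<forall>x\<in>A. \<not> G (opn \<omega>) x) \<le> \<epsilon>"
    if A: "finite A" "A \<subseteq> V" "k * D ^ (2 * m + 1) \<le> card A" for A
  proof -
    obtain S where S: "S \<subseteq> A" "card S = k" "\<forall>x\<in>S. \<forall>y\<in>S. x \<noteq> y \<longrightarrow> near x m \<inter> near y m = {}"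
      using spread_subset[OF A] by blast
    have finS: "finite S" "S \<subseteq> V"
      by (rule finite_subset[OF S(1) A(1)], rule order_trans[OF S(1) A(2)])
    have mD: "{\<omega>\<in>space M. G (opn \<omega>) x \<noteq> L x \<omega>} \<in> events" if "x \<in> S" for x
      by (intro predE pred_intros_logic pred_G mL) (use that finS(2) in blast)+
    have mS: "{\<omega>\<in>space M. \<forall>x\<in>S. \<not> L x \<omega>} \<in> events"
      by (rule predE, rule pred_intros_finite(3)[OF finS(1)], rule pred_intros_logic, rule mL) (use finS in blast)
    have mU: "(\<Union>x\<in>S. {\<omega>\<in>space M. G (opn \<omega>) x \<noteq> L x \<omega>}) \<in> events" by (rule sets.finite_UN[OF finS(1) mD])
    have "\<P>(\<omega> in M. \<forall>x\<in>A. \<not> G (opn \<omega>) x) \<le> prob ({\<omega>\<in>space M. \<forall>x\<in>S. \<not> L x \<omega>} \<union> (\<Union>x\<in>S. {\<omega>\<in>space M. G (opn \<omega>) x \<noteq> L x \<omega>}))"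
      by (rule finite_measure_mono[OF _ sets.Un[OF mS mU]]) (use S(1) in blast)
    also have "\<dots> \<le> \<P>(\<omega> in M. \<forall>x\<in>S. \<not> L x \<omega>) + prob (\<Union>x\<in>S. {\<omega>\<in>space M. G (opn \<omega>) x \<noteq> L x \<omega>})"
      by (rule measure_Un_le[OF mS mU])
    also have "\<P>(\<omega> in M. \<forall>x\<in>S. \<not> L x \<omega>) \<le> (1 - \<theta>/2) ^ k" using prodL[OF finS S(3)] unfolding S(2) .
    also have "prob (\<Union>x\<in>S. {\<omega>\<in>space M. G (opn \<omega>) x \<noteq> L x \<omega>}) \<le> (\<Sum>x\<in>S. \<P>(\<omega> in M. G (opn \<omega>) x \<noteq> L x \<omega>))"
      by (rule finite_measure_subadditive_finite[OF finS(1)]) (intro image_subsetI mD)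
    also have "\<dots> \<le> (\<Sum>x\<in>S. \<delta>)" using finS(2) by (intro sum_mono L(2)) blast
    also have "\<dots> = real k * \<delta>" using S(2) by simp
    finally show ?thesis using k k\<delta> by linarith
  qed
  then show ?thesis by blast
qed

end

section \<open>Boundaries of clusters\<close>

context qt_graph
begin

definition bdry :: "'a set \<Rightarrow> 'a set" where "bdry A = {u\<in>V. u \<notin> A \<and> (\<exists>y\<in>A. {y, u} \<in> E)}"

lemma edge_in_clu:
  assumes "e \<in> K" "K \<subseteq> E" "e \<inter> clu K x \<noteq> {}"
  shows "e \<subseteq> clu K x"
proof -
  obtain s t where st: "e = {s, t}" using subsetD[OF assms(2,1)] by (rule edgeE)
  then consider "s \<in> clu K x" | "t \<in> clu K x" using assms(3) by blast
  then show ?thesis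
  proof cases
    case 1
    then have "t \<in> clu K x" using clu_edge[of s K x t] assms(1) st by blast
    then show ?thesis using 1 st by blast
  next
    case 2
    have "{t, s} \<in> K" using assms(1) st by (simp add: insert_commute)
    then have "s \<in> clu K x" using clu_edge[of t K x s] 2 by blast
    then show ?thesis using 2 st by blast
  qed
qed

lemma bl_off_clu:
  assumes "K \<subseteq> E" "clu K x \<inter> F = {}"
  shows "bl (off F K) x i = bl K x i"
proof (rule bl_cong_clu[symmetric])
  fix e assume e: "e \<inter> clu K x \<noteq> {}"
  show "(e \<in> K) = (e \<in> off F K)"
    using edge_in_clu[OF _ assms(1) e] assms(2) unfolding off_def by blast
qed

lemma clu_off: assumes "K \<subseteq> E" "clu K x \<inter> F = {}" shows "clu (off F K) x = clu K x"
proof -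
  have "bl (off F K) x = bl K x" by (rule ext) (rule bl_off_clu[OF assms])
  then show ?thesis unfolding clu_def by (simp only:)
qed

end

text \<open>Weights for which a vertex grows exactly when its cluster is infinite: the weighted average is
  \<open>card (bl K x n) / (n + 1)\<close>, and in an infinite cluster the ball of radius \<open>n\<close> has at
  least \<open>n + 1\<close> vertices.\<close>
abbreviation Ninf :: "nat \<Rightarrow> nat" where "Ninf \<equiv> Suc"
definition Hinf :: "nat \<Rightarrow> nat \<Rightarrow> real" where "Hinf n t = (if t = n then 1 / (real n + 1) else 0)"

lemma Hinf_sum: "(\<Sum>t<Ninf n. Hinf n t * f t) = f n / (real n + 1)"
  by (simp add: Hinf_def)

lemma growth_weights_inf: "growth_weights Ninf Hinf"
proof
  show "0 \<le> Hinf n t" for n t by (simp add: Hinf_def)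
  have "(\<Sum>t<Ninf n. Hinf n t) = 1 / (real n + 1)" for n using Hinf_sum[of n "\<lambda>_. 1"] by simp
  moreover have "(\<lambda>n. 1 / (real n + 1)) \<longlonglongrightarrow> 0" by real_asymp
  ultimately show "(\<lambda>n. \<Sum>t<Ninf n. Hinf n t) \<longlonglongrightarrow> 0" by (simp only:)
qed

lemma (in qt_graph) grows_inf_iff:
  assumes K: "K \<subseteq> E" and x: "x \<in> V"
  shows "grows Ninf Hinf K x \<longleftrightarrow> infinite (clu K x)"
proof
  assume inf: "infinite (clu K x)"
  have "1 \<le> (\<Sum>t<Ninf n. Hinf n t * real (card (bl K x t)))" for n
    unfolding Hinf_sum using infinite_clu_card[OF K x inf, of n] by (simp add: field_simps)
  then show "grows Ninf Hinf K x" unfolding grows_def by (intro exI[of _ 1]) auto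
next
  assume g: "grows Ninf Hinf K x"
  show "infinite (clu K x)"
  proof
    assume f: "finite (clu K x)"
    obtain c where c: "0 < c" "\<forall>m. \<exists>n\<ge>m. c \<le> (\<Sum>t<Ninf n. Hinf n t * real (card (bl K x t)))"
      using g unfolding grows_def by blast
    have le: "real (card (bl K x n)) \<le> real (card (clu K x))" for n
      using f by (simp add: card_mono clu_def UN_upper)
    obtain m where m: "real (card (clu K x)) / c < real m" using reals_Archimedean2 by blast
    obtain n where n: "m \<le> n" "c \<le> (\<Sum>t<Ninf n. Hinf n t * real (card (bl K x t)))" using c(2) by blast
    have "c * (real n + 1) \<le> real (card (bl K x n))" using n(2) unfolding Hinf_sum by (simp add: field_simps)
    also have "\<dots> \<le> real (card (clu K x))" by (rule le)
    also have "\<dots> < c * real m" using m c(1) by (simp add: field_simps)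
    also have "\<dots> \<le> c * (real n + 1)" using n(1) c(1) by (intro mult_left_mono) auto
    finally show False by simp
  qed
qed

section \<open>Exploring clusters in two coupled percolations\<close>

text \<open>Two nested percolations: at level \<open>False\<close> an edge is open when its first bit is set, at level
  \<open>True\<close> when one of its two bits is set. Both parameters are less than one, so that finitely many
  edges can be closed with positive probability.\<close>
locale coupling = qt_graph V E for V :: "'a set" and E +
  fixes a s :: real
  assumes a: "0 < a" "a < 1" and s: "0 < s" "s < 1" and V_ne: "V \<noteq> {}"
begin

definition J :: "('a set \<times> bool) set" where "J = E \<times> UNIV"
definition q :: "'a set \<times> bool \<Rightarrow> real" where "q j = (if snd j then s else a)"
abbreviation Nm where "Nm \<equiv> bits J q"

sublocale prob_space Nm by (rule prob_space_bits)

definition lev :: "bool \<Rightarrow> ('a set \<times> bool \<Rightarrow> bool) \<Rightarrow> 'a set \<Rightarrow> bool" where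
  "lev b \<omega> e \<longleftrightarrow> \<omega> (e, False) \<or> (b \<and> \<omega> (e, True))"
definition Ob :: "bool \<Rightarrow> ('a set \<times> bool \<Rightarrow> bool) \<Rightarrow> 'a set set" where
  "Ob b \<omega> = {e\<in>E. lev b \<omega> e}"
definition pr :: "bool \<Rightarrow> real" where "pr b = (if b then 1 - (1 - a) * (1 - s) else a)"
definition proj :: "bool \<Rightarrow> ('a set \<times> bool \<Rightarrow> bool) \<Rightarrow> 'a set \<Rightarrow> bool" where
  "proj b \<omega> = restrict (lev b \<omega>) E"

lemma opn_proj: "open_edges E (proj b \<omega>) = Ob b \<omega>"
  by (auto simp: open_edges_def proj_def Ob_def)

lemma Ob_subset: "Ob b \<omega> \<subseteq> E" by (auto simp: Ob_def)

lemma Ob_mono: "Ob False \<omega> \<subseteq> Ob b \<omega>" by (auto simp: Ob_def lev_def)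

lemma JI: "e \<in> E \<Longrightarrow> (e, b) \<in> J" by (simp add: J_def)

lemma countable_J: "countable J" unfolding J_def by (intro countable_SIGMA countable_E countable_finite) simp

lemma q01: "0 < q j" "q j < 1" using a s by (simp_all add: q_def)

lemma prob_coord: "j \<in> J \<Longrightarrow> \<P>(\<omega> in Nm. \<omega> j = c) = (if c then q j else 1 - q j)"
  by (rule prob_bit[where q=q]) (simp_all add: less_imp_le[OF q01(1)] less_imp_le[OF q01(2)])

lemma prob_coord_pos: "j \<in> J \<Longrightarrow> 0 < \<P>(\<omega> in Nm. \<omega> j = c)"
  unfolding prob_coord using q01[of j] by (cases c) simp_all

lemma pr01: "0 < pr b" "pr b < 1"
proof -
  have "0 < (1 - a) * (1 - s)" "(1 - a) * (1 - s) < 1 * 1" using a s by (simp, intro mult_strict_mono, simp_all)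
  then show "0 < pr b" "pr b < 1" using a by (simp_all add: pr_def)
qed

lemma pred_lev: "e \<in> E \<Longrightarrow> Measurable.pred Nm (\<lambda>\<omega>. lev b \<omega> e)"
proof -
  assume e: "e \<in> E"
  have "Measurable.pred Nm (\<lambda>\<omega>. \<omega> (e, False) \<or> (b \<and> \<omega> (e, True)))"
    by (intro pred_intros_logic pred_bits_coord JI e) (cases b, simp_all)
  then show ?thesis unfolding lev_def .
qed

lemma prob_lev: assumes e: "e \<in> E" shows "\<P>(\<omega> in Nm. lev b \<omega> e) = pr b"
proof (cases b)
  case False
  have "\<P>(\<omega> in Nm. lev b \<omega> e) = \<P>(\<omega> in Nm. \<omega> (e, False) = True)" using False by (simp only: lev_def simp_thms)
  also have "\<dots> = a" unfolding prob_coord[OF JI[OF e]] by (simp add: q_def)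
  finally show ?thesis using False by (simp add: pr_def)
next
  case True
  have m: "Measurable.pred Nm (\<lambda>\<omega>. \<omega> (e, c) = False)" for c
    by (rule measurable_compose[OF pred_bits_coord[OF JI[OF e]]]) simp
  have "\<P>(\<omega> in Nm. \<not> lev b \<omega> e) = \<P>(\<omega> in Nm. \<omega> (e, False) = False \<and> \<omega> (e, True) = False)"
    using True by (simp only: lev_def simp_thms de_Morgan_disj)
  also have "\<dots> = \<P>(\<omega> in Nm. \<omega> (e, False) = False) * \<P>(\<omega> in Nm. \<omega> (e, True) = False)"
    by (rule bits_indep[OF m m, where X="{(e, False)}" and Y="{(e, True)}"]) (auto simp: depends_def)
  also have "\<dots> = (1 - a) * (1 - s)" unfolding prob_coord[OF JI[OF e]] by (simp add: q_def)
  finally have "\<P>(\<omega> in Nm. \<not> lev b \<omega> e) = (1 - a) * (1 - s)" .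
  moreover have "\<P>(\<omega> in Nm. \<not> lev b \<omega> e) = 1 - \<P>(\<omega> in Nm. lev b \<omega> e)" by (rule prob_neg[OF predE[OF pred_lev[OF e]]])
  ultimately show ?thesis using True by (simp add: pr_def)
qed

lemma distr_proj: "distr Nm (bits E (\<lambda>_. pr b)) (proj b) = bits E (\<lambda>_. pr b)"
  unfolding proj_def
proof (rule distr_bits[where blk="\<lambda>e. {(e, False), (e, True)}"])
  fix e assume e: "e \<in> E"
  show "Measurable.pred Nm (\<lambda>\<omega>. lev b \<omega> e)" by (rule pred_lev[OF e])
  show "depends (\<lambda>\<omega>. lev b \<omega> e) {(e, False), (e, True)}" by (rule dependsI) (simp add: lev_def)
  show "0 \<le> pr b \<and> pr b \<le> 1 \<and> \<P>(\<omega> in Nm. lev b \<omega> e) = pr b" using prob_lev[OF e, of b] pr01[of b] by simp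
qed blast

lemma measurable_proj: "proj b \<in> measurable Nm (bits E (\<lambda>_. pr b))"
  unfolding proj_def by (rule measurable_bits_into) (rule pred_lev)

lemma prob_proj:
  assumes "Measurable.pred (bits E (\<lambda>_. pr b)) P"
  shows "\<P>(\<omega> in Nm. P (proj b \<omega>)) = \<P>(\<omega> in bits E (\<lambda>_. pr b). P \<omega>)"
proof -
  let ?E = "bits E (\<lambda>_. pr b)"
  have "\<P>(\<omega> in ?E. P \<omega>) = measure (distr Nm ?E (proj b)) {\<omega>\<in>space ?E. P \<omega>}" by (simp only: distr_proj)
  also have "\<dots> = measure Nm (proj b -` {\<omega>\<in>space ?E. P \<omega>} \<inter> space Nm)"
    by (rule measure_distr[OF measurable_proj predE[OF assms]])
  also have "proj b -` {\<omega>\<in>space ?E. P \<omega>} \<inter> space Nm = {\<omega>\<in>space Nm. P (proj b \<omega>)}"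
    using measurable_space[OF measurable_proj, of _ b] by blast
  finally show ?thesis by simp
qed

lemma AE_proj:
  assumes "Measurable.pred (bits E (\<lambda>_. pr b)) P" "AE \<omega> in Nm. P (proj b \<omega>)"
  shows "AE \<omega> in bits E (\<lambda>_. pr b). P \<omega>"
proof -
  have "AE \<omega> in distr Nm (bits E (\<lambda>_. pr b)) (proj b). P \<omega>"
    using assms(2) by (subst AE_distr_iff[OF measurable_proj predE[OF assms(1)]])
  then show ?thesis by (simp only: distr_proj)
qed

lemma random_edges_Ob: "random_edges Nm (Ob b)"
  unfolding random_edges_def
proof (intro conjI allI ballI Ob_subset)
  fix e assume e: "e \<in> E"
  then have "(\<lambda>\<omega>. e \<in> Ob b \<omega>) = (\<lambda>\<omega>. lev b \<omega> e)" by (simp add: Ob_def)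
  then show "Measurable.pred Nm (\<lambda>\<omega>. e \<in> Ob b \<omega>)" using pred_lev[OF e, of b] by (simp only:)
qed

text \<open>The bad event when the cluster at level \<open>c\<close> is explored in search of vertices that grow at level
  \<open>b\<close>. Two levels are kept apart because each of them plays both parts later.\<close>
definition untouched :: "(nat \<Rightarrow> nat) \<Rightarrow> (nat \<Rightarrow> nat \<Rightarrow> real) \<Rightarrow> bool \<Rightarrow> bool \<Rightarrow> 'a \<Rightarrow> ('a set \<times> bool \<Rightarrow> bool) \<Rightarrow> bool" where
  "untouched N H c b v \<omega> \<longleftrightarrow> infinite (clu (Ob c \<omega>) v) \<and>
     (\<forall>x\<in>V. \<forall>y\<in>V. y \<in> clu (Ob c \<omega>) v \<longrightarrow> (y = x \<or> {y, x} \<in> E) \<longrightarrow> \<not> grows N H (Ob b \<omega>) x)"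

lemma pred_grows_Ob:
  assumes "growth_weights N H" "x \<in> V"
  shows "Measurable.pred Nm (\<lambda>\<omega>. grows N H (Ob b \<omega>) x)"
proof -
  interpret growing V E N H using assms(1) by (intro growing.intro qt_graph_axioms)
  show ?thesis by (rule pred_grows[OF random_edges_Ob assms(2)])
qed

lemma pred_untouched:
  assumes "growth_weights N H" "v \<in> V"
  shows "Measurable.pred Nm (untouched N H c b v)"
proof -
  have "Measurable.pred Nm (\<lambda>\<omega>. infinite (clu (Ob c \<omega>) v) \<and>
     (\<forall>x\<in>V. \<forall>y\<in>V. y \<in> clu (Ob c \<omega>) v \<longrightarrow> (y = x \<or> {y, x} \<in> E) \<longrightarrow> \<not> grows N H (Ob b \<omega>) x))"
  proof (intro pred_intros_logic(3) pred_infinite_clu random_edges_Ob assms(2) pred_ball_countable countable_V)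
    fix x y assume x: "x \<in> V"
    have "Measurable.pred Nm (\<lambda>\<omega>. \<not> grows N H (Ob b \<omega>) x)" by (intro pred_intros_logic pred_grows_Ob assms x)
    then show "Measurable.pred Nm (\<lambda>\<omega>. y \<in> clu (Ob c \<omega>) v \<longrightarrow> (y = x \<or> {y, x} \<in> E) \<longrightarrow> \<not> grows N H (Ob b \<omega>) x)"
      by (cases "y = x \<or> {y, x} \<in> E") (simp_all only: simp_thms pred_intros_logic(4)[OF pred_clu[OF random_edges_Ob]] measurable_const space_count_space UNIV_I)
  qed
  then show ?thesis unfolding untouched_def[abs_def] .
qed

text \<open>Explore the ball of radius \<open>m\<close> in the cluster of \<open>v\<close>; if the cluster is infinite this ball
  \<open>A\<close> has more than \<open>m\<close> vertices, and such a set is unlikely to contain no growing vertex.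
  By \<open>grows_leave\<close> the event \<open>Q A\<close> that no boundary vertex of \<open>A\<close> grows off
  \<open>A\<close> is then unlikely as well. It depends on unexplored edges only, so it remains unlikely given that
  the explored ball is \<open>A\<close>.\<close>
lemma untouched_null:
  assumes gp: "growing_perc V E (pr b) N H" and v: "v \<in> V"
  shows "AE \<omega> in Nm. \<not> untouched N H c b v \<omega>"
proof -
  interpret gp: growing_perc V E "pr b" N H by (rule gp)
  have gw: "growth_weights N H" by (rule gp.growth_weights_axioms)
  have mU: "Measurable.pred Nm (untouched N H c b v)" by (rule pred_untouched[OF gw v])
  have "\<P>(\<omega> in Nm. untouched N H c b v \<omega>) \<le> \<epsilon>" if \<epsilon>: "0 < \<epsilon>" for \<epsilon>
  proof -
    obtain m where m: "\<And>A. finite A \<Longrightarrow> A \<subseteq> V \<Longrightarrow> m \<le> card A \<Longrightarrow>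
        \<P>(\<omega> in bits E (\<lambda>_. pr b). \<forall>x\<in>A. \<not> grows N H (open_edges E \<omega>) x) \<le> \<epsilon>"
      using gp.large_sets_meet_G[OF \<epsilon>] by blast
    let ?AA = "{A\<in>Pow (bl E v m). m \<le> card A}"
    define Q where "Q A \<omega> \<longleftrightarrow> (\<forall>u\<in>bdry A. \<not> grows N H (off A (Ob b \<omega>)) u)" for A \<omega>
    have fin: "finite (bl E v m)" by (rule finite_bl[OF order_refl v])
    have inV: "bl E v m \<subseteq> V" by (rule bl_subset_V[OF order_refl v])
    have AA: "finite A" "A \<subseteq> V" if "A \<in> ?AA" for A using that fin inV finite_subset by auto
    have sub: "bl (Ob c \<omega>) v m \<subseteq> bl E v m" for \<omega> by (rule bl_mono[OF Ob_subset])
    have bdV: "bdry A \<subseteq> V" for A by (auto simp: bdry_def)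
    have mB: "Measurable.pred Nm (\<lambda>\<omega>. bl (Ob c \<omega>) v m = A)" for A
      by (rule pred_set_eq[OF fin sub pred_bl[OF random_edges_Ob]])
    have mG: "Measurable.pred Nm (\<lambda>\<omega>. grows N H (off A (Ob b \<omega>)) u)" if "u \<in> V" for A u
      by (rule gp.pred_grows[OF random_edges_off[OF random_edges_Ob] that])
    have mQ: "Measurable.pred Nm (Q A)" for A
    proof -
      have "Measurable.pred Nm (\<lambda>\<omega>. \<forall>u\<in>bdry A. \<not> grows N H (off A (Ob b \<omega>)) u)"
        by (rule pred_ball_countable[OF countable_subset[OF bdV countable_V]], rule pred_intros_logic, rule mG) (use bdV in blast)
      then show ?thesis unfolding Q_def[abs_def] .
    qed
    have dB: "depends (\<lambda>\<omega>. bl (Ob c \<omega>) v m = A) (touching A \<times> UNIV)" for A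
    proof (rule dependsI)
      have half: "bl (Ob c \<omega>') v m = A" if ag: "\<And>j. j \<in> touching A \<times> UNIV \<Longrightarrow> \<omega> j = \<omega>' j" and A: "bl (Ob c \<omega>) v m = A" for \<omega> \<omega>'
      proof -
        have "bl (Ob c \<omega>) v m = bl (Ob c \<omega>') v m"
        proof (rule bl_local'[OF _ order_refl])
          fix e assume "e \<inter> bl (Ob c \<omega>) v m \<noteq> {}"
          then have "e \<in> touching A" if "e \<in> E" using that A by (auto simp: touching_def)
          then show "e \<in> Ob c \<omega> \<longleftrightarrow> e \<in> Ob c \<omega>'"
            using ag[of "(e, False)"] ag[of "(e, True)"] by (auto simp: Ob_def lev_def)
        qed
        then show ?thesis using A by simp
      qed
      fix \<omega> \<omega>' :: "'a set \<times> bool \<Rightarrow> bool" assume ag: "\<And>j. j \<in> touching A \<times> UNIV \<Longrightarrow> \<omega> j = \<omega>' j"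
      show "(bl (Ob c \<omega>) v m = A) = (bl (Ob c \<omega>') v m = A)"
        using half[of \<omega> \<omega>'] half[of \<omega>' \<omega>] ag by metis
    qed
    have dQ: "depends (Q A) (- (touching A \<times> UNIV))" for A
    proof (rule dependsI)
      fix \<omega> \<omega>' :: "'a set \<times> bool \<Rightarrow> bool" assume ag: "\<And>j. j \<in> - (touching A \<times> UNIV) \<Longrightarrow> \<omega> j = \<omega>' j"
      have "off A (Ob b \<omega>) = off A (Ob b \<omega>')"
      proof -
        have "e \<in> off A (Ob b \<omega>) \<longleftrightarrow> e \<in> off A (Ob b \<omega>')" for e
        proof (cases "e \<in> touching A")
          case True
          then show ?thesis by (auto simp: off_def touching_def)
        next
          case False
          then have "lev b \<omega> e = lev b \<omega>' e" using ag[of "(e, False)"] ag[of "(e, True)"] by (simp add: lev_def)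
          then show ?thesis by (simp add: off_def Ob_def)
        qed
        then show ?thesis by blast
      qed
      then show "Q A \<omega> = Q A \<omega>'" unfolding Q_def by (simp only:)
    qed
    \<comment> \<open>If a vertex of \<open>A\<close> grows then a boundary vertex of \<open>A\<close> grows off \<open>A\<close>, so \<open>Q A\<close> forces all of \<open>A\<close> not to grow.\<close>
    have PQ: "\<P>(\<omega> in Nm. Q A \<omega>) \<le> \<epsilon>" if A: "A \<in> ?AA" for A
    proof -
      have mA: "Measurable.pred (bits E (\<lambda>_. pr b)) (\<lambda>\<omega>. \<forall>x\<in>A. \<not> grows N H (open_edges E \<omega>) x)"
        by (rule pred_intros_finite(3)[OF AA(1)[OF A]], rule pred_intros_logic, rule gp.pred_G) (use AA(2)[OF A] in blast)
      have mA': "Measurable.pred Nm (\<lambda>\<omega>. \<forall>x\<in>A. \<not> grows N H (Ob b \<omega>) x)"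
        by (rule pred_intros_finite(3)[OF AA(1)[OF A]], rule pred_intros_logic, rule pred_grows_Ob[OF gw]) (use AA(2)[OF A] in blast)
      have imp: "\<forall>x\<in>A. \<not> grows N H (Ob b \<omega>) x" if "Q A \<omega>" for \<omega>
      proof (intro ballI notI)
        fix x assume x: "x \<in> A" and g: "grows N H (Ob b \<omega>) x"
        obtain u y where u: "u \<notin> A" "y \<in> A" "{y, u} \<in> Ob b \<omega>" "grows N H (off A (Ob b \<omega>)) u"
          using gp.grows_leave[OF AA[OF A] Ob_subset x g] by blast
        have "{y, u} \<in> E" using u(3) Ob_subset by blast
        then have "u \<in> bdry A" using u(1,2) edge_in_V unfolding bdry_def by blast
        then show False using that u(4) unfolding Q_def by blast
      qed
      have "\<P>(\<omega> in Nm. Q A \<omega>) \<le> \<P>(\<omega> in Nm. \<forall>x\<in>A. \<not> grows N H (Ob b \<omega>) x)"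
        by (rule finite_measure_mono[OF _ predE[OF mA']]) (use imp in blast)
      also have "\<dots> = \<P>(\<omega> in bits E (\<lambda>_. pr b). \<forall>x\<in>A. \<not> grows N H (open_edges E \<omega>) x)"
        using prob_proj[OF mA] unfolding opn_proj .
      also have "\<dots> \<le> \<epsilon>" using A by (intro m AA) auto
      finally show ?thesis .
    qed
    have mBQ: "Measurable.pred Nm (\<lambda>\<omega>. bl (Ob c \<omega>) v m = A \<and> Q A \<omega>)" for A by (intro pred_intros_logic(3) mB mQ)
    have finAA: "finite ?AA" using fin by simp
    have "\<P>(\<omega> in Nm. untouched N H c b v \<omega>) \<le> prob (\<Union>A\<in>?AA. {\<omega>\<in>space Nm. bl (Ob c \<omega>) v m = A \<and> Q A \<omega>})"
    proof (rule finite_measure_mono)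
      show "(\<Union>A\<in>?AA. {\<omega>\<in>space Nm. bl (Ob c \<omega>) v m = A \<and> Q A \<omega>}) \<in> events" by (rule sets.finite_UN[OF finAA predE[OF mBQ]])
      show "{\<omega>\<in>space Nm. untouched N H c b v \<omega>} \<subseteq> (\<Union>A\<in>?AA. {\<omega>\<in>space Nm. bl (Ob c \<omega>) v m = A \<and> Q A \<omega>})"
      proof
        fix \<omega> assume "\<omega> \<in> {\<omega>\<in>space Nm. untouched N H c b v \<omega>}"
        then have \<omega>: "\<omega> \<in> space Nm" and U: "untouched N H c b v \<omega>" by blast+
        let ?A = "bl (Ob c \<omega>) v m"
        have "infinite (clu (Ob c \<omega>) v)" using U by (simp add: untouched_def)
        then have "m \<le> card ?A" using infinite_clu_card[OF Ob_subset v, of c \<omega> m] by simp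
        moreover have "Q ?A \<omega>" unfolding Q_def
        proof (intro ballI notI)
          fix u assume u: "u \<in> bdry ?A" and g: "grows N H (off ?A (Ob b \<omega>)) u"
          have uV: "u \<in> V" using u bdV by blast
          have g': "grows N H (Ob b \<omega>) u" by (rule gp.grows_mono[OF off_subset Ob_subset uV g])
          obtain y where y: "y \<in> ?A" "{y, u} \<in> E" using u by (auto simp: bdry_def)
          have "y \<in> clu (Ob c \<omega>) v" using y(1) by (auto simp: clu_def)
          moreover have "y \<in> V" using y(1) sub inV by blast
          ultimately show False using U g' y(2) uV unfolding untouched_def by blast
        qed
        ultimately show "\<omega> \<in> (\<Union>A\<in>?AA. {\<omega>\<in>space Nm. bl (Ob c \<omega>) v m = A \<and> Q A \<omega>})" using \<omega> sub by blast
      qed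
    qed
    also have "\<dots> \<le> (\<Sum>A\<in>?AA. \<P>(\<omega> in Nm. bl (Ob c \<omega>) v m = A \<and> Q A \<omega>))"
      by (rule finite_measure_subadditive_finite[OF finAA]) (intro image_subsetI predE mBQ)
    also have "\<dots> = (\<Sum>A\<in>?AA. \<P>(\<omega> in Nm. bl (Ob c \<omega>) v m = A) * \<P>(\<omega> in Nm. Q A \<omega>))"
      by (intro sum.cong refl bits_indep[OF mB mQ dB dQ]) blast
    also have "\<dots> \<le> (\<Sum>A\<in>?AA. \<P>(\<omega> in Nm. bl (Ob c \<omega>) v m = A) * \<epsilon>)"
      by (intro sum_mono mult_left_mono PQ measure_nonneg)
    also have "\<dots> = (\<Sum>A\<in>?AA. \<P>(\<omega> in Nm. bl (Ob c \<omega>) v m = A)) * \<epsilon>" by (rule sum_distrib_right[symmetric])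
    also have "\<dots> \<le> 1 * \<epsilon>"
    proof (rule mult_right_mono)
      have "(\<Sum>A\<in>?AA. \<P>(\<omega> in Nm. bl (Ob c \<omega>) v m = A)) = prob (\<Union>A\<in>?AA. {\<omega>\<in>space Nm. bl (Ob c \<omega>) v m = A})"
      proof (rule finite_measure_finite_Union[OF finAA, symmetric])
        show "disjoint_family_on (\<lambda>A. {\<omega>\<in>space Nm. bl (Ob c \<omega>) v m = A}) ?AA" unfolding disjoint_family_on_def by blast
        show "(\<lambda>A. {\<omega>\<in>space Nm. bl (Ob c \<omega>) v m = A}) ` ?AA \<subseteq> events" by (intro image_subsetI predE mB)
      qed
      then show "(\<Sum>A\<in>?AA. \<P>(\<omega> in Nm. bl (Ob c \<omega>) v m = A)) \<le> 1" by (simp only: prob_le_1)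
    qed (use \<epsilon> in simp)
    finally show ?thesis by simp
  qed
  then have "\<P>(\<omega> in Nm. untouched N H c b v \<omega>) \<le> 0" by (rule dense_ge)
  then have "\<P>(\<omega> in Nm. untouched N H c b v \<omega>) = 0" using measure_nonneg by (rule order_antisym)
  then have "AE \<omega> in Nm. \<omega> \<notin> {\<omega>\<in>space Nm. untouched N H c b v \<omega>}" by (simp only: prob_eq_0[OF predE[OF mU]])
  then show ?thesis using AE_space by eventually_elim blast
qed

text \<open>If no vertex of the cluster grows and only a finite set \<open>F\<close> of boundary vertices does, close all edges
  touching \<open>F\<close>. The cluster is unchanged and a vertex of \<open>F\<close>, now isolated, does not grow,
  so the modified configuration is untouched. There are countably many \<open>F\<close>.\<close>
lemma meets_or_touches_infinitely_often:
  assumes gp: "growing_perc V E (pr b) N H" and v: "v \<in> V"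
  shows "AE \<omega> in Nm. infinite (clu (Ob c \<omega>) v) \<longrightarrow>
    (\<exists>x\<in>clu (Ob c \<omega>) v. grows N H (Ob b \<omega>) x) \<or> infinite {u\<in>bdry (clu (Ob c \<omega>) v). grows N H (Ob b \<omega>) u}"
proof -
  interpret gp: growing_perc V E "pr b" N H by (rule gp)
  have gw: "growth_weights N H" by (rule gp.growth_weights_axioms)
  let ?FF = "{F. finite F \<and> F \<subseteq> V}"
  have cFF: "countable ?FF" by (rule countable_Collect_finite_subset[OF countable_V])
  have null: "AE \<omega> in Nm. \<not> untouched N H c b v (restrict (overwrite (touching F \<times> UNIV) False \<omega>) J)" if F: "F \<in> ?FF" for F
  proof (rule finite_modification_null[OF pred_untouched[OF gw v]])
    have "finite F" "F \<subseteq> V" using F by simp_all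
    then have "finite (touching F)" by (rule finite_touching)
    then show "finite (touching F \<times> (UNIV :: bool set))" by (intro finite_cartesian_product finite)
    show sub: "touching F \<times> UNIV \<subseteq> J" unfolding J_def by (rule Sigma_mono[OF touching_subset order_refl])
    show "0 < \<P>(\<omega> in Nm. \<omega> j = False)" if "j \<in> touching F \<times> UNIV" for j
      by (rule prob_coord_pos[OF subsetD[OF sub that]])
    show "AE \<omega> in Nm. \<not> untouched N H c b v \<omega>" by (rule untouched_null[OF gp v])
  qed
  have "AE \<omega> in Nm. \<forall>F\<in>?FF. \<not> untouched N H c b v (restrict (overwrite (touching F \<times> UNIV) False \<omega>) J)"
    by (subst AE_ball_countable[OF cFF]) (rule ballI, rule null)
  then show ?thesis
  proof eventually_elim
    case (elim \<omega>)
    show ?case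
    proof (rule impI, rule ccontr)
      let ?C = "clu (Ob c \<omega>) v"
      let ?F = "{u\<in>bdry ?C. grows N H (Ob b \<omega>) u}"
      assume inf: "infinite ?C" and neg: "\<not> ((\<exists>x\<in>?C. grows N H (Ob b \<omega>) x) \<or> infinite ?F)"
      have FV: "?F \<subseteq> V" by (auto simp: bdry_def)
      have F: "?F \<in> ?FF" using neg FV by blast
      let ?\<omega>' = "restrict (overwrite (touching ?F \<times> UNIV) False \<omega>) J"
      \<comment> \<open>The modification closes the edges touching \<open>?F\<close> at both levels.\<close>
      have O': "Ob d ?\<omega>' = off ?F (Ob d \<omega>)" for d
        by (auto simp: Ob_def lev_def off_def overwrite_def touching_def J_def)
      have disj: "?C \<inter> ?F = {}" by (auto simp: bdry_def)
      have C': "clu (Ob c ?\<omega>') v = ?C" unfolding O' by (rule clu_off[OF Ob_subset disj])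
      have "untouched N H c b v ?\<omega>'"
        unfolding untouched_def C'
      proof (intro conjI inf ballI impI notI)
        fix x y assume x: "x \<in> V" and y: "y \<in> V" "y \<in> ?C" "y = x \<or> {y, x} \<in> E" and g: "grows N H (Ob b ?\<omega>') x"
        have g0: "grows N H (Ob b \<omega>) x" using gp.grows_mono[OF _ Ob_subset x g] unfolding O' using off_subset by blast
        then have "x \<notin> ?C" using neg by blast
        then have "x \<in> bdry ?C" using x y unfolding bdry_def by blast
        then have xF: "x \<in> ?F" using g0 by blast
        obtain u where "{x, u} \<in> Ob b ?\<omega>'"
          using gp.grows_leave[of "{x}" "Ob b ?\<omega>'" x] Ob_subset x g by blast
        then show False using xF unfolding O' off_def by blast
      qed
      then show False using elim F by blast
    qed
  qed
qed

end

context coupling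
begin

text \<open>\<open>self_blind_not_all_closed\<close> for the second bits of a set of edges that is found from the first bits and
  from the second bits of other edges.\<close>
lemma revealed_last_not_all_closed:
  fixes X :: "('a set \<times> bool \<Rightarrow> bool) \<Rightarrow> 'a set set"
  assumes XE: "\<And>\<omega>. X \<omega> \<subseteq> E"
    and mX: "\<And>e. e \<in> E \<Longrightarrow> Measurable.pred Nm (\<lambda>\<omega>. e \<in> X \<omega>)"
    and blind: "\<And>\<omega> \<omega>'. (\<And>e. \<omega> (e, False) = \<omega>' (e, False)) \<Longrightarrow> (\<And>e. e \<notin> X \<omega> \<Longrightarrow> \<omega> (e, True) = \<omega>' (e, True)) \<Longrightarrow> X \<omega>' = X \<omega>"
  shows "AE \<omega> in Nm. \<not> (infinite (X \<omega>) \<and> (\<forall>e\<in>X \<omega>. e \<notin> Ob True \<omega>))"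
proof -
  let ?Y = "\<lambda>\<omega>. (\<lambda>e. (e, True)) ` X \<omega>"
  have "AE \<omega> in Nm. \<not> (infinite (?Y \<omega>) \<and> (\<forall>j\<in>?Y \<omega>. \<not> \<omega> j))"
  proof (rule self_blind_not_all_closed[OF countable_J _ _ s(1) less_imp_le[OF s(2)]])
    show "q j \<le> 1" for j using q01[of j] by simp
    show "s \<le> q j" if "j \<in> ?Y \<omega>" for \<omega> j using that by (auto simp: q_def)
    show "?Y \<omega> \<subseteq> J" for \<omega> using XE[of \<omega>] by (auto simp: J_def)
    show "Measurable.pred Nm (\<lambda>\<omega>. j \<in> ?Y \<omega>)" if "j \<in> J" for j
    proof (cases j)
      case (Pair e c)
      have e: "e \<in> E" using that Pair by (simp add: J_def)
      show ?thesis
      proof (cases c)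
        case True
        have "(\<lambda>\<omega>. j \<in> ?Y \<omega>) = (\<lambda>\<omega>. e \<in> X \<omega>)" using Pair True by (intro ext) auto
        then show ?thesis using mX[OF e] by (simp only:)
      next
        case False
        have "(\<lambda>\<omega>. j \<in> ?Y \<omega>) = (\<lambda>\<omega>. False)" using Pair False by (intro ext) auto
        then show ?thesis by simp
      qed
    qed
    fix \<omega> \<omega>' :: "'a set \<times> bool \<Rightarrow> bool" and F assume F: "F \<subseteq> ?Y \<omega>" and ag: "\<And>j. j \<notin> F \<Longrightarrow> \<omega> j = \<omega>' j"
    have "X \<omega>' = X \<omega>"
    proof (rule blind)
      fix e
      have "(e, False) \<notin> F" using F by blast
      then show "\<omega> (e, False) = \<omega>' (e, False)" by (rule ag)
      assume "e \<notin> X \<omega>"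
      then have "(e, True) \<notin> F" using F by blast
      then show "\<omega> (e, True) = \<omega>' (e, True)" by (rule ag)
    qed
    then show "?Y \<omega>' = ?Y \<omega>" by (simp only:)
  qed
  then show ?thesis
  proof eventually_elim
    case (elim \<omega>)
    have "finite (?Y \<omega>) \<longleftrightarrow> finite (X \<omega>)" by (rule finite_image_iff) (simp add: inj_on_def)
    moreover have "\<not> \<omega> (e, True)" if "e \<in> X \<omega>" "e \<notin> Ob True \<omega>" for e
      using that XE[of \<omega>] by (auto simp: Ob_def lev_def)
    ultimately show ?case using elim by blast
  qed
qed

lemma infinitely_many_edges:
  assumes "infinite U" "\<And>u. u \<in> U \<Longrightarrow> \<exists>y. {y, u} \<in> X"  "X \<subseteq> E"
  shows "infinite X"
proof
  assume "finite X"
  moreover have "finite e" if "e \<in> X" for e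
    using subsetD[OF assms(3) that] by (rule edgeE) simp
  ultimately have "finite (\<Union>X)" by blast
  moreover have "U \<subseteq> \<Union>X" using assms(2) by blast
  ultimately show False using assms(1) finite_subset by blast
qed

lemma Ob_False_cong: "(\<And>e. \<omega> (e, False) = \<omega>' (e, False)) \<Longrightarrow> Ob False \<omega> = Ob False \<omega>'"
  by (simp add: Ob_def lev_def)

lemma off_Ob_cong:
  assumes "\<And>e. \<omega> (e, False) = \<omega>' (e, False)" "\<And>e. e \<inter> W = {} \<Longrightarrow> \<omega> (e, True) = \<omega>' (e, True)"
  shows "off W (Ob True \<omega>) = off W (Ob True \<omega>')"
  using assms by (auto simp: off_def Ob_def lev_def)

text \<open>Let \<open>W\<close> be the set of vertices that grow at the lower level, which is known from the first bits.
  Explore the cluster of \<open>v\<close> at the upper level without using edges that touch \<open>W\<close>, and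
  let \<open>X\<close> be the edges from it to \<open>W\<close>; their second bits are not looked at. If the whole
  cluster avoids \<open>W\<close> then the exploration finds all of it, \<open>X\<close> is infinite, and all its
  edges are closed.\<close>
lemma large_cluster_contains_good:
  assumes gp: "growing_perc V E (pr False) N H" and v: "v \<in> V"
  shows "AE \<omega> in Nm. infinite (clu (Ob True \<omega>) v) \<longrightarrow> (\<exists>x\<in>clu (Ob True \<omega>) v. grows N H (Ob False \<omega>) x)"
proof -
  interpret gp: growing_perc V E "pr False" N H by (rule gp)
  have gw: "growth_weights N H" by (rule gp.growth_weights_axioms)
  define W where "W \<omega> = {u\<in>V. grows N H (Ob False \<omega>) u}" for \<omega>
  define X where "X \<omega> = {e\<in>E. \<exists>y\<in>V. \<exists>u\<in>V. e = {y, u} \<and> grows N H (Ob False \<omega>) u \<and> y \<in> clu (off (W \<omega>) (Ob True \<omega>)) v}" for \<omega>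
  have re: "random_edges Nm (\<lambda>\<omega>. off (W \<omega>) (Ob True \<omega>))"
    unfolding random_edges_def
  proof (intro conjI allI ballI)
    show "off (W \<omega>) (Ob True \<omega>) \<subseteq> E" for \<omega> using off_subset Ob_subset by blast
    fix e assume e: "e \<in> E"
    have "(\<lambda>\<omega>. e \<in> off (W \<omega>) (Ob True \<omega>)) = (\<lambda>\<omega>. e \<in> Ob True \<omega> \<and> (\<forall>u\<in>V. u \<in> e \<longrightarrow> \<not> grows N H (Ob False \<omega>) u))"
      unfolding off_def W_def by (rule ext) blast
    moreover have "Measurable.pred Nm (\<lambda>\<omega>. e \<in> Ob True \<omega> \<and> (\<forall>u\<in>V. u \<in> e \<longrightarrow> \<not> grows N H (Ob False \<omega>) u))"
    proof (rule pred_intros_logic(3))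
      show "Measurable.pred Nm (\<lambda>\<omega>. e \<in> Ob True \<omega>)" using random_edges_Ob e unfolding random_edges_def by blast
      show "Measurable.pred Nm (\<lambda>\<omega>. \<forall>u\<in>V. u \<in> e \<longrightarrow> \<not> grows N H (Ob False \<omega>) u)"
      proof (rule pred_ball_countable[OF countable_V])
        fix u assume u: "u \<in> V"
        have m: "Measurable.pred Nm (\<lambda>\<omega>. \<not> grows N H (Ob False \<omega>) u)" by (rule pred_intros_logic(2)[OF pred_grows_Ob[OF gw u]])
        show "Measurable.pred Nm (\<lambda>\<omega>. u \<in> e \<longrightarrow> \<not> grows N H (Ob False \<omega>) u)"
        proof (cases "u \<in> e")
          case True then show ?thesis using m by (simp only: simp_thms)
        next
          case False
          then have "(\<lambda>\<omega>. u \<in> e \<longrightarrow> \<not> grows N H (Ob False \<omega>) u) = (\<lambda>_. True)" by blast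
          then show ?thesis by simp
        qed
      qed
    qed
    ultimately show "Measurable.pred Nm (\<lambda>\<omega>. e \<in> off (W \<omega>) (Ob True \<omega>))" by (simp only:)
  qed
  have "AE \<omega> in Nm. \<not> (infinite (X \<omega>) \<and> (\<forall>e\<in>X \<omega>. e \<notin> Ob True \<omega>))"
  proof (rule revealed_last_not_all_closed)
    show "X \<omega> \<subseteq> E" for \<omega> by (auto simp: X_def)
    fix e assume e: "e \<in> E"
    have "Measurable.pred Nm (\<lambda>\<omega>. \<exists>y\<in>V. \<exists>u\<in>V. e = {y, u} \<and> (grows N H (Ob False \<omega>) u \<and> y \<in> clu (off (W \<omega>) (Ob True \<omega>)) v))"
    proof (intro pred_bex_countable countable_V)
      fix y u assume u: "u \<in> V"
      show "Measurable.pred Nm (\<lambda>\<omega>. e = {y, u} \<and> (grows N H (Ob False \<omega>) u \<and> y \<in> clu (off (W \<omega>) (Ob True \<omega>)) v))"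
        by (rule pred_intros_logic(3), simp, rule pred_intros_logic(3)[OF pred_grows_Ob[OF gw u] pred_clu[OF re]])
    qed
    moreover have "(\<lambda>\<omega>. e \<in> X \<omega>) = (\<lambda>\<omega>. \<exists>y\<in>V. \<exists>u\<in>V. e = {y, u} \<and> (grows N H (Ob False \<omega>) u \<and> y \<in> clu (off (W \<omega>) (Ob True \<omega>)) v))"
      using e unfolding X_def by (intro ext) blast
    ultimately show "Measurable.pred Nm (\<lambda>\<omega>. e \<in> X \<omega>)" by (simp only:)
  next
    fix \<omega> \<omega>' :: "'a set \<times> bool \<Rightarrow> bool"
    assume F: "\<And>e. \<omega> (e, False) = \<omega>' (e, False)" and T: "\<And>e. e \<notin> X \<omega> \<Longrightarrow> \<omega> (e, True) = \<omega>' (e, True)"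
    have O1: "Ob False \<omega> = Ob False \<omega>'" by (rule Ob_False_cong) (rule F)
    have W: "W \<omega> = W \<omega>'" unfolding W_def O1 ..
    have off: "off (W \<omega>) (Ob True \<omega>) = off (W \<omega>) (Ob True \<omega>')"
    proof (rule off_Ob_cong)
      show "\<omega> (e, False) = \<omega>' (e, False)" for e by (rule F)
      show "\<omega> (e, True) = \<omega>' (e, True)" if "e \<inter> W \<omega> = {}" for e
      proof (rule T)
        show "e \<notin> X \<omega>" using that unfolding X_def W_def by blast
      qed
    qed
    show "X \<omega>' = X \<omega>" unfolding X_def off[unfolded W] W O1 ..
  qed
  with meets_or_touches_infinitely_often[OF gp v, of True] show ?thesis
  proof eventually_elim
    case (elim \<omega>)
    let ?C = "clu (Ob True \<omega>) v"
    show ?case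
    proof (rule impI, rule ccontr)
      assume inf: "infinite ?C" and neg: "\<not> (\<exists>x\<in>?C. grows N H (Ob False \<omega>) x)"
      have infU: "infinite {u\<in>bdry ?C. grows N H (Ob False \<omega>) u}" using elim(1) inf neg by blast
      have CV: "?C \<subseteq> V" by (rule clu_subset_V[OF Ob_subset v])
      have "?C \<inter> W \<omega> = {}" using neg unfolding W_def by blast
      then have C: "clu (off (W \<omega>) (Ob True \<omega>)) v = ?C" by (rule clu_off[OF Ob_subset])
      have "infinite (X \<omega>)"
      proof (rule infinitely_many_edges[OF infU])
        fix u assume u: "u \<in> {u\<in>bdry ?C. grows N H (Ob False \<omega>) u}"
        then obtain y where y: "y \<in> ?C" "{y, u} \<in> E" unfolding bdry_def by blast
        then have "{y, u} \<in> X \<omega>" using u edge_in_V[OF y(2)] unfolding X_def C by blast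
        then show "\<exists>y. {y, u} \<in> X \<omega>" by blast
      qed (auto simp: X_def)
      moreover have "\<forall>e\<in>X \<omega>. e \<notin> Ob True \<omega>"
      proof (intro ballI notI)
        fix e assume e: "e \<in> X \<omega>" "e \<in> Ob True \<omega>"
        then obtain y u where yu: "e = {y, u}" "grows N H (Ob False \<omega>) u" "y \<in> ?C" unfolding X_def C by blast
        then have "u \<in> ?C" using clu_edge[of y "Ob True \<omega>" v u] e(2) by blast
        then show False using neg yu(2) by blast
      qed
      ultimately show False using elim(2) by blast
    qed
  qed
qed

text \<open>Let \<open>C\<close> be the cluster of \<open>v\<close> at the lower level, known from the first bits, and let
  \<open>X\<close> be the edges from \<open>C\<close> to vertices that grow off \<open>C\<close> at the upper level;
  the second bits of edges touching \<open>C\<close> are not looked at. If \<open>v\<close> does not grow at the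
  upper level then clusters of growing vertices avoid \<open>C\<close>, so removing \<open>C\<close> does not change
  them; then \<open>X\<close> is infinite and all its edges are closed.\<close>
lemma small_infinite_cluster_good:
  assumes gp: "growing_perc V E (pr True) N H" and v: "v \<in> V"
  shows "AE \<omega> in Nm. infinite (clu (Ob False \<omega>) v) \<longrightarrow> grows N H (Ob True \<omega>) v"
proof -
  interpret gp: growing_perc V E "pr True" N H by (rule gp)
  have gw: "growth_weights N H" by (rule gp.growth_weights_axioms)
  define C where "C \<omega> = clu (Ob False \<omega>) v" for \<omega>
  define X where "X \<omega> = {e\<in>E. \<exists>y\<in>V. \<exists>u\<in>V. e = {y, u} \<and> y \<in> C \<omega> \<and> grows N H (off (C \<omega>) (Ob True \<omega>)) u}" for \<omega>
  have CV: "C \<omega> \<subseteq> V" for \<omega> unfolding C_def by (rule clu_subset_V[OF Ob_subset v])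
  have mC: "Measurable.pred Nm (\<lambda>\<omega>. y \<in> C \<omega>)" for y unfolding C_def by (rule pred_clu[OF random_edges_Ob])
  have re: "random_edges Nm (\<lambda>\<omega>. off (C \<omega>) (Ob True \<omega>))"
    unfolding random_edges_def
  proof (intro conjI allI ballI)
    show "off (C \<omega>) (Ob True \<omega>) \<subseteq> E" for \<omega> using off_subset Ob_subset by blast
    fix e assume e: "e \<in> E"
    then obtain y z where yz: "e = {y, z}" by (rule edgeE)
    have "(\<lambda>\<omega>. e \<in> off (C \<omega>) (Ob True \<omega>)) = (\<lambda>\<omega>. e \<in> Ob True \<omega> \<and> (\<not> y \<in> C \<omega> \<and> \<not> z \<in> C \<omega>))"
      unfolding off_def yz by (rule ext) blast
    moreover have "Measurable.pred Nm (\<lambda>\<omega>. e \<in> Ob True \<omega> \<and> (\<not> y \<in> C \<omega> \<and> \<not> z \<in> C \<omega>))"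
    proof (intro pred_intros_logic(3) pred_intros_logic(2) mC)
      show "Measurable.pred Nm (\<lambda>\<omega>. e \<in> Ob True \<omega>)" using random_edges_Ob e unfolding random_edges_def by blast
    qed
    ultimately show "Measurable.pred Nm (\<lambda>\<omega>. e \<in> off (C \<omega>) (Ob True \<omega>))" by (simp only:)
  qed
  have "AE \<omega> in Nm. \<not> (infinite (X \<omega>) \<and> (\<forall>e\<in>X \<omega>. e \<notin> Ob True \<omega>))"
  proof (rule revealed_last_not_all_closed)
    show "X \<omega> \<subseteq> E" for \<omega> by (auto simp: X_def)
    fix e assume e: "e \<in> E"
    have "Measurable.pred Nm (\<lambda>\<omega>. \<exists>y\<in>V. \<exists>u\<in>V. e = {y, u} \<and> (y \<in> C \<omega> \<and> grows N H (off (C \<omega>) (Ob True \<omega>)) u))"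
    proof (intro pred_bex_countable countable_V)
      fix y u assume u: "u \<in> V"
      show "Measurable.pred Nm (\<lambda>\<omega>. e = {y, u} \<and> (y \<in> C \<omega> \<and> grows N H (off (C \<omega>) (Ob True \<omega>)) u))"
        by (rule pred_intros_logic(3), simp, rule pred_intros_logic(3)[OF mC gp.pred_grows[OF re u]])
    qed
    moreover have "(\<lambda>\<omega>. e \<in> X \<omega>) = (\<lambda>\<omega>. \<exists>y\<in>V. \<exists>u\<in>V. e = {y, u} \<and> (y \<in> C \<omega> \<and> grows N H (off (C \<omega>) (Ob True \<omega>)) u))"
      using e unfolding X_def by (intro ext) blast
    ultimately show "Measurable.pred Nm (\<lambda>\<omega>. e \<in> X \<omega>)" by (simp only:)
  next
    fix \<omega> \<omega>' :: "'a set \<times> bool \<Rightarrow> bool"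
    assume F: "\<And>e. \<omega> (e, False) = \<omega>' (e, False)" and T: "\<And>e. e \<notin> X \<omega> \<Longrightarrow> \<omega> (e, True) = \<omega>' (e, True)"
    have O1: "Ob False \<omega> = Ob False \<omega>'" by (rule Ob_False_cong) (rule F)
    have C: "C \<omega> = C \<omega>'" unfolding C_def O1 ..
    have off: "off (C \<omega>) (Ob True \<omega>) = off (C \<omega>) (Ob True \<omega>')"
    proof (rule off_Ob_cong)
      show "\<omega> (e, False) = \<omega>' (e, False)" for e by (rule F)
      show "\<omega> (e, True) = \<omega>' (e, True)" if "e \<inter> C \<omega> = {}" for e
      proof (rule T)
        show "e \<notin> X \<omega>" using that unfolding X_def by blast
      qed
    qed
    show "X \<omega>' = X \<omega>" unfolding X_def off[unfolded C] C ..
  qed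
  with meets_or_touches_infinitely_often[OF gp v, of False] show ?thesis
  proof eventually_elim
    case (elim \<omega>)
    have sub: "clu (Ob False \<omega>) x \<subseteq> clu (Ob True \<omega>) x" for x by (rule clu_mono[OF Ob_mono])
    have toV: "grows N H (Ob True \<omega>) v" if x: "x \<in> C \<omega>" and g: "grows N H (Ob True \<omega>) x" for x
    proof (rule gp.grows_clu[OF Ob_subset _ g])
      show "x \<in> V" using x CV by blast
      show "v \<in> clu (Ob True \<omega>) x" using clu_sym[of x "Ob False \<omega>" v] x sub[of x] unfolding C_def by blast
    qed
    show ?case
    proof (rule impI, rule ccontr)
      assume inf: "infinite (clu (Ob False \<omega>) v)" and neg: "\<not> grows N H (Ob True \<omega>) v"
      have negC: "\<not> grows N H (Ob True \<omega>) x" if "x \<in> C \<omega>" for x using toV[OF that] neg by blast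
      have infU: "infinite {u\<in>bdry (C \<omega>). grows N H (Ob True \<omega>) u}" using elim(1) inf negC unfolding C_def by blast
      have avoid: "clu (Ob True \<omega>) u \<inter> C \<omega> = {}" if "u \<in> V" "grows N H (Ob True \<omega>) u" for u
        using gp.grows_clu[OF Ob_subset that] negC by blast
      have "infinite (X \<omega>)"
      proof (rule infinitely_many_edges[OF infU])
        fix u assume u: "u \<in> {u\<in>bdry (C \<omega>). grows N H (Ob True \<omega>) u}"
        then obtain y where y: "y \<in> C \<omega>" "{y, u} \<in> E" unfolding bdry_def by blast
        have uV: "u \<in> V" using edge_in_V[OF y(2)] by blast
        have g: "grows N H (Ob True \<omega>) u" using u by blast
        have "grows N H (off (C \<omega>) (Ob True \<omega>)) u = grows N H (Ob True \<omega>) u"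
          by (rule gp.grows_cong) (rule bl_off_clu[OF Ob_subset avoid[OF uV g]])
        then have "{y, u} \<in> X \<omega>" using g y edge_in_V[OF y(2)] unfolding X_def by blast
        then show "\<exists>y. {y, u} \<in> X \<omega>" by blast
      qed (auto simp: X_def)
      moreover have "\<forall>e\<in>X \<omega>. e \<notin> Ob True \<omega>"
      proof (intro ballI notI)
        fix e assume e: "e \<in> X \<omega>" "e \<in> Ob True \<omega>"
        then obtain y u where yu: "e = {y, u}" "y \<in> C \<omega>" "u \<in> V" "grows N H (off (C \<omega>) (Ob True \<omega>)) u" unfolding X_def by blast
        have g: "grows N H (Ob True \<omega>) u" by (rule gp.grows_mono[OF off_subset Ob_subset yu(3,4)])
        have "{u, y} \<in> Ob True \<omega>" using e(2) unfolding yu(1) by (simp only: insert_commute)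
        then have "y \<in> clu (Ob True \<omega>) u" by (rule clu_edge[OF clu_refl])
        then show False using avoid[OF yu(3) g] yu(2) by blast
      qed
      ultimately show False using elim(2) by blast
    qed
  qed
qed

end

section \<open>Every infinite cluster grows\<close>

context qt_graph
begin

lemma all_closed_at_zero:
  assumes v: "v \<in> V"
  shows "AE \<omega> in bits E (\<lambda>_. 0). finite (clu (open_edges E \<omega>) v)"
proof -
  interpret prob_space "bits E (\<lambda>_. 0)" by simp
  have "AE \<omega> in bits E (\<lambda>_. 0). \<forall>e\<in>E. \<not> \<omega> e"
    unfolding AE_ball_countable[OF countable_E]
  proof
    fix e assume e: "e \<in> E"
    have "\<P>(\<omega> in bits E (\<lambda>_. 0). \<omega> e = True) = 0" using prob_bit[of e E "\<lambda>_. 0" True] e by (simp only: if_True)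
    then have "\<P>(\<omega> in bits E (\<lambda>_. 0). \<omega> e) = 0" by (simp only: eq_True)
    then have "AE \<omega> in bits E (\<lambda>_. 0). \<omega> \<notin> {\<omega>\<in>space (bits E (\<lambda>_. 0)). \<omega> e}"
      by (simp only: prob_eq_0[OF predE[OF pred_bits_coord[OF e]]])
    then show "AE \<omega> in bits E (\<lambda>_. 0). \<not> \<omega> e" using AE_space by eventually_elim blast
  qed
  then show ?thesis
  proof eventually_elim
    case (elim \<omega>)
    then have "open_edges E \<omega> = {}" by (auto simp: open_edges_def)
    moreover have "bl {} v n = {v}" for n by (induction n) auto
    ultimately show ?case by (simp add: clu_def)
  qed
qed

lemma percolates_above_critical:
  assumes "critical_prob V E < a" "0 \<le> a" "a \<le> 1"
  shows "\<exists>v\<in>V. 0 < \<P>(\<omega> in bits E (\<lambda>_. a). infinite (clu (open_edges E \<omega>) v))"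
proof (rule ccontr)
  interpret prob_space "bits E (\<lambda>_. a)" by simp
  assume neg: "\<not> ?thesis"
  have "AE \<omega> in bits E (\<lambda>_. a). \<forall>v\<in>V. \<not> infinite (clu (open_edges E \<omega>) v)"
    unfolding AE_ball_countable[OF countable_V]
  proof
    fix v assume v: "v \<in> V"
    have m: "Measurable.pred (bits E (\<lambda>_. a)) (\<lambda>\<omega>. infinite (clu (open_edges E \<omega>) v))"
      by (rule pred_infinite_clu[OF random_edges_opn v])
    have "\<P>(\<omega> in bits E (\<lambda>_. a). infinite (clu (open_edges E \<omega>) v)) = 0"
      (is "?P = 0")
    proof -
      have "\<not> 0 < ?P" using neg v by blast
      then show ?thesis using measure_nonneg[of "bits E (\<lambda>_. a)"] by (simp only: not_less order_antisym)
    qed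
    then have "AE \<omega> in bits E (\<lambda>_. a). \<omega> \<notin> {\<omega>\<in>space (bits E (\<lambda>_. a)). infinite (clu (open_edges E \<omega>) v)}"
      by (simp only: prob_eq_0[OF predE[OF m]])
    then show "AE \<omega> in bits E (\<lambda>_. a). \<not> infinite (clu (open_edges E \<omega>) v)" using AE_space by eventually_elim blast
  qed
  then have "AE \<omega> in percolation E a. \<not> (\<exists>v\<in>V. infinite (open_cluster E \<omega> v))"
    unfolding percolation_def bits_def[symmetric] open_cluster_eq by eventually_elim blast
  then have "a \<in> {p\<in>{0..1}. AE \<omega> in percolation E p. \<not> (\<exists>v\<in>V. infinite (open_cluster E \<omega> v))}"
    using assms by simp
  then have "a \<le> critical_prob V E" unfolding critical_prob_def by (intro cSup_upper bdd_aboveI[of _ 1]) auto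
  then show False using assms(1) by simp
qed

text \<open>The set in the definition of the critical probability contains \<open>0\<close> and is bounded, so its supremum is
  not an arbitrary value.\<close>
lemma critical_prob_nonneg: "0 \<le> critical_prob V E"
proof -
  have "AE \<omega> in bits E (\<lambda>_. 0). \<forall>v\<in>V. finite (clu (open_edges E \<omega>) v)"
    unfolding AE_ball_countable[OF countable_V] using all_closed_at_zero by blast
  then have "AE \<omega> in percolation E 0. \<not> (\<exists>v\<in>V. infinite (open_cluster E \<omega> v))"
    unfolding percolation_def bits_def[symmetric] open_cluster_eq by eventually_elim blast
  then have "0 \<in> {p\<in>{0..1}. AE \<omega> in percolation E p. \<not> (\<exists>v\<in>V. infinite (open_cluster E \<omega> v))}" by simp
  then show ?thesis unfolding critical_prob_def by (intro cSup_upper bdd_aboveI[of _ 1]) auto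
qed

end

context perc
begin

text \<open>Couple with a parameter \<open>a\<close> strictly between the critical probability and \<open>p\<close>. An infinite
  \<open>p\<close>-cluster contains an infinite \<open>a\<close>-cluster, which in turn lies in a
  \<open>p\<close>-cluster that grows.\<close>
lemma infinite_clusters_grow_below_one:
  assumes gw: "growth_weights N H" and some: "\<exists>y\<in>V. 0 < \<P>(\<omega> in M. grows N H (opn \<omega>) y)"
    and pc: "critical_prob V E < p" and p1: "p < 1" and v: "v \<in> V"
  shows "AE \<omega> in M. infinite (clu (opn \<omega>) v) \<longrightarrow> grows N H (opn \<omega>) v"
proof -
  define a where "a = (critical_prob V E + p) / 2"
  have pc0: "0 \<le> critical_prob V E" by (rule critical_prob_nonneg)
  have a: "critical_prob V E < a" "a < p" "0 < a" "a < 1" using pc pc0 p1 by (simp_all add: a_def)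
  \<comment> \<open>The solution of \<open>(1 - a) * (1 - s) = 1 - p\<close>, the probability that an edge is closed at the upper level.\<close>
  define s where "s = 1 - (1 - p) / (1 - a)"
  have s: "0 < s" "s < 1" using a p1 by (simp_all add: s_def field_simps)
  interpret cp: coupling V E a s using a s V_ne by unfold_locales
  have "(1 - a) * (1 - s) = 1 - p" using a(4) by (simp add: s_def)
  then have prT: "cp.pr True = p" by (simp add: cp.pr_def)
  have prF: "cp.pr False = a" by (simp add: cp.pr_def)
  interpret gr: growing V E N H using gw by (intro growing.intro qt_graph_axioms)
  interpret gi: growing V E Ninf Hinf using growth_weights_inf by (intro growing.intro qt_graph_axioms)
  have gpT: "growing_perc V E (cp.pr True) N H"
    unfolding prT by (intro growing_perc.intro perc_axioms gr.growing_axioms growing_perc_axioms.intro some) (use a in linarith)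
  have "perc V E a" using a by (intro perc.intro qt_graph_axioms perc_axioms.intro V_ne) auto
  moreover have "\<exists>y\<in>V. 0 < \<P>(\<omega> in bits E (\<lambda>_. a). grows Ninf Hinf (open_edges E \<omega>) y)"
  proof -
    obtain y where y: "y \<in> V" "0 < \<P>(\<omega> in bits E (\<lambda>_. a). infinite (clu (open_edges E \<omega>) y))"
      using percolates_above_critical[OF a(1) less_imp_le[OF a(3)] less_imp_le[OF a(4)]] by blast
    show ?thesis by (rule bexI[OF _ y(1)]) (unfold grows_inf_iff[OF opn_subset y(1)], rule y(2))
  qed
  ultimately have gpF: "growing_perc V E (cp.pr False) Ninf Hinf"
    unfolding prF by (intro growing_perc.intro gi.growing_axioms growing_perc_axioms.intro a(3))
  have "AE \<omega> in cp.Nm. \<forall>x\<in>V. infinite (clu (cp.Ob False \<omega>) x) \<longrightarrow> grows N H (cp.Ob True \<omega>) x"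
    unfolding AE_ball_countable[OF countable_V] using cp.small_infinite_cluster_good[OF gpT] by blast
  with cp.large_cluster_contains_good[OF gpF v]
  have "AE \<omega> in cp.Nm. infinite (clu (cp.Ob True \<omega>) v) \<longrightarrow> grows N H (cp.Ob True \<omega>) v"
  proof eventually_elim
    case (elim \<omega>)
    show ?case
    proof
      assume "infinite (clu (cp.Ob True \<omega>) v)"
      then obtain x where x: "x \<in> clu (cp.Ob True \<omega>) v" "grows Ninf Hinf (cp.Ob False \<omega>) x" using elim(1) by blast
      have xV: "x \<in> V" using x(1) clu_subset_V[OF cp.Ob_subset v] by blast
      have "infinite (clu (cp.Ob False \<omega>) x)" using x(2) unfolding grows_inf_iff[OF cp.Ob_subset xV] .
      then have "grows N H (cp.Ob True \<omega>) x" using elim(2) xV by blast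
      then show "grows N H (cp.Ob True \<omega>) v" by (rule gr.grows_clu[OF cp.Ob_subset xV _ clu_sym[OF x(1)]])
    qed
  qed
  then have *: "AE \<omega> in cp.Nm. infinite (clu (opn (cp.proj True \<omega>)) v) \<longrightarrow> grows N H (opn (cp.proj True \<omega>)) v"
    unfolding cp.opn_proj .
  have "AE \<omega> in bits E (\<lambda>_. cp.pr True). infinite (clu (opn \<omega>) v) \<longrightarrow> grows N H (opn \<omega>) v"
    by (rule cp.AE_proj[OF _ *]) (intro pred_intros_logic(4) pred_infinite_clu random_edges_opn gr.pred_grows v)
  then show ?thesis unfolding prT .
qed

text \<open>For \<open>p = 1\<close> the configuration is deterministic and there is only one cluster.\<close>
lemma infinite_clusters_grow:
  assumes gw: "growth_weights N H" and some: "\<exists>y\<in>V. 0 < \<P>(\<omega> in M. grows N H (opn \<omega>) y)"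
    and pc: "critical_prob V E < p" and v: "v \<in> V"
  shows "AE \<omega> in M. infinite (clu (opn \<omega>) v) \<longrightarrow> grows N H (opn \<omega>) v"
proof (cases "p < 1")
  case True
  then show ?thesis by (rule infinite_clusters_grow_below_one[OF gw some pc _ v])
next
  case False
  then have p1: "p = 1" using p by simp
  interpret gr: growing V E N H using gw by (intro growing.intro qt_graph_axioms)
  have "AE \<omega> in M. \<forall>e\<in>E. \<omega> e"
    unfolding AE_ball_countable[OF countable_E]
  proof
    fix e assume e: "e \<in> E"
    have "\<P>(\<omega> in M. \<omega> e = False) = 0" using prob_bit[of e E "\<lambda>_. p" False] e p1 by simp
    then have "\<P>(\<omega> in M. \<not> \<omega> e) = 0" by (simp only: eq_False)
    moreover have "Measurable.pred M (\<lambda>\<omega>. \<not> \<omega> e)" by (rule pred_intros_logic(2)[OF pred_bits_coord[OF e]])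
    ultimately have "AE \<omega> in M. \<omega> \<notin> {\<omega>\<in>space M. \<not> \<omega> e}" by (simp only: prob_eq_0[OF predE])
    then show "AE \<omega> in M. \<omega> e" using AE_space by eventually_elim blast
  qed
  then have all: "AE \<omega> in M. opn \<omega> = E" by eventually_elim (auto simp: open_edges_def)
  obtain y where y: "y \<in> V" "0 < \<P>(\<omega> in M. grows N H (opn \<omega>) y)" using some by blast
  have gE: "grows N H E y"
  proof (rule ccontr)
    assume n: "\<not> grows N H E y"
    have "AE \<omega> in M. \<omega> \<notin> {\<omega>\<in>space M. grows N H (opn \<omega>) y}" using all by eventually_elim (use n in simp)
    then have "\<P>(\<omega> in M. grows N H (opn \<omega>) y) = 0"
      by (simp only: prob_eq_0[OF predE[OF gr.pred_grows[OF random_edges_opn y(1)]]])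
    then show False using y(2) by simp
  qed
  have "v \<in> clu E y" using v V_eq_ball_union[OF y(1)] unfolding clu_def by blast
  then have gv: "grows N H E v" by (rule gr.grows_clu[OF order_refl y(1) gE])
  show ?thesis using all by eventually_elim (simp only: gv simp_thms)
qed

theorem sphere_growth:
  assumes pc: "critical_prob V E < p" and v: "v \<in> V"
  shows "AE \<omega> in M. infinite (clu (opn \<omega>) v) \<longrightarrow> (\<exists>\<epsilon>>0. \<forall>r. \<epsilon> * exp (\<gamma> * real r) \<le> real (card (sph (opn \<omega>) v r)))"
proof (cases "\<gamma> = 0")
  case True
  show ?thesis
  proof (rule AE_I2, rule impI)
    fix \<omega> assume inf: "infinite (clu (opn \<omega>) v)"
    have "1 * exp (\<gamma> * real r) \<le> real (card (sph (opn \<omega>) v r))" for r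
    proof -
      have "sph (opn \<omega>) v r \<noteq> {}" by (rule infinite_clu_sph[OF opn_subset v inf])
      moreover have "finite (sph (opn \<omega>) v r)" using finite_bl[OF opn_subset v, of \<omega> r] by (simp add: sph_def)
      ultimately have "1 \<le> card (sph (opn \<omega>) v r)" by (simp add: Suc_leI card_gt_0_iff)
      then show ?thesis using True by simp
    qed
    then show "\<exists>\<epsilon>>0. \<forall>r. \<epsilon> * exp (\<gamma> * real r) \<le> real (card (sph (opn \<omega>) v r))" by (intro exI[of _ 1]) auto
  qed
next
  case False
  then have "0 < \<gamma>" using gamma_facts(1) by simp
  from growth_property[OF this v] obtain N H where NH: "growth_weights N H"
      "\<exists>y\<in>V. 0 < \<P>(\<omega> in M. grows N H (opn \<omega>) y)"
      "AE \<omega> in M. grows N H (opn \<omega>) v \<longrightarrow> (\<exists>\<epsilon>>0. \<forall>r. \<epsilon> * exp (\<gamma> * real r) \<le> real (card (sph (opn \<omega>) v r)))"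
    by (elim exE conjE)
  from infinite_clusters_grow[OF NH(1,2) pc v] NH(3) show ?thesis by eventually_elim blast
qed

end

section \<open>Growth rates of spheres and balls\<close>

theorem theorem1p5:
  fixes V :: "'a set" and E :: "'a set set" and v :: 'a and p :: real
  assumes "simple_graph V E"
    and "connected_graph V E"
    and "locally_finite V E"
    and "quasi_transitive V E"
    and "v \<in> V"
    and "critical_prob V E < p" and "p \<le> 1"
  shows "(AE \<omega> in percolation E p. infinite (open_cluster E \<omega> v) \<longrightarrow>
            ((\<lambda>r. ln (real (card (int_sphere E \<omega> v r))) / real r) \<longlonglongrightarrow> gamma_int V E p) \<and>
            ((\<lambda>r. ln (real (card (int_ball E \<omega> v r))) / real r) \<longlonglongrightarrow> gamma_int V E p)) \<and>
         (AE \<omega> in percolation E p. infinite (open_cluster E \<omega> v) \<longrightarrow>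
            liminf (\<lambda>r. ereal (exp (- gamma_int V E p * real r)
                                 * real (card (int_sphere E \<omega> v r)))) > 0)"
proof -
  interpret qt_graph V E using assms by unfold_locales
  have "0 < p" using critical_prob_nonneg assms(6) by linarith
  interpret perc V E p using \<open>0 < p\<close> assms(5,7) by unfold_locales auto
  note low = sphere_growth[OF assms(6,5)]
  have "AE \<omega> in M. infinite (clu (opn \<omega>) v) \<longrightarrow>
      ((\<lambda>r. ln (real (card (sph (opn \<omega>) v r))) / real r) \<longlonglongrightarrow> \<gamma>) \<and>
      ((\<lambda>r. ln (real (card (bl (opn \<omega>) v r))) / real r) \<longlonglongrightarrow> \<gamma>)"
    using low ball_upper_bound[OF assms(5)]
  proof eventually_elim
    case (elim \<omega>)
    show ?case
    proof
      assume "infinite (clu (opn \<omega>) v)"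
      then obtain \<epsilon> where \<epsilon>: "0 < \<epsilon>" "\<forall>r. \<epsilon> * exp (\<gamma> * real r) \<le> real (card (sph (opn \<omega>) v r))" using elim(1) by blast
      have "card (sph (opn \<omega>) v r) \<le> card (bl (opn \<omega>) v r)" for r
        unfolding sph_def by (intro card_mono finite_bl[OF opn_subset assms(5)]) auto
      then show "((\<lambda>r. ln (real (card (sph (opn \<omega>) v r))) / real r) \<longlonglongrightarrow> \<gamma>) \<and>
          ((\<lambda>r. ln (real (card (bl (opn \<omega>) v r))) / real r) \<longlonglongrightarrow> \<gamma>)"
        using \<epsilon> by (intro growth_limits[OF Gr_ge_1 gamma_facts(2) _ elim(2)] always_eventually) auto
    qed
  qed
  moreover have "AE \<omega> in M. infinite (clu (opn \<omega>) v) \<longrightarrow>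
      liminf (\<lambda>r. ereal (exp (- \<gamma> * real r) * real (card (sph (opn \<omega>) v r)))) > 0"
    using low
  proof eventually_elim
    case (elim \<omega>)
    show ?case
    proof
      assume "infinite (clu (opn \<omega>) v)"
      then obtain \<epsilon> where \<epsilon>: "0 < \<epsilon>" "\<And>r. \<epsilon> * exp (\<gamma> * real r) \<le> real (card (sph (opn \<omega>) v r))" using elim by blast
      have le: "\<epsilon> \<le> exp (- \<gamma> * real r) * real (card (sph (opn \<omega>) v r))" for r
      proof -
        have "\<epsilon> = exp (- \<gamma> * real r) * (\<epsilon> * exp (\<gamma> * real r))" by (simp add: exp_minus)
        also have "\<dots> \<le> exp (- \<gamma> * real r) * real (card (sph (opn \<omega>) v r))" by (intro mult_left_mono \<epsilon>(2)) simp
        finally show ?thesis .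
      qed
      have "0 < ereal \<epsilon>" using \<epsilon>(1) by simp
      also have "ereal \<epsilon> \<le> liminf (\<lambda>r. ereal (exp (- \<gamma> * real r) * real (card (sph (opn \<omega>) v r))))"
        by (intro Liminf_bounded always_eventually allI) (simp only: ereal_less_eq le)
      finally show "liminf (\<lambda>r. ereal (exp (- \<gamma> * real r) * real (card (sph (opn \<omega>) v r)))) > 0" .
    qed
  qed
  ultimately show ?thesis
    unfolding percolation_eq int_sphere_eq int_ball_eq open_cluster_eq \<gamma>_def by (rule conjI)
qed

end
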